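(* Let $(X,d,\mu)$ be a metric-measure space with Borel regular doubling measure that supports a $p$-Poincaré inequality for some $p\in[1,\infty)$. Then the space $N^{1,p}(X)$ is separable.
   Context: All function spaces are real. Setting: $(X,d)$ is a metric space, $\mu$ is a Borel measure with $0<\mu(B)<\infty$ for every ball $B$; a ball is $B(x,r)=\{y:d(x,y)<r\}$ with prescribed center and radius $r>0$, and $\lambda B$ is the concentric ball with radius multiplied by $\lambda$. $\mu$ is Borel regular (every $\mu$-measurable set is contained in a Borel set of equal measure) and doubling: there is $C_d\ge1$ with $\mu(2B)\le C_d\,\mu(B)$ for every ball $B$. $L^1_{\rm loc}(X)$ denotes functions integrable on every ball; $u_B=\frac{1}{\mu(B)}\int_B u\,d\mu$. Curves and Sobolev space: $\Gamma(X)$ is the family of nonconstant rectifiable curves $\gamma:[a,b]\to X$; for Borel $\varrho\ge0$, $\int_\gamma\varrho\,ds$ is the integral with respect to arc length. A Borel function $g:X\to[0,\infty]$ is an upper gradient of a Borel function $u:X\to[-\infty,\infty]$ if $|u(\gamma(a))-u(\gamma(b))|\le\int_\gamma g\,ds$ for every $\gamma\in\Gamma(X)$, with the convention $|(\pm\infty)-(\pm\infty)|=\infty$. $\widetilde N^{1,p}(X)$ is the set of Borel $u:X\to[-\infty,\infty]$ with $\|u\|_{N^{1,p}(X)}:=(\|u\|_{L^p(X)}^p+\inf_g\|g\|_{L^p(X)}^p)^{1/p}<\infty$, the infimum over all upper gradients $g$ of $u$; $N^{1,p}(X)=\widetilde N^{1,p}(X)/\!\sim$, where $u\sim v$ iff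 $\|u-v\|_{N^{1,p}(X)}=0$. It is a Banach space with this norm. Poincaré inequality: $X$ supports a $p$-Poincaré inequality if there are $c_{\mathrm{PI}}>0$, $\lambda\ge1$ such that $\frac1{\mu(B)}\int_B|u-u_B|\,d\mu\le c_{\mathrm{PI}}\operatorname{diam}(B)\big(\frac1{\mu(\lambda B)}\int_{\lambda B}g^p\,d\mu\big)^{1/p}$ for all balls $B$, all Borel $u\in L^1_{\rm loc}(X)$ and all upper gradients $g$ of $u$. *)

theory Defs
  imports "HOL-Analysis.Analysis"
begin

subsection \<open>Metric measure spaces\<close>

text \<open>
  The metric space is the type \<open>'a::metric_space\<close>. The sigma-algebra \<open>sets M\<close> of measurable sets
  may be strictly larger than the Borel sigma-algebra; \<open>space M = UNIV\<close> follows from the inclusion.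
\<close>

definition metric_measure_space :: "'a::metric_space measure \<Rightarrow> bool" where
  "metric_measure_space M \<longleftrightarrow>
     sets borel \<subseteq> sets M \<and>
     (\<forall>x r. r > 0 \<longrightarrow> 0 < emeasure M (ball x r) \<and> emeasure M (ball x r) < \<infinity>)"

definition borel_regular :: "'a::metric_space measure \<Rightarrow> bool" where
  "borel_regular M \<longleftrightarrow>
     (\<forall>A\<in>sets M. \<exists>B\<in>sets borel. A \<subseteq> B \<and> emeasure M B = emeasure M A)"

definition doubling_measure :: "'a::metric_space measure \<Rightarrow> bool" where
  "doubling_measure M \<longleftrightarrow>
     (\<exists>C::real. C \<ge> 1 \<and>
        (\<forall>x r. r > 0 \<longrightarrow> emeasure M (ball x (2 * r)) \<le> ennreal C * emeasure M (ball x r)))"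


subsection \<open>Powers and Lebesgue norms\<close>

text \<open>Real powers on \<open>[0,\<infinity>]\<close>, only used for exponents \<open>a > 0\<close> (so that \<open>\<infinity>\<close> is sent to \<open>\<infinity>\<close>).\<close>

definition ennreal_rpow :: "ennreal \<Rightarrow> real \<Rightarrow> ennreal" where
  "ennreal_rpow x a = (if x = \<infinity> then \<infinity> else ennreal (enn2real x powr a))"

definition Lp_norm :: "'a measure \<Rightarrow> real \<Rightarrow> ('a \<Rightarrow> ennreal) \<Rightarrow> ennreal" where
  "Lp_norm M p f = ennreal_rpow (\<integral>\<^sup>+x. ennreal_rpow (f x) p \<partial>M) (1 / p)"


subsection \<open>Rectifiable curves and arc length integrals\<close>

definition curve_length :: "(real \<Rightarrow> 'a::metric_space) \<Rightarrow> real \<Rightarrow> real \<Rightarrow> ennreal" where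
  "curve_length \<gamma> a b =
     (SUP (n, t) \<in> {(n::nat, t::nat \<Rightarrow> real).
                      t 0 = a \<and> t n = b \<and> (\<forall>i<n. t i \<le> t (Suc i))}.
        \<Sum>i<n. ennreal (dist (\<gamma> (t i)) (\<gamma> (t (Suc i)))))"

definition nonconst_rectifiable_curve ::
    "(real \<Rightarrow> 'a::metric_space) \<Rightarrow> real \<Rightarrow> real \<Rightarrow> bool" where
  "nonconst_rectifiable_curve \<gamma> a b \<longleftrightarrow>
     a \<le> b \<and> continuous_on {a..b} \<gamma> \<and> curve_length \<gamma> a b < \<infinity> \<and>
     (\<exists>s\<in>{a..b}. \<exists>t\<in>{a..b}. \<gamma> s \<noteq> \<gamma> t)"

text \<open>
  The arc length parametrization: its value at \<open>s\<close> is \<open>\<gamma> t\<close> for any \<open>t\<close> such that \<open>\<gamma>\<close> restricted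
  to \<open>{a..t}\<close> has length \<open>s\<close>. All such \<open>t\<close> give the same point, as \<open>\<gamma>\<close> is constant on each interval
  on which its length function is constant.
\<close>

definition arc_length_param ::
    "(real \<Rightarrow> 'a::metric_space) \<Rightarrow> real \<Rightarrow> real \<Rightarrow> real \<Rightarrow> 'a" where
  "arc_length_param \<gamma> a b s =
     \<gamma> (SOME t. t \<in> {a..b} \<and> curve_length \<gamma> a t = ennreal s)"

definition curve_integral ::
    "(real \<Rightarrow> 'a::metric_space) \<Rightarrow> real \<Rightarrow> real \<Rightarrow> ('a \<Rightarrow> ennreal) \<Rightarrow> ennreal" where
  "curve_integral \<gamma> a b \<rho> =
     (\<integral>\<^sup>+s\<in>{0..enn2real (curve_length \<gamma> a b)}. \<rho> (arc_length_param \<gamma> a b s) \<partial>lborel)"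


subsection \<open>Upper gradients\<close>

text \<open>
  The convention that \<open>\<bar>u - v\<bar> = \<infinity>\<close> as soon as one of \<open>u\<close>, \<open>v\<close> is infinite, even if they are equal,
  is the behaviour of subtraction on \<^typ>\<open>ereal\<close>.
\<close>

lemma ereal_abs_diff_convention:
  fixes u v :: ereal
  assumes "\<bar>u\<bar> = \<infinity> \<or> \<bar>v\<bar> = \<infinity>"
  shows "\<bar>u - v\<bar> = \<infinity>"
  using assms by (cases u; cases v) auto

definition upper_gradient ::
    "('a::metric_space \<Rightarrow> ennreal) \<Rightarrow> ('a \<Rightarrow> ereal) \<Rightarrow> bool" where
  "upper_gradient g u \<longleftrightarrow>
     g \<in> borel_measurable borel \<and>
     (\<forall>\<gamma> a b. nonconst_rectifiable_curve \<gamma> a b \<longrightarrow>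
        e2ennreal \<bar>u (\<gamma> a) - u (\<gamma> b)\<bar> \<le> curve_integral \<gamma> a b g)"


subsection \<open>The Newtonian space\<close>

definition newtonian_norm ::
    "'a::metric_space measure \<Rightarrow> real \<Rightarrow> ('a \<Rightarrow> ereal) \<Rightarrow> ennreal" where
  "newtonian_norm M p u =
     ennreal_rpow
       (ennreal_rpow (Lp_norm M p (\<lambda>x. e2ennreal \<bar>u x\<bar>)) p
        + (INF g \<in> {g. upper_gradient g u}. ennreal_rpow (Lp_norm M p g) p))
       (1 / p)"

definition newtonian_functions ::
    "'a::metric_space measure \<Rightarrow> real \<Rightarrow> ('a \<Rightarrow> ereal) set" where
  "newtonian_functions M p =
     {u. u \<in> borel_measurable borel \<and> newtonian_norm M p u < \<infinity>}"

text \<open>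
  Functions in \<open>newtonian_functions M p\<close> may take infinite values, and \<open>u x - v x\<close> is then read as in
  \<^typ>\<open>ereal\<close>. The norm of the difference does not depend on this choice: if \<open>g\<close> is an upper gradient
  of \<open>u\<close>, then \<open>g\<close> has infinite integral along every curve with an end point where \<open>u\<close> is infinite,
  so adding a small multiple of \<open>g\<close> makes the values of a function at these points irrelevant.
\<close>

definition newtonian_rel ::
    "'a::metric_space measure \<Rightarrow> real \<Rightarrow> (('a \<Rightarrow> ereal) \<times> ('a \<Rightarrow> ereal)) set" where
  "newtonian_rel M p =
     {(u, v). u \<in> newtonian_functions M p \<and> v \<in> newtonian_functions M p \<and>
              newtonian_norm M p (\<lambda>x. u x - v x) = 0}"

definition newtonian_space ::
    "'a::metric_space measure \<Rightarrow> real \<Rightarrow> ('a \<Rightarrow> ereal) set set" where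
  "newtonian_space M p = newtonian_functions M p // newtonian_rel M p"

text \<open>
  The distance induced by the norm on the quotient; it does not depend on the representatives.
\<close>

definition newtonian_dist ::
    "'a::metric_space measure \<Rightarrow> real \<Rightarrow> ('a \<Rightarrow> ereal) set \<Rightarrow> ('a \<Rightarrow> ereal) set \<Rightarrow> real" where
  "newtonian_dist M p U V =
     enn2real (newtonian_norm M p (\<lambda>x. (SOME u. u \<in> U) x - (SOME v. v \<in> V) x))"

definition newtonian_topology ::
    "'a::metric_space measure \<Rightarrow> real \<Rightarrow> ('a \<Rightarrow> ereal) set topology" where
  "newtonian_topology M p = Metric_space.mtopology (newtonian_space M p) (newtonian_dist M p)"


subsection \<open>The Poincare inequality\<close>

definition locally_integrable :: "'a::metric_space measure \<Rightarrow> ('a \<Rightarrow> ereal) \<Rightarrow> bool" where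
  "locally_integrable M u \<longleftrightarrow>
     u \<in> borel_measurable M \<and>
     (\<forall>x r. r > 0 \<longrightarrow> (\<integral>\<^sup>+y\<in>ball x r. e2ennreal \<bar>u y\<bar> \<partial>M) < \<infinity>)"

text \<open>
  A locally integrable function is finite almost everywhere, so that nothing is lost by passing to
  \<open>real_of_ereal\<close> in its mean values.
\<close>

definition mean_value :: "'a measure \<Rightarrow> 'a set \<Rightarrow> ('a \<Rightarrow> ereal) \<Rightarrow> real" where
  "mean_value M B u = (LINT y:B|M. real_of_ereal (u y)) / measure M B"

definition supports_Poincare :: "'a::metric_space measure \<Rightarrow> real \<Rightarrow> bool" where
  "supports_Poincare M p \<longleftrightarrow>
     (\<exists>c l::real. c > 0 \<and> l \<ge> 1 \<and>
        (\<forall>x r u g.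
           r > 0 \<longrightarrow> u \<in> borel_measurable borel \<longrightarrow> locally_integrable M u \<longrightarrow>
           upper_gradient g u \<longrightarrow>
             (\<integral>\<^sup>+y\<in>ball x r. e2ennreal \<bar>u y - ereal (mean_value M (ball x r) u)\<bar> \<partial>M)
               / emeasure M (ball x r)
             \<le> ennreal (c * diameter (ball x r)) *
                ennreal_rpow
                  ((\<integral>\<^sup>+y\<in>ball x (l * r). ennreal_rpow (g y) p \<partial>M)
                    / emeasure M (ball x (l * r)))
                  (1 / p)))"

end

theory Submission
  imports Defs
begin

text \<open>
  The pairs \<open>(u, g)\<close> of an \<open>L\<^sup>p\<close> function and an \<open>L\<^sup>p\<close> upper gradient of it form a subset of the
  separable space \<open>L\<^sup>p \<times> L\<^sup>p\<close>, so there is a countable set \<open>S\<close> of pairs, closed under midpoints,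
  that approximates every pair in \<open>L\<^sup>p \<times> L\<^sup>p\<close>. This does not yet make \<open>u - s\<close> small in the
  Newtonian norm, since the sum of upper gradients of \<open>u\<close> and \<open>s\<close> is not small. But if pairs
  \<open>(s\<^sub>j, h\<^sub>j)\<close> converge fast to \<open>(u, g)\<close>, then all \<open>h\<^sub>j\<close> are dominated by one \<open>\<omega>\<close> in \<open>L\<^sup>p\<close>, and
  midpoints of the \<open>s\<^sub>j\<close> converge in norm, for every \<open>p \<ge> 1\<close>, by a uniform convexity argument.

  For this, cover the space at scale \<open>r = 2\<^sup>-\<^sup>k\<close> by balls of radius \<open>r\<close> around a maximal separated
  set, and let \<open>E\<^sub>k(v)\<close> be the integral of \<open>D\<^sup>2\<^sup>p / R\<^sub>k\<close>, where \<open>D\<close> is built from the difference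
  quotients of the means of \<open>v\<close> over neighbouring balls and \<open>R\<^sub>k\<close> is an average at scale \<open>r\<close> of
  \<open>\<rho> = (2\<omega>)\<^sup>p + \<theta>\<close>, with \<open>\<theta> > 0\<close> integrable. The Poincare inequality bounds \<open>E\<^sub>k(v)\<close> uniformly in
  \<open>k\<close> when \<open>v\<close> has an upper gradient below \<open>2\<omega>\<close>. Clarkson's inequality for the exponent \<open>2p \<ge> 2\<close>
  makes \<open>limsup E\<^sub>k\<close> uniformly convex, so near minimizers \<open>v\<^sub>n\<close> among the differences \<open>s - u\<close>
  satisfy \<open>liminf E\<^sub>k((v\<^sub>n - v\<^sub>m) / 2) \<rightarrow> 0\<close>. Finally, small \<open>liminf E\<^sub>k(v)\<close> forces an upper gradient of
  \<open>v\<close> with small norm: along a curve the ball means change by at most \<open>4 \<integral> D\<close>, and near minimizers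
  among the functions that are upper gradients up to scale \<open>r\<close> converge, again by Clarkson's
  inequality, to an upper gradient.
\<close>

section \<open>Length and arc length parametrization of curves\<close>

text \<open>An upper gradient does not depend linearly on its function, so separability of L^p x L^p
  yields nothing directly for the norm, and for p = 1 the space L^1 has no uniform convexity of its
  own. The weight 1 / R_k creates it. If g^p \<le> \<rho>, then D^(2p) is at most a constant times
  R_k^2, so D^(2p) / R_k is at most a constant times R_k and has bounded integral; and the exponent
  2p is always at least 2. The way back is Young's inequality x \<le> \<tau> * x^2 / \<Omega> +
  \<Omega> / \<tau> with x = H^p, where \<Omega> is an integrable majorant of the averages R_k.
  Minimization takes place for limsup E_k, and the defect in its midpoint inequality is only the
  liminf of E_k for the half difference. So smallness is known just along a subsequence of scales,
  and the energy bound is formulated for such subsequences. Both passages to a limit use one device: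
  a fast subsequence is taken, and a series of gradients serves as upper gradient outside a null
  set.\<close>

lemma partition_mono:
  fixes t :: "nat \<Rightarrow> real"
  assumes "\<forall>i<n. t i \<le> t (Suc i)" "i \<le> j" "j \<le> n"
  shows "t i \<le> t j"
  using assms(2,3)
proof (induction j rule: dec_induct)
  case (step k)
  then show ?case using assms(1) by (meson Suc_le_lessD less_imp_le_nat order_trans)
qed simp

section \<open>Additivity and continuity of the length\<close>

lemma curve_length_upper:
  assumes "t 0 = a" "t n = b" "\<forall>i<n. t i \<le> t (Suc i)"
  shows "(\<Sum>i<n. ennreal (dist (\<gamma> (t i)) (\<gamma> (t (Suc i))))) \<le> curve_length \<gamma> a b"
  unfolding curve_length_def using assms by (intro SUP_upper2[of "(n, t)"]) auto

lemma curve_length_least: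
  assumes "\<And>n t. t 0 = a \<Longrightarrow> t n = b \<Longrightarrow> \<forall>i<n. t i \<le> t (Suc i) \<Longrightarrow>
    (\<Sum>i<n. ennreal (dist (\<gamma> (t i)) (\<gamma> (t (Suc i))))) \<le> B"
  shows "curve_length \<gamma> a b \<le> B"
  unfolding curve_length_def using assms by (intro SUP_least) auto

lemma dist_le_curve_length:
  assumes "x \<le> y"
  shows "ennreal (dist (\<gamma> x) (\<gamma> y)) \<le> curve_length \<gamma> x y"
  using curve_length_upper[of "\<lambda>i. if i = 0 then x else y" x 1 y \<gamma>] assms by simp

lemma curve_length_refl [simp]: "curve_length \<gamma> a a = 0"
proof -
  have "curve_length \<gamma> a a \<le> 0"
  proof (rule curve_length_least)
    fix n and t :: "nat \<Rightarrow> real"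
    assume t: "t 0 = a" "t n = a" "\<forall>i<n. t i \<le> t (Suc i)"
    then have "\<And>i. i \<le> n \<Longrightarrow> t i = a"
      using partition_mono[OF t(3)] by (metis le0 order_antisym order_refl)
    then show "(\<Sum>i<n. ennreal (dist (\<gamma> (t i)) (\<gamma> (t (Suc i))))) \<le> 0"
      by (auto intro!: sum_nonpos)
  qed
  then show ?thesis by simp
qed

lemma curve_length_extend:
  assumes "a \<le> x" "x \<le> y"
  shows "curve_length \<gamma> a x + ennreal (dist (\<gamma> x) (\<gamma> y)) \<le> curve_length \<gamma> a y"
proof -
  have *: "(\<Sum>i<n. ennreal (dist (\<gamma> (t i)) (\<gamma> (t (Suc i))))) + ennreal (dist (\<gamma> x) (\<gamma> y))
      \<le> curve_length \<gamma> a y"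
    if t: "t 0 = a" "t n = x" "\<forall>i<n. t i \<le> t (Suc i)" for n and t :: "nat \<Rightarrow> real"
  proof -
    have "(\<Sum>i<n. ennreal (dist (\<gamma> (t i)) (\<gamma> (t (Suc i))))) + ennreal (dist (\<gamma> x) (\<gamma> y))
      = (\<Sum>i<Suc n. ennreal (dist (\<gamma> ((t(Suc n := y)) i)) (\<gamma> ((t(Suc n := y)) (Suc i)))))"
      using t(2) by (auto intro!: sum.cong arg_cong2[where f = "(+)"])
    also have "\<dots> \<le> curve_length \<gamma> a y"
      by (rule curve_length_upper) (use t assms in \<open>auto simp: less_Suc_eq\<close>)
    finally show ?thesis .
  qed
  have "curve_length \<gamma> a x \<le> curve_length \<gamma> a y - ennreal (dist (\<gamma> x) (\<gamma> y))"
    by (rule curve_length_least) (use * in \<open>simp add: ennreal_le_minus_iff\<close>)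
  moreover have "ennreal (dist (\<gamma> x) (\<gamma> y)) \<le> curve_length \<gamma> a y"
    using *[of "\<lambda>i. if i = 0 then a else x" 1] assms by (simp add: add_increasing order_trans[OF _ *])
       (metis add_increasing order_refl zero_le order_trans)
  ultimately show ?thesis
    by (auto simp: ennreal_le_minus_iff)
qed

text \<open>A partition of [a, c] need not contain b; the triangle inequality inserts b into the one
  segment that crosses it. The induction carries an arbitrary right end \<open>t n\<close>, with
  nothing to prove until b is reached.\<close>

lemma curve_length_add_le:
  assumes "a \<le> b" "b \<le> c"
  shows "curve_length \<gamma> a c \<le> curve_length \<gamma> a b + curve_length \<gamma> b c"
proof (rule curve_length_least)
  have "t n \<ge> b \<longrightarrow> (\<Sum>i<n. ennreal (dist (\<gamma> (t i)) (\<gamma> (t (Suc i)))))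
          \<le> curve_length \<gamma> a b + curve_length \<gamma> b (t n)"
    if "t 0 = a" "\<forall>i<n. t i \<le> t (Suc i)" for n and t :: "nat \<Rightarrow> real"
    using that(2)
  proof (induction n)
    case 0
    then show ?case by simp
  next
    case (Suc n)
    let ?S = "\<Sum>i<n. ennreal (dist (\<gamma> (t i)) (\<gamma> (t (Suc i))))"
    have mono: "a \<le> t n"
      using partition_mono[of n t 0 n] Suc.prems that(1) by auto
    show ?case
    proof (intro impI)
      assume ge: "t (Suc n) \<ge> b"
      show "(\<Sum>i<Suc n. ennreal (dist (\<gamma> (t i)) (\<gamma> (t (Suc i)))))
          \<le> curve_length \<gamma> a b + curve_length \<gamma> b (t (Suc n))"
      proof (cases "b \<le> t n")
        case True
        have "(\<Sum>i<Suc n. ennreal (dist (\<gamma> (t i)) (\<gamma> (t (Suc i)))))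
          \<le> (curve_length \<gamma> a b + curve_length \<gamma> b (t n)) + ennreal (dist (\<gamma> (t n)) (\<gamma> (t (Suc n))))"
          using Suc True by (simp add: add_mono)
        also have "\<dots> \<le> curve_length \<gamma> a b + curve_length \<gamma> b (t (Suc n))"
          unfolding add.assoc by (intro add_left_mono curve_length_extend) (use Suc True in auto)
        finally show ?thesis .
      next
        case False
        have "?S \<le> curve_length \<gamma> a (t n)"
          by (rule curve_length_upper) (use Suc.prems that in auto)
        then have "(\<Sum>i<Suc n. ennreal (dist (\<gamma> (t i)) (\<gamma> (t (Suc i)))))
          \<le> curve_length \<gamma> a (t n) + ennreal (dist (\<gamma> (t n)) (\<gamma> b) + dist (\<gamma> b) (\<gamma> (t (Suc n))))"
          by (simp only: sum.lessThan_Suc) (intro add_mono ennreal_leI dist_triangle)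
        also have "\<dots> = (curve_length \<gamma> a (t n) + ennreal (dist (\<gamma> (t n)) (\<gamma> b)))
             + ennreal (dist (\<gamma> b) (\<gamma> (t (Suc n))))"
          by (simp add: ennreal_plus add.assoc)
        also have "\<dots> \<le> curve_length \<gamma> a b + curve_length \<gamma> b (t (Suc n))"
          by (intro add_mono curve_length_extend dist_le_curve_length) (use False ge mono in auto)
        finally show ?thesis .
      qed
    qed
  qed
  then show "\<And>n t. t 0 = a \<Longrightarrow> t n = c \<Longrightarrow> \<forall>i<n. t i \<le> t (Suc i) \<Longrightarrow>
    (\<Sum>i<n. ennreal (dist (\<gamma> (t i)) (\<gamma> (t (Suc i))))) \<le> curve_length \<gamma> a b + curve_length \<gamma> b c"
    using assms by metis
qed

text \<open>For the remaining inequality a partition of [b, c] is appended to [a, b] segment by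
  segment. Infinite length on [a, b] is a case of its own because subtraction in
  \<open>ennreal\<close> is reversible only for finite values.\<close>

lemma curve_length_add:
  assumes "a \<le> b" "b \<le> c"
  shows "curve_length \<gamma> a c = curve_length \<gamma> a b + curve_length \<gamma> b c"
proof (rule antisym[OF curve_length_add_le[OF assms]])
  have *: "curve_length \<gamma> a b + (\<Sum>i<n. ennreal (dist (\<gamma> (t i)) (\<gamma> (t (Suc i))))) \<le> curve_length \<gamma> a (t n)"
    if "t 0 = b" "\<forall>i<n. t i \<le> t (Suc i)" for n and t :: "nat \<Rightarrow> real"
    using that(2)
  proof (induction n)
    case 0
    then show ?case using that by simp
  next
    case (Suc n)
    have mono: "b \<le> t n"
      using partition_mono[of n t 0 n] Suc.prems that(1) by auto
    have "curve_length \<gamma> a b + (\<Sum>i<Suc n. ennreal (dist (\<gamma> (t i)) (\<gamma> (t (Suc i)))))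
        \<le> curve_length \<gamma> a (t n) + ennreal (dist (\<gamma> (t n)) (\<gamma> (t (Suc n))))"
      using Suc by (simp add: add.assoc[symmetric] add_mono)
    also have "\<dots> \<le> curve_length \<gamma> a (t (Suc n))"
      by (rule curve_length_extend) (use mono Suc assms in auto)
    finally show ?case .
  qed
  show "curve_length \<gamma> a b + curve_length \<gamma> b c \<le> curve_length \<gamma> a c"
  proof (cases "curve_length \<gamma> a b = \<infinity>")
    case True
    then show ?thesis using *[of "\<lambda>i. if i = 0 then b else c" 1] assms by (simp add: top_unique)
  next
    case False
    have "curve_length \<gamma> b c \<le> curve_length \<gamma> a c - curve_length \<gamma> a b"
      by (rule curve_length_least) (use * False in \<open>auto simp: ennreal_le_minus_iff add.commute\<close>)
    moreover have "curve_length \<gamma> a b \<le> curve_length \<gamma> a b + ennreal (dist (\<gamma> b) (\<gamma> c))"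
      by simp
    then have "curve_length \<gamma> a b \<le> curve_length \<gamma> a c"
      by (rule order_trans) (use *[of "\<lambda>i. if i = 0 then b else c" 1] assms in simp)
    ultimately show ?thesis
      using False by (auto simp: ennreal_le_minus_iff add.commute)
  qed
qed

text \<open>Locates the length that a partition sum misses: if no partition point lies strictly
  between x and y, that piece counts only through its chord. Together with additivity, a nearly
  optimal partition forces the length of [x, y] to be close to the chord.\<close>

lemma curve_length_gap:
  assumes t: "t 0 = a" "t n = b" "\<forall>i<n. t i \<le> t (Suc i)"
    and xy: "a \<le> x" "x \<le> y" "y \<le> b" and gap: "\<forall>i\<le>n. t i \<le> x \<or> y \<le> t i"
  shows "(\<Sum>i<n. ennreal (dist (\<gamma> (t i)) (\<gamma> (t (Suc i)))))
    \<le> curve_length \<gamma> a x + ennreal (dist (\<gamma> x) (\<gamma> y)) + curve_length \<gamma> y b"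
proof -
  have "y \<le> t n \<longrightarrow> (\<Sum>i<n. ennreal (dist (\<gamma> (t i)) (\<gamma> (t (Suc i)))))
    \<le> curve_length \<gamma> a x + ennreal (dist (\<gamma> x) (\<gamma> y)) + curve_length \<gamma> y (t n)"
    using t(3) gap
  proof (induction n)
    case 0
    then show ?case by simp
  next
    case (Suc n)
    have mono: "a \<le> t n"
      using partition_mono[of n t 0 n] Suc.prems t(1) by auto
    show ?case
    proof (intro impI)
      assume ge: "t (Suc n) \<ge> y"
      show "(\<Sum>i<Suc n. ennreal (dist (\<gamma> (t i)) (\<gamma> (t (Suc i)))))
          \<le> curve_length \<gamma> a x + ennreal (dist (\<gamma> x) (\<gamma> y)) + curve_length \<gamma> y (t (Suc n))"
      proof (cases "y \<le> t n")
        case True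
        have "(\<Sum>i<Suc n. ennreal (dist (\<gamma> (t i)) (\<gamma> (t (Suc i)))))
          \<le> (curve_length \<gamma> a x + ennreal (dist (\<gamma> x) (\<gamma> y)) + curve_length \<gamma> y (t n))
              + ennreal (dist (\<gamma> (t n)) (\<gamma> (t (Suc n))))"
          using Suc True by (simp add: add_mono)
        also have "\<dots> \<le> curve_length \<gamma> a x + ennreal (dist (\<gamma> x) (\<gamma> y)) + curve_length \<gamma> y (t (Suc n))"
          unfolding add.assoc by (intro add_left_mono curve_length_extend) (use Suc True in auto)
        finally show ?thesis .
      next
        case False
        then have tx: "t n \<le> x" using Suc.prems(2) by (metis le_SucI order_refl)
        have "(\<Sum>i<n. ennreal (dist (\<gamma> (t i)) (\<gamma> (t (Suc i))))) \<le> curve_length \<gamma> a (t n)"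
          by (rule curve_length_upper) (use Suc.prems t in auto)
        moreover have "dist (\<gamma> (t n)) (\<gamma> (t (Suc n))) \<le>
           dist (\<gamma> (t n)) (\<gamma> x) + dist (\<gamma> x) (\<gamma> y) + dist (\<gamma> y) (\<gamma> (t (Suc n)))"
          by (meson add_mono dist_triangle order_refl order_trans)
        ultimately have "(\<Sum>i<Suc n. ennreal (dist (\<gamma> (t i)) (\<gamma> (t (Suc i)))))
          \<le> curve_length \<gamma> a (t n) + ennreal (dist (\<gamma> (t n)) (\<gamma> x) + dist (\<gamma> x) (\<gamma> y)
              + dist (\<gamma> y) (\<gamma> (t (Suc n))))"
          by (simp only: sum.lessThan_Suc) (intro add_mono ennreal_leI)
        also have "\<dots> = (curve_length \<gamma> a (t n) + ennreal (dist (\<gamma> (t n)) (\<gamma> x)))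
             + ennreal (dist (\<gamma> x) (\<gamma> y)) + ennreal (dist (\<gamma> y) (\<gamma> (t (Suc n))))"
          by (simp add: ennreal_plus add.assoc)
        also have "\<dots> \<le> curve_length \<gamma> a x + ennreal (dist (\<gamma> x) (\<gamma> y)) + curve_length \<gamma> y (t (Suc n))"
          by (intro add_mono curve_length_extend dist_le_curve_length order_refl) (use tx ge mono in auto)
        finally show ?thesis .
      qed
    qed
  qed
  then show ?thesis using t(2) xy(3) by simp
qed

text \<open>A partition that is optimal up to e/2 has finitely many points, so a short interval with
  end point x has none of them in its interior. By \<open>curve_length_gap\<close> its length
  exceeds its chord by at most e/2, and the chord is at most e/2 by continuity of \<gamma>.\<close>

lemma curve_length_continuous:
  assumes cont: "continuous_on {a..b} \<gamma>" and fin: "curve_length \<gamma> a b < \<infinity>"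
    and x: "x \<in> {a..b}" and e: "0 < e"
  obtains d where "0 < d" "\<And>s t. s \<in> {a..b} \<Longrightarrow> t \<in> {a..b} \<Longrightarrow> s \<le> t \<Longrightarrow> s = x \<or> t = x \<Longrightarrow> t - s < d
     \<Longrightarrow> curve_length \<gamma> s t \<le> ennreal e"
proof -
  let ?l = "curve_length \<gamma> a b"
  have "\<exists>n t. t 0 = a \<and> t n = b \<and> (\<forall>i<n. t i \<le> t (Suc i)) \<and>
      ?l < (\<Sum>i<n. ennreal (dist (\<gamma> (t i)) (\<gamma> (t (Suc i))))) + ennreal (e/2)"
  proof (rule ccontr)
    assume "\<not> ?thesis"
    then have no: "(\<Sum>i<n. ennreal (dist (\<gamma> (t i)) (\<gamma> (t (Suc i))))) + ennreal (e/2) \<le> ?l"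
      if "t 0 = a" "t n = b" "\<forall>i<n. t i \<le> t (Suc i)" for n and t :: "nat \<Rightarrow> real"
      using that not_le by blast
    have "?l \<le> ?l - ennreal (e/2)"
      by (rule curve_length_least) (use no in \<open>simp add: ennreal_le_minus_iff\<close>)
    moreover obtain r where r: "0 \<le> r" "?l = ennreal r"
      using fin by (cases "?l") auto
    ultimately have "r = 0"
      using e by (auto simp: ennreal_minus ennreal_le_iff2 split: if_splits)
    moreover have "ennreal (dist (\<gamma> a) (\<gamma> b)) + ennreal (e/2) \<le> ?l"
      using no[of "\<lambda>i. if i = 0 then a else b" 1] x by simp
    ultimately show False using e r by simp
  qed
  then obtain n t where t: "t 0 = a" "t n = b" "\<forall>i<n. t i \<le> t (Suc i)"
    and tl: "?l < (\<Sum>i<n. ennreal (dist (\<gamma> (t i)) (\<gamma> (t (Suc i))))) + ennreal (e/2)" by blast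
  obtain d1 where d1: "0 < d1" "\<And>y. y \<in> {a..b} \<Longrightarrow> dist y x < d1 \<Longrightarrow> dist (\<gamma> y) (\<gamma> x) < e/2"
    using cont x e unfolding continuous_on_iff by (meson half_gt_zero)
  \<comment> \<open>The least distance from x to a partition point other than x; the inserted 1
    covers the case that there is none.\<close>
  define d2 where "d2 = Min (insert 1 ((\<lambda>i. \<bar>t i - x\<bar>) ` {i. i \<le> n \<and> t i \<noteq> x}))"
  have fin2: "finite ((\<lambda>i. \<bar>t i - x\<bar>) ` {i. i \<le> n \<and> t i \<noteq> x})" by auto
  have d2: "0 < d2" "\<And>i. i \<le> n \<Longrightarrow> t i \<noteq> x \<Longrightarrow> d2 \<le> \<bar>t i - x\<bar>"
    using fin2 by (auto simp: d2_def intro: Min_le)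
  show thesis
  proof (rule that[of "min d1 d2"])
    show "0 < min d1 d2" using d1 d2 by auto
    fix p q assume pq: "p \<in> {a..b}" "q \<in> {a..b}" "p \<le> q" "p = x \<or> q = x" "q - p < min d1 d2"
    have gap: "\<forall>i\<le>n. t i \<le> p \<or> q \<le> t i"
      using pq d2(2) by (smt (verit))
    have dd: "dist (\<gamma> p) (\<gamma> q) \<le> e/2"
      using pq d1(2)[of p] d1(2)[of q] e by (auto simp: dist_real_def dist_commute)
    have *: "?l = curve_length \<gamma> a p + curve_length \<gamma> p q + curve_length \<gamma> q b"
      using pq by (simp add: curve_length_add[of a q b] curve_length_add[of a p q])
    have "curve_length \<gamma> a p + curve_length \<gamma> p q + curve_length \<gamma> q b
       \<le> (curve_length \<gamma> a p + ennreal (dist (\<gamma> p) (\<gamma> q)) + curve_length \<gamma> q b) + ennreal (e/2)"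
      unfolding *[symmetric]
      using less_imp_le[OF tl] curve_length_gap[OF t _ _ _ gap, of \<gamma>] pq
      by (meson add_right_mono atLeastAtMost_iff order_trans)
    also have "\<dots> \<le> (curve_length \<gamma> a p + ennreal (e/2) + curve_length \<gamma> q b) + ennreal (e/2)"
      using dd by (intro add_mono ennreal_leI) auto
    also have "\<dots> = curve_length \<gamma> a p + curve_length \<gamma> q b + ennreal e"
      using e by (simp add: ac_simps flip: ennreal_plus)
    finally have "(curve_length \<gamma> a p + curve_length \<gamma> q b) + curve_length \<gamma> p q
        \<le> (curve_length \<gamma> a p + curve_length \<gamma> q b) + ennreal e" by (simp add: ac_simps)
    moreover have "curve_length \<gamma> a p + curve_length \<gamma> q b \<noteq> \<infinity>"
      using fin * by auto
    ultimately show "curve_length \<gamma> p q \<le> ennreal e"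
      by (simp add: ennreal_add_left_cancel_le)
  qed
qed

text \<open>Intermediate value theorem for the length of [a, t] as a function of t, which is
  continuous by \<open>curve_length_continuous\<close>.\<close>

lemma curve_length_surj:
  assumes cont: "continuous_on {a..b} \<gamma>" and fin: "curve_length \<gamma> a b < \<infinity>" and ab: "a \<le> b"
    and s: "0 \<le> s" "s \<le> enn2real (curve_length \<gamma> a b)"
  shows "\<exists>t\<in>{a..b}. curve_length \<gamma> a t = ennreal s"
proof -
  define L where "L t = enn2real (curve_length \<gamma> a t)" for t
  have finL: "curve_length \<gamma> p q < \<infinity>" if "a \<le> p" "p \<le> q" "q \<le> b" for p q
    using fin that by (auto simp: curve_length_add[of a q b] curve_length_add[of a p q])
  have eL: "curve_length \<gamma> a t = ennreal (L t)" if "t \<in> {a..b}" for t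
    using finL[of a t] that by (simp add: L_def)
  have diff: "L q - L p = enn2real (curve_length \<gamma> p q)" if "a \<le> p" "p \<le> q" "q \<le> b" for p q
    using finL[of a p] finL[of p q] that by (simp add: L_def curve_length_add[of a p q] enn2real_plus)
  have "continuous_on {a..b} L"
    unfolding continuous_on_iff
  proof (intro ballI allI impI)
    fix x and e :: real assume x: "x \<in> {a..b}" and e: "0 < e"
    obtain d where d: "0 < d" "\<And>s t. s \<in> {a..b} \<Longrightarrow> t \<in> {a..b} \<Longrightarrow> s \<le> t \<Longrightarrow> s = x \<or> t = x \<Longrightarrow> t - s < d
     \<Longrightarrow> curve_length \<gamma> s t \<le> ennreal (e/2)"
      using curve_length_continuous[OF cont fin x, of "e/2"] e by auto
    have *: "\<bar>L q - L p\<bar> < e" if "p \<in> {a..b}" "q \<in> {a..b}" "p \<le> q" "p = x \<or> q = x" "q - p < d" for p q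
    proof -
      have "enn2real (curve_length \<gamma> p q) \<le> e/2"
        using d(2)[OF that] e by (intro enn2real_leI) auto
      then show ?thesis using diff[of p q] that e by simp
    qed
    show "\<exists>d>0. \<forall>x'\<in>{a..b}. dist x' x < d \<longrightarrow> dist (L x') (L x) < e"
    proof (intro exI[of _ d] conjI ballI impI)
      fix y assume y: "y \<in> {a..b}" "dist y x < d"
      then show "dist (L y) (L x) < e"
        using *[of x y] *[of y x] x by (cases "x \<le> y") (auto simp: dist_real_def abs_minus_commute)
    qed (use d in auto)
  qed
  moreover have "L a = 0" "L b = enn2real (curve_length \<gamma> a b)" by (auto simp: L_def)
  ultimately obtain t where "t \<in> {a..b}" "L t = s"
    using IVT'[of L a s b] s ab by auto
  then show ?thesis using eL by auto
qed

definition total_length :: "(real \<Rightarrow> 'a::metric_space) \<Rightarrow> real \<Rightarrow> real \<Rightarrow> real" where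
  "total_length \<gamma> a b = enn2real (curve_length \<gamma> a b)"

lemma rectifiable_curve_length_pos:
  assumes "nonconst_rectifiable_curve \<gamma> a b"
  shows "0 < total_length \<gamma> a b"
proof -
  have ab: "a \<le> b" "curve_length \<gamma> a b < \<infinity>" using assms by (auto simp: nonconst_rectifiable_curve_def)
  obtain s t where st: "s \<in> {a..b}" "t \<in> {a..b}" "\<gamma> s \<noteq> \<gamma> t"
    using assms by (auto simp: nonconst_rectifiable_curve_def)
  obtain p q where pq: "p \<in> {a..b}" "q \<in> {a..b}" "p \<le> q" "\<gamma> p \<noteq> \<gamma> q"
    using st by (metis linorder_linear)
  have "0 < ennreal (dist (\<gamma> p) (\<gamma> q))" using pq by simp
  also have "\<dots> \<le> curve_length \<gamma> p q" using pq by (intro dist_le_curve_length)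
  also have "\<dots> \<le> curve_length \<gamma> a b"
    using pq by (simp add: curve_length_add[of a q b] curve_length_add[of a p q] add_increasing
        add_increasing2)
  finally show ?thesis using ab by (simp add: total_length_def enn2real_positive_iff)
qed

lemma arc_length_param_spec:
  assumes \<gamma>: "nonconst_rectifiable_curve \<gamma> a b" and s: "0 \<le> s" "s \<le> total_length \<gamma> a b"
  obtains t where "t \<in> {a..b}" "curve_length \<gamma> a t = ennreal s" "arc_length_param \<gamma> a b s = \<gamma> t"
proof -
  have "\<exists>t. t \<in> {a..b} \<and> curve_length \<gamma> a t = ennreal s"
    using curve_length_surj[of a b \<gamma> s] s \<gamma> by (auto simp: nonconst_rectifiable_curve_def total_length_def)
  from someI_ex[OF this] show thesis
    by (intro that[of "SOME t. t \<in> {a..b} \<and> curve_length \<gamma> a t = ennreal s"])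
       (auto simp: arc_length_param_def)
qed

lemma arc_length_param_dist:
  assumes \<gamma>: "nonconst_rectifiable_curve \<gamma> a b"
    and s: "0 \<le> s" "s \<le> t" "t \<le> total_length \<gamma> a b"
  shows "dist (arc_length_param \<gamma> a b s) (arc_length_param \<gamma> a b t) \<le> t - s"
proof -
  obtain p where p: "p \<in> {a..b}" "curve_length \<gamma> a p = ennreal s" "arc_length_param \<gamma> a b s = \<gamma> p"
    using arc_length_param_spec[OF \<gamma>, of s] s by auto
  obtain q where q: "q \<in> {a..b}" "curve_length \<gamma> a q = ennreal t" "arc_length_param \<gamma> a b t = \<gamma> q"
    using arc_length_param_spec[OF \<gamma>, of t] s by auto
  show ?thesis
  proof (cases "p \<le> q")
    case True
    then have "ennreal s + curve_length \<gamma> p q = ennreal t"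
      using curve_length_add[of a p q \<gamma>] p q by auto
    then have "ennreal s + curve_length \<gamma> p q = ennreal s + ennreal (t - s)"
      using s by (simp flip: ennreal_plus)
    then have "curve_length \<gamma> p q = ennreal (t - s)"
      by (simp add: ennreal_add_left_cancel)
    then show ?thesis using dist_le_curve_length[OF True, of \<gamma>] p q s by simp
  next
    \<comment> \<open>The parameters picked for s and t can be in the wrong order only if the piece
      between them has length zero.\<close>
    case False
    then have "ennreal t + curve_length \<gamma> q p = ennreal s"
      using curve_length_add[of a q p \<gamma>] p q by auto
    then have "ennreal s + curve_length \<gamma> q p \<le> ennreal s + 0"
      using s by (metis add.right_neutral add_right_mono ennreal_leI)
    then have "curve_length \<gamma> q p = 0"
      by (simp only: ennreal_add_left_cancel_le) auto
    then show ?thesis using dist_le_curve_length[of q p \<gamma>] False p q s by (simp add: dist_commute)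
  qed
qed

text \<open>Two parameters with the same length to their left bound a piece of length zero, on which
  \<gamma> is constant; so the choice inside \<open>arc_length_param\<close> is immaterial.\<close>

lemma arc_length_param_unique:
  assumes \<gamma>: "nonconst_rectifiable_curve \<gamma> a b" and t: "t \<in> {a..b}" "curve_length \<gamma> a t = ennreal s" "0 \<le> s"
  shows "arc_length_param \<gamma> a b s = \<gamma> t"
proof -
  have fin: "curve_length \<gamma> a b < \<infinity>" using \<gamma> by (auto simp: nonconst_rectifiable_curve_def)
  have "ennreal s \<le> curve_length \<gamma> a b"
    using t by (simp add: curve_length_add[of a t b] flip: t(2))
  then have "s \<le> total_length \<gamma> a b" using fin t unfolding total_length_def
      by (metis ennreal_enn2real ennreal_le_iff enn2real_nonneg infinity_ennreal_def)
  then obtain p where p: "p \<in> {a..b}" "curve_length \<gamma> a p = ennreal s" "arc_length_param \<gamma> a b s = \<gamma> p"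
    using arc_length_param_spec[OF \<gamma>, of s] t by auto
  have *: "\<gamma> x = \<gamma> y" if "x \<in> {a..b}" "y \<in> {a..b}" "curve_length \<gamma> a x = ennreal s"
      "curve_length \<gamma> a y = ennreal s" "x \<le> y" for x y
  proof -
    have "ennreal s + curve_length \<gamma> x y = ennreal s + 0"
      using curve_length_add[of a x y \<gamma>] that by auto
    then have "curve_length \<gamma> x y = 0"
      by (simp only: ennreal_add_left_cancel) auto
    then show ?thesis using dist_le_curve_length[of x y \<gamma>] that by simp
  qed
  show ?thesis using * p t by (metis linorder_linear)
qed

lemma arc_length_param_start:
  assumes "nonconst_rectifiable_curve \<gamma> a b"
  shows "arc_length_param \<gamma> a b 0 = \<gamma> a"
  using assms by (intro arc_length_param_unique) (auto simp: nonconst_rectifiable_curve_def)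

lemma arc_length_param_end:
  assumes "nonconst_rectifiable_curve \<gamma> a b"
  shows "arc_length_param \<gamma> a b (total_length \<gamma> a b) = \<gamma> b"
  using assms by (intro arc_length_param_unique) (auto simp: nonconst_rectifiable_curve_def
      total_length_def)

text \<open>The upper bound telescopes the Lipschitz bound \<open>arc_length_param_dist\<close>. For
  the lower bound each partition of \<gamma> is carried over by the length function L, since
  \<sigma> composed with L gives back \<gamma>.\<close>

lemma curve_length_arc_length_param:
  assumes \<gamma>: "nonconst_rectifiable_curve \<gamma> a b"
    and s: "0 \<le> s" "s \<le> t" "t \<le> total_length \<gamma> a b"
  shows "curve_length (arc_length_param \<gamma> a b) s t = ennreal (t - s)"
proof (rule antisym)
  let ?\<sigma> = "arc_length_param \<gamma> a b"
  have ab: "a \<le> b" "curve_length \<gamma> a b < \<infinity>" using \<gamma> by (auto simp: nonconst_rectifiable_curve_def)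
  show "curve_length ?\<sigma> s t \<le> ennreal (t - s)"
  proof (rule curve_length_least)
    fix n and v :: "nat \<Rightarrow> real"
    assume v: "v 0 = s" "v n = t" "\<forall>i<n. v i \<le> v (Suc i)"
    have "(\<Sum>i<n. ennreal (dist (?\<sigma> (v i)) (?\<sigma> (v (Suc i))))) \<le> (\<Sum>i<n. ennreal (v (Suc i) - v i))"
    proof (intro sum_mono ennreal_leI arc_length_param_dist[OF \<gamma>])
      fix i assume "i \<in> {..<n}"
      then show "0 \<le> v i" "v i \<le> v (Suc i)" "v (Suc i) \<le> total_length \<gamma> a b"
        using partition_mono[OF v(3), of 0 i] partition_mono[OF v(3), of "Suc i" n] v s by auto
    qed
    also have "\<dots> = ennreal (\<Sum>i<n. v (Suc i) - v i)"
      using v by (intro sum_ennreal) auto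
    also have "\<dots> = ennreal (t - s)"
      using v by (simp add: sum_lessThan_telescope)
    finally show "(\<Sum>i<n. ennreal (dist (?\<sigma> (v i)) (?\<sigma> (v (Suc i))))) \<le> ennreal (t - s)" .
  qed
  show "ennreal (t - s) \<le> curve_length ?\<sigma> s t"
  proof (cases "s = t")
    case False
    obtain p where p: "p \<in> {a..b}" "curve_length \<gamma> a p = ennreal s"
      using arc_length_param_spec[OF \<gamma>, of s] s by auto
    obtain q where q: "q \<in> {a..b}" "curve_length \<gamma> a q = ennreal t"
      using arc_length_param_spec[OF \<gamma>, of t] s by auto
    have pq: "p \<le> q"
    proof (rule ccontr)
      assume "\<not> p \<le> q"
      then have "ennreal t \<le> ennreal s"
        using curve_length_add[of a q p \<gamma>] p q by (auto simp: add_increasing2)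
      then show False using False s by simp
    qed
    have "ennreal s + curve_length \<gamma> p q = ennreal t"
      using curve_length_add[of a p q \<gamma>] p q pq by auto
    then have "ennreal s + curve_length \<gamma> p q = ennreal s + ennreal (t - s)"
      using s by (simp flip: ennreal_plus)
    then have len: "curve_length \<gamma> p q = ennreal (t - s)"
      by (simp add: ennreal_add_left_cancel)
    define L where "L x = enn2real (curve_length \<gamma> a x)" for x
    have fin: "curve_length \<gamma> a x < \<infinity>" if "x \<in> {a..b}" for x
      using ab that by (auto simp: curve_length_add[of a x b])
    have \<sigma>L: "?\<sigma> (L x) = \<gamma> x" if "x \<in> {a..b}" for x
      by (rule arc_length_param_unique[OF \<gamma>]) (use that fin[OF that] in \<open>auto simp: L_def\<close>)
    have Lmono: "L x \<le> L y" if "x \<in> {a..b}" "y \<in> {a..b}" "x \<le> y" for x y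
      unfolding L_def using that fin[of y] by (intro enn2real_mono) (auto simp: curve_length_add[of a x y])
    have "curve_length \<gamma> p q \<le> curve_length ?\<sigma> s t"
    proof (rule curve_length_least)
      fix n and v :: "nat \<Rightarrow> real"
      assume v: "v 0 = p" "v n = q" "\<forall>i<n. v i \<le> v (Suc i)"
      have vi: "v i \<in> {a..b}" if "i \<le> n" for i
        using partition_mono[OF v(3), of 0 i] partition_mono[OF v(3), of i n] v p q that by auto
      have "(\<Sum>i<n. ennreal (dist (\<gamma> (v i)) (\<gamma> (v (Suc i)))))
         = (\<Sum>i<n. ennreal (dist (?\<sigma> (L (v i))) (?\<sigma> (L (v (Suc i))))))"
        by (intro sum.cong refl) (use vi in \<open>simp add: \<sigma>L\<close>)
      also have "\<dots> \<le> curve_length ?\<sigma> s t"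
        by (rule curve_length_upper[of "\<lambda>i. L (v i)"])
           (use v p q s vi in \<open>auto simp: L_def[of p] L_def[of q] intro!: Lmono\<close>)
      finally show "(\<Sum>i<n. ennreal (dist (\<gamma> (v i)) (\<gamma> (v (Suc i))))) \<le> curve_length ?\<sigma> s t" .
    qed
    then show ?thesis using len by simp
  qed simp
qed

text \<open>Makes every piece of an arc length parametrization an admissible curve, so that the
  upper gradient inequality can be localized to subintervals. The positive length t - s rules out
  constancy.\<close>

lemma nonconst_rectifiable_arc_length_param:
  assumes \<gamma>: "nonconst_rectifiable_curve \<gamma> a b"
    and s: "0 \<le> s" "s < t" "t \<le> total_length \<gamma> a b"
  shows "nonconst_rectifiable_curve (arc_length_param \<gamma> a b) s t"
proof -
  let ?\<sigma> = "arc_length_param \<gamma> a b"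
  have "continuous_on {s..t} ?\<sigma>"
    unfolding continuous_on_iff
  proof (intro ballI allI impI)
    fix x and e :: real assume x: "x \<in> {s..t}" and e: "0 < e"
    have "dist (?\<sigma> y) (?\<sigma> x) < e" if "y \<in> {s..t}" "dist y x < e" for y
      using arc_length_param_dist[OF \<gamma>, of x y] arc_length_param_dist[OF \<gamma>, of y x] s x that
      by (cases "x \<le> y") (auto simp: dist_real_def dist_commute)
    then show "\<exists>d>0. \<forall>x'\<in>{s..t}. dist x' x < d \<longrightarrow> dist (?\<sigma> x') (?\<sigma> x) < e"
      using e by blast
  qed
  moreover have len: "curve_length ?\<sigma> s t = ennreal (t - s)"
    using curve_length_arc_length_param[OF \<gamma>, of s t] s by simp
  moreover have "\<exists>x\<in>{s..t}. \<exists>y\<in>{s..t}. ?\<sigma> x \<noteq> ?\<sigma> y"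
  proof (rule ccontr)
    assume "\<not> ?thesis"
    then have eq: "?\<sigma> x = ?\<sigma> y" if "x \<in> {s..t}" "y \<in> {s..t}" for x y using that by blast
    have "curve_length ?\<sigma> s t \<le> 0"
    proof (rule curve_length_least)
      fix n and v :: "nat \<Rightarrow> real"
      assume v: "v 0 = s" "v n = t" "\<forall>i<n. v i \<le> v (Suc i)"
      have vi: "v i \<in> {s..t}" if "i \<le> n" for i
        using partition_mono[OF v(3), of 0 i] partition_mono[OF v(3), of i n] v that by auto
      then show "(\<Sum>i<n. ennreal (dist (?\<sigma> (v i)) (?\<sigma> (v (Suc i))))) \<le> 0"
        by (intro sum_nonpos) (simp add: eq)
    qed
    then show False using len s by simp
  qed
  ultimately show ?thesis
    using s by (simp add: nonconst_rectifiable_curve_def)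
qed

lemma arc_length_param_arc_length_param:
  assumes \<gamma>: "nonconst_rectifiable_curve \<gamma> a b"
    and s: "0 \<le> s" "s < t" "t \<le> total_length \<gamma> a b" and x: "0 \<le> x" "x \<le> t - s"
  shows "arc_length_param (arc_length_param \<gamma> a b) s t x = arc_length_param \<gamma> a b (s + x)"
  by (rule arc_length_param_unique[OF nonconst_rectifiable_arc_length_param])
     (use assms in \<open>auto simp: curve_length_arc_length_param\<close>)

lemma arc_length_param_measurable:
  fixes g :: "'a::metric_space \<Rightarrow> ennreal"
  assumes \<gamma>: "nonconst_rectifiable_curve \<gamma> a b" and g: "g \<in> borel_measurable borel"
    and s: "0 \<le> s" "t \<le> total_length \<gamma> a b"
  shows "(\<lambda>x. g (arc_length_param \<gamma> a b x) * indicator {s..t} x) \<in> borel_measurable (borel::real measure)"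
proof -
  let ?\<sigma> = "arc_length_param \<gamma> a b"
  have "nonconst_rectifiable_curve ?\<sigma> 0 (total_length \<gamma> a b)"
    using nonconst_rectifiable_arc_length_param[OF \<gamma>, of 0
        "total_length \<gamma> a b"] rectifiable_curve_length_pos[OF \<gamma>] by simp
  then have "continuous_on {0..total_length \<gamma> a b} ?\<sigma>" by (simp add: nonconst_rectifiable_curve_def)
  then have "continuous_on {s..t} ?\<sigma>" by (rule continuous_on_subset) (use s in auto)
  then have "?\<sigma> \<in> measurable (restrict_space borel {s..t}) borel"
    by (rule borel_measurable_continuous_on_restrict)
  then have "(\<lambda>x. g (?\<sigma> x)) \<in> borel_measurable (restrict_space borel {s..t})"
    using g by (rule measurable_compose)
  then show ?thesis
    by (subst (asm) borel_measurable_restrict_space_iff_ennreal) (auto simp: mult.commute)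
qed

text \<open>An integral over part of a fixed arc length parametrization. Keeping \<sigma> fixed
  makes it additive in the interval, whereas \<open>curve_integral\<close> of a piece chooses a new
  parametrization.\<close>

definition line_integral :: "(real \<Rightarrow> 'a::metric_space) \<Rightarrow> real \<Rightarrow> real \<Rightarrow> ('a \<Rightarrow> ennreal) \<Rightarrow> ennreal" where
  "line_integral \<sigma> s t g = (\<integral>\<^sup>+x\<in>{s..t}. g (\<sigma> x) \<partial>lborel)"

lemma curve_integral_eq_line_integral:
  "curve_integral \<gamma> a b g = line_integral (arc_length_param \<gamma> a b) 0 (total_length \<gamma> a b) g"
  by (simp add: curve_integral_def line_integral_def total_length_def)

lemma curve_integral_arc_length_param:
  assumes \<gamma>: "nonconst_rectifiable_curve \<gamma> a b" and g: "g \<in> borel_measurable borel"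
    and s: "0 \<le> s" "s < t" "t \<le> total_length \<gamma> a b"
  shows "curve_integral (arc_length_param \<gamma> a b) s t g = line_integral (arc_length_param \<gamma> a b) s t g"
proof -
  let ?\<sigma> = "arc_length_param \<gamma> a b"
  have "curve_integral ?\<sigma> s t g = (\<integral>\<^sup>+x. g (?\<sigma> (s + x)) * indicator {s..t} (s + x) \<partial>lborel)"
    unfolding curve_integral_def
    using s by (intro nn_integral_cong)
      (auto simp: curve_length_arc_length_param[OF \<gamma>] arc_length_param_arc_length_param[OF \<gamma>] indicator_def)
  also have "\<dots> = line_integral ?\<sigma> s t g"
    unfolding line_integral_def
    using arc_length_param_measurable[OF \<gamma> g, of s t] s
    by (subst nn_integral_real_affine[where c = 1 and t = s]) auto
  finally show ?thesis .
qed

lemma upper_gradient_subcurve: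
  assumes \<gamma>: "nonconst_rectifiable_curve \<gamma> a b" and g: "upper_gradient g u"
    and s: "0 \<le> s" "s < t" "t \<le> total_length \<gamma> a b"
  shows "e2ennreal \<bar>u (arc_length_param \<gamma> a b s) - u (arc_length_param \<gamma> a b t)\<bar>
    \<le> line_integral (arc_length_param \<gamma> a b) s t g"
  using g nonconst_rectifiable_arc_length_param[OF \<gamma> s] curve_integral_arc_length_param[OF \<gamma> _ s, of g]
  by (metis upper_gradient_def)

section \<open>Real powers\<close>

lemma rpow_ennreal [simp]: "0 \<le> x \<Longrightarrow> ennreal_rpow (ennreal x) a = ennreal (x powr a)"
  by (simp add: ennreal_rpow_def)

lemma rpow_top [simp]: "ennreal_rpow top a = top"
  by (simp add: ennreal_rpow_def)

lemma rpow_0 [simp]: "ennreal_rpow 0 a = 0"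
  by (simp add: ennreal_rpow_def)

lemma rpow_one [simp]: "ennreal_rpow x 1 = x"
  by (cases x) auto

lemma rpow_eq_top_iff [simp]: "ennreal_rpow x a = top \<longleftrightarrow> x = top"
  by (cases x) auto

lemma rpow_less_top_iff [simp]: "ennreal_rpow x a < top \<longleftrightarrow> x < top"
  by (simp only: less_top[symmetric] rpow_eq_top_iff)

lemma rpow_mono: "x \<le> y \<Longrightarrow> 0 \<le> a \<Longrightarrow> ennreal_rpow x a \<le> ennreal_rpow y a"
  by (cases x; cases y) (auto simp: top_unique intro!: ennreal_leI powr_mono2)

lemma rpow_mult: "ennreal_rpow (x * y) a = ennreal_rpow x a * ennreal_rpow y a"
  by (cases x; cases y)
     (auto simp: powr_mult ennreal_mult_top ennreal_top_mult ennreal_eq_0_iff simp flip: ennreal_mult)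

lemma rpow_rpow: "ennreal_rpow (ennreal_rpow x a) b = ennreal_rpow x (a * b)"
  by (cases x) (auto simp: powr_powr)

lemma rpow_inverse [simp]:
  assumes "0 < a"
  shows "ennreal_rpow (ennreal_rpow x (1 / a)) a = x" "ennreal_rpow (ennreal_rpow x a) (1 / a) = x"
  using assms by (simp_all add: rpow_rpow)

lemma rpow_double: "ennreal_rpow x (2 * a) = ennreal_rpow x a * ennreal_rpow x a"
proof (cases x)
  case (real r)
  have "r powr (2 * a) = r powr a * r powr a"
    unfolding mult_2 by (rule powr_add)
  then show ?thesis using real by (simp add: ennreal_mult)
qed simp

lemma rpow_le_iff:
  assumes "0 < a"
  shows "ennreal_rpow x a \<le> y \<longleftrightarrow> x \<le> ennreal_rpow y (1 / a)"
  using rpow_mono[of "ennreal_rpow x a" y "1 / a"] rpow_mono[of x "ennreal_rpow y (1 / a)" a] assms by auto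

lemma rpow_measurable [measurable (raw)]:
  assumes [measurable]: "f \<in> borel_measurable M"
  shows "(\<lambda>x. ennreal_rpow (f x) a) \<in> borel_measurable M"
  unfolding ennreal_rpow_def by measurable

section \<open>Convexity and Clarkson inequalities for real powers\<close>

lemma powr_convex_ge0:
  assumes p: "1 \<le> p" and "0 \<le> x" "0 \<le> y" "0 < \<alpha>" "0 < \<beta>" "\<alpha> + \<beta> = 1"
  shows "(\<alpha> * x + \<beta> * y) powr p \<le> \<alpha> * x powr p + \<beta> * y powr (p::real)"
proof (cases "x = 0 \<or> y = 0")
  case True
  have "\<alpha> powr p \<le> \<alpha>" "\<beta> powr p \<le> \<beta>"
    using assms powr_mono'[of 1 p \<alpha>] powr_mono'[of 1 p \<beta>] by auto
  then show ?thesis using True assms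
    by (auto simp: powr_mult intro!: mult_right_mono)
next
  case False
  then have "((1 - \<beta>) *\<^sub>R x + \<beta> *\<^sub>R y) powr p \<le> (1 - \<beta>) * x powr p + \<beta> * y powr p"
    using assms by (intro convex_onD[OF powr_convex[OF p]]) auto
  moreover have "1 - \<beta> = \<alpha>" using assms by simp
  ultimately show ?thesis by simp
qed

text \<open>Convexity of the power at the points s * x / \<alpha> and s * y / \<beta> with weights
  \<alpha> / s and \<beta> / s, where s = \<alpha> + \<beta>. When \<alpha> and \<beta> are the
  norms of two functions, integration gives Minkowski's inequality.\<close>

lemma powr_add_le_weighted:
  assumes p: "1 \<le> p" and "0 \<le> x" "0 \<le> y" "0 < \<alpha>" "0 < \<beta>"
  shows "(x + y) powr p
    \<le> (\<alpha> + \<beta>) powr (p - 1) * \<alpha> powr (1 - p) * x powr p + (\<alpha> + \<beta>) powr (p - 1) * \<beta> powr (1 - p)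
        * y powr (p::real)"
proof -
  let ?s = "\<alpha> + \<beta>"
  have "x + y = (\<alpha> / ?s) * (?s / \<alpha> * x) + (\<beta> / ?s) * (?s / \<beta> * y)"
    using assms by simp
  also have "\<dots> powr p \<le> (\<alpha> / ?s) * (?s / \<alpha> * x) powr p + (\<beta> / ?s) * (?s / \<beta> * y) powr p"
    by (rule powr_convex_ge0) (use assms in \<open>auto simp: add_divide_distrib[symmetric]\<close>)
  also have "(\<alpha> / ?s) * (?s / \<alpha> * x) powr p = ?s powr (p - 1) * \<alpha> powr (1 - p) * x powr p"
    using assms unfolding powr_mult powr_divide by (simp add: powr_diff divide_simps)
  also have "(\<beta> / ?s) * (?s / \<beta> * y) powr p = ?s powr (p - 1) * \<beta> powr (1 - p) * y powr p"
    using assms unfolding powr_mult powr_divide by (simp add: powr_diff divide_simps)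
  finally show ?thesis .
qed

lemma rpow_add_le_weighted:
  assumes p: "1 \<le> p" and "0 < \<alpha>" "0 < \<beta>"
  shows "ennreal_rpow (x + y) p
    \<le> ennreal ((\<alpha> + \<beta>) powr (p - 1) * \<alpha> powr (1 - p)) * ennreal_rpow x p
     + ennreal ((\<alpha> + \<beta>) powr (p - 1) * \<beta> powr (1 - p)) * ennreal_rpow y p"
proof (cases "x = top \<or> y = top")
  case True
  then show ?thesis using assms by (auto simp: ennreal_mult_top)
next
  case False
  then obtain a b where "x = ennreal a" "y = ennreal b" "0 \<le> a" "0 \<le> b"
    by (cases x; cases y) auto
  then show ?thesis using powr_add_le_weighted[OF p, of a b \<alpha> \<beta>] assms
    by (simp flip: ennreal_plus ennreal_mult)
qed

lemma rpow_add_le: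
  assumes p: "0 \<le> p"
  shows "ennreal_rpow (x + y) p \<le> ennreal (2 powr p) * (ennreal_rpow x p + ennreal_rpow y p)"
proof -
  have "ennreal_rpow (x + y) p \<le> ennreal_rpow (ennreal 2 * max x y) p"
  proof (rule rpow_mono)
    have "x + y \<le> max x y + max x y" by (intro add_mono) auto
    then show "x + y \<le> ennreal 2 * max x y" by (simp flip: mult_2)
  qed (use p in auto)
  also have "\<dots> = ennreal (2 powr p) * ennreal_rpow (max x y) p"
    by (simp add: rpow_mult del: ennreal_numeral)
  also have "\<dots> \<le> ennreal (2 powr p) * (ennreal_rpow x p + ennreal_rpow y p)"
    by (intro mult_left_mono) (auto simp: max_def)
  finally show ?thesis .
qed

text \<open>Splitting off the first summand costs one more factor 2^p for every later term, whence
  the geometric weights; they are harmless for rapidly decreasing terms.\<close>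

lemma rpow_sum_le:
  assumes p: "0 \<le> p"
  shows "ennreal_rpow (\<Sum>i<n. x i) p \<le> (\<Sum>i<n. ennreal ((2 powr p) ^ Suc i) * ennreal_rpow (x i) p)"
proof (induction n arbitrary: x)
  case (Suc n)
  have "ennreal_rpow (\<Sum>i<Suc n. x i) p
     \<le> ennreal (2 powr p) * (ennreal_rpow (x 0) p + ennreal_rpow (\<Sum>i<n. x (Suc i)) p)"
    by (simp only: sum.lessThan_Suc_shift) (rule rpow_add_le[OF p])
  also have "\<dots> \<le> ennreal (2 powr p) * (ennreal_rpow (x 0) p +
      (\<Sum>i<n. ennreal ((2 powr p) ^ Suc i) * ennreal_rpow (x (Suc i)) p))"
    by (intro mult_left_mono add_left_mono Suc) auto
  also have "\<dots> = (\<Sum>i<Suc n. ennreal ((2 powr p) ^ Suc i) * ennreal_rpow (x i) p)"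
    by (simp only: sum.lessThan_Suc_shift)
       (simp add: distrib_left sum_distrib_left mult.assoc[symmetric] ennreal_mult)
  finally show ?case .
qed simp

lemma rpow_suminf_le:
  assumes p: "0 < p"
  shows "ennreal_rpow (\<Sum>i. x i) p \<le> (\<Sum>i. ennreal ((2 powr p) ^ Suc i) * ennreal_rpow (x i) p)"
proof -
  have "(\<Sum>i<n. x i) \<le> ennreal_rpow (\<Sum>i. ennreal ((2 powr p) ^ Suc i) * ennreal_rpow (x i) p) (1 / p)" for n
    unfolding rpow_le_iff[OF p, symmetric]
    by (rule order_trans[OF rpow_sum_le]) (use p in \<open>auto intro!: sum_le_suminf\<close>)
  then show ?thesis
    unfolding rpow_le_iff[OF p] by (intro suminf_le_const) auto
qed

text \<open>With A and B the half sum and the half difference, s = A^2 + B^2 = (a^2 + b^2) / 2. Each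
  of |A|^q, |B|^q is at most its square times s^(q/2 - 1), so their sum is at most s^(q/2), and
  convexity of t^(q/2) finishes. Both steps use q \<ge> 2.\<close>

lemma clarkson:
  fixes a b q :: real
  assumes q: "2 \<le> q"
  shows "\<bar>(a + b) / 2\<bar> powr q + \<bar>(a - b) / 2\<bar> powr q \<le> (\<bar>a\<bar> powr q + \<bar>b\<bar> powr q) / 2"
proof -
  have sq: "(\<bar>z\<bar>)\<^sup>2 powr (q / 2) = \<bar>z\<bar> powr q" for z :: real
  proof -
    have "(\<bar>z\<bar>)\<^sup>2 powr (q / 2) = \<bar>z\<bar> powr (q / 2) * \<bar>z\<bar> powr (q / 2)"
      unfolding power2_eq_square by (rule powr_mult)
    also have "\<dots> = \<bar>z\<bar> powr (q / 2 + q / 2)" by (rule powr_add[symmetric])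
    finally show ?thesis by (simp only: field_sum_of_halves)
  qed
  define s where "s = \<bar>(a + b) / 2\<bar>\<^sup>2 + \<bar>(a - b) / 2\<bar>\<^sup>2"
  have s: "s = (\<bar>a\<bar>\<^sup>2 + \<bar>b\<bar>\<^sup>2) / 2" by (simp add: s_def power2_eq_square field_simps)
  have le: "\<bar>z\<bar> powr q \<le> \<bar>z\<bar>\<^sup>2 * s powr (q / 2 - 1)" if "\<bar>z\<bar>\<^sup>2 \<le> s" for z
  proof (cases "z = 0")
    case False
    have "\<bar>z\<bar> powr q = \<bar>z\<bar>\<^sup>2 * (\<bar>z\<bar>\<^sup>2) powr (q / 2 - 1)"
      using False by (simp add: sq[symmetric] powr_mult_base)
    also have "\<dots> \<le> \<bar>z\<bar>\<^sup>2 * s powr (q / 2 - 1)"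
      using q that by (intro mult_left_mono powr_mono2) auto
    finally show ?thesis .
  qed auto
  have "\<bar>(a + b) / 2\<bar> powr q + \<bar>(a - b) / 2\<bar> powr q \<le> s * s powr (q / 2 - 1)"
    using le[of "(a + b) / 2"] le[of "(a - b) / 2"] by (simp add: s_def algebra_simps)
  also have "\<dots> = s powr (q / 2)"
    using q by (cases "s = 0") (auto simp: s_def powr_mult_base)
  also have "\<dots> \<le> ((\<bar>a\<bar>\<^sup>2) powr (q / 2) + (\<bar>b\<bar>\<^sup>2) powr (q / 2)) / 2"
    using powr_convex_ge0[of "q / 2" "\<bar>a\<bar>\<^sup>2" "\<bar>b\<bar>\<^sup>2" "1 / 2" "1 / 2"] q
        by (simp add: s algebra_simps add_divide_distrib)
  finally show ?thesis unfolding sq .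
qed

lemma powr_superadd:
  fixes a b p :: real
  assumes "1 \<le> p" "0 \<le> a" "0 \<le> b"
  shows "a powr p + b powr p \<le> (a + b) powr p"
proof (cases "a = 0 \<or> b = 0")
  case False
  have "z powr p \<le> z * (a + b) powr (p - 1)" if "0 < z" "z \<le> a + b" for z
  proof -
    have "z powr p = z * z powr (p - 1)" using that by (simp add: powr_mult_base)
    also have "\<dots> \<le> z * (a + b) powr (p - 1)"
      using that assms by (intro mult_left_mono powr_mono2) auto
    finally show ?thesis .
  qed
  from this[of a] this[of b] have "a powr p + b powr p \<le> (a + b) * (a + b) powr (p - 1)"
    using False assms by (simp add: algebra_simps)
  also have "\<dots> = (a + b) powr p" using False assms by (simp add: powr_mult_base)
  finally show ?thesis .
qed (use assms in auto)

lemma abs_diff_powr_le: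
  fixes a b p :: real
  assumes "1 \<le> p" "0 \<le> a" "0 \<le> b"
  shows "\<bar>a - b\<bar> powr p \<le> \<bar>a powr p - b powr p\<bar>"
proof -
  have *: "(y - x) powr p \<le> y powr p - x powr p" if "0 \<le> x" "x \<le> y" for x y
  proof -
    have "x powr p + (y - x) powr p \<le> (x + (y - x)) powr p"
      using that assms(1) by (intro powr_superadd) auto
    then show ?thesis by simp
  qed
  show ?thesis
  proof (cases "a \<le> b")
    case True
    then show ?thesis using *[of a b] assms(2) by (simp add: abs_minus_commute)
  next
    case False
    then show ?thesis using *[of b a] assms(3) by simp
  qed
qed

text \<open>The Mazur map: composition with it carries real L^p functions to L^1 functions, so that
  density questions are settled in L^1.\<close>

definition spowr :: "real \<Rightarrow> real \<Rightarrow> real" where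
  "spowr x p = sgn x * \<bar>x\<bar> powr p"

lemma abs_spowr [simp]: "\<bar>spowr x p\<bar> = \<bar>x\<bar> powr p"
  by (auto simp: spowr_def abs_mult abs_sgn_eq)

lemma spowr_nonneg: "0 \<le> x \<Longrightarrow> spowr x p = x powr p"
  by (cases "x = 0") (simp_all add: spowr_def)

lemma spowr_nonpos: "x \<le> 0 \<Longrightarrow> spowr x p = - ((- x) powr p)"
  by (cases "x = 0") (simp_all add: spowr_def)

text \<open>Hoelder continuity of the inverse Mazur map. Equal signs reduce to superadditivity of
  the power; for opposite signs |a - b| is at most twice the larger absolute value, which costs the
  factor 2^p.\<close>

lemma abs_diff_powr_le_spowr:
  fixes a b p :: real
  assumes p: "1 \<le> p"
  shows "\<bar>a - b\<bar> powr p \<le> 2 powr p * \<bar>spowr a p - spowr b p\<bar>"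
proof -
  have two: "1 \<le> 2 powr p" using p by (intro ge_one_powr_ge_zero) auto
  have *: "\<bar>x - y\<bar> powr p \<le> 2 powr p * \<bar>spowr x p - spowr y p\<bar>" if "y \<le> x" for x y
  proof (cases "0 \<le> y \<or> x \<le> 0")
    case True
    have "\<bar>x - y\<bar> powr p \<le> \<bar>spowr x p - spowr y p\<bar>"
      using True
    proof
      assume "0 \<le> y"
      then show ?thesis
        using abs_diff_powr_le[OF p, of x y] that by (simp only: spowr_nonneg order_trans[of 0 y x])
    next
      assume x: "x \<le> 0"
      have "\<bar>- x - - y\<bar> powr p \<le> \<bar>(- x) powr p - (- y) powr p\<bar>"
        using x that by (intro abs_diff_powr_le[OF p]) auto
      moreover have "\<bar>- x - - y\<bar> = \<bar>x - y\<bar>" by simp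
      moreover have "\<bar>(- x) powr p - (- y) powr p\<bar> = \<bar>spowr x p - spowr y p\<bar>"
        using x that spowr_nonpos[of x p] spowr_nonpos[of y p] by simp
      ultimately show ?thesis by metis
    qed
    also have "\<dots> \<le> 2 powr p * \<bar>spowr x p - spowr y p\<bar>"
      using mult_right_mono[OF two abs_ge_zero] by simp
    finally show ?thesis .
  next
    case False
    have "(x + (-y)) powr p \<le> (2 * max x (-y)) powr p"
      using False p by (intro powr_mono2) auto
    also have "\<dots> = 2 powr p * max x (-y) powr p" by (rule powr_mult)
    also have "max x (-y) powr p \<le> x powr p + (-y) powr p"
      by (simp add: max_def)
    also have "\<dots> = \<bar>spowr x p - spowr y p\<bar>"
      using False spowr_nonneg[of x p] spowr_nonpos[of y p] by simp
    finally show ?thesis using that by simp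
  qed
  show ?thesis
  proof (cases "a \<le> b")
    case True
    then show ?thesis using *[of a b] by (simp only: abs_minus_commute)
  next
    case False
    then have "b \<le> a" by simp
    then show ?thesis by (rule *)
  qed
qed

text \<open>Either x \<le> \<Omega> / \<tau>, or \<tau> * x / \<Omega> is at least 1 and the first
  term alone suffices. With x = H^p this trades a weighted integral of H^(2p) for a plain integral
  of H^p.\<close>

lemma ennreal_amgm:
  assumes "0 < \<Omega>" "\<Omega> < top" "0 < (\<tau>::real)"
  shows "x \<le> ennreal \<tau> * (x * x / \<Omega>) + \<Omega> / ennreal \<tau>"
proof (cases x)
  case (real r)
  obtain w where w: "\<Omega> = ennreal w" "0 < w" using assms by (cases \<Omega>) auto
  have "r \<le> \<tau> * (r * r / w) + w / \<tau>"
  proof (cases "r \<le> w / \<tau>")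
    case False
    then have "1 \<le> \<tau> * r / w" using assms w by (simp add: field_simps)
    then have "r * 1 \<le> r * (\<tau> * r / w)" using real by (intro mult_left_mono) auto
    moreover have "0 \<le> w / \<tau>" using assms w by simp
    ultimately show ?thesis by (simp add: mult.left_commute mult.commute)
  next
    case True
    moreover have "0 \<le> \<tau> * (r * r / w)" using assms w by simp
    ultimately show ?thesis by linarith
  qed
  then show ?thesis using real w assms
    by (simp add: divide_ennreal flip: ennreal_mult ennreal_plus)
next
  case top
  then show ?thesis using assms
    by (simp add: ennreal_mult_top ennreal_top_mult divide_ennreal_def ennreal_mult_eq_top_iff)
qed

section \<open>Upper gradients of real-valued functions\<close>

definition real_upper_gradient :: "('a::metric_space \<Rightarrow> ennreal) \<Rightarrow> ('a \<Rightarrow> real) \<Rightarrow> bool" where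
  "real_upper_gradient g f \<longleftrightarrow> g \<in> borel_measurable borel \<and>
     (\<forall>\<gamma> a b. nonconst_rectifiable_curve \<gamma> a b \<longrightarrow>
        ennreal \<bar>f (\<gamma> a) - f (\<gamma> b)\<bar> \<le> line_integral (arc_length_param \<gamma> a b) 0 (total_length \<gamma> a b) g)"

lemma real_upper_gradient_iff: "real_upper_gradient g f \<longleftrightarrow> upper_gradient g (\<lambda>x. ereal (f x))"
  by (simp add: real_upper_gradient_def upper_gradient_def curve_integral_eq_line_integral)

lemma real_upper_gradientD:
  assumes "real_upper_gradient g f"
  shows "g \<in> borel_measurable borel"
    and "nonconst_rectifiable_curve \<gamma> a b \<Longrightarrow>
      ennreal \<bar>f (\<gamma> a) - f (\<gamma> b)\<bar> \<le> line_integral (arc_length_param \<gamma> a b) 0 (total_length \<gamma> a b) g"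
  using assms by (auto simp: real_upper_gradient_def)

lemma real_upper_gradient_subcurve:
  assumes \<gamma>: "nonconst_rectifiable_curve \<gamma> a b" and g: "real_upper_gradient g f"
    and s: "0 \<le> s" "s \<le> t" "t \<le> total_length \<gamma> a b"
  shows "ennreal \<bar>f (arc_length_param \<gamma> a b s) - f (arc_length_param \<gamma> a b t)\<bar>
    \<le> line_integral (arc_length_param \<gamma> a b) s t g"
  using upper_gradient_subcurve[OF \<gamma> _ s(1) _ s(3)] g s unfolding real_upper_gradient_iff
  by (cases "s = t") fastforce+

lemma line_integral_mono:
  assumes "\<And>x. g x \<le> h x" "s' \<le> s" "t \<le> t'"
  shows "line_integral \<sigma> s t g \<le> line_integral \<sigma> s' t' h"
  unfolding line_integral_def using assms by (intro nn_integral_mono) (auto simp: indicator_def)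

context
  fixes \<gamma> :: "real \<Rightarrow> 'a::metric_space" and a b s t :: real
  assumes \<gamma>: "nonconst_rectifiable_curve \<gamma> a b" and s: "0 \<le> s" and t: "t \<le> total_length \<gamma> a b"
begin

lemma line_integral_measurable:
  fixes g :: "'a \<Rightarrow> ennreal"
  assumes "g \<in> borel_measurable borel"
  shows "(\<lambda>x. g (arc_length_param \<gamma> a b x) * indicator {s..t} x) \<in> borel_measurable lborel"
  using arc_length_param_measurable[OF \<gamma> assms s t] by simp

lemma line_integral_add:
  assumes "g \<in> borel_measurable borel" "h \<in> borel_measurable borel"
  shows "line_integral (arc_length_param \<gamma> a b) s t (\<lambda>x. g x + h x)
    = line_integral (arc_length_param \<gamma> a b) s t g + line_integral (arc_length_param \<gamma> a b) s t h"
  unfolding line_integral_def distrib_right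
  by (intro nn_integral_add line_integral_measurable assms)

lemma line_integral_cmult:
  assumes "g \<in> borel_measurable borel"
  shows "line_integral (arc_length_param \<gamma> a b) s t (\<lambda>x. c * g x) = c
      * line_integral (arc_length_param \<gamma> a b) s t g"
  unfolding line_integral_def mult.assoc
  by (intro nn_integral_cmult line_integral_measurable assms)

lemma line_integral_suminf:
  assumes "\<And>n. g n \<in> borel_measurable borel"
  shows "line_integral (arc_length_param \<gamma> a b) s t (\<lambda>x. \<Sum>n. g n x)
    = (\<Sum>n. line_integral (arc_length_param \<gamma> a b) s t (g n))"
  unfolding line_integral_def ennreal_suminf_multc[symmetric]
  by (intro nn_integral_suminf line_integral_measurable assms)

lemma line_integral_split:
  assumes g: "g \<in> borel_measurable borel" and u: "s \<le> u" "u \<le> t"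
  shows "line_integral (arc_length_param \<gamma> a b) s t g
    = line_integral (arc_length_param \<gamma> a b) s u g + line_integral (arc_length_param \<gamma> a b) u t g"
proof -
  let ?\<sigma> = "arc_length_param \<gamma> a b"
  have m: "(\<lambda>x. g (?\<sigma> x) * indicator {s..u} x) \<in> borel_measurable lborel"
    "(\<lambda>x. g (?\<sigma> x) * indicator {u..t} x) \<in> borel_measurable lborel"
    using arc_length_param_measurable[OF \<gamma> g, of s u] arc_length_param_measurable[OF \<gamma> g, of u t] s t u
        by auto
  show ?thesis
    unfolding line_integral_def nn_integral_add[OF m, symmetric]
  proof (rule nn_integral_cong_AE)
    show "AE x in lborel. g (?\<sigma> x) * indicator {s..t} x = g (?\<sigma> x) * indicator {s..u} x + g (?\<sigma> x)
        * indicator {u..t} x"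
      using AE_lborel_singleton[of u] by eventually_elim (use u in \<open>auto simp: indicator_def\<close>)
  qed
qed

end

lemma real_upper_gradient_add:
  assumes g: "real_upper_gradient g f" and h: "real_upper_gradient h k"
  shows "real_upper_gradient (\<lambda>x. g x + h x) (\<lambda>x. f x + k x)"
  unfolding real_upper_gradient_def
proof (intro conjI allI impI)
  note m [measurable] = real_upper_gradientD(1)[OF g] real_upper_gradientD(1)[OF h]
  show "(\<lambda>x. g x + h x) \<in> borel_measurable borel" by measurable
  fix \<gamma> :: "real \<Rightarrow> 'a" and a b assume \<gamma>: "nonconst_rectifiable_curve \<gamma> a b"
  have "ennreal \<bar>(f (\<gamma> a) + k (\<gamma> a)) - (f (\<gamma> b) + k (\<gamma> b))\<bar>
    \<le> ennreal (\<bar>f (\<gamma> a) - f (\<gamma> b)\<bar> + \<bar>k (\<gamma> a) - k (\<gamma> b)\<bar>)"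
    by (intro ennreal_leI) linarith
  also have "\<dots> = ennreal \<bar>f (\<gamma> a) - f (\<gamma> b)\<bar> + ennreal \<bar>k (\<gamma> a) - k (\<gamma> b)\<bar>"
    by simp
  also have "\<dots> \<le> line_integral (arc_length_param \<gamma> a b) 0 (total_length \<gamma> a b) (\<lambda>x. g x + h x)"
    by (simp add: line_integral_add[OF \<gamma>] m add_mono real_upper_gradientD(2)[OF g \<gamma>]
        real_upper_gradientD(2)[OF h \<gamma>])
  finally show "ennreal \<bar>(f (\<gamma> a) + k (\<gamma> a)) - (f (\<gamma> b) + k (\<gamma> b))\<bar>
    \<le> line_integral (arc_length_param \<gamma> a b) 0 (total_length \<gamma> a b) (\<lambda>x. g x + h x)" .
qed

lemma real_upper_gradient_cmult:
  assumes g: "real_upper_gradient g f"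
  shows "real_upper_gradient (\<lambda>x. ennreal \<bar>c\<bar> * g x) (\<lambda>x. c * f x)"
  unfolding real_upper_gradient_def
proof (intro conjI allI impI)
  note m [measurable] = real_upper_gradientD(1)[OF g]
  show "(\<lambda>x. ennreal \<bar>c\<bar> * g x) \<in> borel_measurable borel" by measurable
  fix \<gamma> :: "real \<Rightarrow> 'a" and a b assume \<gamma>: "nonconst_rectifiable_curve \<gamma> a b"
  have "ennreal \<bar>c * f (\<gamma> a) - c * f (\<gamma> b)\<bar> = ennreal \<bar>c\<bar> * ennreal \<bar>f (\<gamma> a) - f (\<gamma> b)\<bar>"
    by (simp flip: ennreal_mult abs_mult right_diff_distrib)
  also have "\<dots> \<le> ennreal \<bar>c\<bar> * line_integral (arc_length_param \<gamma> a b) 0 (total_length \<gamma> a b) g"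
    by (intro mult_left_mono real_upper_gradientD(2)[OF g \<gamma>]) auto
  finally show "ennreal \<bar>c * f (\<gamma> a) - c * f (\<gamma> b)\<bar>
    \<le> line_integral (arc_length_param \<gamma> a b) 0 (total_length \<gamma> a b) (\<lambda>x. ennreal \<bar>c\<bar> * g x)"
    by (simp add: line_integral_cmult[OF \<gamma>] m)
qed

text \<open>The indicators of intervals shrinking to a point tend to 0 almost everywhere, and f
  itself dominates. It yields continuity at the ends of a curve along which an upper gradient is
  integrable.\<close>

lemma nn_integral_small_interval:
  fixes f :: "real \<Rightarrow> ennreal"
  assumes f [measurable]: "f \<in> borel_measurable lborel" and fin: "(\<integral>\<^sup>+x. f x \<partial>lborel) < \<infinity>"
    and \<eta>: "0 < (\<eta>::ennreal)"
  obtains d where "0 < d" "(\<integral>\<^sup>+x\<in>{a-d..a+d}. f x \<partial>lborel) < \<eta>"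
proof -
  let ?A = "\<lambda>n. {a - 1 / real (Suc n)..a + 1 / real (Suc n)}"
  have "(\<lambda>n. \<integral>\<^sup>+x. f x * indicator (?A n) x \<partial>lborel) \<longlonglongrightarrow> (\<integral>\<^sup>+x. 0 \<partial>(lborel::real measure))"
  proof (rule nn_integral_dominated_convergence[where w = f])
    show "AE x in lborel. (\<lambda>n. f x * indicator (?A n) x) \<longlonglongrightarrow> 0"
      using AE_lborel_singleton[of a]
    proof eventually_elim
      case (elim x)
      have "0 < \<bar>x - a\<bar>" using elim by simp
      then obtain N where N: "1 / real (Suc N) < \<bar>x - a\<bar>"
        using nat_approx_posE by blast
      have "f x * indicator (?A n) x = 0" if "n \<ge> N" for n
      proof -
        have "1 / real (Suc n) \<le> 1 / real (Suc N)" using that by (intro divide_left_mono) auto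
        then show ?thesis using N by (auto simp: indicator_def abs_if split: if_splits)
      qed
      then show ?case
        by (intro tendsto_eventually) (auto simp: eventually_sequentially)
    qed
  qed (use fin in \<open>auto simp: indicator_def\<close>)
  then have "eventually (\<lambda>n. (\<integral>\<^sup>+x. f x * indicator (?A n) x \<partial>lborel) < \<eta>) sequentially"
    using \<eta> by (intro order_tendstoD(2)) simp_all
  then obtain n where "(\<integral>\<^sup>+x. f x * indicator (?A n) x \<partial>lborel) < \<eta>"
    by (auto simp: eventually_sequentially)
  then show thesis by (intro that[of "1 / real (Suc n)"]) auto
qed

lemma AE_lborel_interval_witness:
  fixes u v :: real
  assumes "AE x in lborel. x \<in> {u..v} \<longrightarrow> P x" and "u \<le> s" "s < t" "t \<le> v"
  obtains x where "s < x" "x < t" "P x"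
proof -
  obtain N where N: "{x \<in> space lborel. \<not> (x \<in> {u..v} \<longrightarrow> P x)} \<subseteq> N" "emeasure lborel N = 0" "N \<in> sets lborel"
    using assms(1) by (rule AE_E)
  have "\<not> {s<..<t} \<subseteq> N"
  proof
    assume "{s<..<t} \<subseteq> N"
    then have "emeasure lborel {s<..<t} \<le> emeasure lborel N" using N by (intro emeasure_mono) auto
    then show False using N assms by simp
  qed
  then obtain x where "x \<in> {s<..<t}" "x \<notin> N" by blast
  then have "s < x" "x < t" "x \<notin> N" by auto
  moreover have "P x"
  proof (rule ccontr)
    assume "\<not> P x"
    moreover have "x \<in> {u..v}" using \<open>s < x\<close> \<open>x < t\<close> assms(2,4) by simp
    ultimately have "x \<in> N" using N(1) by auto
    then show False using \<open>x \<notin> N\<close> by simp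
  qed
  ultimately show thesis by (intro that) auto
qed

text \<open>
  A curve that spends positive length in \<open>E\<close> has an infinite integral of \<open>\<infinity> \<cdot> 1\<^sub>E\<close>. On every other
  curve with a finite integral of \<open>g0\<close>, points outside \<open>E\<close> accumulate at the end points, where \<open>f\<close> is
  continuous along the curve.
\<close>

lemma real_upper_gradient_weakI:
  assumes g0: "real_upper_gradient g0 f" and E [measurable]: "E \<in> sets borel"
    and H [measurable]: "H \<in> borel_measurable borel" and \<epsilon>: "0 < (\<epsilon>::real)"
    and le: "\<And>\<gamma> a b s t. nonconst_rectifiable_curve \<gamma> a b \<Longrightarrow> 0 < s \<Longrightarrow> s < t \<Longrightarrow> t < total_length \<gamma> a b \<Longrightarrow>
      arc_length_param \<gamma> a b s \<notin> E \<Longrightarrow> arc_length_param \<gamma> a b t \<notin> E \<Longrightarrow>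
      ennreal \<bar>f (arc_length_param \<gamma> a b s) - f (arc_length_param \<gamma> a b t)\<bar>
        \<le> line_integral (arc_length_param \<gamma> a b) 0 (total_length \<gamma> a b) H"
  shows "real_upper_gradient (\<lambda>x. ennreal \<epsilon> * g0 x + (H x + top * indicator E x)) f"
  unfolding real_upper_gradient_def
proof (intro conjI allI impI)
  note m [measurable] = real_upper_gradientD(1)[OF g0]
  show "(\<lambda>x. ennreal \<epsilon> * g0 x + (H x + top * indicator E x)) \<in> borel_measurable borel" by measurable
  fix \<gamma> :: "real \<Rightarrow> 'a" and a b assume \<gamma>: "nonconst_rectifiable_curve \<gamma> a b"
  let ?\<sigma> = "arc_length_param \<gamma> a b" and ?l = "total_length \<gamma> a b"
  let ?I = "line_integral ?\<sigma> 0 ?l"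
  have mi: "(\<lambda>x. g (?\<sigma> x) * indicator {0..?l} x) \<in> borel_measurable lborel"
    if "g \<in> borel_measurable borel" for g :: "'a \<Rightarrow> ennreal"
    by (rule line_integral_measurable[OF \<gamma>]) (use that in auto)
  have lpos: "0 < ?l" by (rule rectifiable_curve_length_pos[OF \<gamma>])
  have eq: "?I (\<lambda>x. ennreal \<epsilon> * g0 x + (H x + top * indicator E x))
      = ennreal \<epsilon> * ?I g0 + (?I H + top * ?I (indicator E))"
  proof -
    have "?I (\<lambda>x. ennreal \<epsilon> * g0 x + (H x + top * indicator E x))
       = ?I (\<lambda>x. ennreal \<epsilon> * g0 x) + ?I (\<lambda>x. H x + top * indicator E x)"
      by (rule line_integral_add[OF \<gamma>]) auto
    also have "?I (\<lambda>x. H x + top * indicator E x) = ?I H + ?I (\<lambda>x. top * indicator E x)"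
      by (rule line_integral_add[OF \<gamma>]) auto
    also have "?I (\<lambda>x. top * indicator E x) = top * ?I (indicator E)"
      by (rule line_integral_cmult[OF \<gamma>]) auto
    also have "?I (\<lambda>x. ennreal \<epsilon> * g0 x) = ennreal \<epsilon> * ?I g0"
      by (rule line_integral_cmult[OF \<gamma>]) auto
    finally show ?thesis .
  qed
  show "ennreal \<bar>f (\<gamma> a) - f (\<gamma> b)\<bar> \<le> ?I (\<lambda>x. ennreal \<epsilon> * g0 x + (H x + top * indicator E x))"
  proof (cases "?I g0 = top \<or> ?I (indicator E) \<noteq> 0")
    case True
    then show ?thesis unfolding eq using \<epsilon> by (auto simp: ennreal_mult_top ennreal_top_mult)
  next
    case False
    have "AE x in lborel. indicator E (?\<sigma> x) * indicator {0..?l} x = (0::ennreal)"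
      using False mi[of "indicator E"] by (auto simp: line_integral_def nn_integral_0_iff_AE)
    then have AE: "AE x in lborel. x \<in> {0..?l} \<longrightarrow> ?\<sigma> x \<notin> E"
      by eventually_elim (auto simp: indicator_def split: if_splits)
    have fin: "(\<integral>\<^sup>+x. g0 (?\<sigma> x) * indicator {0..?l} x \<partial>lborel) < \<infinity>"
      using False by (auto simp: line_integral_def less_top)
    have "ennreal \<bar>f (\<gamma> a) - f (\<gamma> b)\<bar> \<le> ?I H"
    proof (rule ennreal_le_epsilon)
      fix e :: real assume e: "0 < e"
      have e2: "0 < ennreal (e / 2)" using e by simp
      obtain d1 where d1: "0 < d1" "(\<integral>\<^sup>+x\<in>{0-d1..0+d1}. (g0 (?\<sigma> x) * indicator {0..?l} x) \<partial>lborel)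
          < ennreal (e/2)"
        using nn_integral_small_interval[OF mi[OF m] fin e2] by blast
      obtain d2 where d2: "0 < d2" "(\<integral>\<^sup>+x\<in>{?l-d2..?l+d2}. (g0 (?\<sigma> x) * indicator {0..?l} x) \<partial>lborel)
          < ennreal (e/2)"
        using nn_integral_small_interval[OF mi[OF m] fin e2] by blast
      \<comment> \<open>Points off E exist arbitrarily near both ends, because the curve spends no
        time in E; nearness makes the integral of \<open>g0\<close> over the two cut off pieces
        small. The bound \<open>?l/2\<close> keeps s before t.\<close>
      obtain s where s: "0 < s" "s < min d1 (?l/2)" "?\<sigma> s \<notin> E"
        by (rule AE_lborel_interval_witness[OF AE, of 0 "min d1 (?l/2)"]) (use d1 lpos in auto)
      obtain t where t: "max (?l-d2) (?l/2) < t" "t < ?l" "?\<sigma> t \<notin> E"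
        by (rule AE_lborel_interval_witness[OF AE, of "max (?l-d2) (?l/2)" ?l]) (use d2 lpos in auto)
      have A: "ennreal \<bar>f (?\<sigma> 0) - f (?\<sigma> s)\<bar> \<le> ennreal (e/2)"
      proof -
        have "ennreal \<bar>f (?\<sigma> 0) - f (?\<sigma> s)\<bar> \<le> line_integral ?\<sigma> 0 s g0"
          by (rule real_upper_gradient_subcurve[OF \<gamma> g0]) (use s in auto)
        also have "\<dots> \<le> (\<integral>\<^sup>+x\<in>{0-d1..0+d1}. (g0 (?\<sigma> x) * indicator {0..?l} x) \<partial>lborel)"
          unfolding line_integral_def by (intro nn_integral_mono) (use s in \<open>auto simp: indicator_def\<close>)
        finally show ?thesis using d1 by auto
      qed
      have B: "ennreal \<bar>f (?\<sigma> t) - f (?\<sigma> ?l)\<bar> \<le> ennreal (e/2)"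
      proof -
        have "ennreal \<bar>f (?\<sigma> t) - f (?\<sigma> ?l)\<bar> \<le> line_integral ?\<sigma> t ?l g0"
          by (rule real_upper_gradient_subcurve[OF \<gamma> g0]) (use t lpos in auto)
        also have "\<dots> \<le> (\<integral>\<^sup>+x\<in>{?l-d2..?l+d2}. (g0 (?\<sigma> x) * indicator {0..?l} x) \<partial>lborel)"
          unfolding line_integral_def by (intro nn_integral_mono) (use t d2 lpos
              in \<open>auto simp: indicator_def\<close>)
        finally show ?thesis using d2 by auto
      qed
      have C: "ennreal \<bar>f (?\<sigma> s) - f (?\<sigma> t)\<bar> \<le> ?I H"
        by (rule le[OF \<gamma>]) (use s t in auto)
      have "ennreal \<bar>f (\<gamma> a) - f (\<gamma> b)\<bar> \<le>
        ennreal (\<bar>f (?\<sigma> 0) - f (?\<sigma> s)\<bar> + \<bar>f (?\<sigma> s) - f (?\<sigma> t)\<bar> + \<bar>f (?\<sigma> t) - f (?\<sigma> ?l)\<bar>)"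
        using arc_length_param_start[OF \<gamma>] arc_length_param_end[OF \<gamma>] by (intro ennreal_leI) simp
      also have "\<dots> = ennreal \<bar>f (?\<sigma> 0) - f (?\<sigma> s)\<bar> + ennreal \<bar>f (?\<sigma> s) - f (?\<sigma> t)\<bar> + ennreal \<bar>f (?\<sigma> t)
          - f (?\<sigma> ?l)\<bar>"
        by (simp add: ennreal_plus)
      also have "\<dots> \<le> ennreal (e/2) + ?I H + ennreal (e/2)"
        by (intro add_mono A B C)
      also have "\<dots> = ?I H + ennreal e"
        using e by (simp add: ac_simps flip: ennreal_plus)
      finally show "ennreal \<bar>f (\<gamma> a) - f (\<gamma> b)\<bar> \<le> ?I H + ennreal e" .
    qed
    also have "?I H \<le> ?I H + top * ?I (indicator E)" by simp
    also have "\<dots> \<le> ennreal \<epsilon> * ?I g0 + (?I H + top * ?I (indicator E))" by simp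
    finally show ?thesis unfolding eq .
  qed
qed

section \<open>Energy and limits of functions\<close>

text \<open>The projection argument of Hilbert spaces in abstract form. The infima of Q over the
  decreasing sets \<open>C n\<close> increase to a limit; for near minimizers \<open>v n\<close>,
  \<open>v m\<close> in \<open>C N\<close> the midpoint stays in \<open>C N\<close>, so Q is at
  least the infimum there and little is left for D.\<close>

lemma midpoint_minimizing_sequence:
  fixes Q :: "'v \<Rightarrow> real" and D :: "'v \<Rightarrow> 'v \<Rightarrow> real" and C :: "nat \<Rightarrow> 'v set"
  assumes ne: "\<And>n. C n \<noteq> {}" and dec: "\<And>m n. m \<le> n \<Longrightarrow> C n \<subseteq> C m"
    and mid: "\<And>n x y. x \<in> C n \<Longrightarrow> y \<in> C n \<Longrightarrow> mid x y \<in> C n"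
    and Q: "\<And>x. x \<in> C 0 \<Longrightarrow> 0 \<le> Q x" "\<And>x. x \<in> C 0 \<Longrightarrow> Q x \<le> K"
    and D: "\<And>x y. x \<in> C 0 \<Longrightarrow> y \<in> C 0 \<Longrightarrow> Q (mid x y) + D x y \<le> (Q x + Q y) / 2"
  obtains v where "\<And>n. v n \<in> C n" "\<And>e. 0 < e \<Longrightarrow> \<exists>N. \<forall>n\<ge>N. \<forall>m\<ge>N. D (v n) (v m) < e"
proof -
  define d where "d n = (INF x\<in>C n. Q x)" for n
  have C0: "x \<in> C 0" if "x \<in> C n" for x n using dec[of 0 n] that by auto
  have bdd: "bdd_below (Q ` C n)" for n
    by (rule bdd_belowI[of _ 0]) (use Q(1) C0 in auto)
  have d_le: "d n \<le> Q x" if "x \<in> C n" for n x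
    unfolding d_def by (rule cINF_lower[OF bdd that])
  have d_mono: "d m \<le> d n" if "m \<le> n" for m n
    unfolding d_def by (rule cINF_superset_mono[OF ne bdd dec[OF that]]) simp
  have d_K: "d n \<le> K" for n
    using ne[of n] d_le Q(2) C0 by (meson all_not_in_conv order_trans)
  define dlim where "dlim = (SUP n. d n)"
  have bd: "bdd_above (range d)" using d_K by (auto intro!: bdd_aboveI)
  have d_lim: "d n \<le> dlim" for n unfolding dlim_def by (rule cSUP_upper[OF _ bd]) simp
  have "\<exists>x\<in>C n. Q x < d n + 1 / real (Suc n)" for n
    using cINF_less_iff[OF ne bdd, of n "d n + 1 / real (Suc n)"] by (auto simp: d_def)
  then obtain v where v: "\<And>n. v n \<in> C n" "\<And>n. Q (v n) < d n + 1 / real (Suc n)" by metis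
  show thesis
  proof (rule that[OF v(1)])
    fix e :: real assume e: "0 < e"
    obtain N1 where N1: "dlim - e/2 < d N1"
      using less_cSUP_iff[OF _ bd, of "dlim - e/2"] e by (auto simp: dlim_def)
    obtain N2 where N2: "1 / real (Suc N2) < e/2" using nat_approx_posE[of "e/2"] e by auto
    define N where "N = max N1 N2"
    have N: "dlim - e/2 < d N" "1 / real (Suc N) < e/2"
    proof -
      show "dlim - e/2 < d N" using N1 d_mono[of N1 N] by (simp add: N_def)
      have "1 / real (Suc N) \<le> 1 / real (Suc N2)"
        by (intro divide_left_mono) (auto simp: N_def)
      then show "1 / real (Suc N) < e/2" using N2 by linarith
    qed
    have "D (v n) (v m) < e" if "n \<ge> N" "m \<ge> N" for n m
    proof -
      have small: "Q (v k) < dlim + e/2" if "k \<ge> N" for k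
      proof -
        have "1 / real (Suc k) \<le> 1 / real (Suc N)" using that by (intro divide_left_mono) auto
        then show ?thesis using v(2)[of k] d_lim[of k] N by linarith
      qed
      have "v n \<in> C N" "v m \<in> C N" using v(1) dec that by blast+
      then have "d N \<le> Q (mid (v n) (v m))" by (intro d_le mid)
      moreover have "Q (mid (v n) (v m)) + D (v n) (v m) \<le> (Q (v n) + Q (v m)) / 2"
        by (rule D) (use v(1) C0 in auto)
      ultimately show ?thesis using small[OF that(1)] small[OF that(2)] N(1) by argo
    qed
    then show "\<exists>N. \<forall>n\<ge>N. \<forall>m\<ge>N. D (v n) (v m) < e" by blast
  qed
qed

lemma tendsto_0_of_summable_powr:
  fixes u :: "nat \<Rightarrow> real"
  assumes p: "0 < p" and fin: "(\<Sum>n. ennreal (\<bar>u n\<bar> powr p)) < \<infinity>"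
  shows "u \<longlonglongrightarrow> 0"
proof -
  have "summable (\<lambda>n. \<bar>u n\<bar> powr p)"
    by (rule summable_suminf_not_top) (use fin in auto)
  then have "(\<lambda>n. \<bar>u n\<bar> powr p) \<longlonglongrightarrow> 0" by (rule summable_LIMSEQ_zero)
  then have "(\<lambda>n. (\<bar>u n\<bar> powr p) powr (1 / p)) \<longlonglongrightarrow> 0"
    by (rule tendsto_zero_powrI[where b = "1 / p"]) (use p in auto)
  then have "(\<lambda>n. \<bar>u n\<bar>) \<longlonglongrightarrow> 0" using p by (simp add: powr_powr)
  then show ?thesis by (rule tendsto_rabs_zero_cancel)
qed

text \<open>Only Borel functions enter the Newtonian norm, so the analysis takes place for the
  restriction of the measure to the Borel sets, with a single sigma-algebra in all measurability
  proofs.\<close>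

locale borel_measure =
  fixes M :: "'a::metric_space measure"
  assumes sets_M [measurable_cong]: "sets M = sets borel"
begin

lemma space_M [simp]: "space M = UNIV"
  using sets_eq_imp_space_eq[OF sets_M] by simp

text \<open>The gradient part of the Newtonian norm, to the power p. It is used through near optimal
  upper gradients, not through a minimal weak one.\<close>

definition energy :: "real \<Rightarrow> ('a \<Rightarrow> real) \<Rightarrow> ennreal" where
  "energy p f = (INF g\<in>{g. real_upper_gradient g f}. \<integral>\<^sup>+x. ennreal_rpow (g x) p \<partial>M)"

lemma energy_le: "real_upper_gradient g f \<Longrightarrow> energy p f \<le> (\<integral>\<^sup>+x. ennreal_rpow (g x) p \<partial>M)"
  unfolding energy_def by (rule INF_lower) simp

lemma energy_lessD:
  assumes "energy p f < e"
  obtains g where "real_upper_gradient g f" "(\<integral>\<^sup>+x. ennreal_rpow (g x) p \<partial>M) < e"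
  using assms unfolding energy_def by (auto simp: INF_less_iff)

lemma energy_cmult:
  assumes c: "c \<noteq> 0" and f: "energy p f < e"
  shows "energy p (\<lambda>x. c * f x) \<le> ennreal (\<bar>c\<bar> powr p) * e"
proof -
  obtain g where g: "real_upper_gradient g f" "(\<integral>\<^sup>+x. ennreal_rpow (g x) p \<partial>M) < e"
    using f by (rule energy_lessD)
  note [measurable] = real_upper_gradientD(1)[OF g(1)]
  have "energy p (\<lambda>x. c * f x) \<le> (\<integral>\<^sup>+x. ennreal_rpow (ennreal \<bar>c\<bar> * g x) p \<partial>M)"
    by (rule energy_le[OF real_upper_gradient_cmult[OF g(1)]])
  also have "\<dots> = ennreal (\<bar>c\<bar> powr p) * (\<integral>\<^sup>+x. ennreal_rpow (g x) p \<partial>M)"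
    by (simp add: rpow_mult nn_integral_cmult)
  also have "\<dots> \<le> ennreal (\<bar>c\<bar> powr p) * e"
    using g(2) by (intro mult_left_mono) auto
  finally show ?thesis .
qed

text \<open>In the upper gradient from \<open>real_upper_gradient_weakI\<close> the value
  \<infinity> on the null set E does not contribute to the integral, and \<epsilon> *
  \<open>g0\<close> disappears with \<epsilon>. The factor 2^p is the price for splitting the power
  of a sum.\<close>

lemma energy_weak_le:
  assumes p: "1 \<le> p" and g0: "real_upper_gradient g0 f" and fin: "(\<integral>\<^sup>+x. ennreal_rpow (g0 x) p \<partial>M) < \<infinity>"
    and E [measurable]: "E \<in> sets borel" and E0: "emeasure M E = 0"
    and H [measurable]: "H \<in> borel_measurable borel"
    and le: "\<And>\<gamma> a b s t. nonconst_rectifiable_curve \<gamma> a b \<Longrightarrow> 0 < s \<Longrightarrow> s < t \<Longrightarrow> t < total_length \<gamma> a b \<Longrightarrow>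
      arc_length_param \<gamma> a b s \<notin> E \<Longrightarrow> arc_length_param \<gamma> a b t \<notin> E \<Longrightarrow>
      ennreal \<bar>f (arc_length_param \<gamma> a b s) - f (arc_length_param \<gamma> a b t)\<bar>
        \<le> line_integral (arc_length_param \<gamma> a b) 0 (total_length \<gamma> a b) H"
  shows "energy p f \<le> ennreal (2 powr p) * (\<integral>\<^sup>+x. ennreal_rpow (H x) p \<partial>M)"
proof (rule ennreal_le_epsilon)
  note [measurable] = real_upper_gradientD(1)[OF g0]
  fix e :: real assume e: "0 < e"
  obtain K where K: "0 \<le> K" "(\<integral>\<^sup>+x. ennreal_rpow (g0 x) p \<partial>M) = ennreal K"
    using fin by (cases "\<integral>\<^sup>+x. ennreal_rpow (g0 x) p \<partial>M") auto
  \<comment> \<open>\<epsilon> \<le> 1 allows \<epsilon>^p to be replaced by \<epsilon>, and K + 1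
    keeps the denominator positive.\<close>
  define \<epsilon> where "\<epsilon> = min 1 (e / (2 powr p * (K + 1)))"
  have pos: "0 < 2 powr p * (K + 1)" using K by simp
  have \<epsilon>: "0 < \<epsilon>" "\<epsilon> \<le> 1" using e pos by (auto simp: \<epsilon>_def)
  have "2 powr p * (\<epsilon> powr p * K) \<le> 2 powr p * (\<epsilon> * (K + 1))"
    using powr_mono'[of 1 p \<epsilon>] \<epsilon> p K by (intro mult_left_mono mult_mono) auto
  also have "\<dots> = \<epsilon> * (2 powr p * (K + 1))" by simp
  also have "\<dots> \<le> e / (2 powr p * (K + 1)) * (2 powr p * (K + 1))"
    using pos by (intro mult_right_mono) (auto simp: \<epsilon>_def)
  also have "\<dots> = e" using pos K(1) by auto
  finally have small: "2 powr p * (\<epsilon> powr p * K) \<le> e" .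
  have AE: "AE x in M. x \<notin> E"
    using E E0 by (intro AE_not_in) (auto simp: null_sets_def sets_M)
  have "energy p f \<le> (\<integral>\<^sup>+x. ennreal_rpow (ennreal \<epsilon> * g0 x + (H x + top * indicator E x)) p \<partial>M)"
    by (intro energy_le real_upper_gradient_weakI[OF g0 E H \<epsilon>(1)] le)
  also have "\<dots> = (\<integral>\<^sup>+x. ennreal_rpow (ennreal \<epsilon> * g0 x + H x) p \<partial>M)"
    by (rule nn_integral_cong_AE) (use AE in eventually_elim, auto)
  also have "\<dots> \<le> (\<integral>\<^sup>+x. ennreal (2 powr p) * (ennreal_rpow (ennreal \<epsilon> * g0 x) p + ennreal_rpow (H x) p) \<partial>M)"
    by (intro nn_integral_mono rpow_add_le) (use p in auto)
  also have "\<dots> = ennreal (2 powr p) * (ennreal (\<epsilon> powr p) * ennreal K) + ennreal (2 powr p)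
      * (\<integral>\<^sup>+x. ennreal_rpow (H x) p \<partial>M)"
    using \<epsilon> by (simp add: rpow_mult nn_integral_cmult nn_integral_add K distrib_left)
  also have "ennreal (2 powr p) * (ennreal (\<epsilon> powr p) * ennreal K) = ennreal (2 powr p * (\<epsilon> powr p * K))"
    using K by (simp add: ennreal_mult)
  also have "\<dots> \<le> ennreal e" using small by (rule ennreal_leI)
  finally show "energy p f \<le> ennreal (2 powr p) * (\<integral>\<^sup>+x. ennreal_rpow (H x) p \<partial>M) + ennreal e"
    by (simp add: add.commute add_mono)
qed

text \<open>The remainder \<open>u m\<close> is kept in the bound, so that afterwards its limit has
  to be known only at the two end points and not along the curve.\<close>

lemma telescoping_curve_bound:
  assumes g: "\<And>i. real_upper_gradient (g i) (\<lambda>x. u (Suc i) x - u i x)"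
    and \<gamma>: "nonconst_rectifiable_curve \<gamma> a b" and st: "0 \<le> s" "s \<le> t" "t \<le> total_length \<gamma> a b"
  defines "\<sigma> \<equiv> arc_length_param \<gamma> a b"
  shows "ennreal \<bar>u 0 (\<sigma> s) - u 0 (\<sigma> t)\<bar>
    \<le> (\<Sum>i<m. line_integral \<sigma> 0 (total_length \<gamma> a b) (g i)) + ennreal \<bar>u m (\<sigma> s) - u m (\<sigma> t)\<bar>"
proof (induction m)
  case (Suc m)
  have "ennreal \<bar>(u (Suc m) (\<sigma> s) - u m (\<sigma> s)) - (u (Suc m) (\<sigma> t) - u m (\<sigma> t))\<bar> \<le> line_integral \<sigma> s t (g m)"
    unfolding \<sigma>_def by (rule real_upper_gradient_subcurve[OF \<gamma> g st])
  also have "\<dots> \<le> line_integral \<sigma> 0 (total_length \<gamma> a b) (g m)"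
    by (rule line_integral_mono) (use st in auto)
  finally have *: "ennreal \<bar>(u (Suc m) (\<sigma> s) - u m (\<sigma> s)) - (u (Suc m) (\<sigma> t) - u m (\<sigma> t))\<bar>
    \<le> line_integral \<sigma> 0 (total_length \<gamma> a b) (g m)" .
  have "ennreal \<bar>u m (\<sigma> s) - u m (\<sigma> t)\<bar>
    \<le> ennreal (\<bar>(u (Suc m) (\<sigma> s) - u m (\<sigma> s)) - (u (Suc m) (\<sigma> t) - u m (\<sigma> t))\<bar> + \<bar>u (Suc m) (\<sigma> s)
        - u (Suc m) (\<sigma> t)\<bar>)"
    by (rule ennreal_leI) linarith
  also have "\<dots> \<le> line_integral \<sigma> 0 (total_length \<gamma> a b) (g m) + ennreal \<bar>u (Suc m) (\<sigma> s) - u (Suc m) (\<sigma> t)\<bar>"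
    using * by (simp add: ennreal_plus add_right_mono)
  finally show ?case using Suc.IH by (simp add: add.assoc) (meson add_left_mono order_trans)
qed simp

lemma AE_tendsto_0:
  fixes u :: "nat \<Rightarrow> 'a \<Rightarrow> real"
  assumes [measurable]: "\<And>n. u n \<in> borel_measurable borel" and p: "0 < p"
    and fin: "(\<Sum>n. \<integral>\<^sup>+x. ennreal (\<bar>u n x\<bar> powr p) \<partial>M) < \<infinity>"
  shows "AE x in M. (\<lambda>n. u n x) \<longlonglongrightarrow> 0"
proof -
  have "(\<integral>\<^sup>+x. (\<Sum>n. ennreal (\<bar>u n x\<bar> powr p)) \<partial>M) = (\<Sum>n. \<integral>\<^sup>+x. ennreal (\<bar>u n x\<bar> powr p) \<partial>M)"
    by (intro nn_integral_suminf) measurable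
  then have "AE x in M. (\<Sum>n. ennreal (\<bar>u n x\<bar> powr p)) \<noteq> \<infinity>"
    using fin by (intro nn_integral_PInf_AE) auto
  then show ?thesis
    by eventually_elim (use p in \<open>auto intro: tendsto_0_of_summable_powr simp: less_top\<close>)
qed

text \<open>A closedness property: functions that vanish in the L^p limit and are Cauchy in energy
  cannot keep energy. Starting from \<open>v n\<close> a fast subsequence is telescoped. It tends to
  0 off a null set, so the sum H of near optimal upper gradients of the increments controls
  \<open>v n\<close> between points off that set.\<close>

lemma energy_tendsto_0:
  fixes v :: "nat \<Rightarrow> 'a \<Rightarrow> real"
  assumes p: "1 \<le> p" and v [measurable]: "\<And>n. v n \<in> borel_measurable borel"
    and g0: "\<And>n. real_upper_gradient (g0 n) (v n)" "\<And>n. (\<integral>\<^sup>+x. ennreal_rpow (g0 n x) p \<partial>M) < \<infinity>"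
    and lim: "\<And>e. 0 < e \<Longrightarrow> \<exists>N. \<forall>n\<ge>N. (\<integral>\<^sup>+x. ennreal (\<bar>v n x\<bar> powr p) \<partial>M) < ennreal e"
    and cauchy: "\<And>e. 0 < e \<Longrightarrow> \<exists>N. \<forall>n\<ge>N. \<forall>m\<ge>N. energy p (\<lambda>x. v n x - v m x) < ennreal e"
    and e: "0 < e"
  shows "\<exists>N. \<forall>n\<ge>N. energy p (v n) \<le> ennreal e"
proof -
  define q where "q = (2::real) powr p"
  have q: "1 \<le> q" using p unfolding q_def by (intro ge_one_powr_ge_zero) auto
  \<comment> \<open>The power of q cancels the weights from \<open>rpow_suminf_le\<close>, the
    powers of 1/2 sum to 1, and the remaining 1 / q is undone by the factor in
    \<open>energy_weak_le\<close>.\<close>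
  define \<epsilon> where "\<epsilon> i = e / q * (1/2) ^ Suc i / q ^ Suc i" for i
  have \<epsilon>: "0 < \<epsilon> i" for i using e q by (simp add: \<epsilon>_def)
  have "\<exists>K. \<forall>n\<ge>K. \<forall>m\<ge>K. (\<integral>\<^sup>+x. ennreal (\<bar>v n x\<bar> powr p) \<partial>M) < ennreal ((1/2)^i) \<and>
     energy p (\<lambda>x. v n x - v m x) < ennreal (\<epsilon> i)" for i
  proof -
    obtain N1 where "\<forall>n\<ge>N1. (\<integral>\<^sup>+x. ennreal (\<bar>v n x\<bar> powr p) \<partial>M) < ennreal ((1/2)^i)"
      using lim[of "(1/2)^i"] by auto
    moreover obtain N2 where "\<forall>n\<ge>N2. \<forall>m\<ge>N2. energy p (\<lambda>x. v n x - v m x) < ennreal (\<epsilon> i)"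
      using cauchy[OF \<epsilon>[of i]] by blast
    ultimately show ?thesis by (intro exI[of _ "max N1 N2"]) auto
  qed
  then obtain K where K: "\<And>i n m. n \<ge> K i \<Longrightarrow> m \<ge> K i \<Longrightarrow> (\<integral>\<^sup>+x. ennreal (\<bar>v n x\<bar> powr p) \<partial>M)
      < ennreal ((1/2)^i)"
    "\<And>i n m. n \<ge> K i \<Longrightarrow> m \<ge> K i \<Longrightarrow> energy p (\<lambda>x. v n x - v m x) < ennreal (\<epsilon> i)" by metis
  have "energy p (v n) \<le> ennreal e" if n: "n \<ge> K 0" for n
  proof -
    \<comment> \<open>The subsequence starts at n itself, so that u 0 = v n, and both
      \<open>r i\<close> and \<open>r (Suc i)\<close> are beyond \<open>K i\<close>.\<close>
    define r where "r i = n + (\<Sum>j<i. K (Suc j))" for i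
    have r: "K i \<le> r i" for i
      using n by (cases i) (auto simp: r_def)
    have r': "K i \<le> r (Suc i)" for i
      using r[of i] by (simp add: r_def)
    define u where "u i = v (r i)" for i
    have um [measurable]: "u i \<in> borel_measurable borel" for i unfolding u_def by measurable
    have "\<exists>g. real_upper_gradient g (\<lambda>x. u (Suc i) x - u i x) \<and> (\<integral>\<^sup>+x. ennreal_rpow (g x) p \<partial>M)
        < ennreal (\<epsilon> i)" for i
      using energy_lessD[OF K(2)[OF r' r, of i]] unfolding u_def by metis
    then obtain g where g: "\<And>i. real_upper_gradient (g i) (\<lambda>x. u (Suc i) x - u i x)"
      "\<And>i. (\<integral>\<^sup>+x. ennreal_rpow (g i x) p \<partial>M) < ennreal (\<epsilon> i)" by metis
    note [measurable] = real_upper_gradientD(1)[OF g(1)]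
    have AE: "AE x in M. (\<lambda>i. u i x) \<longlonglongrightarrow> 0"
    proof (rule AE_tendsto_0[OF um, of p])
      have "(\<Sum>i. \<integral>\<^sup>+x. ennreal (\<bar>u i x\<bar> powr p) \<partial>M) \<le> (\<Sum>i. ennreal ((1/2)^i))"
        by (intro suminf_le less_imp_le) (auto simp: u_def intro!: K(1)[OF r r])
      also have "\<dots> = ennreal (\<Sum>i. (1/2)^i)"
        by (intro suminf_ennreal2) (auto intro: summable_geometric)
      finally show "(\<Sum>i. \<integral>\<^sup>+x. ennreal (\<bar>u i x\<bar> powr p) \<partial>M) < \<infinity>"
        by (rule le_less_trans) simp
    qed (use p in auto)
    define E where "E = {x. \<not> (\<lambda>i. u i x) \<longlonglongrightarrow> 0}"
    have Em [measurable]: "E \<in> sets borel"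
      unfolding E_def by measurable
    have E0: "emeasure M E = 0"
      using AE unfolding E_def by (subst (asm) AE_iff_measurable[OF _ refl]) (use Em
          in \<open>auto simp: sets_M E_def\<close>)
    define H where "H x = (\<Sum>i. g i x)" for x
    have Hm [measurable]: "H \<in> borel_measurable borel" unfolding H_def by measurable
    have "energy p (v n) \<le> ennreal q * (\<integral>\<^sup>+x. ennreal_rpow (H x) p \<partial>M)"
      unfolding q_def
    proof (rule energy_weak_le[OF p g0 Em E0 Hm])
      fix \<gamma> :: "real \<Rightarrow> 'a" and a b s t
      assume \<gamma>: "nonconst_rectifiable_curve \<gamma> a b" and st: "0 < s" "s < t" "t < total_length \<gamma> a b"
      define \<sigma> where "\<sigma> = arc_length_param \<gamma> a b"
      assume "arc_length_param \<gamma> a b s \<notin> E" "arc_length_param \<gamma> a b t \<notin> E"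
      then have lim: "(\<lambda>i. u i (\<sigma> s)) \<longlonglongrightarrow> 0" "(\<lambda>i. u i (\<sigma> t)) \<longlonglongrightarrow> 0"
        by (auto simp: E_def \<sigma>_def)
      have H: "line_integral \<sigma> 0 (total_length \<gamma> a b) H = (\<Sum>i. line_integral \<sigma> 0 (total_length \<gamma> a b)
          (g i))"
        unfolding H_def \<sigma>_def by (rule line_integral_suminf[OF \<gamma>]) auto
      have "ennreal \<bar>u 0 (\<sigma> s) - u 0 (\<sigma> t)\<bar> \<le> line_integral \<sigma> 0 (total_length \<gamma> a b) H"
      proof (rule ennreal_le_epsilon)
        fix \<eta> :: real assume \<eta>: "0 < \<eta>"
        have "(\<lambda>i. \<bar>u i (\<sigma> s) - u i (\<sigma> t)\<bar>) \<longlonglongrightarrow> \<bar>0 - 0\<bar>"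
          by (intro tendsto_intros lim)
        then have "eventually (\<lambda>i. \<bar>u i (\<sigma> s) - u i (\<sigma> t)\<bar> < \<eta>) sequentially"
          using \<eta> by (intro order_tendstoD(2)) auto
        then obtain m where m: "\<bar>u m (\<sigma> s) - u m (\<sigma> t)\<bar> < \<eta>"
          by (auto simp: eventually_sequentially)
        have "ennreal \<bar>u 0 (\<sigma> s) - u 0 (\<sigma> t)\<bar>
           \<le> (\<Sum>i<m. line_integral \<sigma> 0 (total_length \<gamma> a b) (g i)) + ennreal \<bar>u m (\<sigma> s) - u m (\<sigma> t)\<bar>"
          unfolding \<sigma>_def by (rule telescoping_curve_bound[where g = g and u = u, OF g(1) \<gamma>]) (use st
              in auto)
        also have "\<dots> \<le> line_integral \<sigma> 0 (total_length \<gamma> a b) H + ennreal \<eta>"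
          unfolding H using m by (intro add_mono sum_le_suminf ennreal_leI) auto
        finally show "ennreal \<bar>u 0 (\<sigma> s) - u 0 (\<sigma> t)\<bar> \<le> line_integral \<sigma> 0 (total_length \<gamma> a b) H
            + ennreal \<eta>" .
      qed
      then show "ennreal \<bar>v n (arc_length_param \<gamma> a b s) - v n (arc_length_param \<gamma> a b t)\<bar>
        \<le> line_integral (arc_length_param \<gamma> a b) 0 (total_length \<gamma> a b) H"
        by (simp add: u_def r_def \<sigma>_def)
    qed
    also have "(\<integral>\<^sup>+x. ennreal_rpow (H x) p \<partial>M) \<le> (\<integral>\<^sup>+x. (\<Sum>i. ennreal (q ^ Suc i) * ennreal_rpow (g i x) p)
        \<partial>M)"
      unfolding H_def q_def by (intro nn_integral_mono rpow_suminf_le) (use p in auto)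
    also have "\<dots> = (\<Sum>i. \<integral>\<^sup>+x. ennreal (q ^ Suc i) * ennreal_rpow (g i x) p \<partial>M)"
      by (intro nn_integral_suminf) measurable
    also have "\<dots> = (\<Sum>i. ennreal (q ^ Suc i) * (\<integral>\<^sup>+x. ennreal_rpow (g i x) p \<partial>M))"
      by (intro suminf_cong nn_integral_cmult) measurable
    also have "\<dots> \<le> (\<Sum>i. ennreal (e / q * (1/2) ^ Suc i))"
    proof (intro suminf_le)
      fix i
      have "ennreal (q ^ Suc i) * (\<integral>\<^sup>+x. ennreal_rpow (g i x) p \<partial>M) \<le> ennreal (q ^ Suc i) * ennreal (\<epsilon> i)"
        by (rule mult_left_mono[OF less_imp_le[OF g(2)]]) simp
      also have "\<dots> = ennreal (e / q * (1/2) ^ Suc i)"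
      proof -
        have "0 < q ^ Suc i" using q by (intro zero_less_power) linarith
        then have "q ^ Suc i * \<epsilon> i = e / q * (1/2) ^ Suc i" unfolding \<epsilon>_def by (simp del: power_Suc)
        then show ?thesis using \<open>0 < q ^ Suc i\<close> \<epsilon>[of i]
            by (simp add: ennreal_mult[symmetric] del: power_Suc)
      qed
      finally show "ennreal (q ^ Suc i) * (\<integral>\<^sup>+x. ennreal_rpow (g i x) p \<partial>M) \<le> ennreal (e / q
          * (1/2) ^ Suc i)" .
    qed auto
    also have "\<dots> = ennreal (e / q)"
    proof -
      have "(\<lambda>i. e / q * (1/2) ^ Suc i) sums (e / q * 1)"
        by (intro sums_mult power_half_series)
      then show ?thesis using q e by (subst suminf_ennreal_eq) auto
    qed
    also have "ennreal q * ennreal (e / q) = ennreal e"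
      using q e by (simp flip: ennreal_mult)
    finally show ?thesis by (simp add: mult_left_mono)
  qed
  then show ?thesis by blast
qed

end

section \<open>Nets and cells in doubling spaces\<close>

lemma ennreal_divide_mult_cancel: "b \<noteq> 0 \<Longrightarrow> b \<noteq> top \<Longrightarrow> a / b * b = (a::ennreal)"
  by (metis ennreal_times_divide mult.commute mult_divide_eq_ennreal)

locale doubling_space = borel_measure M for M :: "'a::metric_space measure" +
  fixes C :: real
  assumes ball_pos: "0 < r \<Longrightarrow> 0 < emeasure M (ball x r)"
    and ball_finite: "emeasure M (ball x r) < \<infinity>"
    and C_ge_1: "1 \<le> C"
    and doubling: "0 < r \<Longrightarrow> emeasure M (ball x (2 * r)) \<le> ennreal C * emeasure M (ball x r)"
begin

lemma ball_in_sets [measurable, simp]: "ball x r \<in> sets M"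
  by (simp add: sets_M)

definition doubling_const :: "real \<Rightarrow> real" where
  "doubling_const \<Lambda> = C ^ (LEAST n. \<Lambda> \<le> 2 ^ n)"

lemma doubling_const_ge_1: "1 \<le> doubling_const \<Lambda>"
  unfolding doubling_const_def using C_ge_1 by (rule one_le_power)

text \<open>The first ball lies in the dilation by \<Lambda> of the second, and the doubling
  condition is iterated until 2^n reaches \<Lambda>.\<close>

lemma emeasure_ball_le:
  assumes r: "0 < r" and sub: "dist x y + s \<le> \<Lambda> * r"
  shows "emeasure M (ball x s) \<le> ennreal (doubling_const \<Lambda>) * emeasure M (ball y r)"
proof -
  have pow: "emeasure M (ball y (2 ^ n * r)) \<le> ennreal (C ^ n) * emeasure M (ball y r)" for n
  proof (induction n)
    case (Suc n)
    have "emeasure M (ball y (2 ^ Suc n * r)) \<le> ennreal C * emeasure M (ball y (2 ^ n * r))"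
      using doubling[of "2 ^ n * r" y] r by (simp add: mult.assoc)
    also have "\<dots> \<le> ennreal C * (ennreal (C ^ n) * emeasure M (ball y r))"
      by (intro mult_left_mono Suc) auto
    finally show ?case using C_ge_1 by (simp add: ennreal_mult mult.assoc)
  qed simp
  let ?n = "LEAST n. \<Lambda> \<le> 2 ^ n"
  have "\<exists>n. \<Lambda> < 2 ^ n" by (rule real_arch_pow) simp
  then have n: "\<Lambda> \<le> 2 ^ ?n" by (metis (mono_tags, lifting) LeastI less_imp_le)
  have "ball x s \<subseteq> ball y (2 ^ ?n * r)"
  proof
    fix z assume "z \<in> ball x s"
    then have "dist y z < \<Lambda> * r" using sub dist_triangle[of y z x] by (simp add: dist_commute)
    also have "\<dots> \<le> 2 ^ ?n * r" using n r by (intro mult_right_mono) auto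
    finally show "z \<in> ball y (2 ^ ?n * r)" by simp
  qed
  then have "emeasure M (ball x s) \<le> emeasure M (ball y (2 ^ ?n * r))"
    by (intro emeasure_mono) auto
  also have "\<dots> \<le> ennreal (doubling_const \<Lambda>) * emeasure M (ball y r)"
    unfolding doubling_const_def by (rule pow)
  finally show ?thesis .
qed

section \<open>Separated sets and packing bounds\<close>

definition separated :: "real \<Rightarrow> 'a set \<Rightarrow> bool" where
  "separated r A \<longleftrightarrow> (\<forall>x\<in>A. \<forall>y\<in>A. x \<noteq> y \<longrightarrow> r \<le> dist x y)"

text \<open>The argument of \<open>doubling_const\<close>: for y in the ball of radius \<Lambda> * r
  about x, the ball of radius (\<Lambda> + 1) * r about x lies in the ball of radius (2 * \<Lambda>
  + 1) * r about y, whose radius is 2 * (2 * \<Lambda> + 1) times r / 2.\<close>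

definition packing :: "real \<Rightarrow> nat" where
  "packing \<Lambda> = nat \<lceil>doubling_const (2 * (2 * \<Lambda> + 1))\<rceil>"

text \<open>Volume counting: the balls of radius r / 2 about the points are disjoint, lie in one
  ball of radius (\<Lambda> + 1) * r, and by doubling each carries a fixed fraction of its
  measure.\<close>

lemma separated_card_le:
  assumes A: "separated r A" "A \<subseteq> ball x (\<Lambda> * r)" and r: "0 < r" and \<Lambda>: "0 < \<Lambda>"
  shows "finite A \<and> card A \<le> packing \<Lambda>"
proof (rule finite_if_finite_subsets_card_bdd)
  fix F assume F: "F \<subseteq> A" "finite F"
  let ?B = "ball x ((\<Lambda> + 1) * r)" and ?K = "doubling_const (2 * (2 * \<Lambda> + 1))"
  obtain m where m: "0 < m" "emeasure M ?B = ennreal m"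
    using ball_pos[of "(\<Lambda> + 1) * r" x] ball_finite[of x "(\<Lambda> + 1) * r"] r \<Lambda>
    by (cases "emeasure M ?B") auto
  have disj: "disjoint_family_on (\<lambda>y. ball y (r / 2)) F"
    unfolding disjoint_family_on_def
  proof (intro ballI impI, rule ccontr)
    fix y z assume yz: "y \<in> F" "z \<in> F" "y \<noteq> z" and "ball y (r / 2) \<inter> ball z (r / 2) \<noteq> {}"
    then obtain w where "dist y w < r / 2" "dist z w < r / 2" by auto
    then have "dist y z < r" using dist_triangle[of y z w] by (simp add: dist_commute)
    then show False using A(1) yz F unfolding separated_def by (meson not_le subsetD)
  qed
  have each: "ennreal m \<le> ennreal ?K * emeasure M (ball y (r / 2))" if "y \<in> F" for y
  proof -
    have "dist x y < \<Lambda> * r" using that F A by auto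
    then show ?thesis unfolding m(2)[symmetric]
      using r by (intro emeasure_ball_le) (auto simp: algebra_simps)
  qed
  have "of_nat (card F) * ennreal m = (\<Sum>y\<in>F. ennreal m)" by simp
  also have "\<dots> \<le> (\<Sum>y\<in>F. ennreal ?K * emeasure M (ball y (r / 2)))"
    by (intro sum_mono each)
  also have "\<dots> = ennreal ?K * emeasure M (\<Union>y\<in>F. ball y (r / 2))"
    using disj F by (subst sum_emeasure[symmetric]) (auto simp: sum_distrib_left)
  also have "\<dots> \<le> ennreal ?K * emeasure M ?B"
  proof (intro mult_left_mono emeasure_mono)
    show "(\<Union>y\<in>F. ball y (r / 2)) \<subseteq> ?B"
    proof
      fix z assume "z \<in> (\<Union>y\<in>F. ball y (r / 2))"
      then obtain y where y: "y \<in> F" "dist y z < r / 2" by auto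
      then have "dist x y < \<Lambda> * r" using F A by auto
      then show "z \<in> ?B" using y(2) r dist_triangle[of x z y] by (simp add: algebra_simps)
    qed
  qed auto
  finally have "ennreal (real (card F) * m) \<le> ennreal (?K * m)"
    using m doubling_const_ge_1[of "2 * (2 * \<Lambda> + 1)"]
        by (simp add: ennreal_mult ennreal_of_nat_eq_real_of_nat)
  then have "real (card F) * m \<le> ?K * m"
    using m doubling_const_ge_1[of "2 * (2 * \<Lambda> + 1)"] by (subst (asm) ennreal_le_iff) auto
  then have "real (card F) \<le> ?K" using m by simp
  then show "card F \<le> packing \<Lambda>" unfolding packing_def by linarith
qed

text \<open>A maximal separated set, from Zorn's lemma, has the covering property: a point at
  distance at least r from all of it could be added.\<close>

lemma net_exists:
  assumes r: "0 < r"
  shows "\<exists>N. separated r N \<and> (\<forall>x. \<exists>y\<in>N. dist x y < r)"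
proof -
  have "\<exists>N\<in>{A. separated r A}. \<forall>X\<in>{A. separated r A}. N \<subseteq> X \<longrightarrow> X = N"
  proof (rule subset_Zorn')
    fix \<C> assume ch: "subset.chain {A. separated r A} \<C>"
    show "\<Union>\<C> \<in> {A. separated r A}"
      unfolding mem_Collect_eq separated_def
    proof (intro ballI impI)
      fix x y assume "x \<in> \<Union>\<C>" "y \<in> \<Union>\<C>" "x \<noteq> y"
      then obtain X Y where XY: "X \<in> \<C>" "Y \<in> \<C>" "x \<in> X" "y \<in> Y" by auto
      then have "X \<subseteq> Y \<or> Y \<subseteq> X" using ch unfolding subset_chain_def by blast
      then obtain Z where "Z \<in> \<C>" "x \<in> Z" "y \<in> Z" using XY by blast
      then show "r \<le> dist x y" using ch \<open>x \<noteq> y\<close> unfolding subset_chain_def separated_def by blast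
    qed
  qed
  then obtain N where N: "separated r N" "\<And>X. separated r X \<Longrightarrow> N \<subseteq> X \<Longrightarrow> X = N" by auto
  have "\<exists>y\<in>N. dist x y < r" for x
  proof (rule ccontr)
    assume "\<not> ?thesis"
    then have far: "\<And>y. y \<in> N \<Longrightarrow> r \<le> dist x y" by (auto simp: not_less)
    then have "separated r (insert x N)"
      using N(1) by (auto simp: separated_def dist_commute)
    then have "x \<in> N" using N(2)[of "insert x N"] by auto
    then show False using far[of x] r by simp
  qed
  then show ?thesis using N by auto
qed

section \<open>Dyadic nets and the partition into cells\<close>

definition rad :: "nat \<Rightarrow> real" where "rad k = (1 / 2) ^ k"

lemma rad_pos [simp]: "0 < rad k" "0 \<le> rad k"
  by (simp_all add: rad_def)

lemma rad_nonzero [simp]: "rad k \<noteq> 0"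
  by (simp add: rad_def)

lemma rad_le_1: "rad k \<le> 1"
  by (simp add: rad_def power_le_one)

lemma rad_tendsto: "rad \<longlonglongrightarrow> 0"
  unfolding rad_def by (rule LIMSEQ_realpow_zero) auto

definition net :: "nat \<Rightarrow> 'a set" where
  "net k = (SOME N. separated (rad k) N \<and> (\<forall>x. \<exists>y\<in>N. dist x y < rad k))"

lemma net: "separated (rad k) (net k)" "\<exists>y\<in>net k. dist x y < rad k"
  using someI_ex[OF net_exists[OF rad_pos(1), of k]] unfolding net_def by auto

lemma net_ball_card:
  assumes "0 < \<Lambda>"
  shows "finite (net k \<inter> ball x (\<Lambda> * rad k))" "card (net k \<inter> ball x (\<Lambda> * rad k)) \<le> packing \<Lambda>"
  using separated_card_le[of "rad k" "net k \<inter> ball x (\<Lambda> * rad k)" x \<Lambda>] net(1)[of k] assms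
  by (auto simp: separated_def)

lemma finite_net_ball: "finite (net k \<inter> ball x R)"
proof (cases "R > 0")
  case True
  then show ?thesis using net_ball_card(1)[of "R / rad k" k x] by simp
qed (simp add: ball_empty)

lemma countable_net: "countable (net k)"
proof -
  fix x0 :: 'a
  have "net k = (\<Union>n. net k \<inter> ball x0 (real n))"
    using reals_Archimedean2 by fastforce
  then show ?thesis
    by (metis countable_UN countable_finite finite_net_ball uncountable_def countableI_type)
qed

text \<open>Sending each point to the first net point within reach, in a fixed enumeration, turns
  the covering by balls into a countable Borel partition.\<close>

definition cell_index :: "nat \<Rightarrow> 'a \<Rightarrow> nat" where
  "cell_index k x = (LEAST n. dist x (from_nat_into (net k) n) < rad k)"

definition cell :: "nat \<Rightarrow> 'a \<Rightarrow> 'a" where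
  "cell k x = from_nat_into (net k) (cell_index k x)"

lemma cell_in_net [simp]: "cell k x \<in> net k"
  unfolding cell_def using net(2)[of k] by (intro from_nat_into) auto

lemma dist_cell: "dist x (cell k x) < rad k"
proof -
  obtain y where "y \<in> net k" "dist x y < rad k" using net(2) by blast
  then obtain n where "dist x (from_nat_into (net k) n) < rad k"
    using from_nat_into_surj[OF countable_net] by metis
  then show ?thesis unfolding cell_def cell_index_def by (rule LeastI)
qed

lemma cell_measurable [measurable]: "cell k \<in> measurable borel (count_space UNIV)"
proof -
  have "cell_index k \<in> measurable borel (count_space UNIV)"
    unfolding cell_index_def
  proof (rule measurable_Least)
    fix n
    have "{x \<in> space borel. dist x (from_nat_into (net k) n) < rad k} = ball (from_nat_into (net k) n)
        (rad k)"
      by (auto simp: dist_commute)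
    then show "Measurable.pred borel (\<lambda>x. dist x (from_nat_into (net k) n) < rad k)"
      unfolding pred_def by simp
  qed
  then show ?thesis
    unfolding cell_def by (rule measurable_compose) simp
qed

text \<open>Since \<open>cell k\<close> is measurable into the discrete sigma-algebra, an arbitrary
  F may be composed with it. This settles measurability of averages, cell means and difference
  quotients.\<close>

lemma cell_compose_measurable [measurable]: "(\<lambda>x. F (cell k x)) \<in> borel_measurable borel"
  by (rule measurable_compose[OF cell_measurable]) simp

definition cell_set :: "nat \<Rightarrow> 'a \<Rightarrow> 'a set" where
  "cell_set k i = {x. cell k x = i}"

lemma cell_set_measurable [measurable]: "cell_set k i \<in> sets borel"
proof -
  have "cell_set k i = cell k -` {i} \<inter> space borel" by (auto simp: cell_set_def)
  also have "\<dots> \<in> sets borel" by (rule measurable_sets[OF cell_measurable]) simp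
  finally show ?thesis .
qed

lemma cell_set_subset: "cell_set k i \<subseteq> ball i (rad k)"
  using dist_cell by (auto simp: cell_set_def dist_commute)

lemma nn_integral_cells:
  assumes [measurable]: "F \<in> borel_measurable borel"
  shows "(\<integral>\<^sup>+x. F x \<partial>M) = (\<integral>\<^sup>+i. (\<integral>\<^sup>+x\<in>cell_set k i. F x \<partial>M) \<partial>count_space (net k))"
proof -
  have "F x = (\<integral>\<^sup>+i. F x * indicator (cell_set k i) x \<partial>count_space (net k))" for x
  proof -
    have "(\<integral>\<^sup>+i. F x * indicator (cell_set k i) x \<partial>count_space (net k)) = (\<Sum>i\<in>{cell k x}. F x
        * indicator (cell_set k i) x)"
      by (rule nn_integral_count_space') (auto simp: cell_set_def indicator_def)
    then show ?thesis by (simp add: cell_set_def)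
  qed
  then have "(\<integral>\<^sup>+x. F x \<partial>M) = (\<integral>\<^sup>+x. (\<integral>\<^sup>+i. F x * indicator (cell_set k i) x \<partial>count_space (net k)) \<partial>M)"
    by simp
  also have "\<dots> = (\<integral>\<^sup>+i. (\<integral>\<^sup>+x\<in>cell_set k i. F x \<partial>M) \<partial>count_space (net k))"
    by (rule nn_integral_count_space_nn_integral[OF countable_net]) measurable
  finally show ?thesis .
qed

text \<open>Bounded overlap: a point lies in the dilated balls of at most
  \<open>packing \<Lambda>\<close> net points, so estimates on single cells add up to a global
  one.\<close>

lemma cells_integral_le:
  assumes [measurable]: "F \<in> borel_measurable borel" "h \<in> borel_measurable borel" and \<Lambda>: "0 < \<Lambda>"
    and le: "\<And>i. i \<in> net k \<Longrightarrow> (\<integral>\<^sup>+x\<in>cell_set k i. F x \<partial>M) \<le> (\<integral>\<^sup>+x\<in>ball i (\<Lambda> * rad k). h x \<partial>M)"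
  shows "(\<integral>\<^sup>+x. F x \<partial>M) \<le> of_nat (packing \<Lambda>) * (\<integral>\<^sup>+x. h x \<partial>M)"
proof -
  have "(\<integral>\<^sup>+x. F x \<partial>M) \<le> (\<integral>\<^sup>+i. (\<integral>\<^sup>+x\<in>ball i (\<Lambda> * rad k). h x \<partial>M) \<partial>count_space (net k))"
    unfolding nn_integral_cells[OF assms(1), of k] by (rule nn_integral_mono) (simp add: le)
  also have "\<dots> = (\<integral>\<^sup>+x. (\<integral>\<^sup>+i. h x * indicator (ball i (\<Lambda> * rad k)) x \<partial>count_space (net k)) \<partial>M)"
    by (rule nn_integral_count_space_nn_integral[OF countable_net, symmetric]) measurable
  also have "\<dots> \<le> (\<integral>\<^sup>+x. of_nat (packing \<Lambda>) * h x \<partial>M)"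
  proof (rule nn_integral_mono)
    fix x
    let ?S = "net k \<inter> ball x (\<Lambda> * rad k)"
    have "(\<integral>\<^sup>+i. h x * indicator (ball i (\<Lambda> * rad k)) x \<partial>count_space (net k))
       = (\<Sum>i\<in>?S. h x * indicator (ball i (\<Lambda> * rad k)) x)"
      by (rule nn_integral_count_space'[OF net_ball_card(1)[OF \<Lambda>]]) (auto simp: dist_commute indicator_def)
    also have "\<dots> = (\<Sum>i\<in>?S. h x)" by (rule sum.cong) (auto simp: dist_commute)
    also have "\<dots> = of_nat (card ?S) * h x" by simp
    also have "\<dots> \<le> of_nat (packing \<Lambda>) * h x"
      using net_ball_card(2)[OF \<Lambda>, of k x] by (intro mult_right_mono) auto
    finally show "(\<integral>\<^sup>+i. h x * indicator (ball i (\<Lambda> * rad k)) x \<partial>count_space (net k)) \<le> of_nat (packing \<Lambda>)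
        * h x" .
  qed
  also have "\<dots> = of_nat (packing \<Lambda>) * (\<integral>\<^sup>+x. h x \<partial>M)"
    by (rule nn_integral_cmult) measurable
  finally show ?thesis .
qed

text \<open>Constant on each cell, hence Borel whatever f is; the dilation \<Lambda> leaves room for
  the enlarged ball on the right of the Poincare inequality.\<close>

definition avg :: "real \<Rightarrow> nat \<Rightarrow> ('a \<Rightarrow> ennreal) \<Rightarrow> 'a \<Rightarrow> ennreal" where
  "avg \<Lambda> k f x = (\<integral>\<^sup>+y\<in>ball (cell k x) (\<Lambda> * rad k). f y \<partial>M) / emeasure M (ball (cell k x) (\<Lambda> * rad k))"

lemma avg_measurable [measurable]: "avg \<Lambda> k f \<in> borel_measurable borel"
  unfolding avg_def by (rule cell_compose_measurable)

lemma avg_integral_le: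
  assumes [measurable]: "f \<in> borel_measurable borel" and \<Lambda>: "1 \<le> \<Lambda>"
  shows "(\<integral>\<^sup>+x. avg \<Lambda> k f x \<partial>M) \<le> of_nat (packing \<Lambda>) * (\<integral>\<^sup>+x. f x \<partial>M)"
proof (rule cells_integral_le[where k = k])
  fix i assume "i \<in> net k"
  let ?B = "ball i (\<Lambda> * rad k)"
  let ?c = "(\<integral>\<^sup>+y\<in>?B. f y \<partial>M) / emeasure M ?B"
  have "(\<integral>\<^sup>+x\<in>cell_set k i. avg \<Lambda> k f x \<partial>M) = (\<integral>\<^sup>+x\<in>cell_set k i. ?c \<partial>M)"
    by (rule nn_integral_cong) (auto simp: avg_def cell_set_def indicator_def)
  also have "\<dots> = ?c * emeasure M (cell_set k i)"
    by (rule nn_integral_cmult_indicator) (simp add: sets_M)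
  also have "\<dots> \<le> ?c * emeasure M ?B"
  proof (intro mult_left_mono emeasure_mono)
    have "rad k \<le> \<Lambda> * rad k" using \<Lambda> by simp
    then show "cell_set k i \<subseteq> ?B" using cell_set_subset[of k i] subset_ball[of "rad k" "\<Lambda> * rad k" i]
        by blast
  qed auto
  also have "\<dots> = (\<integral>\<^sup>+y\<in>?B. f y \<partial>M)"
    using ball_pos[of "\<Lambda> * rad k" i] ball_finite[of i "\<Lambda> * rad k"] \<Lambda>
    by (intro ennreal_divide_mult_cancel) auto
  finally show "(\<integral>\<^sup>+x\<in>cell_set k i. avg \<Lambda> k f x \<partial>M) \<le> (\<integral>\<^sup>+y\<in>?B. f y \<partial>M)" .
qed (use \<Lambda> in auto)

section \<open>Density of Lipschitz functions in the space of integrable functions\<close>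

definition base :: 'a where "base = undefined"

definition lip_bounded_support :: "('a \<Rightarrow> real) \<Rightarrow> bool" where
  "lip_bounded_support \<phi> \<longleftrightarrow> (\<exists>L. 0 \<le> L \<and> (\<forall>x y. \<bar>\<phi> x - \<phi> y\<bar> \<le> L * dist x y)) \<and>
      (\<exists>R. 0 < R \<and> (\<forall>x. R \<le> dist base x \<longrightarrow> \<phi> x = 0))"

lemma lip_bounded_supportE:
  assumes "lip_bounded_support \<phi>"
  obtains L R where "0 \<le> L" "\<And>x y. \<bar>\<phi> x - \<phi> y\<bar> \<le> L * dist x y" "0 < R" "\<And>x. R \<le> dist base x \<Longrightarrow> \<phi> x = 0"
  using assms unfolding lip_bounded_support_def by blast

lemma lip_bounded_supportI:
  assumes "0 \<le> L" "\<And>x y. \<bar>\<phi> x - \<phi> y\<bar> \<le> L * dist x y" "0 < R" "\<And>x. R \<le> dist base x \<Longrightarrow> \<phi> x = 0"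
  shows "lip_bounded_support \<phi>"
  using assms unfolding lip_bounded_support_def by blast

lemma lipschitz_measurable:
  assumes L: "0 \<le> L" "\<And>x y. \<bar>\<phi> x - \<phi> y\<bar> \<le> L * dist x (y::'a)"
  shows "\<phi> \<in> borel_measurable borel"
proof (rule borel_measurable_continuous_onI)
  have "L-lipschitz_on UNIV \<phi>"
    by (rule lipschitz_onI) (use L in \<open>auto simp: dist_real_def\<close>)
  then show "continuous_on UNIV \<phi>" by (rule lipschitz_on_continuous_on)
qed

lemma lip_bounded_support_measurable [measurable_dest]: "lip_bounded_support \<phi> \<Longrightarrow> \<phi> \<in> borel_measurable borel"
  by (metis lip_bounded_supportE lipschitz_measurable)

lemma lip_bounded_support_add:
  assumes "lip_bounded_support \<phi>" "lip_bounded_support \<psi>"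
  shows "lip_bounded_support (\<lambda>x. \<phi> x + \<psi> x)"
proof -
  obtain L R where 1: "0 \<le> L" "\<And>x y. \<bar>\<phi> x - \<phi> y\<bar> \<le> L * dist x y" "0 < R" "\<And>x. R \<le> dist base x \<Longrightarrow> \<phi> x = 0"
    using lip_bounded_supportE[OF assms(1)] by blast
  obtain L' R' where 2: "0 \<le> L'" "\<And>x y. \<bar>\<psi> x - \<psi> y\<bar> \<le> L' * dist x y" "0 < R'" "\<And>x. R' \<le> dist base x \<Longrightarrow>
      \<psi> x = 0"
    using lip_bounded_supportE[OF assms(2)] by blast
  show ?thesis
  proof (rule lip_bounded_supportI[of "L + L'" _ "max R R'"])
    fix x y show "\<bar>\<phi> x + \<psi> x - (\<phi> y + \<psi> y)\<bar> \<le> (L + L') * dist x y"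
      using 1(2)[of x y] 2(2)[of x y] by (simp add: algebra_simps)
  qed (use 1 2 in auto)
qed

lemma lip_bounded_support_cmult:
  assumes "lip_bounded_support \<phi>"
  shows "lip_bounded_support (\<lambda>x. c * \<phi> x)"
proof -
  obtain L R where 1: "0 \<le> L" "\<And>x y. \<bar>\<phi> x - \<phi> y\<bar> \<le> L * dist x y" "0 < R" "\<And>x. R \<le> dist base x \<Longrightarrow> \<phi> x = 0"
    using lip_bounded_supportE[OF assms(1)] by blast
  show ?thesis
  proof (rule lip_bounded_supportI[of "\<bar>c\<bar> * L" _ R])
    fix x y
    have "\<bar>c * \<phi> x - c * \<phi> y\<bar> = \<bar>c\<bar> * \<bar>\<phi> x - \<phi> y\<bar>" by (simp flip: abs_mult right_diff_distrib)
    also have "\<dots> \<le> \<bar>c\<bar> * (L * dist x y)" by (intro mult_left_mono 1) auto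
    finally show "\<bar>c * \<phi> x - c * \<phi> y\<bar> \<le> \<bar>c\<bar> * L * dist x y" by simp
  qed (use 1 in auto)
qed

definition cutoff :: "nat \<Rightarrow> 'a \<Rightarrow> real" where
  "cutoff n x = max 0 (min 1 (real n - dist base x))"

lemma cutoff_bounds: "0 \<le> cutoff n x" "cutoff n x \<le> 1"
  by (auto simp: cutoff_def)

lemma cutoff_lip: "\<bar>cutoff n x - cutoff n y\<bar> \<le> dist x y"
  using dist_triangle[of base x y] dist_triangle[of base y x]
      by (auto simp: cutoff_def max_def min_def dist_commute)

lemma cutoff_zero: "real n \<le> dist base x \<Longrightarrow> cutoff n x = 0"
  by (auto simp: cutoff_def)

lemma lip_bounded_support_mult_cutoff:
  assumes \<phi>: "0 \<le> L" "\<And>x y. \<bar>\<phi> x - \<phi> y\<bar> \<le> L * dist x y" "\<And>x. \<bar>\<phi> x\<bar> \<le> 1"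
  shows "lip_bounded_support (\<lambda>x. \<phi> x * cutoff n x)"
proof (rule lip_bounded_supportI[of "L + 1" _ "real n + 1"])
  fix x y
  have "\<phi> x * cutoff n x - \<phi> y * cutoff n y = (\<phi> x - \<phi> y) * cutoff n x + \<phi> y * (cutoff n x - cutoff n y)"
    by (simp add: algebra_simps)
  also have "\<bar>\<dots>\<bar> \<le> \<bar>\<phi> x - \<phi> y\<bar> * \<bar>cutoff n x\<bar> + \<bar>\<phi> y\<bar> * \<bar>cutoff n x - cutoff n y\<bar>"
    by (metis abs_mult abs_triangle_ineq)
  also have "\<dots> \<le> (L * dist x y) * 1 + 1 * dist x y"
    by (intro add_mono mult_mono \<phi> cutoff_lip) (use \<phi>(1) cutoff_bounds[of n x] in auto)
  finally show "\<bar>\<phi> x * cutoff n x - \<phi> y * cutoff n y\<bar> \<le> (L + 1) * dist x y"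
    by (simp add: algebra_simps)
qed (use \<phi>(1) in \<open>auto simp: cutoff_zero\<close>)

lemma cutoff_measurable [measurable]: "cutoff n \<in> borel_measurable borel"
  by (rule lipschitz_measurable[of 1]) (auto simp: cutoff_lip)

lemma cutoff_integral: "(\<integral>\<^sup>+x. ennreal (cutoff n x) \<partial>M) < \<infinity>"
proof -
  have "(\<integral>\<^sup>+x. ennreal (cutoff n x) \<partial>M) \<le> (\<integral>\<^sup>+x. indicator (ball base (real n)) x \<partial>M)"
    using cutoff_bounds(2)[of n] cutoff_zero[of n]
    by (intro nn_integral_mono) (auto simp: indicator_def)
  then show ?thesis using ball_finite[of base "real n"] by (simp add: le_less_trans)
qed

definition approximable :: "('a \<Rightarrow> real) \<Rightarrow> bool" where
  "approximable f \<longleftrightarrow> (\<forall>e>0. \<exists>\<phi>. lip_bounded_support \<phi> \<and> (\<integral>\<^sup>+x. ennreal \<bar>f x - \<phi> x\<bar> \<partial>M) < ennreal e)"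

lemma nn_integral_abs_triangle:
  fixes f g h :: "'a \<Rightarrow> real"
  assumes [measurable]: "f \<in> borel_measurable borel" "g \<in> borel_measurable borel"
      "h \<in> borel_measurable borel"
  shows "(\<integral>\<^sup>+x. ennreal \<bar>f x - h x\<bar> \<partial>M) \<le> (\<integral>\<^sup>+x. ennreal \<bar>f x - g x\<bar> \<partial>M) + (\<integral>\<^sup>+x. ennreal \<bar>g x - h x\<bar> \<partial>M)"
proof -
  have "(\<integral>\<^sup>+x. ennreal \<bar>f x - h x\<bar> \<partial>M) \<le> (\<integral>\<^sup>+x. ennreal \<bar>f x - g x\<bar> + ennreal \<bar>g x - h x\<bar> \<partial>M)"
    by (intro nn_integral_mono) (simp flip: ennreal_plus)
  also have "\<dots> = (\<integral>\<^sup>+x. ennreal \<bar>f x - g x\<bar> \<partial>M) + (\<integral>\<^sup>+x. ennreal \<bar>g x - h x\<bar> \<partial>M)"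
    by (intro nn_integral_add) measurable
  finally show ?thesis .
qed

lemma approximable_limit:
  assumes [measurable]: "f \<in> borel_measurable borel"
    and lim: "\<And>e. 0 < e \<Longrightarrow> \<exists>g. g \<in> borel_measurable borel \<and> approximable g \<and> (\<integral>\<^sup>+x. ennreal \<bar>f x - g x\<bar> \<partial>M)
        < ennreal e"
  shows "approximable f"
  unfolding approximable_def
proof (intro allI impI)
  fix e :: real assume e: "0 < e"
  then obtain g where [measurable]: "g \<in> borel_measurable borel"
    and g: "approximable g" "(\<integral>\<^sup>+x. ennreal \<bar>f x - g x\<bar> \<partial>M) < ennreal (e/2)"
    using lim[of "e/2"] by auto
  obtain \<phi> where \<phi>: "lip_bounded_support \<phi>" "(\<integral>\<^sup>+x. ennreal \<bar>g x - \<phi> x\<bar> \<partial>M) < ennreal (e/2)"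
    using g(1) e unfolding approximable_def by (meson half_gt_zero)
  note [measurable] = lip_bounded_support_measurable[OF \<phi>(1)]
  have "(\<integral>\<^sup>+x. ennreal \<bar>f x - \<phi> x\<bar> \<partial>M) \<le> (\<integral>\<^sup>+x. ennreal \<bar>f x - g x\<bar> \<partial>M) + (\<integral>\<^sup>+x. ennreal \<bar>g x - \<phi> x\<bar> \<partial>M)"
    by (rule nn_integral_abs_triangle) measurable
  also have "\<dots> < ennreal (e/2) + ennreal (e/2)" by (rule add_strict_mono[OF g(2) \<phi>(2)])
  also have "\<dots> = ennreal e" using e by (simp flip: ennreal_plus)
  finally show "\<exists>\<phi>. lip_bounded_support \<phi> \<and> (\<integral>\<^sup>+x. ennreal \<bar>f x - \<phi> x\<bar> \<partial>M) < ennreal e" using \<phi> by blast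
qed

text \<open>Dominated convergence turns the pointwise limit into an L^1 limit; all limits in the
  density proof pass through this closure property.\<close>

lemma approximable_dominated:
  fixes u :: "nat \<Rightarrow> 'a \<Rightarrow> real"
  assumes [measurable]: "f \<in> borel_measurable borel" "\<And>n. u n \<in> borel_measurable borel"
      "w \<in> borel_measurable borel"
    and u: "\<And>n. approximable (u n)" "\<And>n x. \<bar>u n x\<bar> \<le> w x" and w: "(\<integral>\<^sup>+x. ennreal (w x) \<partial>M) < \<infinity>"
    and lim: "\<And>x. (\<lambda>n. u n x) \<longlonglongrightarrow> f x"
  shows "approximable f"
proof (rule approximable_limit)
  fix e :: real assume e: "0 < e"
  have "(\<lambda>n. \<integral>\<^sup>+x. ennreal (norm (f x - u n x)) \<partial>M) \<longlonglongrightarrow> 0"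
    by (rule nn_integral_dominated_convergence_norm[where w = w]) (use u w lim in auto)
  then have "eventually (\<lambda>n. (\<integral>\<^sup>+x. ennreal (norm (f x - u n x)) \<partial>M) < ennreal e) sequentially"
    using e by (intro order_tendstoD(2)) auto
  then obtain n where "(\<integral>\<^sup>+x. ennreal (norm (f x - u n x)) \<partial>M) < ennreal e"
    by (auto simp: eventually_sequentially)
  then show "\<exists>g. g \<in> borel_measurable borel \<and> approximable g \<and> (\<integral>\<^sup>+x. ennreal \<bar>f x - g x\<bar> \<partial>M) < ennreal e"
    using u by (intro exI[of _ "u n"]) auto
qed simp

lemma approximable_lip: "lip_bounded_support \<phi> \<Longrightarrow> approximable \<phi>"
  unfolding approximable_def by (auto intro!: exI[of _ \<phi>])

lemma approximable_add:
  assumes [measurable]: "f \<in> borel_measurable borel" "g \<in> borel_measurable borel"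
    and f: "approximable f" and g: "approximable g"
  shows "approximable (\<lambda>x. f x + g x)"
  unfolding approximable_def
proof (intro allI impI)
  fix e :: real assume e: "0 < e"
  obtain \<phi> where \<phi>: "lip_bounded_support \<phi>" "(\<integral>\<^sup>+x. ennreal \<bar>f x - \<phi> x\<bar> \<partial>M) < ennreal (e/2)"
    using f e unfolding approximable_def by (meson half_gt_zero)
  obtain \<psi> where \<psi>: "lip_bounded_support \<psi>" "(\<integral>\<^sup>+x. ennreal \<bar>g x - \<psi> x\<bar> \<partial>M) < ennreal (e/2)"
    using g e unfolding approximable_def by (meson half_gt_zero)
  note [measurable] = lip_bounded_support_measurable[OF \<phi>(1)] lip_bounded_support_measurable[OF \<psi>(1)]
  have "(\<integral>\<^sup>+x. ennreal \<bar>f x + g x - (\<phi> x + \<psi> x)\<bar> \<partial>M) \<le> (\<integral>\<^sup>+x. ennreal \<bar>f x - \<phi> x\<bar> + ennreal \<bar>g x - \<psi> x\<bar> \<partial>M)"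
    by (intro nn_integral_mono) (simp flip: ennreal_plus)
  also have "\<dots> = (\<integral>\<^sup>+x. ennreal \<bar>f x - \<phi> x\<bar> \<partial>M) + (\<integral>\<^sup>+x. ennreal \<bar>g x - \<psi> x\<bar> \<partial>M)"
    by (intro nn_integral_add) measurable
  also have "\<dots> < ennreal (e/2) + ennreal (e/2)" by (rule add_strict_mono[OF \<phi>(2) \<psi>(2)])
  also have "\<dots> = ennreal e" using e by (simp flip: ennreal_plus)
  finally show "\<exists>\<phi>. lip_bounded_support \<phi> \<and> (\<integral>\<^sup>+x. ennreal \<bar>f x + g x - \<phi> x\<bar> \<partial>M) < ennreal e"
    using lip_bounded_support_add[OF \<phi>(1) \<psi>(1)] by blast
qed

lemma approximable_cmult:
  assumes [measurable]: "f \<in> borel_measurable borel" and f: "approximable f"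
  shows "approximable (\<lambda>x. c * f x)"
  unfolding approximable_def
proof (intro allI impI)
  fix e :: real assume e: "0 < e"
  then have e': "0 < e / (\<bar>c\<bar> + 1)" by simp
  obtain \<phi> where \<phi>: "lip_bounded_support \<phi>" "(\<integral>\<^sup>+x. ennreal \<bar>f x - \<phi> x\<bar> \<partial>M) < ennreal (e / (\<bar>c\<bar> + 1))"
    using f e' unfolding approximable_def by meson
  note [measurable] = lip_bounded_support_measurable[OF \<phi>(1)]
  have "(\<integral>\<^sup>+x. ennreal \<bar>c * f x - c * \<phi> x\<bar> \<partial>M) = (\<integral>\<^sup>+x. ennreal \<bar>c\<bar> * ennreal \<bar>f x - \<phi> x\<bar> \<partial>M)"
    by (simp flip: ennreal_mult abs_mult right_diff_distrib)
  also have "\<dots> = ennreal \<bar>c\<bar> * (\<integral>\<^sup>+x. ennreal \<bar>f x - \<phi> x\<bar> \<partial>M)" by (rule nn_integral_cmult) measurable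
  also have "\<dots> \<le> ennreal \<bar>c\<bar> * ennreal (e / (\<bar>c\<bar> + 1))" using \<phi> by (intro mult_left_mono) auto
  also have "\<dots> < ennreal e"
    using e by (simp add: ennreal_lessI field_simps flip: ennreal_mult)
  finally show "\<exists>\<phi>. lip_bounded_support \<phi> \<and> (\<integral>\<^sup>+x. ennreal \<bar>c * f x - \<phi> x\<bar> \<partial>M) < ennreal e"
    using lip_bounded_support_cmult[OF \<phi>(1)] by blast
qed

text \<open>Dynkin induction from the closed sets, an intersection stable generator of the Borel
  sets. The cutoff serves as an integrable majorant, since A may have infinite measure.\<close>

lemma approximable_indicator_cutoff:
  assumes A: "A \<in> sets borel"
  shows "approximable (\<lambda>x. indicator A x * cutoff m x)"
proof -
  have A': "A \<in> sigma_sets UNIV (Collect closed)"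
    using A by (simp add: borel_eq_closed)
  have sb: "B \<in> sets borel" if "B \<in> sigma_sets UNIV (Collect closed)" for B :: "'a set"
    using that by (simp add: borel_eq_closed)
  have Int: "Int_stable (Collect closed :: 'a set set)" by (auto simp: Int_stable_def)
  show ?thesis
  proof (rule sigma_sets_induct_disjoint[OF Int _ A', where P =
      "\<lambda>A. approximable (\<lambda>x. indicator A x * cutoff m x)"])
    fix F :: "'a set" assume "F \<in> Collect closed"
    then have F: "closed F" by simp
    show "approximable (\<lambda>x. indicator F x * cutoff m x)"
    proof (cases "F = {}")
      case True
      show ?thesis unfolding True by (rule approximable_lip, rule lip_bounded_supportI[of 0 _ 1]) auto
    next
      case False
      \<comment> \<open>Lipschitz functions decreasing to the indicator of the closed set F; they
        vanish at distance 1 / n and beyond.\<close>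
      define \<phi> where "\<phi> n x = max 0 (1 - real n * infdist x F)" for n x
      have lip: "\<bar>\<phi> n x - \<phi> n y\<bar> \<le> real n * dist x y" for n x y
      proof -
        have "\<bar>real n * infdist x F - real n * infdist y F\<bar> \<le> real n * dist x y"
          using infdist_triangle_abs[of x F y]
              by (simp add: abs_mult mult_left_mono flip: right_diff_distrib)
        then show ?thesis unfolding \<phi>_def by linarith
      qed
      have b: "0 \<le> \<phi> n x" "\<phi> n x \<le> 1" for n x
        using infdist_nonneg[of x F] by (auto simp: \<phi>_def)
      show ?thesis
      proof (rule approximable_dominated[where u = "\<lambda>n x. \<phi> n x * cutoff m x" and w = "cutoff m"])
        have "F \<in> sets borel" using F by simp
        then show "(\<lambda>x. indicator F x * cutoff m x) \<in> borel_measurable borel" by measurable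
        have "\<phi> n \<in> borel_measurable borel" for n by (rule lipschitz_measurable[of "real n"]) (use lip
            in auto)
        then show "(\<lambda>x. \<phi> n x * cutoff m x) \<in> borel_measurable borel" for n by measurable
        show "approximable (\<lambda>x. \<phi> n x * cutoff m x)" for n
          by (intro approximable_lip lip_bounded_support_mult_cutoff[of "real n"]) (use lip b in auto)
        show "\<bar>\<phi> n x * cutoff m x\<bar> \<le> cutoff m x" for n x
          using b[of n x] cutoff_bounds[of m x] by (simp add: abs_mult mult_left_le_one_le)
        show "(\<lambda>n. \<phi> n x * cutoff m x) \<longlonglongrightarrow> indicator F x * cutoff m x" for x
        proof (cases "x \<in> F")
          case True
          then show ?thesis by (simp add: \<phi>_def)
        next
          case nF: False
          have pos: "0 < infdist x F" using F False nF by (simp add: infdist_pos_not_in_closed)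
          obtain N where N: "1 / infdist x F < real N" using reals_Archimedean2 by blast
          have "\<phi> n x * cutoff m x = 0" if "n \<ge> N" for n
          proof -
            have "1 < real N * infdist x F" using N pos by (simp add: field_simps)
            also have "\<dots> \<le> real n * infdist x F" using that pos by (intro mult_right_mono) auto
            finally show ?thesis by (simp add: \<phi>_def)
          qed
          then have "(\<lambda>n. \<phi> n x * cutoff m x) \<longlonglongrightarrow> 0"
            by (intro tendsto_eventually) (auto simp: eventually_sequentially)
          then show ?thesis using nF by simp
        qed
      qed (use cutoff_integral in auto)
    qed
  next
    show "approximable (\<lambda>x. indicator {} x * cutoff m x)"
      by (rule approximable_lip, rule lip_bounded_supportI[of 0 _ 1]) auto
  next
    fix A :: "'a set" assume A: "A \<in> sigma_sets UNIV (Collect closed)" and IH: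
        "approximable (\<lambda>x. indicator A x * cutoff m x)"
    note [measurable] = sb[OF A]
    have "lip_bounded_support (cutoff m)"
      using lip_bounded_support_mult_cutoff[of 0 "\<lambda>_. 1" m] by simp
    then have "approximable (\<lambda>x. cutoff m x + (-1) * (indicator A x * cutoff m x))"
      by (intro approximable_add approximable_cmult IH approximable_lip) measurable
    also have "(\<lambda>x. cutoff m x + (-1) * (indicator A x * cutoff m x)) = (\<lambda>x. indicator (UNIV - A) x
        * cutoff m x)"
      by (auto simp: indicator_def)
    finally show "approximable (\<lambda>x. indicator (UNIV - A) x * cutoff m x)" .
  next
    fix A :: "nat \<Rightarrow> 'a set"
    assume disj: "disjoint_family A" and A: "range A \<subseteq> sigma_sets UNIV (Collect closed)"
      and IH: "\<And>i. approximable (\<lambda>x. indicator (A i) x * cutoff m x)"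
    have [measurable]: "A i \<in> sets borel" for i using A sb by auto
    show "approximable (\<lambda>x. indicator (\<Union> (range A)) x * cutoff m x)"
    proof (rule approximable_dominated[where u = "\<lambda>n x. indicator (\<Union>i<n. A i) x * cutoff m x" and w =
        "cutoff m"])
      show "approximable (\<lambda>x. indicator (\<Union>i<n. A i) x * cutoff m x)" for n
      proof (induction n)
        case 0
        show ?case by (rule approximable_lip, rule lip_bounded_supportI[of 0 _ 1]) auto
      next
        case (Suc n)
        have "A n \<inter> A i = {}" if "i < n" for i
          using disjoint_family_onD[OF disj, of n i] that by auto
        then have dj: "(\<Union>i<n. A i) \<inter> A n = {}" by blast
        have "(\<lambda>x. indicator (\<Union>i<Suc n. A i) x * cutoff m x) =
           (\<lambda>x. indicator (\<Union>i<n. A i) x * cutoff m x + indicator (A n) x * cutoff m x)"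
        proof
          fix x
          have "(\<Union>i<Suc n. A i) = (\<Union>i<n. A i) \<union> A n" by (simp add: lessThan_Suc Un_commute)
          then show "indicator (\<Union>i<Suc n. A i) x * cutoff m x
             = indicator (\<Union>i<n. A i) x * cutoff m x + indicator (A n) x * cutoff m x"
            using indicator_add[OF dj, of x, where 'b = real] by (simp only: distrib_right[symmetric])
        qed
        moreover have "approximable (\<lambda>x. indicator (\<Union>i<n. A i) x * cutoff m x + indicator (A n) x
            * cutoff m x)"
          by (intro approximable_add Suc IH) measurable
        ultimately show ?case by simp
      qed
      show "\<bar>indicator (\<Union>i<n. A i) x * cutoff m x\<bar> \<le> cutoff m x" for n x
        using cutoff_bounds[of m x] by (auto simp: indicator_def)
      show "(\<lambda>n. indicator (\<Union>i<n. A i) x * cutoff m x) \<longlonglongrightarrow> indicator (\<Union> (range A)) x * cutoff m x" for x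
        by (intro tendsto_mult tendsto_const LIMSEQ_indicator_UN)
    qed (use cutoff_integral in auto)
  qed auto
qed

lemma approximable_indicator:
  assumes [measurable]: "A \<in> sets borel" and fin: "(\<integral>\<^sup>+x. ennreal (indicator A x) \<partial>M) < \<infinity>"
  shows "approximable (indicator A)"
proof (rule approximable_dominated[where u = "\<lambda>n x. indicator A x * cutoff n x" and w = "indicator A"])
  show "\<bar>indicator A x * cutoff n x\<bar> \<le> indicator A x" for n x
    using cutoff_bounds[of n x] by (auto simp: indicator_def)
  show "(\<lambda>n. indicator A x * cutoff n x) \<longlonglongrightarrow> indicator A x" for x
  proof -
    obtain N where N: "dist base x + 1 < real N" using reals_Archimedean2 by blast
    then have "eventually (\<lambda>n. cutoff n x = 1) sequentially"
      by (intro eventually_sequentiallyI[of N]) (auto simp: cutoff_def)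
    then have "eventually (\<lambda>n. indicator A x * cutoff n x = indicator A x) sequentially"
      by eventually_elim simp
    then show ?thesis by (rule tendsto_eventually)
  qed
qed (use fin in \<open>auto intro: approximable_indicator_cutoff\<close>)

lemma approximable_nonneg:
  assumes f: "f \<in> borel_measurable borel" and nn: "\<And>x. 0 \<le> f x" and fin: "(\<integral>\<^sup>+x. ennreal (f x) \<partial>M) < \<infinity>"
  shows "approximable f"
proof -
  have "(\<integral>\<^sup>+x. ennreal (f x) \<partial>M) < \<infinity> \<longrightarrow> approximable f"
    using f nn
  \<comment> \<open>Finiteness of the integral is a premise inside the induction claim; in each case
    the smaller functions inherit it.\<close>
  proof (induction rule: borel_measurable_induct_real)
    case (set A)
    then show ?case using approximable_indicator by auto
  next
    case (mult u c)
    note [measurable] = mult(2)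
    show ?case
    proof (cases "c = 0")
      case True
      then show ?thesis by (auto intro!: approximable_lip lip_bounded_supportI[of 0 _ 1])
    next
      case False
      then show ?thesis using mult
        by (auto intro!: approximable_cmult simp: ennreal_mult nn_integral_cmult ennreal_mult_less_top)
    qed
  next
    case (add u v)
    note [measurable] = add(1,3)
    show ?case
      using add by (auto intro!: approximable_add simp: nn_integral_add)
  next
    case (seq U)
    note [measurable] = seq(1) f
    show ?case
    proof
      assume fin: "(\<integral>\<^sup>+x. ennreal (f x) \<partial>M) < \<infinity>"
      have le: "U i x \<le> f x" for i x
        using seq by (intro incseq_le) (auto simp: incseq_def le_fun_def)
      have finU: "(\<integral>\<^sup>+x. ennreal (U i x) \<partial>M) < \<infinity>" for i
        using fin by (rule le_less_trans[rotated]) (intro nn_integral_mono ennreal_leI le)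
      show "approximable f"
      proof (rule approximable_dominated[where u = U and w = f])
        show "\<bar>U n x\<bar> \<le> f x" for n x using le[of n x] seq(2)[of n x] by simp
        show "(\<lambda>n. U n x) \<longlonglongrightarrow> f x" for x by (rule seq(4)) simp
        show "approximable (U n)" for n using seq(5)[of n] finU[of n] by blast
      qed (use fin in auto)
    qed
  qed
  then show ?thesis using fin by simp
qed

lemma approximable_integrable:
  assumes f [measurable]: "f \<in> borel_measurable borel" and fin: "(\<integral>\<^sup>+x. ennreal \<bar>f x\<bar> \<partial>M) < \<infinity>"
  shows "approximable f"
proof -
  have *: "approximable (\<lambda>x. max 0 (s * f x))" if "\<bar>s\<bar> = 1" for s
  proof (rule approximable_nonneg)
    have "(\<integral>\<^sup>+x. ennreal (max 0 (s * f x)) \<partial>M) \<le> (\<integral>\<^sup>+x. ennreal \<bar>f x\<bar> \<partial>M)"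
      using that by (intro nn_integral_mono ennreal_leI) (auto simp: abs_if split: if_splits)
    then show "(\<integral>\<^sup>+x. ennreal (max 0 (s * f x)) \<partial>M) < \<infinity>" using fin by (rule le_less_trans)
  qed auto
  have "approximable (\<lambda>x. max 0 (1 * f x) + (-1) * max 0 ((-1) * f x))"
    by (intro approximable_add approximable_cmult *) auto
  also have "(\<lambda>x. max 0 (1 * f x) + (-1) * max 0 ((-1) * f x)) = f" by (auto simp: max_def)
  finally show ?thesis .
qed

section \<open>Convergence of averages and separability of pairs\<close>

lemma avg_const_le: "0 < \<Lambda> \<Longrightarrow> (\<integral>\<^sup>+y\<in>ball (cell k x) (\<Lambda> * rad k). c \<partial>M) / emeasure M (ball (cell k x) (\<Lambda>
    * rad k)) = c"
  using ball_pos[of "\<Lambda> * rad k" "cell k x"] ball_finite[of "cell k x" "\<Lambda> * rad k"]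
  by (simp add: nn_integral_cmult_indicator mult_divide_eq_ennreal)

text \<open>Subtraction in \<open>ennreal\<close> is truncated, so only the excess of the average
  over \<rho> is measured, which suffices for a majorant of the averages. A Lipschitz \<phi> close
  to \<rho> in L^1 has averages uniformly close to \<phi>, and averaging the error \<psi> increases
  its integral at most by the factor \<open>packing \<Lambda>\<close>.\<close>

lemma avg_minus_small:
  fixes \<rho> :: "'a \<Rightarrow> ennreal"
  assumes \<rho> [measurable]: "\<rho> \<in> borel_measurable borel" and fin: "(\<integral>\<^sup>+x. \<rho> x \<partial>M) < \<infinity>"
    and \<Lambda>: "1 \<le> \<Lambda>" and e: "0 < e"
  shows "\<exists>K. \<forall>k\<ge>K. (\<integral>\<^sup>+x. avg \<Lambda> k \<rho> x - \<rho> x \<partial>M) \<le> ennreal e"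
proof -
  let ?N = "real (packing \<Lambda>)"
  define \<rho>' where "\<rho>' x = enn2real (\<rho> x)" for x
  have [measurable]: "\<rho>' \<in> borel_measurable borel" unfolding \<rho>'_def by measurable
  have AE: "AE x in M. \<rho> x \<noteq> \<infinity>"
    using fin by (intro nn_integral_PInf_AE) auto
  have AE': "AE x in M. \<rho> x = ennreal (\<rho>' x)"
    using AE by eventually_elim (simp add: \<rho>'_def less_top)
  have "(\<integral>\<^sup>+x. ennreal \<bar>\<rho>' x\<bar> \<partial>M) = (\<integral>\<^sup>+x. \<rho> x \<partial>M)"
    by (rule nn_integral_cong_AE) (use AE' in eventually_elim, simp add: \<rho>'_def)
  then have "approximable \<rho>'" using fin by (intro approximable_integrable) auto
  moreover have "0 < e / (2 * (?N + 1))" using e by simp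
  ultimately obtain \<phi> where \<phi>: "lip_bounded_support \<phi>"
    and \<phi>e: "(\<integral>\<^sup>+x. ennreal \<bar>\<rho>' x - \<phi> x\<bar> \<partial>M) < ennreal (e / (2 * (?N + 1)))"
    unfolding approximable_def by meson
  note [measurable] = lip_bounded_support_measurable[OF \<phi>]
  obtain L R where L: "0 \<le> L" "\<And>x y. \<bar>\<phi> x - \<phi> y\<bar> \<le> L * dist x y" and R: "0 < R" "\<And>x. R \<le> dist base x \<Longrightarrow>
      \<phi> x = 0"
    using lip_bounded_supportE[OF \<phi>] by blast
  define \<psi> where "\<psi> x = ennreal \<bar>\<rho>' x - \<phi> x\<bar>" for x
  have [measurable]: "\<psi> \<in> borel_measurable borel" unfolding \<psi>_def by measurable
  \<comment> \<open>A point is less than \<Lambda> + 1 away from every point of its averaging ball;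
    so for a point off B, \<phi> vanishes at the point and on the whole averaging ball.\<close>
  define B where "B = ball base (R + \<Lambda> + 1)"
  obtain m where m: "0 \<le> m" "emeasure M B = ennreal m"
    using ball_finite[of base "R + \<Lambda> + 1"] unfolding B_def by (cases
        "emeasure M (ball base (R + \<Lambda> + 1))") auto
  define a where "a k = L * (\<Lambda> + 1) * rad k" for k
  have a0: "0 \<le> a k" for k using L \<Lambda> by (simp add: a_def)
  \<comment> \<open>\<rho> is replaced by \<phi> under the average, and \<phi> x by \<rho> x
    afterwards, so the error \<psi> enters once averaged and once pointwise.\<close>
  have pt: "avg \<Lambda> k \<rho> x \<le> \<rho> x + (\<psi> x + ennreal (a k) * indicator B x + avg \<Lambda> k \<psi> x)" if x:
      "\<rho> x = ennreal (\<rho>' x)" for x k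
  proof -
    let ?D = "ball (cell k x) (\<Lambda> * rad k)"
    have D: "\<phi> y \<le> \<phi> x + a k * indicator B x" if "y \<in> ?D" for y
    proof -
      have d: "dist x y < (\<Lambda> + 1) * rad k"
        using that dist_cell[of x k] dist_triangle[of x y "cell k x"] by (simp add: algebra_simps)
      also have "\<dots> \<le> (\<Lambda> + 1) * 1" using \<Lambda> rad_le_1[of k] by (intro mult_left_mono) auto
      finally have d1: "dist x y < \<Lambda> + 1" by simp
      show ?thesis
      proof (cases "x \<in> B")
        case True
        have "\<phi> y \<le> \<phi> x + L * dist x y" using L(2)[of x y] by (simp add: abs_le_iff)
        also have "\<dots> \<le> \<phi> x + L * ((\<Lambda> + 1) * rad k)" using d L(1)
            by (intro add_left_mono mult_left_mono) auto
        finally show ?thesis using True by (simp add: a_def algebra_simps)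
      next
        case False
        then have "R + \<Lambda> + 1 \<le> dist base x" by (simp add: B_def)
        then have "R \<le> dist base y" "R \<le> dist base x"
          using d1 dist_triangle[of base x y] \<Lambda> by (auto simp: dist_commute)
        then show ?thesis using R(2) False by simp
      qed
    qed
    have "(\<integral>\<^sup>+y\<in>?D. \<rho> y \<partial>M) \<le> (\<integral>\<^sup>+y. (ennreal (\<phi> x) + ennreal (a k) * indicator B x) * indicator ?D y
        + \<psi> y * indicator ?D y \<partial>M)"
    proof (rule nn_integral_mono_AE)
      show "AE y in M. \<rho> y * indicator ?D y \<le> (ennreal (\<phi> x) + ennreal (a k) * indicator B x)
          * indicator ?D y + \<psi> y * indicator ?D y"
        using AE'
      proof eventually_elim
        case (elim y)
        show ?case
        proof (cases "y \<in> ?D")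
          case True
          have "\<rho> y \<le> ennreal (\<phi> y) + \<psi> y"
          proof -
            have "\<rho>' y \<le> max 0 (\<phi> y) + \<bar>\<rho>' y - \<phi> y\<bar>" by linarith
            then have "\<rho> y \<le> ennreal (max 0 (\<phi> y) + \<bar>\<rho>' y - \<phi> y\<bar>)" unfolding elim by (rule ennreal_leI)
            then show ?thesis unfolding \<psi>_def by (simp add: ennreal_plus ennreal_max_0)
          qed
          also have "ennreal (\<phi> y) \<le> ennreal (max 0 (\<phi> x) + a k * indicator B x)"
            using D[OF True] by (intro ennreal_leI) (auto simp: max_def)
          also have "\<dots> = ennreal (\<phi> x) + ennreal (a k) * indicator B x"
            using a0 by (simp add: ennreal_plus ennreal_max_0 indicator_def)
          finally show ?thesis using True by (simp add: add_right_mono)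
        qed simp
      qed
    qed
    also have "\<dots> = (\<integral>\<^sup>+y\<in>?D. (ennreal (\<phi> x) + ennreal (a k) * indicator B x) \<partial>M) + (\<integral>\<^sup>+y\<in>?D. \<psi> y \<partial>M)"
      by (intro nn_integral_add) measurable
    finally have "avg \<Lambda> k \<rho> x \<le> ((\<integral>\<^sup>+y\<in>?D. (ennreal (\<phi> x) + ennreal (a k) * indicator B x) \<partial>M)
        + (\<integral>\<^sup>+y\<in>?D. \<psi> y \<partial>M)) / emeasure M ?D"
      unfolding avg_def by (rule divide_right_mono_ennreal)
    also have "\<dots> = (ennreal (\<phi> x) + ennreal (a k) * indicator B x) + avg \<Lambda> k \<psi> x"
      using \<Lambda> by (simp add: add_divide_distrib_ennreal avg_const_le avg_def)
    also have "ennreal (\<phi> x) \<le> \<rho> x + \<psi> x"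
    proof -
      have "\<phi> x \<le> \<rho>' x + \<bar>\<rho>' x - \<phi> x\<bar>" by linarith
      then have "ennreal (\<phi> x) \<le> ennreal (\<rho>' x + \<bar>\<rho>' x - \<phi> x\<bar>)" by (rule ennreal_leI)
      also have "\<dots> = \<rho> x + \<psi> x" unfolding x \<psi>_def by (simp add: ennreal_plus \<rho>'_def)
      finally show ?thesis .
    qed
    finally show ?thesis by (simp add: add_ac add_mono)
  qed
  have int: "(\<integral>\<^sup>+x. avg \<Lambda> k \<rho> x - \<rho> x \<partial>M) \<le> ennreal (e / 2) + ennreal (a k * m)" for k
  proof -
    have "(\<integral>\<^sup>+x. avg \<Lambda> k \<rho> x - \<rho> x \<partial>M) \<le> (\<integral>\<^sup>+x. \<psi> x + ennreal (a k) * indicator B x + avg \<Lambda> k \<psi> x \<partial>M)"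
    proof (rule nn_integral_mono_AE)
      show "AE x in M. avg \<Lambda> k \<rho> x - \<rho> x \<le> \<psi> x + ennreal (a k) * indicator B x + avg \<Lambda> k \<psi> x"
        using AE' by eventually_elim (use pt in \<open>auto simp: ennreal_minus_le_iff\<close>)
    qed
    also have "\<dots> = (\<integral>\<^sup>+x. \<psi> x \<partial>M) + ennreal (a k) * emeasure M B + (\<integral>\<^sup>+x. avg \<Lambda> k \<psi> x \<partial>M)"
      by (simp add: nn_integral_add nn_integral_cmult B_def)
    also have "\<dots> \<le> (\<integral>\<^sup>+x. \<psi> x \<partial>M) + ennreal (a k) * emeasure M B + of_nat (packing \<Lambda>) * (\<integral>\<^sup>+x. \<psi> x \<partial>M)"
      by (intro add_left_mono avg_integral_le \<Lambda>) measurable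
    also have "\<dots> = ennreal (?N + 1) * (\<integral>\<^sup>+x. \<psi> x \<partial>M) + ennreal (a k) * ennreal m"
      unfolding m by (simp add: ennreal_of_nat_eq_real_of_nat distrib_right add_ac)
    also have "\<dots> \<le> ennreal (?N + 1) * ennreal (e / (2 * (?N + 1))) + ennreal (a k) * ennreal m"
      using \<phi>e unfolding \<psi>_def by (intro add_right_mono mult_left_mono) auto
    also have "\<dots> = ennreal ((?N + 1) * (e / (2 * (?N + 1)))) + ennreal (a k * m)"
      using e m a0[of k] by (intro arg_cong2[where f = "(+)"] ennreal_mult[symmetric]) auto
    also have "(?N + 1) * (e / (2 * (?N + 1))) = e / 2"
      by (simp add: field_simps add_nonneg_eq_0_iff)
    finally show ?thesis .
  qed
  have "(\<lambda>k. L * (\<Lambda> + 1) * rad k * m) \<longlonglongrightarrow> L * (\<Lambda> + 1) * 0 * m"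
    by (intro tendsto_intros rad_tendsto)
  then have "eventually (\<lambda>k. a k * m < e / 2) sequentially"
    using e unfolding a_def by (intro order_tendstoD(2)) auto
  then obtain K where K: "\<And>k. k \<ge> K \<Longrightarrow> a k * m < e / 2" by (auto simp: eventually_sequentially)
  have "(\<integral>\<^sup>+x. avg \<Lambda> k \<rho> x - \<rho> x \<partial>M) \<le> ennreal e" if "k \<ge> K" for k
  proof -
    have "ennreal (e / 2) + ennreal (a k * m) = ennreal (e / 2 + a k * m)"
      using e a0[of k] m by (simp add: ennreal_plus)
    also have "\<dots> \<le> ennreal e" using K[OF that] by (intro ennreal_leI) auto
    finally show ?thesis using int[of k] by (rule order_trans[rotated])
  qed
  then show ?thesis by blast
qed

text \<open>A function that is constant on cells, encoded by a finite list of net points with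
  rational values; countability of all such functions is then a fact about lists.\<close>

definition step_fun :: "nat \<Rightarrow> ('a \<times> rat) list \<Rightarrow> 'a \<Rightarrow> real" where
  "step_fun k xs x = (case map_of xs (cell k x) of None \<Rightarrow> 0 | Some q \<Rightarrow> of_rat q)"

lemma step_fun_measurable: "step_fun k xs \<in> borel_measurable borel"
  unfolding step_fun_def by (rule cell_compose_measurable)

definition step_funs :: "('a \<Rightarrow> real) set" where
  "step_funs = (\<Union>k. step_fun k ` lists (net k \<times> UNIV))"

lemma countable_step_funs: "countable step_funs"
  unfolding step_funs_def by (intro countable_UN countable_image countable_lists countable_SIGMA
      countable_net) auto

lemma step_funs_measurable: "s \<in> step_funs \<Longrightarrow> s \<in> borel_measurable borel"
  by (auto simp: step_funs_def step_fun_measurable)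

text \<open>A Lipschitz approximation \<phi> is sampled at the finitely many cell centres within its
  support radius and rounded to rationals. The error is at most (L + 1) * \<open>rad k\<close> on a
  bounded set: L from sampling, 1 from rounding or from cutting off.\<close>

lemma step_funs_dense:
  fixes f :: "'a \<Rightarrow> real"
  assumes f [measurable]: "f \<in> borel_measurable borel" and fin: "(\<integral>\<^sup>+x. ennreal \<bar>f x\<bar> \<partial>M) < \<infinity>"
    and e: "0 < e"
  shows "\<exists>s\<in>step_funs. (\<integral>\<^sup>+x. ennreal \<bar>f x - s x\<bar> \<partial>M) < ennreal e"
proof -
  have "approximable f" by (rule approximable_integrable[OF f fin])
  then obtain \<phi> where \<phi>: "lip_bounded_support \<phi>" and \<phi>e: "(\<integral>\<^sup>+x. ennreal \<bar>f x - \<phi> x\<bar> \<partial>M) < ennreal (e / 2)"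
    using e unfolding approximable_def by (meson half_gt_zero)
  note [measurable] = lip_bounded_support_measurable[OF \<phi>]
  obtain L R where L: "0 \<le> L" "\<And>x y. \<bar>\<phi> x - \<phi> y\<bar> \<le> L * dist x y" and R: "0 < R" "\<And>x. R \<le> dist base x \<Longrightarrow>
      \<phi> x = 0"
    using lip_bounded_supportE[OF \<phi>] by blast
  define B where "B = ball base (R + 1)"
  obtain m where m: "0 \<le> m" "emeasure M B = ennreal m"
    using ball_finite[of base "R + 1"] unfolding B_def by (cases "emeasure M (ball base (R + 1))") auto
  have "(\<lambda>k. (L + 1) * rad k * m) \<longlonglongrightarrow> (L + 1) * 0 * m"
    by (intro tendsto_intros rad_tendsto)
  then have "eventually (\<lambda>k. (L + 1) * rad k * m < e / 2) sequentially"
    using e by (intro order_tendstoD(2)) auto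
  then obtain k where k: "(L + 1) * rad k * m < e / 2" by (auto simp: eventually_sequentially)
  have "\<exists>q. \<bar>\<phi> i - of_rat q\<bar> < rad k" for i
  proof -
    obtain q where "\<phi> i - rad k < of_rat q" "of_rat q < \<phi> i + rad k"
      using of_rat_dense[of "\<phi> i - rad k" "\<phi> i + rad k"] by auto
    then show ?thesis by (intro exI[of _ q]) (auto simp: abs_less_iff)
  qed
  then obtain q where q: "\<And>i. \<bar>\<phi> i - of_rat (q i)\<bar> < rad k" by metis
  obtain ns where ns: "set ns = net k \<inter> ball base R" using finite_list[OF finite_net_ball] by blast
  define xs where "xs = map (\<lambda>i. (i, q i)) ns"
  have s: "step_fun k xs x = (if cell k x \<in> ball base R then of_rat (q (cell k x)) else 0)" for x
  proof -
    have "map_of xs = (\<lambda>i. if i \<in> set ns then Some (q i) else None)"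
      unfolding xs_def by (simp add: map_of_map_restrict restrict_map_def fun_eq_iff)
    then show ?thesis by (simp add: step_fun_def ns)
  qed
  have "step_fun k xs \<in> step_funs"
    unfolding step_funs_def xs_def
    by (rule UN_I[of k], simp, rule imageI) (use ns in auto)
  moreover have "(\<integral>\<^sup>+x. ennreal \<bar>f x - step_fun k xs x\<bar> \<partial>M) < ennreal e"
  proof -
    note [measurable] = step_fun_measurable
    have "\<bar>\<phi> x - step_fun k xs x\<bar> \<le> (L + 1) * rad k * indicator B x" for x
    proof -
      let ?i = "cell k x"
      have d: "dist x ?i < rad k" by (rule dist_cell)
      have "L * dist x ?i \<le> L * rad k" using d L(1) by (intro mult_left_mono) auto
      then have a: "\<bar>\<phi> x - \<phi> ?i\<bar> \<le> L * rad k" using L(2)[of x ?i] by linarith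
      show ?thesis
      proof (cases "x \<in> B")
        case True
        have "\<bar>\<phi> ?i - step_fun k xs x\<bar> \<le> rad k"
          using q[of ?i] R(2)[of ?i] by (auto simp: s less_imp_le)
        then have "\<bar>\<phi> x - step_fun k xs x\<bar> \<le> L * rad k + rad k" using a by linarith
        then show ?thesis using True by (simp add: algebra_simps)
      next
        case False
        then have "R + 1 \<le> dist base x" by (simp add: B_def)
        moreover have "dist base x \<le> dist base ?i + dist x ?i" using dist_triangle[of base x ?i]
            by (simp add: dist_commute)
        ultimately have "R \<le> dist base ?i" "R \<le> dist base x" using d rad_le_1[of k] by auto
        then show ?thesis using R(2) False by (simp add: s)
      qed
    qed
    then have "(\<integral>\<^sup>+x. ennreal \<bar>\<phi> x - step_fun k xs x\<bar> \<partial>M) \<le> (\<integral>\<^sup>+x. ennreal ((L + 1) * rad k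
        * indicator B x) \<partial>M)"
      by (intro nn_integral_mono ennreal_leI)
    also have "\<dots> = (\<integral>\<^sup>+x. ennreal ((L + 1) * rad k) * indicator B x \<partial>M)"
      by (intro nn_integral_cong) (simp add: indicator_def)
    also have "\<dots> = ennreal ((L + 1) * rad k) * ennreal m"
      using m by (subst nn_integral_cmult_indicator) (auto simp: B_def)
    also have "\<dots> < ennreal (e / 2)"
      using k L m by (subst ennreal_mult[symmetric]) (auto intro!: ennreal_lessI simp: e)
    finally have b: "(\<integral>\<^sup>+x. ennreal \<bar>\<phi> x - step_fun k xs x\<bar> \<partial>M) < ennreal (e / 2)" .
    have "(\<integral>\<^sup>+x. ennreal \<bar>f x - step_fun k xs x\<bar> \<partial>M)
        \<le> (\<integral>\<^sup>+x. ennreal \<bar>f x - \<phi> x\<bar> \<partial>M) + (\<integral>\<^sup>+x. ennreal \<bar>\<phi> x - step_fun k xs x\<bar> \<partial>M)"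
      by (rule nn_integral_abs_triangle) measurable
    also have "\<dots> < ennreal (e/2) + ennreal (e/2)" by (rule add_strict_mono[OF \<phi>e b])
    also have "\<dots> = ennreal e" using e by (simp flip: ennreal_plus)
    finally show ?thesis .
  qed
  ultimately show ?thesis by blast
qed

section \<open>Separability of the set of Sobolev pairs\<close>

definition sobolev_pair :: "real \<Rightarrow> ('a \<Rightarrow> real) \<times> ('a \<Rightarrow> ennreal) \<Rightarrow> bool" where
  "sobolev_pair p = (\<lambda>(u, g). u \<in> borel_measurable borel \<and> real_upper_gradient g u \<and>
     (\<integral>\<^sup>+x. ennreal (\<bar>u x\<bar> powr p) \<partial>M) < \<infinity> \<and> (\<integral>\<^sup>+x. ennreal_rpow (g x) p \<partial>M) < \<infinity>)"

lemma sobolev_pairD: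
  assumes "sobolev_pair p (u, g)"
  shows "u \<in> borel_measurable borel" "real_upper_gradient g u" "g \<in> borel_measurable borel"
    "(\<integral>\<^sup>+x. ennreal (\<bar>u x\<bar> powr p) \<partial>M) < \<infinity>" "(\<integral>\<^sup>+x. ennreal_rpow (g x) p \<partial>M) < \<infinity>"
  using assms real_upper_gradientD(1) by (auto simp: sobolev_pair_def)

text \<open>Step functions need not form Sobolev pairs, so they serve only as targets: for each
  target (\<phi>, \<psi>, n) that some pair meets, one such pair is chosen. The Mazur map for u and
  the p-th power for g move both components into L^1. For gradients the excess of h over g is
  enough, as a common majorant is all that will be built from them.\<close>

lemma sobolev_pairs_separable:
  assumes p: "1 \<le> p"
  obtains D where "countable D" "\<And>z. z \<in> D \<Longrightarrow> sobolev_pair p z"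
    "\<And>u g e. sobolev_pair p (u, g) \<Longrightarrow> 0 < e \<Longrightarrow> \<exists>(s, h)\<in>D. (\<integral>\<^sup>+x. ennreal (\<bar>s x - u x\<bar> powr p) \<partial>M)
        < ennreal e \<and>
       (\<integral>\<^sup>+x. ennreal_rpow (h x - g x) p \<partial>M) < ennreal e"
proof -
  define near where "near \<phi> \<psi> n z \<longleftrightarrow> sobolev_pair p z \<and>
      (\<integral>\<^sup>+x. ennreal \<bar>spowr (fst z x) p - \<phi> x\<bar> \<partial>M) < ennreal (1 / real (Suc n)) \<and>
      (\<integral>\<^sup>+x. ennreal \<bar>enn2real (snd z x) powr p - \<psi> x\<bar> \<partial>M) < ennreal (1 / real (Suc n))" for \<phi> \<psi> n z
  define D where "D = (\<lambda>(\<phi>, \<psi>, n). SOME z. near \<phi> \<psi> n z) ` {(\<phi>, \<psi>, n). \<phi> \<in> step_funs \<and> \<psi> \<in> step_funs \<and>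
      (\<exists>z. near \<phi> \<psi> n z)}"
  have D: "\<exists>z\<in>D. near \<phi> \<psi> n z" if "\<phi> \<in> step_funs" "\<psi> \<in> step_funs" "near \<phi> \<psi> n z" for \<phi> \<psi> n z
  proof (rule bexI)
    show "near \<phi> \<psi> n (SOME z. near \<phi> \<psi> n z)" using that(3) by (rule someI)
    show "(SOME z. near \<phi> \<psi> n z) \<in> D"
      unfolding D_def by (rule image_eqI[of _ _ "(\<phi>, \<psi>, n)"]) (simp, use that in blast)
  qed
  show thesis
  proof (rule that[of D])
    have "countable (step_funs \<times> step_funs \<times> (UNIV :: nat set))"
      by (intro countable_SIGMA countable_step_funs) auto
    then have "countable {(\<phi>, \<psi>, n). \<phi> \<in> step_funs \<and> \<psi> \<in> step_funs \<and> (\<exists>z. near \<phi> \<psi> n z)}"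
      by (rule countable_subset[rotated]) auto
    then show "countable D" unfolding D_def by (rule countable_image)
    show "sobolev_pair p z" if "z \<in> D" for z
    proof -
      obtain \<phi> \<psi> n where "\<exists>z. near \<phi> \<psi> n z" "z = (SOME z. near \<phi> \<psi> n z)"
        using \<open>z \<in> D\<close> unfolding D_def by (elim imageE) (clarsimp, blast)
      then have "near \<phi> \<psi> n z" using someI_ex by metis
      then show ?thesis by (simp add: near_def)
    qed
    fix u g and e :: real
    assume ug: "sobolev_pair p (u, g)" and e: "0 < e"
    note [measurable] = sobolev_pairD(1,3)[OF ug]
    define q where "q = (2::real) powr p"
    have q: "1 \<le> q" using p unfolding q_def by (intro ge_one_powr_ge_zero) auto
    \<comment> \<open>The detour through the common target costs 2 / (n + 1), and the return from
      L^1 to L^p costs the factor q = 2^p.\<close>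
    obtain n where n: "1 / real (Suc n) < e / (2 * q)" using nat_approx_posE[of "e / (2 * q)"] e q by auto
    let ?d = "1 / real (Suc n)"
    have spm [measurable]: "(\<lambda>x. spowr (v x) p) \<in> borel_measurable borel" if [measurable]:
        "v \<in> borel_measurable borel" for v :: "'a \<Rightarrow> real"
      unfolding spowr_def by measurable
    have AEg: "AE x in M. h x \<noteq> top" if "sobolev_pair p (v, h)" for v h
    proof -
      note [measurable] = sobolev_pairD(3)[OF that]
      have "AE x in M. ennreal_rpow (h x) p \<noteq> \<infinity>"
        using sobolev_pairD(5)[OF that] by (intro nn_integral_PInf_AE) auto
      then show ?thesis by eventually_elim auto
    qed
    obtain \<phi> where \<phi>: "\<phi> \<in> step_funs" "(\<integral>\<^sup>+x. ennreal \<bar>spowr (u x) p - \<phi> x\<bar> \<partial>M) < ennreal ?d"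
      using step_funs_dense[of "\<lambda>x. spowr (u x) p" ?d] sobolev_pairD(4)[OF ug] by auto
    have "(\<integral>\<^sup>+x. ennreal \<bar>enn2real (g x) powr p\<bar> \<partial>M) = (\<integral>\<^sup>+x. ennreal_rpow (g x) p \<partial>M)"
      by (rule nn_integral_cong_AE) (use AEg[OF ug] in eventually_elim, auto simp: ennreal_rpow_def)
    then obtain \<psi> where \<psi>: "\<psi> \<in> step_funs" "(\<integral>\<^sup>+x. ennreal \<bar>enn2real (g x) powr p - \<psi> x\<bar> \<partial>M) < ennreal ?d"
      using step_funs_dense[of "\<lambda>x. enn2real (g x) powr p" ?d] sobolev_pairD(5)[OF ug] by auto
    have nug: "near \<phi> \<psi> n (u, g)" using ug \<phi> \<psi> by (simp add: near_def)
    obtain s h where sh: "(s, h) \<in> D" "near \<phi> \<psi> n (s, h)"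
      using D[OF \<phi>(1) \<psi>(1) nug] by (metis surj_pair)
    then have vsh: "sobolev_pair p (s, h)" by (simp add: near_def)
    note [measurable] = sobolev_pairD(1,3)[OF vsh] step_funs_measurable[OF \<phi>(1)] step_funs_measurable[OF
        \<psi>(1)]
    have two: "ennreal ?d + ennreal ?d < ennreal (e / q)"
    proof -
      have dd: "?d + ?d < e / q" using n q by (simp add: field_simps)
      have pos: "0 < e / q" using e q by simp
      have "ennreal ?d + ennreal ?d = ennreal (?d + ?d)" by (rule ennreal_plus[symmetric]) auto
      also have "\<dots> < ennreal (e / q)" by (rule ennreal_lessI[OF pos dd])
      finally show ?thesis .
    qed
    have "(\<integral>\<^sup>+x. ennreal \<bar>spowr (s x) p - spowr (u x) p\<bar> \<partial>M)
        \<le> (\<integral>\<^sup>+x. ennreal \<bar>spowr (s x) p - \<phi> x\<bar> \<partial>M) + (\<integral>\<^sup>+x. ennreal \<bar>\<phi> x - spowr (u x) p\<bar> \<partial>M)"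
      by (rule nn_integral_abs_triangle) measurable
    also have "\<dots> < ennreal ?d + ennreal ?d"
      using sh(2) \<phi>(2) by (intro add_strict_mono) (auto simp: near_def abs_minus_commute)
    also note two
    finally have s1: "(\<integral>\<^sup>+x. ennreal \<bar>spowr (s x) p - spowr (u x) p\<bar> \<partial>M) < ennreal (e / q)" .
    have "(\<integral>\<^sup>+x. ennreal (\<bar>s x - u x\<bar> powr p) \<partial>M) \<le> (\<integral>\<^sup>+x. ennreal q * ennreal \<bar>spowr (s x) p
        - spowr (u x) p\<bar> \<partial>M)"
      unfolding q_def by (intro nn_integral_mono) (simp add: ennreal_leI abs_diff_powr_le_spowr[OF p]
          flip: ennreal_mult)
    also have "\<dots> = ennreal q * (\<integral>\<^sup>+x. ennreal \<bar>spowr (s x) p - spowr (u x) p\<bar> \<partial>M)"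
      by (rule nn_integral_cmult) measurable
    also have "\<dots> < ennreal q * ennreal (e / q)"
      using s1 q by (intro ennreal_mult_strict_left_mono) auto
    also have "\<dots> = ennreal e" using q e by (simp flip: ennreal_mult)
    finally have A: "(\<integral>\<^sup>+x. ennreal (\<bar>s x - u x\<bar> powr p) \<partial>M) < ennreal e" .
    have "(\<integral>\<^sup>+x. ennreal_rpow (h x - g x) p \<partial>M) \<le> (\<integral>\<^sup>+x. ennreal \<bar>enn2real (h x) powr p
        - enn2real (g x) powr p\<bar> \<partial>M)"
    proof (rule nn_integral_mono_AE)
      show "AE x in M. ennreal_rpow (h x - g x) p \<le> ennreal \<bar>enn2real (h x) powr p - enn2real (g x) powr p\<bar>"
        using AEg[OF ug] AEg[OF vsh]
      proof eventually_elim
        case (elim x)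
        obtain a b where ab: "h x = ennreal a" "g x = ennreal b" "0 \<le> a" "0 \<le> b"
          using elim by (cases "h x"; cases "g x") auto
        have "ennreal_rpow (ennreal a - ennreal b) p \<le> ennreal (\<bar>a - b\<bar> powr p)"
          using ab p by (cases "b \<le> a") (auto simp: ennreal_minus ennreal_neg)
        also have "\<dots> \<le> ennreal \<bar>a powr p - b powr p\<bar>"
          using ab by (intro ennreal_leI abs_diff_powr_le[OF p])
        finally show ?case using ab by simp
      qed
    qed
    also have "\<dots> \<le> (\<integral>\<^sup>+x. ennreal \<bar>enn2real (h x) powr p - \<psi> x\<bar> \<partial>M) + (\<integral>\<^sup>+x. ennreal \<bar>\<psi> x
        - enn2real (g x) powr p\<bar> \<partial>M)"
      by (rule nn_integral_abs_triangle) measurable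
    also have "\<dots> < ennreal ?d + ennreal ?d"
      using sh(2) \<psi>(2) by (intro add_strict_mono) (auto simp: near_def abs_minus_commute)
    also have "\<dots> < ennreal (e / q)" by (rule two)
    also have "\<dots> \<le> ennreal e" using q e by (intro ennreal_leI) (simp add: divide_le_eq)
    finally have B: "(\<integral>\<^sup>+x. ennreal_rpow (h x - g x) p \<partial>M) < ennreal e" .
    show "\<exists>(s, h)\<in>D. (\<integral>\<^sup>+x. ennreal (\<bar>s x - u x\<bar> powr p) \<partial>M) < ennreal e \<and>
       (\<integral>\<^sup>+x. ennreal_rpow (h x - g x) p \<partial>M) < ennreal e"
      using A B sh(1) by blast
  qed
qed

end

section \<open>Difference quotients at a scale\<close>

lemma ennreal_mult_divide_le: "a * b / b \<le> (a::ennreal)"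
proof (cases "b = 0 \<or> b = top")
  case True
  then show ?thesis by (auto simp: divide_ennreal_def)
next
  case False
  then show ?thesis by (simp add: mult_divide_eq_ennreal)
qed

context doubling_space
begin

definition ball_integrable :: "('a \<Rightarrow> real) \<Rightarrow> bool" where
  "ball_integrable v \<longleftrightarrow> v \<in> borel_measurable borel \<and> (\<forall>x r. (\<integral>\<^sup>+y\<in>ball x r. ennreal \<bar>v y\<bar> \<partial>M) < \<infinity>)"

lemma ball_integrable_measurable: "ball_integrable v \<Longrightarrow> v \<in> borel_measurable borel"
  by (simp add: ball_integrable_def)

definition ball_mean :: "('a \<Rightarrow> real) \<Rightarrow> 'a \<Rightarrow> real \<Rightarrow> real" where
  "ball_mean v x r = (LINT y:ball x r|M. v y) / measure M (ball x r)"

lemma ball_integrable_set_integrable: "ball_integrable v \<Longrightarrow> set_integrable M (ball x r) v"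
proof -
  assume v: "ball_integrable v"
  note [measurable] = ball_integrable_measurable[OF v]
  have "(\<integral>\<^sup>+y. ennreal (norm (indicat_real (ball x r) y *\<^sub>R v y)) \<partial>M) = (\<integral>\<^sup>+y\<in>ball x r. ennreal \<bar>v y\<bar> \<partial>M)"
    by (rule nn_integral_cong) (simp add: indicator_def)
  then show ?thesis
    using v unfolding set_integrable_def integrable_iff_bounded ball_integrable_def by simp
qed

lemma ball_mean_combine:
  assumes v: "ball_integrable v" and w: "ball_integrable w"
  shows "ball_mean (\<lambda>x. a * v x + b * w x) x r = a * ball_mean v x r + b * ball_mean w x r"
  unfolding ball_mean_def
  by (subst set_integral_add(2)) (auto simp: ball_integrable_set_integrable v w add_divide_distrib)

lemma measure_ball_pos: "0 < r \<Longrightarrow> 0 < measure M (ball x r)"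
  using ball_pos[of r x] ball_finite[of x r] by (simp add: measure_def enn2real_positive_iff)

lemma emeasure_ball_eq: "emeasure M (ball x r) = ennreal (measure M (ball x r))"
  using ball_finite[of x r] by (simp add: emeasure_eq_ennreal_measure)

lemma ball_mean_diff_le:
  assumes v: "ball_integrable v" and r: "0 < r"
  shows "ennreal \<bar>ball_mean v x r - b\<bar> * emeasure M (ball x r) \<le> (\<integral>\<^sup>+y\<in>ball x r. ennreal \<bar>v y - b\<bar> \<partial>M)"
proof -
  let ?B = "ball x r" and ?m = "measure M (ball x r)"
  have m: "0 < ?m" by (rule measure_ball_pos[OF r])
  have ib: "set_integrable M ?B (\<lambda>y. b)"
    using ball_finite[of x r] by (simp add: set_integrable_def)
  have "(LINT y:?B|M. v y - b) = (LINT y:?B|M. v y) - b * ?m"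
    by (subst set_integral_diff(2)[OF ball_integrable_set_integrable[OF v] ib])
       (simp add: set_lebesgue_integral_def mult.commute)
  then have "(ball_mean v x r - b) * ?m = (LINT y:?B|M. v y - b)"
    using m by (simp add: ball_mean_def left_diff_distrib)
  then have "\<bar>ball_mean v x r - b\<bar> * ?m = \<bar>LINT y:?B|M. v y - b\<bar>"
    using m by (metis abs_mult abs_of_pos)
  then have "ennreal \<bar>ball_mean v x r - b\<bar> * emeasure M ?B = ennreal \<bar>LINT y:?B|M. v y - b\<bar>"
    using m by (simp add: emeasure_ball_eq flip: ennreal_mult)
  also have "\<dots> \<le> (\<integral>\<^sup>+y. ennreal (norm (indicat_real ?B y *\<^sub>R (v y - b))) \<partial>M)"
    using integral_norm_bound_ennreal[of M "\<lambda>y. indicat_real ?B y *\<^sub>R (v y - b)"]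
      set_integral_diff(1)[OF ball_integrable_set_integrable[OF v] ib]
    by (simp add: set_lebesgue_integral_def set_integrable_def)
  also have "\<dots> = (\<integral>\<^sup>+y\<in>?B. ennreal \<bar>v y - b\<bar> \<partial>M)"
    by (rule nn_integral_cong) (simp add: indicator_def)
  finally show ?thesis .
qed

lemma ball_integrable_of_Lp:
  assumes p: "1 \<le> p" and [measurable]: "v \<in> borel_measurable borel"
    and fin: "(\<integral>\<^sup>+x. ennreal (\<bar>v x\<bar> powr p) \<partial>M) < \<infinity>"
  shows "ball_integrable v"
proof -
  have "(\<integral>\<^sup>+y\<in>ball x r. ennreal \<bar>v y\<bar> \<partial>M) < \<infinity>" for x r
  proof -
    have "(\<integral>\<^sup>+y\<in>ball x r. ennreal \<bar>v y\<bar> \<partial>M) \<le> (\<integral>\<^sup>+y. indicator (ball x r) y + ennreal (\<bar>v y\<bar> powr p) \<partial>M)"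
    proof (rule nn_integral_mono)
      fix y
      have "\<bar>v y\<bar> \<le> 1 + \<bar>v y\<bar> powr p"
        using powr_mono[of 1 p "\<bar>v y\<bar>"] p by (cases "1 \<le> \<bar>v y\<bar>") (auto intro: add_increasing2)
      then have "ennreal \<bar>v y\<bar> \<le> ennreal (1 + \<bar>v y\<bar> powr p)" by (rule ennreal_leI)
      also have "\<dots> = 1 + ennreal (\<bar>v y\<bar> powr p)" by (simp add: ennreal_plus)
      finally show "ennreal \<bar>v y\<bar> * indicator (ball x r) y \<le> indicator (ball x r) y
          + ennreal (\<bar>v y\<bar> powr p)"
        by (simp add: indicator_def)
    qed
    also have "\<dots> = emeasure M (ball x r) + (\<integral>\<^sup>+x. ennreal (\<bar>v x\<bar> powr p) \<partial>M)"
      by (simp add: nn_integral_add)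
    also have "\<dots> < \<infinity>" using fin ball_finite[of x r] by simp
    finally show ?thesis .
  qed
  then show ?thesis by (simp add: ball_integrable_def)
qed

section \<open>Discrete gradients of cell means\<close>

definition cell_mean :: "('a \<Rightarrow> real) \<Rightarrow> nat \<Rightarrow> 'a \<Rightarrow> real" where
  "cell_mean v k i = ball_mean v i (rad k)"

text \<open>The radius is chosen for points at distance at most \<open>rad k\<close>: the centres of
  their cells are less than 3 * \<open>rad k\<close> apart.\<close>

definition neighbours :: "nat \<Rightarrow> 'a \<Rightarrow> 'a set" where
  "neighbours k i = net k \<inter> ball i (4 * rad k)"

lemma finite_neighbours: "finite (neighbours k i)"
  unfolding neighbours_def by (rule finite_net_ball)

text \<open>The q-th power of a discrete gradient, taken in the l^q norm over neighbouring cells so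
  that Clarkson's inequality applies term by term.\<close>

definition quotient_sum :: "real \<Rightarrow> ('a \<Rightarrow> real) \<Rightarrow> nat \<Rightarrow> 'a \<Rightarrow> real" where
  "quotient_sum q v k x =
    (\<Sum>j\<in>neighbours k (cell k x). (\<bar>cell_mean v k (cell k x) - cell_mean v k j\<bar> / rad k) powr q)"

lemma quotient_sum_measurable [measurable]: "quotient_sum q v k \<in> borel_measurable borel"
  unfolding quotient_sum_def by (rule cell_compose_measurable)

lemma quotient_sum_nonneg: "0 \<le> quotient_sum q v k x"
  unfolding quotient_sum_def by (intro sum_nonneg) simp

lemma quotient_sum_clarkson:
  assumes q: "2 \<le> q" and v: "ball_integrable v" and w: "ball_integrable w"
  shows "quotient_sum q (\<lambda>x. (v x + w x) / 2) k x + quotient_sum q (\<lambda>x. (v x - w x) / 2) k x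
    \<le> (quotient_sum q v k x + quotient_sum q w k x) / 2"
proof -
  let ?i = "cell k x"
  have p: "cell_mean (\<lambda>x. (v x + w x) / 2) k j = (cell_mean v k j + cell_mean w k j) / 2" for j
    using ball_mean_combine[OF v w, of "1/2" "1/2" j "rad k"]
        by (simp add: cell_mean_def add_divide_distrib)
  have m: "cell_mean (\<lambda>x. (v x - w x) / 2) k j = (cell_mean v k j - cell_mean w k j) / 2" for j
    using ball_mean_combine[OF v w, of "1/2" "-1/2" j "rad k"]
        by (simp add: cell_mean_def diff_divide_distrib)
  define A where "A j = (cell_mean v k ?i - cell_mean v k j) / rad k" for j
  define B where "B j = (cell_mean w k ?i - cell_mean w k j) / rad k" for j
  have eqp: "(A j + B j) / 2 = ((cell_mean v k ?i + cell_mean w k ?i) / 2 - (cell_mean v k j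
      + cell_mean w k j) / 2) / rad k" for j
    unfolding A_def B_def by (simp add: field_simps)
  have eqm: "(A j - B j) / 2 = ((cell_mean v k ?i - cell_mean w k ?i) / 2 - (cell_mean v k j
      - cell_mean w k j) / 2) / rad k" for j
    unfolding A_def B_def by (simp add: field_simps)
  have "\<bar>(A j + B j) / 2\<bar> powr q + \<bar>(A j - B j) / 2\<bar> powr q \<le> (\<bar>A j\<bar> powr q + \<bar>B j\<bar> powr q) / 2" for j
    by (rule clarkson[OF q])
  then have "(\<Sum>j\<in>neighbours k ?i. \<bar>(A j + B j) / 2\<bar> powr q + \<bar>(A j - B j) / 2\<bar> powr q)
     \<le> (\<Sum>j\<in>neighbours k ?i. (\<bar>A j\<bar> powr q + \<bar>B j\<bar> powr q) / 2)"
    by (intro sum_mono)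
  moreover have "quotient_sum q (\<lambda>x. (v x + w x) / 2) k x = (\<Sum>j\<in>neighbours k ?i. \<bar>(A j + B j) / 2\<bar> powr q)"
    unfolding quotient_sum_def p eqp by (simp add: abs_divide)
  moreover have "quotient_sum q (\<lambda>x. (v x - w x) / 2) k x = (\<Sum>j\<in>neighbours k ?i. \<bar>(A j - B j) / 2\<bar> powr q)"
    unfolding quotient_sum_def m eqm by (simp add: abs_divide)
  moreover have "quotient_sum q v k x = (\<Sum>j\<in>neighbours k ?i. \<bar>A j\<bar> powr q)"
      "quotient_sum q w k x = (\<Sum>j\<in>neighbours k ?i. \<bar>B j\<bar> powr q)"
    by (simp_all add: quotient_sum_def A_def B_def abs_divide)
  ultimately show ?thesis
    by (simp add: sum.distrib sum_divide_distrib[symmetric] add_divide_distrib)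
qed

lemma quotient_le:
  assumes q: "1 \<le> q" and j: "j \<in> neighbours k (cell k x)"
  shows "\<bar>cell_mean v k (cell k x) - cell_mean v k j\<bar> \<le> rad k * quotient_sum q v k x powr (1 / q)"
proof -
  let ?a = "\<bar>cell_mean v k (cell k x) - cell_mean v k j\<bar> / rad k"
  have "?a powr q \<le> quotient_sum q v k x"
    unfolding quotient_sum_def
    by (rule member_le_sum[OF j _ finite_neighbours]) simp
  then have "(?a powr q) powr (1 / q) \<le> quotient_sum q v k x powr (1 / q)"
    using q by (intro powr_mono2) auto
  then have "?a \<le> quotient_sum q v k x powr (1 / q)"
    using q by (simp add: powr_powr)
  then show ?thesis by (simp add: pos_divide_le_eq mult.commute)
qed

text \<open>
  On a piece of the curve of length between \<open>rad k / 2\<close> and \<open>rad k\<close>, the difference quotient at every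
  point controls the oscillation of the cell means along the whole piece.
\<close>

lemma chain_piece:
  assumes q: "1 \<le> q" and \<gamma>: "nonconst_rectifiable_curve \<gamma> a b"
    and s: "0 \<le> s" "t \<le> total_length \<gamma> a b" and st: "rad k / 2 \<le> t - s" "t - s \<le> rad k"
  defines "\<sigma> \<equiv> arc_length_param \<gamma> a b"
  shows "ennreal \<bar>cell_mean v k (cell k (\<sigma> s)) - cell_mean v k (cell k (\<sigma> t))\<bar>
    \<le> line_integral \<sigma> s t (\<lambda>x. ennreal (4 * quotient_sum q v k x powr (1 / q)))"
proof -
  let ?G = "\<lambda>x. quotient_sum q v k x powr (1 / q)"
  let ?d = "\<bar>cell_mean v k (cell k (\<sigma> s)) - cell_mean v k (cell k (\<sigma> t))\<bar>"
  have r: "0 < rad k" by simp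
  have lt: "s < t" using st r by linarith
  \<comment> \<open>Each end is compared with the cell of the intermediate point z, from which it is
    at most \<open>rad k\<close> away along the curve; two comparisons give the factor 2.\<close>
  have pt: "?d \<le> 2 * rad k * ?G (\<sigma> z)" if z: "z \<in> {s..t}" for z
  proof -
    have nb: "cell k (\<sigma> y) \<in> neighbours k (cell k (\<sigma> z))" if y: "y \<in> {s..t}" for y
    proof -
      have "dist (\<sigma> y) (\<sigma> z) \<le> \<bar>y - z\<bar>"
        using arc_length_param_dist[OF \<gamma>, of y z] arc_length_param_dist[OF \<gamma>, of z y] y z s
        unfolding \<sigma>_def by (cases "y \<le> z") (auto simp: dist_commute)
      also have "\<dots> \<le> rad k" using y z st by auto
      finally have "dist (\<sigma> y) (\<sigma> z) \<le> rad k" .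
      then have "dist (cell k (\<sigma> z)) (cell k (\<sigma> y)) < 4 * rad k"
        using dist_cell[of "\<sigma> y" k] dist_cell[of "\<sigma> z" k] r dist_commute[of "\<sigma> z" "\<sigma> y"]
          dist_commute[of "cell k (\<sigma> z)" "\<sigma> z"]
          dist_triangle[of "cell k (\<sigma> z)" "cell k (\<sigma> y)" "\<sigma> y"] dist_triangle[of "cell k (\<sigma> z)" "\<sigma> y" "\<sigma> z"]
        by linarith
      then show ?thesis by (simp add: neighbours_def)
    qed
    have "s \<in> {s..t}" "t \<in> {s..t}" using lt by auto
    from quotient_le[OF q nb[OF this(1)], of v] quotient_le[OF q nb[OF this(2)], of v]
    show ?thesis by linarith
  qed
  \<comment> \<open>The pointwise bound is spread over a piece of length at least
    \<open>rad k\<close> / 2; dividing 2 * \<open>rad k\<close> by this length gives the constant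
    4.\<close>
  have "ennreal ?d = ennreal (2 / rad k * ?d) * ennreal (rad k / 2)"
    by (simp flip: ennreal_mult)
  also have "\<dots> \<le> ennreal (2 / rad k * ?d) * ennreal (t - s)"
    using st by (intro mult_left_mono ennreal_leI) auto
  also have "\<dots> = (\<integral>\<^sup>+x. ennreal (2 / rad k * ?d) * indicator {s..t} x \<partial>lborel)"
    using lt by (simp add: nn_integral_cmult_indicator)
  also have "\<dots> \<le> (\<integral>\<^sup>+x. ennreal (4 * ?G (\<sigma> x)) * indicator {s..t} x \<partial>lborel)"
  proof (rule nn_integral_mono)
    fix x
    show "ennreal (2 / rad k * ?d) * indicator {s..t} x \<le> ennreal (4 * ?G (\<sigma> x)) * indicator {s..t} x"
    proof (cases "x \<in> {s..t}")
      case True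
      have "2 / rad k * ?d \<le> 2 / rad k * (2 * rad k * ?G (\<sigma> x))"
        by (intro mult_left_mono pt[OF True]) simp
      also have "\<dots> = 4 * ?G (\<sigma> x)" by simp
      finally show ?thesis using True by (simp add: ennreal_leI)
    qed simp
  qed
  finally show ?thesis by (simp add: line_integral_def)
qed

text \<open>The parameter interval is cut into m equal pieces, m being (t - s) /
  \<open>rad k\<close> rounded up. As the quotient is at least 1, rounding at most doubles it, so
  the pieces have the lengths that \<open>chain_piece\<close> asks for.\<close>

lemma chain_bound:
  assumes q: "1 \<le> q" and \<gamma>: "nonconst_rectifiable_curve \<gamma> a b"
    and s: "0 \<le> s" "t \<le> total_length \<gamma> a b" and st: "rad k \<le> t - s"
  defines "\<sigma> \<equiv> arc_length_param \<gamma> a b"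
  shows "ennreal \<bar>cell_mean v k (cell k (\<sigma> s)) - cell_mean v k (cell k (\<sigma> t))\<bar>
    \<le> line_integral \<sigma> s t (\<lambda>x. ennreal (4 * quotient_sum q v k x powr (1 / q)))"
proof -
  let ?G = "\<lambda>x. ennreal (4 * quotient_sum q v k x powr (1 / q))"
  let ?V = "\<lambda>y. cell_mean v k (cell k (\<sigma> y))"
  have r: "0 < rad k" by simp
  define m where "m = nat \<lceil>(t - s) / rad k\<rceil>"
  have one: "1 \<le> (t - s) / rad k" using st by simp
  have m1: "(t - s) / rad k \<le> real m" "real m < (t - s) / rad k + 1"
    using one unfolding m_def by linarith+
  then have m0: "0 < real m" using one by linarith
  define \<tau> where "\<tau> = (t - s) / real m"
  have "0 \<le> t - s" using st r by linarith
  then have \<tau>0: "0 \<le> \<tau>" using m0 by (simp add: \<tau>_def)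
  have \<tau>1: "\<tau> \<le> rad k" using m1(1) m0 r by (simp add: \<tau>_def field_simps)
  have \<tau>2: "rad k / 2 \<le> \<tau>"
  proof -
    have "real m \<le> 2 * ((t - s) / rad k)" using m1(2) one by linarith
    then show ?thesis using m0 r by (simp add: \<tau>_def field_simps)
  qed
  have mt: "s + real m * \<tau> = t" using m0 by (simp add: \<tau>_def)
  have step: "n \<le> m \<Longrightarrow> ennreal \<bar>?V s - ?V (s + real n * \<tau>)\<bar> \<le> line_integral \<sigma> s (s + real n * \<tau>) ?G" for n
  proof (induction n)
    case (Suc n)
    have le: "s + real (Suc n) * \<tau> \<le> t"
      using Suc.prems \<tau>0 unfolding mt[symmetric] by (intro add_left_mono mult_right_mono) auto
    have "ennreal \<bar>?V s - ?V (s + real (Suc n) * \<tau>)\<bar>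
       \<le> ennreal (\<bar>?V s - ?V (s + real n * \<tau>)\<bar> + \<bar>?V (s + real n * \<tau>) - ?V (s + real (Suc n) * \<tau>)\<bar>)"
      by (intro ennreal_leI) linarith
    also have "\<dots> = ennreal \<bar>?V s - ?V (s + real n * \<tau>)\<bar> + ennreal \<bar>?V (s + real n * \<tau>)
        - ?V (s + real (Suc n) * \<tau>)\<bar>"
      by (simp add: ennreal_plus)
    also have "\<dots> \<le> line_integral \<sigma> s (s + real n * \<tau>) ?G + line_integral \<sigma> (s + real n * \<tau>) (s
        + real (Suc n) * \<tau>) ?G"
      unfolding \<sigma>_def
      by (intro add_mono chain_piece[OF q \<gamma>] Suc.IH[unfolded \<sigma>_def])
         (use Suc.prems s \<tau>0 \<tau>1 \<tau>2 le in \<open>auto simp: algebra_simps\<close>)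
    also have "\<dots> = line_integral \<sigma> s (s + real (Suc n) * \<tau>) ?G"
      unfolding \<sigma>_def
      by (rule line_integral_split[OF \<gamma>, symmetric])
         (use s \<tau>0 le in \<open>auto simp: algebra_simps\<close>)
    finally show ?case .
  qed simp
  from step[of m] show ?thesis by (simp add: mt)
qed

end

text \<open>The Poincare inequality for real functions, with the radius in place of the diameter and
  multiplied by the measure of the ball, so that its left side is a plain integral.\<close>

locale poincare_space = doubling_space M C for M :: "'a::metric_space measure" and C :: real +
  fixes p c l :: real
  assumes p_ge_1: "1 \<le> p" and c_pos: "0 < c" and l_ge_1: "1 \<le> l"
    and poincare: "0 < r \<Longrightarrow> ball_integrable u \<Longrightarrow> real_upper_gradient g u \<Longrightarrow>
      (\<integral>\<^sup>+y\<in>ball x r. ennreal \<bar>u y - ball_mean u x r\<bar> \<partial>M) \<le> ennreal (c * r) *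
        ennreal_rpow ((\<integral>\<^sup>+y\<in>ball x (l * r). ennreal_rpow (g y) p \<partial>M) / emeasure M (ball x (l * r))) (1 / p)
        * emeasure M (ball x r)"
begin

text \<open>A ball of radius 5 * \<open>rad k\<close> contains the unit balls of the scale about all
  neighbours and lies in the ball of radius 9 * \<open>rad k\<close> about each of them. Two means
  are compared with its mean, which gives 2 * 5 * c times the doubling factor.\<close>

definition quotient_const :: real where "quotient_const = 10 * c * doubling_const 9"

lemma quotient_const_pos: "0 < quotient_const" using c_pos doubling_const_ge_1[of 9]
    by (simp add: quotient_const_def)

text \<open>Both means are compared with the mean over the ball of radius 5 * \<open>rad k\<close>
  about the cell centre. Doubling makes the measures of the small balls comparable to it, and the
  Poincare inequality bounds the oscillation on it.\<close>

lemma cell_mean_diff_le: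
  assumes v: "ball_integrable v" and g: "real_upper_gradient g v" and j: "j \<in> neighbours k (cell k x)"
  shows "ennreal \<bar>cell_mean v k (cell k x) - cell_mean v k j\<bar>
    \<le> ennreal (quotient_const * rad k) * ennreal_rpow (avg (5 * l) k (\<lambda>y. ennreal_rpow (g y) p) x) (1 / p)"
proof -
  let ?i = "cell k x" and ?r = "rad k"
  let ?A = "ennreal_rpow (avg (5 * l) k (\<lambda>y. ennreal_rpow (g y) p) x) (1 / p)"
  define b where "b = ball_mean v ?i (5 * ?r)"
  have r: "0 < ?r" by simp
  note [measurable] = ball_integrable_measurable[OF v]
  have *: "ennreal \<bar>cell_mean v k z - b\<bar> \<le> ennreal (doubling_const 9 * (c * (5 * ?r))) * ?A"
    if z: "dist ?i z < 4 * ?r" for z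
  proof -
    let ?\<mu> = "emeasure M (ball z ?r)"
    have "ennreal \<bar>cell_mean v k z - b\<bar> * ?\<mu> \<le> (\<integral>\<^sup>+y\<in>ball z ?r. ennreal \<bar>v y - b\<bar> \<partial>M)"
      unfolding cell_mean_def by (rule ball_mean_diff_le[OF v r])
    also have "\<dots> \<le> (\<integral>\<^sup>+y\<in>ball ?i (5 * ?r). ennreal \<bar>v y - b\<bar> \<partial>M)"
    proof (rule nn_integral_mono)
      fix y
      have "dist ?i y < 5 * ?r" if "dist z y < ?r"
        using that z dist_triangle[of ?i y z] by linarith
      then show "ennreal \<bar>v y - b\<bar> * indicator (ball z ?r) y \<le> ennreal \<bar>v y - b\<bar>
          * indicator (ball ?i (5 * ?r)) y"
        by (auto simp: indicator_def)
    qed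
    also have "\<dots> \<le> ennreal (c * (5 * ?r)) * ?A * emeasure M (ball ?i (5 * ?r))"
      using poincare[OF _ v g, of "5 * ?r" ?i] r by (simp add: b_def avg_def mult.assoc mult.left_commute)
    also have "\<dots> \<le> ennreal (c * (5 * ?r)) * ?A * (ennreal (doubling_const 9) * ?\<mu>)"
      using z r by (intro mult_left_mono emeasure_ball_le) auto
    also have "\<dots> = ennreal (doubling_const 9 * (c * (5 * ?r))) * ?A * ?\<mu>"
      using doubling_const_ge_1[of 9] c_pos by (simp add: ennreal_mult ac_simps)
    finally have "ennreal \<bar>cell_mean v k z - b\<bar> * ?\<mu> / ?\<mu> \<le> ennreal (doubling_const 9 * (c * (5 * ?r)))
        * ?A * ?\<mu> / ?\<mu>"
      by (rule divide_right_mono_ennreal)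
    then show ?thesis
      using ball_pos[OF r, of z] ball_finite[of z ?r] by (simp add: mult_divide_eq_ennreal less_le)
  qed
  have "ennreal \<bar>cell_mean v k ?i - cell_mean v k j\<bar> \<le> ennreal (\<bar>cell_mean v k ?i - b\<bar> + \<bar>cell_mean v k j
      - b\<bar>)"
    by (intro ennreal_leI) linarith
  also have "\<dots> = ennreal \<bar>cell_mean v k ?i - b\<bar> + ennreal \<bar>cell_mean v k j - b\<bar>" by (simp add: ennreal_plus)
  also have "\<dots> \<le> ennreal (doubling_const 9 * (c * (5 * ?r))) * ?A + ennreal (doubling_const 9
      * (c * (5 * ?r))) * ?A"
    using j by (intro add_mono *) (auto simp: neighbours_def)
  also have "\<dots> = ennreal (quotient_const * ?r) * ?A"
    using doubling_const_ge_1[of 9] c_pos unfolding quotient_const_def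
    by (simp add: distrib_right[symmetric] ennreal_plus[symmetric] algebra_simps del: ennreal_plus)
  finally show ?thesis .
qed

text \<open>The power 2p of R^(1/p) is R^2, where R is the average of \<rho>. One factor R is later
  removed by the weight of \<open>scale_energy\<close>, and the other has an integral bounded
  independently of k.\<close>

lemma quotient_sum_le:
  assumes v: "ball_integrable v" and g: "real_upper_gradient g v" and le: "\<And>x. ennreal_rpow (g x) p \<le> \<rho> x"
    and \<rho>: "\<rho> \<in> borel_measurable borel"
  shows "ennreal (quotient_sum (2 * p) v k x)
    \<le> ennreal (real (packing 4) * quotient_const powr (2 * p)) * avg (5 * l) k \<rho> x * avg (5 * l) k \<rho> x"
proof -
  let ?i = "cell k x" and ?R = "avg (5 * l) k \<rho> x"
  have "avg (5 * l) k (\<lambda>y. ennreal_rpow (g y) p) x \<le> ?R"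
    unfolding avg_def by (intro divide_right_mono_ennreal nn_integral_mono mult_right_mono le) auto
  then have A: "ennreal_rpow (avg (5 * l) k (\<lambda>y. ennreal_rpow (g y) p) x) (1 / p) \<le> ennreal_rpow ?R (1 / p)"
    using p_ge_1 by (intro rpow_mono) auto
  have each: "ennreal ((\<bar>cell_mean v k ?i - cell_mean v k j\<bar> / rad k) powr (2 * p))
      \<le> ennreal (quotient_const powr (2 * p)) * ?R * ?R"
    if "j \<in> neighbours k ?i" for j
  proof -
    let ?d = "\<bar>cell_mean v k ?i - cell_mean v k j\<bar>"
    have "ennreal (?d / rad k) = ennreal ?d / ennreal (rad k)" by (simp add: divide_ennreal)
    also have "\<dots> \<le> ennreal (quotient_const * rad k) * ennreal_rpow ?R (1 / p) / ennreal (rad k)"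
      using cell_mean_diff_le[OF v g that] A
      by (intro divide_right_mono_ennreal) (meson mult_left_mono order_trans zero_le)
    also have "\<dots> = ennreal quotient_const * ennreal_rpow ?R (1 / p) * ennreal (rad k) / ennreal (rad k)"
      using quotient_const_pos by (simp add: ennreal_mult ac_simps)
    also have "\<dots> \<le> ennreal quotient_const * ennreal_rpow ?R (1 / p)" by (rule ennreal_mult_divide_le)
    finally have "ennreal_rpow (ennreal (?d / rad k)) (2 * p) \<le> ennreal_rpow (ennreal quotient_const
        * ennreal_rpow ?R (1 / p)) (2 * p)"
      using p_ge_1 by (intro rpow_mono) auto
    also have "\<dots> = ennreal (quotient_const powr (2 * p)) * ennreal_rpow ?R (2 * 1)"
      using quotient_const_pos p_ge_1 by (simp add: rpow_mult rpow_rpow)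
    also have "\<dots> = ennreal (quotient_const powr (2 * p)) * ?R * ?R"
      unfolding rpow_double by (simp add: mult.assoc)
    finally show ?thesis by simp
  qed
  have "ennreal (quotient_sum (2 * p) v k x) = (\<Sum>j\<in>neighbours k ?i.
      ennreal ((\<bar>cell_mean v k ?i - cell_mean v k j\<bar> / rad k) powr (2 * p)))"
    unfolding quotient_sum_def by (rule sum_ennreal[symmetric]) simp
  also have "\<dots> \<le> (\<Sum>j\<in>neighbours k ?i. ennreal (quotient_const powr (2 * p)) * ?R * ?R)"
    by (rule sum_mono[OF each])
  also have "\<dots> = of_nat (card (neighbours k ?i)) * (ennreal (quotient_const powr (2 * p)) * ?R * ?R)"
      by simp
  also have "\<dots> \<le> of_nat (packing 4) * (ennreal (quotient_const powr (2 * p)) * ?R * ?R)"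
    unfolding neighbours_def using net_ball_card(2)[of 4 k ?i] by (intro mult_right_mono) auto
  also have "\<dots> = ennreal (real (packing 4) * quotient_const powr (2 * p)) * ?R * ?R"
    by (simp add: ennreal_mult ennreal_of_nat_eq_real_of_nat mult.assoc)
  finally show ?thesis .
qed

definition scale_energy :: "('a \<Rightarrow> ennreal) \<Rightarrow> nat \<Rightarrow> ('a \<Rightarrow> real) \<Rightarrow> ennreal" where
  "scale_energy \<rho> k v = (\<integral>\<^sup>+x. ennreal (quotient_sum (2 * p) v k x) / avg (5 * l) k \<rho> x \<partial>M)"

lemma scale_energy_le:
  assumes v: "ball_integrable v" and g: "real_upper_gradient g v" and le: "\<And>x. ennreal_rpow (g x) p \<le> \<rho> x"
    and \<rho>: "\<rho> \<in> borel_measurable borel"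
  shows "scale_energy \<rho> k v \<le> ennreal (real (packing 4) * quotient_const powr (2 * p))
      * (of_nat (packing (5 * l)) * (\<integral>\<^sup>+x. \<rho> x \<partial>M))"
proof -
  have "scale_energy \<rho> k v \<le> (\<integral>\<^sup>+x. ennreal (real (packing 4) * quotient_const powr (2 * p))
      * avg (5 * l) k \<rho> x \<partial>M)"
    unfolding scale_energy_def
  proof (rule nn_integral_mono)
    fix x
    have "ennreal (quotient_sum (2 * p) v k x) / avg (5 * l) k \<rho> x
      \<le> ennreal (real (packing 4) * quotient_const powr (2 * p)) * avg (5 * l) k \<rho> x * avg (5
          * l) k \<rho> x / avg (5 * l) k \<rho> x"
      by (rule divide_right_mono_ennreal[OF quotient_sum_le[OF assms]])
    also have "\<dots> \<le> ennreal (real (packing 4) * quotient_const powr (2 * p)) * avg (5 * l) k \<rho> x"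
      by (rule ennreal_mult_divide_le)
    finally show "ennreal (quotient_sum (2 * p) v k x) / avg (5 * l) k \<rho> x \<le> ennreal (real (packing 4)
        * quotient_const powr (2 * p)) * avg (5 * l) k \<rho> x" .
  qed
  also have "\<dots> = ennreal (real (packing 4) * quotient_const powr (2 * p)) * (\<integral>\<^sup>+x. avg (5 * l) k \<rho> x \<partial>M)"
    by (rule nn_integral_cmult) measurable
  also have "\<dots> \<le> ennreal (real (packing 4) * quotient_const powr (2 * p)) * (of_nat (packing (5 * l))
      * (\<integral>\<^sup>+x. \<rho> x \<partial>M))"
    using l_ge_1 by (intro mult_left_mono avg_integral_le \<rho>) auto
  finally show ?thesis .
qed

lemma scale_energy_clarkson:
  assumes v: "ball_integrable v" and w: "ball_integrable w"
  shows "2 * (scale_energy \<rho> k (\<lambda>x. (v x + w x) / 2) + scale_energy \<rho> k (\<lambda>x. (v x - w x) / 2))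
    \<le> scale_energy \<rho> k v + scale_energy \<rho> k w"
proof -
  let ?Q = "\<lambda>v x. quotient_sum (2 * p) v k x" and ?R = "avg (5 * l) k \<rho>"
  have q: "2 \<le> 2 * p" using p_ge_1 by simp
  have "2 * (scale_energy \<rho> k (\<lambda>x. (v x + w x) / 2) + scale_energy \<rho> k (\<lambda>x. (v x - w x) / 2))
     = (\<integral>\<^sup>+x. 2 * (ennreal (?Q (\<lambda>x. (v x + w x) / 2) x) / ?R x + ennreal (?Q (\<lambda>x. (v x
         - w x) / 2) x) / ?R x) \<partial>M)"
    unfolding scale_energy_def by (simp add: nn_integral_add nn_integral_cmult)
  also have "\<dots> \<le> (\<integral>\<^sup>+x. ennreal (?Q v x) / ?R x + ennreal (?Q w x) / ?R x \<partial>M)"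
  proof (rule nn_integral_mono)
    fix x
    have "2 * (ennreal (?Q (\<lambda>x. (v x + w x) / 2) x) / ?R x + ennreal (?Q (\<lambda>x. (v x - w x) / 2) x) / ?R x)
       = ennreal (2 * (?Q (\<lambda>x. (v x + w x) / 2) x + ?Q (\<lambda>x. (v x - w x) / 2) x)) / ?R x"
      by (simp add: ennreal_mult ennreal_plus quotient_sum_nonneg add_divide_distrib_ennreal[symmetric]
          ennreal_times_divide)
    also have "\<dots> \<le> ennreal (?Q v x + ?Q w x) / ?R x"
      using quotient_sum_clarkson[OF q v w, of k x] by (intro divide_right_mono_ennreal ennreal_leI) simp
    also have "\<dots> = ennreal (?Q v x) / ?R x + ennreal (?Q w x) / ?R x"
      by (simp add: ennreal_plus quotient_sum_nonneg add_divide_distrib_ennreal)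
    finally show "2 * (ennreal (?Q (\<lambda>x. (v x + w x) / 2) x) / ?R x + ennreal (?Q (\<lambda>x. (v x - w x) / 2) x)
        / ?R x)
      \<le> ennreal (?Q v x) / ?R x + ennreal (?Q w x) / ?R x" .
  qed
  also have "\<dots> = scale_energy \<rho> k v + scale_energy \<rho> k w"
    unfolding scale_energy_def by (rule nn_integral_add) measurable
  finally show ?thesis .
qed

end

section \<open>Bounding the energy by difference quotients\<close>

lemma ennreal_divide_antimono: "b \<le> b' \<Longrightarrow> a / b' \<le> a / (b::ennreal)"
proof -
  assume "b \<le> b'"
  then have "inverse b' \<le> inverse b"
  proof (cases "b = 0 \<or> b' = top")
    case False
    then obtain x y where "b = ennreal x" "b' = ennreal y" "0 < x" "0 \<le> y"
      using \<open>b \<le> b'\<close> by (cases b; cases b') (auto simp: top_unique less_le)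
    then show ?thesis
      using \<open>b \<le> b'\<close> by (auto simp: inverse_ennreal ennreal_le_iff intro!: ennreal_leI le_imp_inverse_le)
  qed auto
  then show ?thesis unfolding divide_ennreal_def by (rule mult_left_mono) simp
qed

lemma ennreal_half_add: "ennreal (1 / 2) * (x + x) = x"
proof -
  have "ennreal (1 / 2) * (x + x) = (ennreal (1 / 2) + ennreal (1 / 2)) * x"
    by (simp only: distrib_left distrib_right)
  also have "ennreal (1 / 2) + ennreal (1 / 2) = 1"
    by (subst ennreal_plus[symmetric]) auto
  finally show ?thesis by simp
qed

text \<open>Replaces the root of an average by something additive, at the price of a constant that
  integrates to the measure of a ball.\<close>

lemma rpow_le_1_plus:
  assumes "0 < a" "a \<le> 1"
  shows "ennreal_rpow x a \<le> 1 + x"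
proof (cases x)
  case (real r)
  have "r powr a \<le> 1 + r"
  proof (cases "r \<le> 1")
    case True
    then have "r powr a \<le> 1" using assms real by (intro powr_le1) auto
    then show ?thesis using real by simp
  next
    case False
    then have "r powr a \<le> r powr 1" using assms by (intro powr_mono) auto
    then show ?thesis using False by simp
  qed
  then have "ennreal (r powr a) \<le> ennreal (1 + r)" by (rule ennreal_leI)
  then show ?thesis using real by (simp add: ennreal_plus)
qed simp

context poincare_space
begin

text \<open>The Poincare inequality on each cell supplies the factor \<open>rad k\<close>. With
  A^(1/p) \<le> 1 + A its right side becomes a sum of integrals over dilated balls, which bounded
  overlap adds up; the measure of the larger ball accounts for the summand 1.\<close>

lemma cell_mean_local_error:
  assumes v: "ball_integrable v" and g: "real_upper_gradient g v"
  shows "(\<integral>\<^sup>+x. ennreal \<bar>cell_mean v k (cell k x) - v x\<bar> * indicator (ball base n) x \<partial>M)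
    \<le> of_nat (packing l) * (ennreal (c * rad k) * (emeasure M (ball base (n + 2)) + (\<integral>\<^sup>+x.
        ennreal_rpow (g x) p \<partial>M)))"
proof -
  note [measurable] = ball_integrable_measurable[OF v] real_upper_gradientD(1)[OF g]
  define h where "h x = ennreal (c * rad k) * (indicator (ball base (n + 2)) x + ennreal_rpow (g x) p)"
      for x
  have [measurable]: "h \<in> borel_measurable borel" unfolding h_def by measurable
  have "(\<integral>\<^sup>+x. ennreal \<bar>cell_mean v k (cell k x) - v x\<bar> * indicator (ball base n) x \<partial>M)
      \<le> of_nat (packing l) * (\<integral>\<^sup>+x. h x \<partial>M)"
  proof (rule cells_integral_le[where k = k])
    fix i assume i: "i \<in> net k"
    let ?B = "ball i (rad k)" and ?lB = "ball i (l * rad k)"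
    have lr: "rad k \<le> l * rad k" using l_ge_1 by simp
    have BlB: "?B \<subseteq> ?lB" using lr by (rule subset_ball)
    show "(\<integral>\<^sup>+x\<in>cell_set k i. (ennreal \<bar>cell_mean v k (cell k x) - v x\<bar> * indicator (ball base n) x) \<partial>M)
        \<le> (\<integral>\<^sup>+x\<in>?lB. h x \<partial>M)"
    proof (cases "cell_set k i \<inter> ball base n = {}")
      case True
      then have "(\<integral>\<^sup>+x\<in>cell_set k i. (ennreal \<bar>cell_mean v k (cell k x) - v x\<bar>
          * indicator (ball base n) x) \<partial>M) = (\<integral>\<^sup>+x. 0 \<partial>M)"
        by (intro nn_integral_cong) (auto simp: indicator_def)
      then show ?thesis by simp
    next
      case False
      then obtain z where z: "z \<in> cell_set k i" "dist base z < n" by auto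
      have "dist i z < rad k" using z(1) cell_set_subset[of k i] by auto
      then have iz: "dist base i < n + 1" using z(2) dist_triangle[of base i z] rad_le_1[of k]
          by (simp add: dist_commute)
      \<comment> \<open>The centre of a cell that meets the ball of radius n is within n + 1 of
        \<open>base\<close>, and no scale exceeds 1.\<close>
      have Bn: "?B \<subseteq> ball base (n + 2)"
      proof
        fix y assume "y \<in> ?B"
        then show "y \<in> ball base (n + 2)" using iz dist_triangle[of base y i] rad_le_1[of k] by simp
      qed
      let ?A = "(\<integral>\<^sup>+y\<in>?lB. ennreal_rpow (g y) p \<partial>M) / emeasure M ?lB"
      have "(\<integral>\<^sup>+x\<in>cell_set k i. (ennreal \<bar>cell_mean v k (cell k x) - v x\<bar> * indicator (ball base n) x) \<partial>M)
         \<le> (\<integral>\<^sup>+y\<in>?B. ennreal \<bar>v y - ball_mean v i (rad k)\<bar> \<partial>M)"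
        using cell_set_subset[of k i]
        by (intro nn_integral_mono) (auto simp: indicator_def cell_set_def cell_mean_def abs_minus_commute)
      also have "\<dots> \<le> ennreal (c * rad k) * ennreal_rpow ?A (1 / p) * emeasure M ?B"
        by (rule poincare[OF _ v g]) simp
      also have "\<dots> \<le> ennreal (c * rad k) * (1 + ?A) * emeasure M ?B"
        using p_ge_1 by (intro mult_right_mono mult_left_mono rpow_le_1_plus) auto
      also have "\<dots> = ennreal (c * rad k) * (emeasure M ?B + ?A * emeasure M ?B)"
        by (simp add: distrib_left distrib_right mult.assoc)
      also have "\<dots> \<le> ennreal (c * rad k) * ((\<integral>\<^sup>+y\<in>?lB. indicator (ball base (n + 2)) y \<partial>M)
          + (\<integral>\<^sup>+y\<in>?lB. ennreal_rpow (g y) p \<partial>M))"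
      proof (intro mult_left_mono add_mono)
        have "emeasure M ?B = (\<integral>\<^sup>+y. indicator ?B y \<partial>M)" by simp
        also have "\<dots> \<le> (\<integral>\<^sup>+y\<in>?lB. indicator (ball base (n + 2)) y \<partial>M)"
          using BlB Bn by (intro nn_integral_mono) (auto simp: indicator_def subset_eq)
        finally show "emeasure M ?B \<le> (\<integral>\<^sup>+y\<in>?lB. indicator (ball base (n + 2)) y \<partial>M)" .
        have "?A * emeasure M ?B \<le> ?A * emeasure M ?lB"
          by (intro mult_left_mono emeasure_mono BlB) auto
        also have "\<dots> = (\<integral>\<^sup>+y\<in>?lB. ennreal_rpow (g y) p \<partial>M)"
          using ball_pos[of "l * rad k" i] ball_finite[of i "l * rad k"] l_ge_1
          by (intro ennreal_divide_mult_cancel) auto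
        finally show "?A * emeasure M ?B \<le> (\<integral>\<^sup>+y\<in>?lB. ennreal_rpow (g y) p \<partial>M)" .
      qed simp
      also have "\<dots> = (\<integral>\<^sup>+x\<in>?lB. h x \<partial>M)"
        unfolding h_def by (simp add: mult.assoc distrib_right nn_integral_cmult nn_integral_add)
      finally show ?thesis .
    qed
  qed (use l_ge_1 in auto)
  also have "(\<integral>\<^sup>+x. h x \<partial>M) = ennreal (c * rad k) * (emeasure M (ball base (n + 2))
      + (\<integral>\<^sup>+x. ennreal_rpow (g x) p \<partial>M))"
    unfolding h_def by (simp add: nn_integral_cmult nn_integral_add)
  finally show ?thesis .
qed

text \<open>On each ball about \<open>base\<close> the L^1 errors are of order 2^(-k), hence
  summable, which gives convergence almost everywhere; countably many balls exhaust the space.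
  Convergence along all scales passes to the subsequence of scales used later.\<close>

lemma cell_mean_tendsto:
  assumes v: "ball_integrable v" and g: "real_upper_gradient g v" and fin:
      "(\<integral>\<^sup>+x. ennreal_rpow (g x) p \<partial>M) < \<infinity>"
  shows "AE x in M. (\<lambda>k. cell_mean v k (cell k x)) \<longlonglongrightarrow> v x"
proof -
  note [measurable] = ball_integrable_measurable[OF v]
  have "AE x in M. (\<lambda>k. (cell_mean v k (cell k x) - v x) * indicator (ball base (real n)) x) \<longlonglongrightarrow> 0"
      for n :: nat
  proof (rule AE_tendsto_0[where p = 1])
    obtain K where K: "0 \<le> K" "emeasure M (ball base (real n + 2)) + (\<integral>\<^sup>+x. ennreal_rpow (g x) p \<partial>M)
        = ennreal K"
      using ball_finite[of base "real n + 2"] fin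
      by (cases "emeasure M (ball base (real n + 2)) + (\<integral>\<^sup>+x. ennreal_rpow (g x) p \<partial>M)") auto
    have "(\<integral>\<^sup>+x. ennreal (\<bar>(cell_mean v k (cell k x) - v x) * indicator (ball base (real n)) x\<bar> powr 1) \<partial>M)
       \<le> ennreal (real (packing l) * c * K * (1/2) ^ k)" for k
    proof -
      have "(\<integral>\<^sup>+x. ennreal (\<bar>(cell_mean v k (cell k x) - v x) * indicator (ball base (real n)) x\<bar> powr 1)
          \<partial>M)
         = (\<integral>\<^sup>+x. ennreal \<bar>cell_mean v k (cell k x) - v x\<bar> * indicator (ball base (real n)) x \<partial>M)"
        by (intro nn_integral_cong) (simp add: indicator_def)
      also have "\<dots> \<le> of_nat (packing l) * (ennreal (c * rad k) * ennreal K)"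
        using cell_mean_local_error[OF v g, of k "real n"] unfolding K .
      also have "\<dots> = ennreal (real (packing l) * c * K * (1/2) ^ k)"
        using c_pos K by (simp add: ennreal_of_nat_eq_real_of_nat rad_def ac_simps flip: ennreal_mult)
      finally show ?thesis .
    qed
    then have "(\<Sum>k. \<integral>\<^sup>+x. ennreal (\<bar>(cell_mean v k (cell k x) - v x) * indicator (ball base (real n)) x\<bar>
        powr 1) \<partial>M)
       \<le> (\<Sum>k. ennreal (real (packing l) * c * K * (1/2) ^ k))"
      by (intro suminf_le) auto
    also have "\<dots> = ennreal (\<Sum>k. real (packing l) * c * K * (1/2) ^ k)"
      using c_pos K by (intro suminf_ennreal2) (auto intro!: summable_mult summable_geometric)
    finally show "(\<Sum>k. \<integral>\<^sup>+x. ennreal (\<bar>(cell_mean v k (cell k x) - v x) * indicator (ball base (real n))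
        x\<bar> powr 1) \<partial>M) < \<infinity>"
      by (rule le_less_trans) simp
    show "(\<lambda>x. (cell_mean v k (cell k x) - v x) * indicator (ball base (real n)) x) \<in> borel_measurable
        borel" for k
      by (intro borel_measurable_times borel_measurable_diff cell_compose_measurable) measurable
  qed simp
  then have "AE x in M. \<forall>n. (\<lambda>k. (cell_mean v k (cell k x) - v x) * indicator (ball base (real n)) x) \<longlonglongrightarrow> 0"
    by (simp add: AE_all_countable)
  then show ?thesis
  proof eventually_elim
    case (elim x)
    obtain n where "dist base x < real n" using reals_Archimedean2 by blast
    then have "(\<lambda>k. cell_mean v k (cell k x) - v x) \<longlonglongrightarrow> 0" using elim[rule_format, of n] by simp
    then show ?case by (simp add: LIM_zero_iff)
  qed
qed

section \<open>Upper gradients up to a scale\<close>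

definition weighted_power :: "real \<Rightarrow> ('a \<Rightarrow> ennreal) \<Rightarrow> ('a \<Rightarrow> real) \<Rightarrow> ennreal" where
  "weighted_power q \<Omega> G = (\<integral>\<^sup>+x. ennreal (\<bar>G x\<bar> powr q) / \<Omega> x \<partial>M)"

lemma weighted_power_clarkson:
  assumes q: "2 \<le> q" and [measurable]: "F \<in> borel_measurable borel" "G \<in> borel_measurable borel"
      "\<Omega> \<in> borel_measurable borel"
  shows "2 * (weighted_power q \<Omega> (\<lambda>x. (F x + G x) / 2) + weighted_power q \<Omega> (\<lambda>x. (F x - G x) / 2))
    \<le> weighted_power q \<Omega> F + weighted_power q \<Omega> G"
proof -
  have "2 * (weighted_power q \<Omega> (\<lambda>x. (F x + G x) / 2) + weighted_power q \<Omega> (\<lambda>x. (F x - G x) / 2))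
     = (\<integral>\<^sup>+x. 2 * (ennreal (\<bar>(F x + G x) / 2\<bar> powr q) / \<Omega> x + ennreal (\<bar>(F x - G x) / 2\<bar> powr q) / \<Omega> x) \<partial>M)"
    unfolding weighted_power_def by (subst nn_integral_cmult, measurable) (subst nn_integral_add,
        measurable)
  also have "\<dots> \<le> (\<integral>\<^sup>+x. ennreal (\<bar>F x\<bar> powr q) / \<Omega> x + ennreal (\<bar>G x\<bar> powr q) / \<Omega> x \<partial>M)"
  proof (rule nn_integral_mono)
    fix x
    let ?A = "\<bar>(F x + G x) / 2\<bar> powr q" and ?B = "\<bar>(F x - G x) / 2\<bar> powr q"
    have "2 * (ennreal ?A / \<Omega> x + ennreal ?B / \<Omega> x) = ennreal (2 * (?A + ?B)) / \<Omega> x"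
      by (simp only: add_divide_distrib_ennreal[symmetric] ennreal_times_divide ennreal_mult ennreal_plus
          powr_ge_zero
          add_nonneg_nonneg zero_le_numeral ennreal_numeral)
    also have "\<dots> \<le> ennreal (\<bar>F x\<bar> powr q + \<bar>G x\<bar> powr q) / \<Omega> x"
      using mult_left_mono[OF clarkson[OF q, of "F x" "G x"], of 2]
          by (intro divide_right_mono_ennreal ennreal_leI) simp
    also have "\<dots> = ennreal (\<bar>F x\<bar> powr q) / \<Omega> x + ennreal (\<bar>G x\<bar> powr q) / \<Omega> x"
      by (simp add: ennreal_plus add_divide_distrib_ennreal)
    finally show "2 * (ennreal ?A / \<Omega> x + ennreal ?B / \<Omega> x) \<le> ennreal (\<bar>F x\<bar> powr q) / \<Omega> x
        + ennreal (\<bar>G x\<bar> powr q) / \<Omega> x" .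
  qed
  also have "\<dots> = weighted_power q \<Omega> F + weighted_power q \<Omega> G"
    unfolding weighted_power_def by (rule nn_integral_add) measurable
  finally show ?thesis .
qed

text \<open>\<open>P n G\<close> makes G an upper gradient of v on pieces of length at least
  \<open>rad (\<kappa> n)\<close>, up to the error of the cell means at the ends; four times the
  discrete gradient qualifies. The classes \<open>Cn\<close> decrease and are closed under
  midpoints, so near minimizers of the weighted power W are Cauchy. The majorant H of a fast
  subsequence then works at arbitrarily small scales, hence without error off the null set where
  cell means fail to converge.\<close>

lemma energy_le_of_scales:
  fixes \<kappa> :: "nat \<Rightarrow> nat" and \<delta> :: real
  assumes vg: "sobolev_pair p (v, g)" and \<kappa>: "strict_mono \<kappa>" and \<delta>: "0 < \<delta>"
    and \<Omega> [measurable]: "\<Omega> \<in> borel_measurable borel"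
    and dom: "\<And>i x. avg (5 * l) (\<kappa> i) \<rho> x \<le> \<Omega> x"
    and se: "\<And>i. scale_energy \<rho> (\<kappa> i) v \<le> ennreal \<delta>"
  obtains H where "H \<in> borel_measurable borel"
    "(\<integral>\<^sup>+x. ennreal_rpow (H x) (2 * p) / \<Omega> x \<partial>M) \<le> ennreal (2 powr (2 * p) * (2 * (4 powr (2 * p) * \<delta>)))"
    "energy p v \<le> ennreal (2 powr p) * (\<integral>\<^sup>+x. ennreal_rpow (H x) p \<partial>M)"
proof -
  define q where "q = 2 * p"
  have q2: "2 \<le> q" "1 \<le> q" using p_ge_1 by (auto simp: q_def)
  note v_meas [measurable] = sobolev_pairD(1)[OF vg]
  have v: "ball_integrable v" by (rule ball_integrable_of_Lp[OF p_ge_1 v_meas sobolev_pairD(4)[OF vg]])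
  \<comment> \<open>The constant 4 of \<open>chain_bound\<close>, raised to the power q.\<close>
  define T where "T = 4 powr q * \<delta>"
  have T0: "0 < T" using \<delta> by (simp add: T_def)
  define V where "V k x = cell_mean v k (cell k x)" for k x
  have V_meas [measurable]: "V k \<in> borel_measurable borel" for k
    unfolding V_def by (rule cell_compose_measurable)
  define W where "W = weighted_power q \<Omega>"
  \<comment> \<open>The premise ranges over all k \<ge> n and not only k = n: it becomes stronger as
    n decreases, which makes \<open>P n\<close> imply \<open>P m\<close> for m \<le> n.\<close>
  define P where "P n G \<longleftrightarrow> (\<forall>\<gamma> a b s t \<eta>. nonconst_rectifiable_curve \<gamma> a b \<longrightarrow> 0 \<le> s \<longrightarrow> s + rad (\<kappa> n) \<le> t \<longrightarrow>
      t \<le> total_length \<gamma> a b \<longrightarrow> 0 \<le> \<eta> \<longrightarrow>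
      (\<forall>k\<ge>n. \<bar>V (\<kappa> k) (arc_length_param \<gamma> a b s) - v (arc_length_param \<gamma> a b s)\<bar> \<le> \<eta> \<and>
             \<bar>V (\<kappa> k) (arc_length_param \<gamma> a b t) - v (arc_length_param \<gamma> a b t)\<bar> \<le> \<eta>) \<longrightarrow>
      ennreal \<bar>v (arc_length_param \<gamma> a b s) - v (arc_length_param \<gamma> a b t)\<bar>
        \<le> line_integral (arc_length_param \<gamma> a b) s t (\<lambda>x. ennreal (G x)) + ennreal (2
            * \<eta>))" for n and G :: "'a \<Rightarrow> real"
  define Cn where "Cn n = {G. G \<in> borel_measurable borel \<and> (\<forall>x. 0 \<le> G x) \<and> W G \<le> ennreal T \<and> P n G}" for n
  have P_dec: "P m G" if "P n G" "m \<le> n" for n m G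
    unfolding P_def
  proof (intro allI impI)
    fix \<gamma> :: "real \<Rightarrow> 'a" and a b s t \<eta> :: real
    assume A: "nonconst_rectifiable_curve \<gamma> a b" "0 \<le> s" "s + rad (\<kappa> m) \<le> t" "t \<le> total_length \<gamma> a b"
        "0 \<le> \<eta>"
      and B: "\<forall>k\<ge>m. \<bar>V (\<kappa> k) (arc_length_param \<gamma> a b s) - v (arc_length_param \<gamma> a b s)\<bar> \<le> \<eta> \<and>
             \<bar>V (\<kappa> k) (arc_length_param \<gamma> a b t) - v (arc_length_param \<gamma> a b t)\<bar> \<le> \<eta>"
    have "\<kappa> m \<le> \<kappa> n" using \<kappa> that(2) by (simp add: strict_mono_less_eq)
    then have "rad (\<kappa> n) \<le> rad (\<kappa> m)" unfolding rad_def by (intro power_decreasing) auto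
    then have "s + rad (\<kappa> n) \<le> t" using A by linarith
    then show "ennreal \<bar>v (arc_length_param \<gamma> a b s) - v (arc_length_param \<gamma> a b t)\<bar>
        \<le> line_integral (arc_length_param \<gamma> a b) s t (\<lambda>x. ennreal (G x)) + ennreal (2 * \<eta>)"
      using that A B unfolding P_def by (meson order_trans)
  qed
  have P_mid: "P n (\<lambda>x. (F x + G x) / 2)" if FG: "F \<in> Cn n" "G \<in> Cn n" for n F G
    unfolding P_def
  proof (intro allI impI)
    fix \<gamma> :: "real \<Rightarrow> 'a" and a b s t \<eta> :: real
    assume A: "nonconst_rectifiable_curve \<gamma> a b" "0 \<le> s" "s + rad (\<kappa> n) \<le> t" "t \<le> total_length \<gamma> a b"
        "0 \<le> \<eta>"
      and B: "\<forall>k\<ge>n. \<bar>V (\<kappa> k) (arc_length_param \<gamma> a b s) - v (arc_length_param \<gamma> a b s)\<bar> \<le> \<eta> \<and>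
             \<bar>V (\<kappa> k) (arc_length_param \<gamma> a b t) - v (arc_length_param \<gamma> a b t)\<bar> \<le> \<eta>"
    let ?\<sigma> = "arc_length_param \<gamma> a b"
    let ?d = "ennreal \<bar>v (?\<sigma> s) - v (?\<sigma> t)\<bar>"
    have [measurable]: "F \<in> borel_measurable borel" "G \<in> borel_measurable borel" using FG
        by (auto simp: Cn_def)
    have F: "?d \<le> line_integral ?\<sigma> s t (\<lambda>x. ennreal (F x)) + ennreal (2 * \<eta>)"
      and G: "?d \<le> line_integral ?\<sigma> s t (\<lambda>x. ennreal (G x)) + ennreal (2 * \<eta>)"
      using FG A B unfolding Cn_def P_def by blast+
    have half: "ennreal ((F x + G x) / 2) = ennreal (1 / 2) * (ennreal (F x) + ennreal (G x))" for x
    proof -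
      have nn: "0 \<le> F x" "0 \<le> G x" using FG by (auto simp: Cn_def)
      have "ennreal ((F x + G x) / 2) = ennreal (1 / 2 * (F x + G x))" by simp
      also have "\<dots> = ennreal (1 / 2) * ennreal (F x + G x)" using nn by (intro ennreal_mult) auto
      also have "ennreal (F x + G x) = ennreal (F x) + ennreal (G x)" using nn by (intro ennreal_plus)
      finally show ?thesis .
    qed
    have "line_integral ?\<sigma> s t (\<lambda>x. ennreal ((F x + G x) / 2))
      = ennreal (1 / 2) * line_integral ?\<sigma> s t (\<lambda>x. ennreal (F x) + ennreal (G x))"
      unfolding half by (rule line_integral_cmult) (use A in auto)
    also have "line_integral ?\<sigma> s t (\<lambda>x. ennreal (F x) + ennreal (G x))
      = line_integral ?\<sigma> s t (\<lambda>x. ennreal (F x)) + line_integral ?\<sigma> s t (\<lambda>x. ennreal (G x))"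
      by (rule line_integral_add) (use A in auto)
    finally have LI: "line_integral ?\<sigma> s t (\<lambda>x. ennreal ((F x + G x) / 2))
      = ennreal (1 / 2) * (line_integral ?\<sigma> s t (\<lambda>x. ennreal (F x)) + line_integral ?\<sigma> s t (\<lambda>x.
          ennreal (G x)))" .
    have "?d = ennreal (1 / 2) * (?d + ?d)"
      by (rule ennreal_half_add[symmetric])
    also have "\<dots> \<le> ennreal (1 / 2) * ((line_integral ?\<sigma> s t (\<lambda>x. ennreal (F x)) + ennreal (2 * \<eta>))
       + (line_integral ?\<sigma> s t (\<lambda>x. ennreal (G x)) + ennreal (2 * \<eta>)))"
      by (intro mult_left_mono add_mono F G) auto
    also have "\<dots> = ennreal (1 / 2) * (line_integral ?\<sigma> s t (\<lambda>x. ennreal (F x)) + line_integral ?\<sigma> s t (\<lambda>x.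
        ennreal (G x)))
       + ennreal (1 / 2) * (ennreal (2 * \<eta>) + ennreal (2 * \<eta>))"
      by (simp add: distrib_left add_ac)
    also have "ennreal (1 / 2) * (ennreal (2 * \<eta>) + ennreal (2 * \<eta>)) = ennreal (2 * \<eta>)"
      by (rule ennreal_half_add)
    finally show "?d \<le> line_integral ?\<sigma> s t (\<lambda>x. ennreal ((F x + G x) / 2)) + ennreal (2 * \<eta>)"
      unfolding LI .
  qed
  have clark: "2 * (W (\<lambda>x. (F x + G x) / 2) + W (\<lambda>x. (F x - G x) / 2)) \<le> W F + W G"
    if "F \<in> borel_measurable borel" "G \<in> borel_measurable borel" for F G
    unfolding W_def by (rule weighted_power_clarkson[OF q2(1) that \<Omega>])
  have clarkT: "W (\<lambda>x. (F x + G x) / 2) + W (\<lambda>x. (F x - G x) / 2) \<le> ennreal T"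
    if FG: "F \<in> Cn n" "G \<in> Cn n" for F G n
  proof -
    have "2 * (W (\<lambda>x. (F x + G x) / 2) + W (\<lambda>x. (F x - G x) / 2)) \<le> W F + W G"
      using FG by (intro clark) (auto simp: Cn_def)
    also have "\<dots> \<le> ennreal T + ennreal T" using FG by (intro add_mono) (auto simp: Cn_def)
    finally have "ennreal (1 / 2) * ((W (\<lambda>x. (F x + G x) / 2) + W (\<lambda>x. (F x - G x) / 2))
        + (W (\<lambda>x. (F x + G x) / 2) + W (\<lambda>x. (F x - G x) / 2)))
        \<le> ennreal (1 / 2) * (ennreal T + ennreal T)"
      unfolding mult_2 by (rule mult_left_mono) simp
    then show ?thesis unfolding ennreal_half_add .
  qed
  define G0 where "G0 i x = 4 * quotient_sum q v (\<kappa> i) x powr (1 / q)" for i x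
  have G0: "G0 n \<in> Cn n" for n
  proof -
    have m: "G0 n \<in> borel_measurable borel"
      unfolding G0_def by measurable
    have "W (G0 n) \<le> (\<integral>\<^sup>+x. ennreal (4 powr q) * (ennreal (quotient_sum q v (\<kappa> n) x) / avg (5
        * l) (\<kappa> n) \<rho> x) \<partial>M)"
      unfolding W_def weighted_power_def
    proof (rule nn_integral_mono)
      fix x
      have "\<bar>G0 n x\<bar> powr q = 4 powr q * quotient_sum q v (\<kappa> n) x"
        using q2 quotient_sum_nonneg[of q v "\<kappa> n" x] by (simp add: G0_def powr_mult powr_powr)
      then have "ennreal (\<bar>G0 n x\<bar> powr q) / \<Omega> x = ennreal (4 powr q)
          * (ennreal (quotient_sum q v (\<kappa> n) x) / \<Omega> x)"
        using quotient_sum_nonneg by (simp add: ennreal_mult ennreal_times_divide)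
      also have "\<dots> \<le> ennreal (4 powr q) * (ennreal (quotient_sum q v (\<kappa> n) x) / avg (5 * l) (\<kappa> n) \<rho> x)"
        by (intro mult_left_mono ennreal_divide_antimono dom) auto
      finally show "ennreal (\<bar>G0 n x\<bar> powr q) / \<Omega> x \<le> ennreal (4 powr q)
          * (ennreal (quotient_sum q v (\<kappa> n) x) / avg (5 * l) (\<kappa> n) \<rho> x)" .
    qed
    also have "\<dots> = ennreal (4 powr q) * scale_energy \<rho> (\<kappa> n) v"
      unfolding scale_energy_def q_def by (rule nn_integral_cmult) measurable
    also have "\<dots> \<le> ennreal (4 powr q) * ennreal \<delta>" by (intro mult_left_mono se) auto
    also have "\<dots> = ennreal T" using \<delta> by (simp add: T_def ennreal_mult)
    finally have W: "W (G0 n) \<le> ennreal T" .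
    have "P n (G0 n)"
      unfolding P_def
    proof (intro allI impI)
      fix \<gamma> :: "real \<Rightarrow> 'a" and a b s t \<eta> :: real
      assume A: "nonconst_rectifiable_curve \<gamma> a b" "0 \<le> s" "s + rad (\<kappa> n) \<le> t" "t \<le> total_length \<gamma> a b"
          "0 \<le> \<eta>"
        and B: "\<forall>k\<ge>n. \<bar>V (\<kappa> k) (arc_length_param \<gamma> a b s) - v (arc_length_param \<gamma> a b s)\<bar> \<le> \<eta> \<and>
             \<bar>V (\<kappa> k) (arc_length_param \<gamma> a b t) - v (arc_length_param \<gamma> a b t)\<bar> \<le> \<eta>"
      let ?\<sigma> = "arc_length_param \<gamma> a b"
      have ch: "ennreal \<bar>V (\<kappa> n) (?\<sigma> s) - V (\<kappa> n) (?\<sigma> t)\<bar> \<le> line_integral ?\<sigma> s t (\<lambda>x. ennreal (G0 n x))"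
        unfolding V_def G0_def by (rule chain_bound[OF q2(2)]) (use A in auto)
      have B1: "\<bar>V (\<kappa> n) (?\<sigma> s) - v (?\<sigma> s)\<bar> \<le> \<eta>" "\<bar>V (\<kappa> n) (?\<sigma> t) - v (?\<sigma> t)\<bar> \<le> \<eta>"
        using B by auto
      have "ennreal \<bar>v (?\<sigma> s) - v (?\<sigma> t)\<bar> \<le> ennreal (\<bar>V (\<kappa> n) (?\<sigma> s) - V (\<kappa> n) (?\<sigma> t)\<bar> + 2 * \<eta>)"
        using B1 by (intro ennreal_leI) linarith
      also have "\<dots> = ennreal \<bar>V (\<kappa> n) (?\<sigma> s) - V (\<kappa> n) (?\<sigma> t)\<bar> + ennreal (2 * \<eta>)"
        using A by (intro ennreal_plus) auto
      also have "\<dots> \<le> line_integral ?\<sigma> s t (\<lambda>x. ennreal (G0 n x)) + ennreal (2 * \<eta>)"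
        by (intro add_right_mono ch)
      finally show "ennreal \<bar>v (?\<sigma> s) - v (?\<sigma> t)\<bar> \<le> line_integral ?\<sigma> s t (\<lambda>x. ennreal (G0 n x))
          + ennreal (2 * \<eta>)" .
    qed
    then show ?thesis using m W by (simp add: Cn_def G0_def)
  qed
  obtain F where F: "\<And>n. F n \<in> Cn n"
    and FC: "\<And>e. 0 < e \<Longrightarrow> \<exists>N. \<forall>n\<ge>N. \<forall>m\<ge>N. enn2real (W (\<lambda>x. (F n x - F m x) / 2)) < e"
  proof (rule midpoint_minimizing_sequence[of Cn "\<lambda>F G x. (F x + G x) / 2" "\<lambda>G. enn2real (W G)" T
      "\<lambda>F G. enn2real (W (\<lambda>x. (F x - G x) / 2))"])
    show "Cn n \<noteq> {}" for n using G0[of n] by auto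
    show "Cn n \<subseteq> Cn m" if "m \<le> n" for m n
      using P_dec[OF _ that] by (auto simp: Cn_def)
    show "(\<lambda>x. (F x + G x) / 2) \<in> Cn n" if FG: "F \<in> Cn n" "G \<in> Cn n" for n F G
    proof -
      have "W (\<lambda>x. (F x + G x) / 2) \<le> ennreal T"
        using clarkT[OF FG] by (rule order_trans[rotated]) simp
      moreover have "(\<lambda>x. (F x + G x) / 2) \<in> borel_measurable borel" using FG by (auto simp: Cn_def)
      ultimately show ?thesis using P_mid[OF FG] FG by (simp add: Cn_def)
    qed
    show "0 \<le> enn2real (W F)" for F by simp
    show "enn2real (W F) \<le> T" if "F \<in> Cn 0" for F
      using that T0 by (intro enn2real_leI) (auto simp: Cn_def)
    show "enn2real (W (\<lambda>x. (F x + G x) / 2)) + enn2real (W (\<lambda>x. (F x - G x) / 2)) \<le> (enn2real (W F)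
        + enn2real (W G)) / 2"
      if FG: "F \<in> Cn 0" "G \<in> Cn 0" for F G
    proof -
      let ?a = "W (\<lambda>x. (F x + G x) / 2)" and ?b = "W (\<lambda>x. (F x - G x) / 2)"
      have ab: "?a < top" "?b < top"
        using clarkT[OF FG] by (auto simp: less_top[symmetric] top_unique)
      have fg: "W F < top" "W G < top" using FG by (auto simp: Cn_def intro: le_less_trans)
      have "2 * (?a + ?b) \<le> W F + W G" using FG by (intro clark) (auto simp: Cn_def)
      then have "enn2real ((?a + ?b) + (?a + ?b)) \<le> enn2real (W F + W G)"
        unfolding mult_2 using fg by (intro enn2real_mono) auto
      then show ?thesis using ab fg by (simp add: enn2real_mult enn2real_plus)
    qed
  qed blast
  have Fm [measurable]: "F n \<in> borel_measurable borel" and F0: "0 \<le> F n x" and FT: "W (F n) \<le> ennreal T"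
      and FP: "P n (F n)" for n x
    using F[of n] by (auto simp: Cn_def)
  have FCn0: "F n \<in> Cn 0" for n
    using F[of n] P_dec[of n "F n" 0] by (auto simp: Cn_def)
  define Q where "Q = (2::real) powr q"
  have Q1: "1 \<le> Q" unfolding Q_def using q2 by (intro ge_one_powr_ge_zero) auto
  then have Q0: "0 < Q" by linarith
  \<comment> \<open>The single Q undoes the halving of the difference, the power of Q cancels the
    weights from \<open>rpow_suminf_le\<close>, and what remains sums to T.\<close>
  define d where "d i = T * (1/2) ^ Suc i / (Q ^ Suc i * Q)" for i
  have d0: "0 < d i" for i using T0 Q0 by (simp add: d_def)
  obtain N where N: "\<And>i n m. n \<ge> N i \<Longrightarrow> m \<ge> N i \<Longrightarrow> enn2real (W (\<lambda>x. (F n x - F m x) / 2)) < d i"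
    using FC[OF d0] by metis
  \<comment> \<open>At least \<open>N j\<close> for every j \<le> i, and at least i itself, so that
    the scales of \<open>F (\<nu> i)\<close> become arbitrarily small.\<close>
  define \<nu> where "\<nu> i = i + (\<Sum>j\<le>i. N j)" for i
  have \<nu>N: "N i \<le> \<nu> i" "N i \<le> \<nu> (Suc i)" and \<nu>i: "i \<le> \<nu> i" for i
  proof -
    have "N i \<le> (\<Sum>j\<le>i. N j)" by (rule member_le_sum) auto
    then show "N i \<le> \<nu> i" "N i \<le> \<nu> (Suc i)" by (auto simp: \<nu>_def)
  qed (simp add: \<nu>_def)
  define D where "D i x = F (\<nu> (Suc i)) x - F (\<nu> i) x" for i x
  have Dm [measurable]: "D i \<in> borel_measurable borel" for i unfolding D_def by measurable
  have WD: "W (D i) \<le> ennreal (Q * d i)" for i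
  proof -
    let ?h = "W (\<lambda>x. (F (\<nu> (Suc i)) x - F (\<nu> i) x) / 2)"
    have "W (\<lambda>x. (F (\<nu> (Suc i)) x + F (\<nu> i) x) / 2) + ?h \<le> ennreal T"
      by (rule clarkT[OF FCn0 FCn0])
    then have "?h < top" by (auto simp: less_top[symmetric] top_unique)
    then have "?h = ennreal (enn2real ?h)" by simp
    also have "\<dots> \<le> ennreal (d i)"
      by (rule ennreal_leI, rule less_imp_le, rule N[OF \<nu>N(2) \<nu>N(1)])
    finally have h: "?h \<le> ennreal (d i)" .
    have "W (D i) = (\<integral>\<^sup>+x. ennreal Q * (ennreal (\<bar>(F (\<nu> (Suc i)) x - F (\<nu> i) x) / 2\<bar> powr q) / \<Omega> x) \<partial>M)"
      unfolding W_def weighted_power_def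
    proof (rule nn_integral_cong)
      fix x
      have "\<bar>D i x\<bar> powr q = (2 * \<bar>(F (\<nu> (Suc i)) x - F (\<nu> i) x) / 2\<bar>) powr q"
        by (simp add: D_def)
      also have "\<dots> = Q * \<bar>(F (\<nu> (Suc i)) x - F (\<nu> i) x) / 2\<bar> powr q"
        unfolding Q_def by (rule powr_mult)
      finally show "ennreal (\<bar>D i x\<bar> powr q) / \<Omega> x = ennreal Q
          * (ennreal (\<bar>(F (\<nu> (Suc i)) x - F (\<nu> i) x) / 2\<bar> powr q) / \<Omega> x)"
        using Q0 by (simp only: ennreal_mult ennreal_times_divide less_imp_le powr_ge_zero)
    qed
    also have "\<dots> = ennreal Q * ?h"
      unfolding W_def weighted_power_def by (rule nn_integral_cmult) measurable
    also have "\<dots> \<le> ennreal Q * ennreal (d i)" by (intro mult_left_mono h) auto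
    also have "\<dots> = ennreal (Q * d i)" using Q0 d0[of i] by (simp add: ennreal_mult)
    finally show ?thesis .
  qed
  \<comment> \<open>Dominates every \<open>F (\<nu> m)\<close> at once, while its weighted power is
    at most a constant times T.\<close>
  define H where "H x = ennreal (F (\<nu> 0) x) + (\<Sum>i. ennreal \<bar>D i x\<bar>)" for x
  have Hm [measurable]: "H \<in> borel_measurable borel" unfolding H_def by measurable
  have HF: "ennreal (F (\<nu> m) x) \<le> H x" for m x
  proof -
    have "ennreal (F (\<nu> m) x) \<le> ennreal (F (\<nu> 0) x) + (\<Sum>i<m. ennreal \<bar>D i x\<bar>)"
    proof (induction m)
      case (Suc m)
      have "ennreal (F (\<nu> (Suc m)) x) \<le> ennreal (F (\<nu> m) x + \<bar>D m x\<bar>)"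
        by (intro ennreal_leI) (simp add: D_def)
      also have "\<dots> = ennreal (F (\<nu> m) x) + ennreal \<bar>D m x\<bar>" using F0 by (intro ennreal_plus) auto
      also have "\<dots> \<le> (ennreal (F (\<nu> 0) x) + (\<Sum>i<m. ennreal \<bar>D i x\<bar>)) + ennreal \<bar>D m x\<bar>"
        by (intro add_right_mono Suc)
      finally show ?case by (simp add: add.assoc)
    qed simp
    also have "\<dots> \<le> H x" unfolding H_def by (intro add_left_mono sum_le_suminf) auto
    finally show ?thesis .
  qed
  show thesis
  proof (rule that[OF Hm])
    have "(\<integral>\<^sup>+x. ennreal_rpow (H x) q / \<Omega> x \<partial>M)
      \<le> (\<integral>\<^sup>+x. ennreal Q * (ennreal (\<bar>F (\<nu> 0) x\<bar> powr q) / \<Omega> x + (\<Sum>i. ennreal (Q ^ Suc i)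
          * (ennreal (\<bar>D i x\<bar> powr q) / \<Omega> x))) \<partial>M)"
    proof (rule nn_integral_mono)
      fix x
      have "ennreal_rpow (H x) q \<le> ennreal Q * (ennreal_rpow (ennreal (F (\<nu> 0) x)) q + ennreal_rpow (\<Sum>i.
          ennreal \<bar>D i x\<bar>) q)"
        unfolding H_def Q_def using q2 by (intro rpow_add_le) simp
      also have "\<dots> \<le> ennreal Q * (ennreal_rpow (ennreal (F (\<nu> 0) x)) q + (\<Sum>i. ennreal (Q ^ Suc i)
          * ennreal_rpow (ennreal \<bar>D i x\<bar>) q))"
        unfolding Q_def using q2 by (intro mult_left_mono add_left_mono rpow_suminf_le) auto
      also have "\<dots> = ennreal Q * (ennreal (\<bar>F (\<nu> 0) x\<bar> powr q) + (\<Sum>i. ennreal (Q ^ Suc i)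
          * ennreal (\<bar>D i x\<bar> powr q)))"
        using F0[of "\<nu> 0" x] by (simp del: power_Suc)
      finally have "ennreal_rpow (H x) q / \<Omega> x \<le> ennreal Q * (ennreal (\<bar>F (\<nu> 0) x\<bar> powr q)
          + (\<Sum>i. ennreal (Q ^ Suc i) * ennreal (\<bar>D i x\<bar> powr q))) / \<Omega> x"
        by (rule divide_right_mono_ennreal)
      also have "\<dots> = ennreal Q * (ennreal (\<bar>F (\<nu> 0) x\<bar> powr q) / \<Omega> x + (\<Sum>i. ennreal (Q ^ Suc i)
          * (ennreal (\<bar>D i x\<bar> powr q) / \<Omega> x)))"
        unfolding divide_ennreal_def
            by (simp only: distrib_right mult.assoc ennreal_suminf_multc[symmetric])
      finally show "ennreal_rpow (H x) q / \<Omega> x \<le> ennreal Q * (ennreal (\<bar>F (\<nu> 0) x\<bar> powr q) / \<Omega> x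
          + (\<Sum>i. ennreal (Q ^ Suc i) * (ennreal (\<bar>D i x\<bar> powr q) / \<Omega> x)))" .
    qed
    also have "\<dots> = ennreal Q * (W (F (\<nu> 0)) + (\<Sum>i. ennreal (Q ^ Suc i) * W (D i)))"
      unfolding W_def weighted_power_def
      by (subst nn_integral_cmult, measurable, subst nn_integral_add, measurable, subst
          nn_integral_suminf, measurable, subst nn_integral_cmult, measurable)
    also have "\<dots> \<le> ennreal Q * (ennreal T + (\<Sum>i. ennreal (T * (1/2) ^ Suc i)))"
    proof (intro mult_left_mono add_mono suminf_le)
      fix i
      have "ennreal (Q ^ Suc i) * W (D i) \<le> ennreal (Q ^ Suc i) * ennreal (Q * d i)"
        by (rule mult_left_mono[OF WD]) simp
      also have "\<dots> = ennreal (Q ^ Suc i * (Q * d i))"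
        using Q0 d0[of i] by (intro ennreal_mult[symmetric]) auto
      also have "Q ^ Suc i * (Q * d i) = T * (1/2) ^ Suc i"
        using Q0 unfolding d_def by (simp del: power_Suc)
      finally show "ennreal (Q ^ Suc i) * W (D i) \<le> ennreal (T * (1/2) ^ Suc i)" .
    qed (auto simp: FT)
    also have "(\<Sum>i. ennreal (T * (1/2) ^ Suc i)) = ennreal T"
    proof -
      have "(\<lambda>i. T * (1/2) ^ Suc i) sums (T * 1)" by (intro sums_mult power_half_series)
      then show ?thesis using T0 by (subst suminf_ennreal_eq) auto
    qed
    also have "ennreal Q * (ennreal T + ennreal T) = ennreal (Q * (2 * T))"
      using Q0 T0 by (simp add: ennreal_mult mult_2[symmetric] del: mult_2)
    finally show "(\<integral>\<^sup>+x. ennreal_rpow (H x) (2 * p) / \<Omega> x \<partial>M) \<le> ennreal (2 powr (2 * p)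
        * (2 * (4 powr (2 * p) * \<delta>)))"
      by (simp add: q_def Q_def T_def)
    define E where "E = {x. \<not> (\<lambda>k. V k x) \<longlonglongrightarrow> v x}"
    have Em [measurable]: "E \<in> sets borel" unfolding E_def by measurable
    have AE: "AE x in M. (\<lambda>k. V k x) \<longlonglongrightarrow> v x"
      unfolding V_def by (rule cell_mean_tendsto[OF v sobolev_pairD(2)[OF vg] sobolev_pairD(5)[OF vg]])
    have E0: "emeasure M E = 0"
      using AE unfolding E_def by (subst (asm) AE_iff_measurable[OF _ refl]) (use Em
          in \<open>auto simp: sets_M E_def\<close>)
    show "energy p v \<le> ennreal (2 powr p) * (\<integral>\<^sup>+x. ennreal_rpow (H x) p \<partial>M)"
    proof (rule energy_weak_le[OF p_ge_1 sobolev_pairD(2)[OF vg] sobolev_pairD(5)[OF vg] Em E0 Hm])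
      fix \<gamma> :: "real \<Rightarrow> 'a" and a b s t
      assume \<gamma>: "nonconst_rectifiable_curve \<gamma> a b" and st: "0 < s" "s < t" "t < total_length \<gamma> a b"
      define \<sigma> where "\<sigma> = arc_length_param \<gamma> a b"
      assume "arc_length_param \<gamma> a b s \<notin> E" "arc_length_param \<gamma> a b t \<notin> E"
      then have lim: "(\<lambda>k. V k (\<sigma> s)) \<longlonglongrightarrow> v (\<sigma> s)" "(\<lambda>k. V k (\<sigma> t)) \<longlonglongrightarrow> v (\<sigma> t)"
        by (auto simp: E_def \<sigma>_def)
      have "ennreal \<bar>v (\<sigma> s) - v (\<sigma> t)\<bar> \<le> line_integral \<sigma> 0 (total_length \<gamma> a b) H"
      proof (rule ennreal_le_epsilon)
        fix e :: real assume e: "0 < e"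
        have "eventually (\<lambda>k. \<bar>V k (\<sigma> s) - v (\<sigma> s)\<bar> < e / 2) sequentially"
          using tendstoD[OF lim(1), of "e / 2"] e by (simp add: dist_real_def)
        moreover have "eventually (\<lambda>k. \<bar>V k (\<sigma> t) - v (\<sigma> t)\<bar> < e / 2) sequentially"
          using tendstoD[OF lim(2), of "e / 2"] e by (simp add: dist_real_def)
        moreover have "eventually (\<lambda>k. rad k < t - s) sequentially"
          using rad_tendsto st by (intro order_tendstoD(2)) auto
        ultimately have "eventually (\<lambda>k. \<bar>V k (\<sigma> s) - v (\<sigma> s)\<bar> < e / 2 \<and> \<bar>V k (\<sigma> t) - v (\<sigma> t)\<bar> < e / 2 \<and>
            rad k < t - s) sequentially"
          by eventually_elim simp
        then obtain K where K: "\<And>k. k \<ge> K \<Longrightarrow> \<bar>V k (\<sigma> s) - v (\<sigma> s)\<bar> < e / 2 \<and> \<bar>V k (\<sigma> t) - v (\<sigma> t)\<bar> < e / 2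
            \<and> rad k < t - s"
          by (auto simp: eventually_sequentially)
        \<comment> \<open>\<kappa> k \<ge> k \<ge> \<nu> K \<ge> K, so every scale in use lies
          beyond the threshold K of convergence at s and t.\<close>
        have \<kappa>K: "\<kappa> k \<ge> K" if "k \<ge> \<nu> K" for k
          using that \<nu>i[of K] seq_suble[OF \<kappa>, of k] by linarith
        have "ennreal \<bar>v (\<sigma> s) - v (\<sigma> t)\<bar> \<le> line_integral \<sigma> s t (\<lambda>x. ennreal (F (\<nu> K) x))
            + ennreal (2 * (e / 2))"
        proof -
          have r: "s + rad (\<kappa> (\<nu> K)) \<le> t" using K[OF \<kappa>K[of "\<nu> K"]] by simp
          have "\<forall>k\<ge>\<nu> K. \<bar>V (\<kappa> k) (\<sigma> s) - v (\<sigma> s)\<bar> \<le> e / 2 \<and> \<bar>V (\<kappa> k) (\<sigma> t) - v (\<sigma> t)\<bar> \<le> e / 2"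
            using K \<kappa>K by (meson less_imp_le)
          then show ?thesis
            using FP[of "\<nu> K"] \<gamma> st e r unfolding P_def \<sigma>_def by (meson half_gt_zero less_imp_le)
        qed
        also have "\<dots> \<le> line_integral \<sigma> 0 (total_length \<gamma> a b) H + ennreal (2 * (e / 2))"
          using st by (intro add_right_mono line_integral_mono HF) auto
        finally show "ennreal \<bar>v (\<sigma> s) - v (\<sigma> t)\<bar> \<le> line_integral \<sigma> 0 (total_length \<gamma> a b) H + ennreal e"
            by simp
      qed
      then show "ennreal \<bar>v (arc_length_param \<gamma> a b s) - v (arc_length_param \<gamma> a b t)\<bar>
        \<le> line_integral (arc_length_param \<gamma> a b) 0 (total_length \<gamma> a b) H" by (simp add: \<sigma>_def)
    qed
  qed
qed

text \<open>Along suitable scales of small energy the excess of the averages over \<rho> has a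
  summable integral, so one integrable \<Omega> dominates all these averages.
  \<open>energy_le_of_scales\<close> controls H^(2p) / \<Omega>, and \<open>ennreal_amgm\<close>
  returns to H^p.\<close>

lemma energy_small:
  assumes \<rho> [measurable]: "\<rho> \<in> borel_measurable borel" and fin: "(\<integral>\<^sup>+x. \<rho> x \<partial>M) < \<infinity>"
    and pos: "\<And>x. 0 < \<rho> x" and \<epsilon>: "0 < (\<epsilon>::real)"
  obtains \<delta> where "0 < (\<delta>::real)"
    "\<And>v g. sobolev_pair p (v, g) \<Longrightarrow> (\<exists>\<^sub>F k in sequentially. scale_energy \<rho> k v < ennreal \<delta>) \<Longrightarrow>
        energy p v \<le> ennreal \<epsilon>"
proof -
  obtain I where I: "0 \<le> I" "(\<integral>\<^sup>+x. \<rho> x \<partial>M) = ennreal I" using fin by (cases "\<integral>\<^sup>+x. \<rho> x \<partial>M") auto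
  define A where "A = (2::real) powr p"
  define B where "B = (2::real) powr (2 * p) * (2 * 4 powr (2 * p))"
  have AB: "0 < A" "0 < B" by (auto simp: A_def B_def)
  \<comment> \<open>\<tau> makes the second term of \<open>ennreal_amgm\<close> equal to \<epsilon>
    / (2 * A) after integration, and \<delta> does the same for the first; A is the factor 2^p in
    the energy bound.\<close>
  define \<tau> where "\<tau> = 2 * A * (I + 1) / \<epsilon>"
  have \<tau>: "0 < \<tau>" using AB I \<epsilon> by (simp add: \<tau>_def)
  define \<delta> where "\<delta> = \<epsilon> / (2 * A * \<tau> * B)"
  have \<delta>: "0 < \<delta>" using AB \<tau> \<epsilon> by (simp add: \<delta>_def)
  show thesis
  proof (rule that[OF \<delta>])
    fix v g assume vg: "sobolev_pair p (v, g)" and fr: "\<exists>\<^sub>F k in sequentially. scale_energy \<rho> k v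
        < ennreal \<delta>"
    have l5: "1 \<le> 5 * l" using l_ge_1 by simp
    have "\<exists>K. \<forall>k\<ge>K. (\<integral>\<^sup>+x. avg (5 * l) k \<rho> x - \<rho> x \<partial>M) \<le> ennreal ((1/2) ^ Suc i)" for i
      by (rule avg_minus_small[OF \<rho> fin l5]) simp
    then obtain K where K: "\<And>i k. k \<ge> K i \<Longrightarrow> (\<integral>\<^sup>+x. avg (5 * l) k \<rho> x - \<rho> x \<partial>M) \<le> ennreal ((1/2) ^ Suc i)"
        by metis
    have "\<exists>\<kappa>. strict_mono \<kappa> \<and> (\<forall>i. scale_energy \<rho> (\<kappa> i) v < ennreal \<delta> \<and> \<kappa> i \<ge> K i)"
    proof -
      \<comment> \<open>The next scale lies beyond the previous one and beyond the threshold
        \<open>K i\<close> for the averages, and has small energy; by assumption such scales occur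
        infinitely often.\<close>
      define pick where "pick i m = (SOME k. k > m \<and> k \<ge> K i \<and> scale_energy \<rho> k v < ennreal \<delta>)" for i m
      have pick: "pick i m > m \<and> pick i m \<ge> K i \<and> scale_energy \<rho> (pick i m) v < ennreal \<delta>" for i m
      proof -
        obtain k where "k \<ge> max (Suc m) (K i)" "scale_energy \<rho> k v < ennreal \<delta>"
          using fr unfolding frequently_sequentially by blast
        then have "\<exists>k. k > m \<and> k \<ge> K i \<and> scale_energy \<rho> k v < ennreal \<delta>" by (intro exI[of _ k]) auto
        then show ?thesis unfolding pick_def by (rule someI_ex)
      qed
      define \<kappa> where "\<kappa> = rec_nat (pick 0 0) (\<lambda>i m. pick (Suc i) m)"
      have \<kappa>S: "\<kappa> 0 = pick 0 0" "\<kappa> (Suc i) = pick (Suc i) (\<kappa> i)" for i by (simp_all add: \<kappa>_def)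
      have "strict_mono \<kappa>" using pick by (intro strict_monoI_Suc) (simp add: \<kappa>S)
      moreover have "scale_energy \<rho> (\<kappa> i) v < ennreal \<delta> \<and> \<kappa> i \<ge> K i" for i
        using pick by (cases i) (simp_all add: \<kappa>S)
      ultimately show ?thesis by blast
    qed
    then obtain \<kappa> where \<kappa>: "strict_mono \<kappa>" "\<And>i. scale_energy \<rho> (\<kappa> i) v < ennreal \<delta>" "\<And>i. \<kappa> i \<ge> K i" by blast
    define \<Omega> where "\<Omega> x = \<rho> x + (\<Sum>i. avg (5 * l) (\<kappa> i) \<rho> x - \<rho> x)" for x
    have [measurable]: "\<Omega> \<in> borel_measurable borel" unfolding \<Omega>_def by measurable
    have dom: "avg (5 * l) (\<kappa> i) \<rho> x \<le> \<Omega> x" for i x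
    proof -
      have "avg (5 * l) (\<kappa> i) \<rho> x \<le> \<rho> x + (avg (5 * l) (\<kappa> i) \<rho> x - \<rho> x)"
        by (metis add.commute diff_add_self_ennreal linorder_linear order_refl)
      also have "\<dots> \<le> \<Omega> x"
        unfolding \<Omega>_def using sum_le_suminf[of "\<lambda>i. avg (5 * l) (\<kappa> i) \<rho> x - \<rho> x" "{i}"]
        by (intro add_left_mono) auto
      finally show ?thesis .
    qed
    have I\<Omega>: "(\<integral>\<^sup>+x. \<Omega> x \<partial>M) \<le> ennreal (I + 1)"
    proof -
      have "(\<integral>\<^sup>+x. \<Omega> x \<partial>M) = ennreal I + (\<Sum>i. \<integral>\<^sup>+x. avg (5 * l) (\<kappa> i) \<rho> x - \<rho> x \<partial>M)"
        unfolding \<Omega>_def I(2)[symmetric] by (subst nn_integral_add, measurable, subst nn_integral_suminf,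
            measurable)
      also have "\<dots> \<le> ennreal I + (\<Sum>i. ennreal ((1/2) ^ Suc i))"
        using K \<kappa>(3) by (intro add_left_mono suminf_le) auto
      also have "(\<Sum>i. ennreal ((1/2) ^ Suc i)) = ennreal 1"
        by (rule suminf_ennreal_eq[OF _ power_half_series]) simp
      also have "ennreal I + ennreal 1 = ennreal (I + 1)" using I by (simp add: ennreal_plus)
      finally show ?thesis .
    qed
    obtain H where [measurable]: "H \<in> borel_measurable borel"
      and H: "(\<integral>\<^sup>+x. ennreal_rpow (H x) (2 * p) / \<Omega> x \<partial>M) \<le> ennreal (2 powr (2 * p)
          * (2 * (4 powr (2 * p) * \<delta>)))"
        "energy p v \<le> ennreal (2 powr p) * (\<integral>\<^sup>+x. ennreal_rpow (H x) p \<partial>M)"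
      by (rule energy_le_of_scales[OF vg \<kappa>(1) \<delta> _ dom less_imp_le[OF \<kappa>(2)]]) auto
    have \<Omega>fin: "AE x in M. \<Omega> x \<noteq> \<infinity>"
      using I\<Omega> by (intro nn_integral_PInf_AE) (auto simp: top_unique)
    have "(\<integral>\<^sup>+x. ennreal_rpow (H x) p \<partial>M) \<le> (\<integral>\<^sup>+x. ennreal \<tau> * (ennreal_rpow (H x) (2 * p) / \<Omega> x)
        + \<Omega> x / ennreal \<tau> \<partial>M)"
    proof (rule nn_integral_mono_AE)
      show "AE x in M. ennreal_rpow (H x) p \<le> ennreal \<tau> * (ennreal_rpow (H x) (2 * p) / \<Omega> x)
          + \<Omega> x / ennreal \<tau>"
        using \<Omega>fin
      proof eventually_elim
        case (elim x)
        have "0 < \<Omega> x" using pos[of x] by (simp add: \<Omega>_def add_pos_nonneg)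
        then show ?case unfolding rpow_double using elim \<tau> by (intro ennreal_amgm) (auto simp: less_top)
      qed
    qed
    also have "\<dots> = ennreal \<tau> * (\<integral>\<^sup>+x. ennreal_rpow (H x) (2 * p) / \<Omega> x \<partial>M) + (\<integral>\<^sup>+x. \<Omega> x \<partial>M) / ennreal \<tau>"
      by (subst nn_integral_add, measurable, subst nn_integral_cmult, measurable, subst
          nn_integral_divide, measurable)
    also have "\<dots> \<le> ennreal \<tau> * ennreal (B * \<delta>) + ennreal (I + 1) / ennreal \<tau>"
      using H(1) I\<Omega> by (intro add_mono mult_left_mono divide_right_mono_ennreal) (auto simp: B_def
          mult.assoc)
    also have "\<dots> = ennreal (\<tau> * (B * \<delta>)) + ennreal ((I + 1) / \<tau>)"
      using \<tau> I AB \<delta> by (intro arg_cong2[where f = "(+)"] ennreal_mult[symmetric] divide_ennreal) auto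
    also have "\<dots> = ennreal (\<tau> * (B * \<delta>) + (I + 1) / \<tau>)"
      using \<tau> I AB \<delta> by (intro ennreal_plus[symmetric]) auto
    also have "\<tau> * (B * \<delta>) + (I + 1) / \<tau> = \<epsilon> / A"
    proof -
      have "\<tau> * (B * \<delta>) = \<epsilon> / (2 * A)" using \<tau> AB by (simp add: \<delta>_def)
      moreover have "(I + 1) / \<tau> = \<epsilon> / (2 * A)" using I AB \<epsilon> by (simp add: \<tau>_def)
      ultimately show ?thesis by simp
    qed
    finally have HH: "(\<integral>\<^sup>+x. ennreal_rpow (H x) p \<partial>M) \<le> ennreal (\<epsilon> / A)" .
    have "energy p v \<le> ennreal A * ennreal (\<epsilon> / A)"
      using H(2) mult_left_mono[OF HH, of "ennreal A"] unfolding A_def by (rule order_trans) simp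
    also have "\<dots> = ennreal \<epsilon>" using AB \<epsilon> by (simp flip: ennreal_mult)
    finally show "energy p v \<le> ennreal \<epsilon>" .
  qed
qed

end

section \<open>A countable dense set of Sobolev pairs\<close>

text \<open>For infinitely many k the value \<open>A k\<close> is near its upper limit, while B, X
  and Y are eventually on the good side of their limits; so limsup A + liminf B is reached at a
  common k. The bound K makes everything finite and allows the statement in the reals.\<close>

lemma limsup_liminf_parallelogram:
  fixes A B X Y :: "nat \<Rightarrow> ennreal"
  assumes le: "\<And>k. 2 * (A k + B k) \<le> X k + Y k" and K: "\<And>k. X k \<le> ennreal K" "\<And>k. Y k \<le> ennreal K"
  shows "enn2real (limsup A) + enn2real (liminf B) \<le> (enn2real (limsup X) + enn2real (limsup Y)) / 2"
proof -
  have AB: "A k + B k \<le> ennreal K" for k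
  proof -
    have "(A k + B k) + (A k + B k) \<le> ennreal K + ennreal K"
      using le[of k] K[of k] unfolding mult_2 by (meson add_mono order_trans)
    then have "ennreal (1 / 2) * ((A k + B k) + (A k + B k)) \<le> ennreal (1 / 2) * (ennreal K + ennreal K)"
      by (rule mult_left_mono) simp
    then show ?thesis unfolding ennreal_half_add .
  qed
  have A: "A k \<le> ennreal K" and B: "B k \<le> ennreal K" for k
    using AB[of k] by (auto intro: order_trans[rotated])
  have fin: "Z k < top" if "\<And>k. Z k \<le> ennreal K" for Z :: "nat \<Rightarrow> ennreal" and k
    using that[of k] by (auto intro: le_less_trans)
  have sup: "limsup Z < top" if "\<And>k. Z k \<le> ennreal K" for Z :: "nat \<Rightarrow> ennreal"
    using Limsup_bounded[of Z "ennreal K" sequentially] that by (auto intro: le_less_trans)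
  have inf: "liminf B < top"
    using Liminf_le_Limsup[of sequentially B] sup[of B, OF B] by (auto intro: le_less_trans)
  have ev: "eventually (\<lambda>k. enn2real (Z k) < enn2real (limsup Z) + e) sequentially"
    if Z: "\<And>k. Z k \<le> ennreal K" and e: "0 < e" for Z and e :: real
  proof -
    have "limsup Z < ennreal (enn2real (limsup Z) + e)"
    proof -
      have "limsup Z = ennreal (enn2real (limsup Z))" using sup[of Z, OF Z] by simp
      also have "\<dots> < ennreal (enn2real (limsup Z) + e)"
        using e by (intro ennreal_lessI) (auto intro: add_nonneg_pos)
      finally show ?thesis .
    qed
    then have "eventually (\<lambda>k. Z k < ennreal (enn2real (limsup Z) + e)) sequentially"
      by (rule Limsup_lessD)
    then show ?thesis
    proof eventually_elim
      case (elim k)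
      have eq: "ennreal (enn2real (Z k)) = Z k" using fin[of Z k, OF Z] by simp
      have "ennreal (enn2real (Z k)) < ennreal (enn2real (limsup Z) + e)" unfolding eq by (rule elim)
      then show ?case by (subst (asm) ennreal_less_iff) simp_all
    qed
  qed
  have evB: "eventually (\<lambda>k. enn2real (liminf B) - e < enn2real (B k)) sequentially" if e: "0 < e"
      for e :: real
  proof (cases "enn2real (liminf B) - e < 0")
    case True
    then have "\<And>k. enn2real (liminf B) - e < enn2real (B k)"
      by (rule less_le_trans) simp
    then show ?thesis by simp
  next
    case False
    have "ennreal (enn2real (liminf B) - e) < liminf B"
    proof -
      have "ennreal (enn2real (liminf B) - e) < ennreal (enn2real (liminf B))"
        using e False by (intro ennreal_lessI) auto
      also have "\<dots> = liminf B" using inf by simp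
      finally show ?thesis .
    qed
    then have "eventually (\<lambda>k. ennreal (enn2real (liminf B) - e) < B k) sequentially"
      by (rule less_LiminfD)
    then show ?thesis
    proof eventually_elim
      case (elim k)
      have eq: "ennreal (enn2real (B k)) = B k" using fin[of B, OF B] by simp
      have "ennreal (enn2real (liminf B) - e) < ennreal (enn2real (B k))" unfolding eq by (rule elim)
      then show ?case using False by (subst (asm) ennreal_less_iff) simp_all
    qed
  qed
  have frA: "\<exists>\<^sub>F k in sequentially. enn2real (limsup A) - e < enn2real (A k)" if e: "0 < e" for e :: real
  proof (rule ccontr)
    assume "\<not> ?thesis"
    then have ev': "eventually (\<lambda>k. enn2real (A k) \<le> enn2real (limsup A) - e) sequentially"
      by (simp add: not_frequently not_less)
    then have "eventually (\<lambda>k. A k \<le> ennreal (enn2real (limsup A) - e)) sequentially"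
    proof eventually_elim
      case (elim k)
      have "A k = ennreal (enn2real (A k))" using fin[of A, OF A] by simp
      also have "\<dots> \<le> ennreal (enn2real (limsup A) - e)" by (rule ennreal_leI[OF elim])
      finally show ?case .
    qed
    then have lA: "limsup A \<le> ennreal (enn2real (limsup A) - e)" by (rule Limsup_bounded)
    obtain k where "enn2real (A k) \<le> enn2real (limsup A) - e" using ev'
        by (auto simp: eventually_sequentially)
    then have "0 \<le> enn2real (limsup A) - e" using enn2real_nonneg[of "A k"] by linarith
    then have "enn2real (limsup A) \<le> enn2real (limsup A) - e" using lA by (rule enn2real_leI)
    then show False using e by simp
  qed
  show ?thesis
  proof (rule field_le_epsilon)
    fix e :: real assume e: "0 < e"
    then have e3: "0 < e / 3" by simp
    have "eventually (\<lambda>k. enn2real (liminf B) - e/3 < enn2real (B k) \<and>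
        enn2real (X k) < enn2real (limsup X) + e/3 \<and> enn2real (Y k) < enn2real (limsup Y)
            + e/3) sequentially"
      by (intro eventually_conj evB[OF e3] ev[of X, OF K(1) e3] ev[of Y, OF K(2) e3])
    then obtain k0 where k0: "\<And>k. k \<ge> k0 \<Longrightarrow> enn2real (liminf B) - e/3 < enn2real (B k) \<and>
        enn2real (X k) < enn2real (limsup X) + e/3 \<and> enn2real (Y k) < enn2real (limsup Y) + e/3"
      unfolding eventually_sequentially by blast
    obtain k where "k \<ge> k0" and kA: "enn2real (limsup A) - e/3 < enn2real (A k)"
      using frA[OF e3] unfolding frequently_sequentially by blast
    then have k: "enn2real (liminf B) - e/3 < enn2real (B k)"
        "enn2real (X k) < enn2real (limsup X) + e/3" "enn2real (Y k) < enn2real (limsup Y) + e/3"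
      using k0 by blast+
    have "enn2real ((A k + B k) + (A k + B k)) \<le> enn2real (X k + Y k)"
      using le[of k] fin[of X k, OF K(1)] fin[of Y k, OF K(2)] unfolding mult_2
          by (intro enn2real_mono) auto
    then have "2 * (enn2real (A k) + enn2real (B k)) \<le> enn2real (X k) + enn2real (Y k)"
      using fin[of A k, OF A] fin[of B k, OF B] fin[of X k, OF K(1)] fin[of Y k, OF K(2)]
          by (simp add: enn2real_plus)
    then show "enn2real (limsup A) + enn2real (liminf B) \<le> (enn2real (limsup X) + enn2real (limsup Y)) / 2
        + e"
      using k kA by argo
  qed
qed

lemma (in borel_measure) rpow_integral_finite:
  assumes "0 \<le> a" and [measurable]: "f \<in> borel_measurable borel" "h \<in> borel_measurable borel"
    and "(\<integral>\<^sup>+x. ennreal_rpow (f x) a \<partial>M) < \<infinity>" "(\<integral>\<^sup>+x. ennreal_rpow (h x) a \<partial>M) < \<infinity>"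
  shows "(\<integral>\<^sup>+x. ennreal_rpow (ennreal c * f x + ennreal d * h x) a \<partial>M) < \<infinity>"
proof -
  have "(\<integral>\<^sup>+x. ennreal_rpow (ennreal c * f x + ennreal d * h x) a \<partial>M)
    \<le> (\<integral>\<^sup>+x. ennreal (2 powr a) * (ennreal_rpow (ennreal c) a * ennreal_rpow (f x) a
        + ennreal_rpow (ennreal d) a * ennreal_rpow (h x) a) \<partial>M)"
    unfolding rpow_mult[symmetric] by (intro nn_integral_mono rpow_add_le assms)
  also have "\<dots> = ennreal (2 powr a) * (ennreal_rpow (ennreal c) a * (\<integral>\<^sup>+x. ennreal_rpow (f x) a \<partial>M)
      + ennreal_rpow (ennreal d) a * (\<integral>\<^sup>+x. ennreal_rpow (h x) a \<partial>M))"
    by (simp add: nn_integral_cmult nn_integral_add)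
  also have "\<dots> < \<infinity>" using assms by (auto simp: ennreal_mult_less_top)
  finally show ?thesis .
qed

context poincare_space
begin

lemma sobolev_pair_combine:
  assumes u: "sobolev_pair p (u, g)" and v: "sobolev_pair p (v, h)"
  shows "sobolev_pair p (\<lambda>x. a * u x + b * v x, \<lambda>x. ennreal \<bar>a\<bar> * g x + ennreal \<bar>b\<bar> * h x)"
proof -
  note [measurable] = sobolev_pairD(1,3)[OF u] sobolev_pairD(1,3)[OF v]
  have "real_upper_gradient (\<lambda>x. ennreal \<bar>a\<bar> * g x + ennreal \<bar>b\<bar> * h x) (\<lambda>x. a * u x + b * v x)"
    by (intro real_upper_gradient_add real_upper_gradient_cmult sobolev_pairD(2)[OF u] sobolev_pairD(2)[OF
        v])
  moreover have "(\<integral>\<^sup>+x. ennreal_rpow (ennreal \<bar>a\<bar> * g x + ennreal \<bar>b\<bar> * h x) p \<partial>M) < \<infinity>"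
    using p_ge_1 sobolev_pairD(5)[OF u] sobolev_pairD(5)[OF v] by (intro rpow_integral_finite) auto
  moreover have "(\<integral>\<^sup>+x. ennreal (\<bar>a * u x + b * v x\<bar> powr p) \<partial>M) < \<infinity>"
  proof -
    have "(\<integral>\<^sup>+x. ennreal (\<bar>a * u x + b * v x\<bar> powr p) \<partial>M) \<le> (\<integral>\<^sup>+x. ennreal_rpow (ennreal \<bar>a\<bar>
        * ennreal \<bar>u x\<bar> + ennreal \<bar>b\<bar> * ennreal \<bar>v x\<bar>) p \<partial>M)"
    proof (rule nn_integral_mono)
      fix x
      have "ennreal \<bar>a * u x + b * v x\<bar> \<le> ennreal (\<bar>a\<bar> * \<bar>u x\<bar> + \<bar>b\<bar> * \<bar>v x\<bar>)"
        by (intro ennreal_leI) (metis abs_mult abs_triangle_ineq)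
      also have "\<dots> = ennreal \<bar>a\<bar> * ennreal \<bar>u x\<bar> + ennreal \<bar>b\<bar> * ennreal \<bar>v x\<bar>"
        by (simp add: ennreal_mult)
      finally have "ennreal_rpow (ennreal \<bar>a * u x + b * v x\<bar>) p \<le> ennreal_rpow (ennreal \<bar>a\<bar>
          * ennreal \<bar>u x\<bar> + ennreal \<bar>b\<bar> * ennreal \<bar>v x\<bar>) p"
        using p_ge_1 by (intro rpow_mono) auto
      then show "ennreal (\<bar>a * u x + b * v x\<bar> powr p) \<le> ennreal_rpow (ennreal \<bar>a\<bar> * ennreal \<bar>u x\<bar>
          + ennreal \<bar>b\<bar> * ennreal \<bar>v x\<bar>) p"
        by simp
    qed
    also have "\<dots> < \<infinity>"
      using p_ge_1 sobolev_pairD(4)[OF u] sobolev_pairD(4)[OF v] by (intro rpow_integral_finite) auto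
    finally show ?thesis .
  qed
  ultimately show ?thesis by (simp add: sobolev_pair_def)
qed

text \<open>Written exactly as \<open>sobolev_pair_combine\<close> delivers it, including the
  absolute values of 1/2.\<close>

definition pair_mid :: "('a \<Rightarrow> real) \<times> ('a \<Rightarrow> ennreal) \<Rightarrow> ('a \<Rightarrow> real) \<times> ('a \<Rightarrow> ennreal) \<Rightarrow> ('a \<Rightarrow> real) \<times>
    ('a \<Rightarrow> ennreal)" where
  "pair_mid z w = (\<lambda>x. 1/2 * fst z x + 1/2 * fst w x, \<lambda>x. ennreal \<bar>1/2\<bar> * snd z x + ennreal \<bar>1/2\<bar>
      * snd w x)"

text \<open>Midpoints are adjoined in stages. Each stage stays countable, and any two elements of
  the union lie in a common stage.\<close>

lemma midpoint_closure:
  assumes D: "countable D" "\<And>z. z \<in> D \<Longrightarrow> sobolev_pair p z"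
  obtains S where "countable S" "D \<subseteq> S" "\<And>z. z \<in> S \<Longrightarrow> sobolev_pair p z"
    "\<And>z w. z \<in> S \<Longrightarrow> w \<in> S \<Longrightarrow> pair_mid z w \<in> S"
proof -
  define T where "T n = ((\<lambda>A. A \<union> (\<lambda>(z, w). pair_mid z w) ` (A \<times> A)) ^^ n) D" for n
  have T: "T 0 = D" "T (Suc n) = T n \<union> (\<lambda>(z, w). pair_mid z w) ` (T n \<times> T n)" for n
    by (simp_all add: T_def)
  have mono: "T m \<subseteq> T n" if "m \<le> n" for m n
    by (rule lift_Suc_mono_le[OF _ that]) (auto simp: T)
  have cnt: "countable (T n)" for n
    by (induction n) (auto simp: T D(1))
  have sp: "sobolev_pair p z" if "z \<in> T n" for z n
    using that
  proof (induction n arbitrary: z)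
    case 0
    then show ?case using D by (simp add: T)
  next
    case (Suc n)
    have "sobolev_pair p (pair_mid a b)" if "a \<in> T n" "b \<in> T n" for a b
      unfolding pair_mid_def by (rule sobolev_pair_combine) (use Suc.IH that in auto)
    moreover have "z \<in> T n \<or> (\<exists>a\<in>T n. \<exists>b\<in>T n. z = pair_mid a b)"
      using Suc.prems unfolding T by fastforce
    ultimately show ?case using Suc.IH by blast
  qed
  show thesis
  proof (rule that[of "\<Union>n. T n"])
    show "pair_mid z w \<in> (\<Union>n. T n)" if zw: "z \<in> (\<Union>n. T n)" "w \<in> (\<Union>n. T n)" for z w
    proof -
      obtain m n where "z \<in> T m" "w \<in> T n" using zw by blast
      then have "z \<in> T (max m n)" "w \<in> T (max m n)" using mono[of m "max m n"] mono[of n "max m n"] by auto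
      then have "pair_mid z w \<in> T (Suc (max m n))" by (auto simp: T)
      then show ?thesis by blast
    qed
  qed (use cnt sp T in auto)
qed

text \<open>Each ball about \<open>base\<close> receives the weight 2^(-n-1) divided by its measure,
  which is positive and finite; the balls cover the space.\<close>

lemma positive_integrable_function:
  obtains \<theta> where "\<theta> \<in> borel_measurable borel" "\<And>x. 0 < \<theta> x" "(\<integral>\<^sup>+x. \<theta> x \<partial>M) < \<infinity>"
proof -
  let ?B = "\<lambda>n. ball base (real (Suc n))"
  define \<theta> where "\<theta> x = (\<Sum>n. ennreal ((1/2) ^ Suc n) / emeasure M (?B n) * indicator (?B n) x)" for x
  have m: "\<theta> \<in> borel_measurable borel" unfolding \<theta>_def by measurable
  have pos: "0 < \<theta> x" for x
  proof -
    obtain n where n: "dist base x < real n" using reals_Archimedean2 by blast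
    have "0 < ennreal ((1/2) ^ Suc n) / emeasure M (?B n)"
      using ball_finite[of base "real (Suc n)"] by (simp add: ennreal_zero_less_divide)
    also have "\<dots> = (\<Sum>i\<in>{n}. ennreal ((1/2) ^ Suc i) / emeasure M (?B i) * indicator (?B i) x)"
      using n by simp
    also have "\<dots> \<le> \<theta> x" unfolding \<theta>_def by (rule sum_le_suminf) auto
    finally show ?thesis .
  qed
  have "(\<integral>\<^sup>+x. \<theta> x \<partial>M) = (\<Sum>n. ennreal ((1/2) ^ Suc n) / emeasure M (?B n) * emeasure M (?B n))"
    unfolding \<theta>_def by (subst nn_integral_suminf, measurable) (simp add: nn_integral_cmult)
  also have "\<dots> = (\<Sum>n. ennreal ((1/2) ^ Suc n))"
  proof (rule suminf_cong)
    fix n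
    show "ennreal ((1/2) ^ Suc n) / emeasure M (?B n) * emeasure M (?B n) = ennreal ((1/2) ^ Suc n)"
      using ball_pos[of "real (Suc n)" base] ball_finite[of base "real (Suc n)"]
      by (intro ennreal_divide_mult_cancel) auto
  qed
  also have "\<dots> = ennreal 1" by (rule suminf_ennreal_eq[OF _ power_half_series]) simp
  finally have "(\<integral>\<^sup>+x. \<theta> x \<partial>M) < \<infinity>" by simp
  then show thesis using m pos by (intro that) auto
qed

text \<open>The minimization runs over differences of u with elements of S, which is why S has to
  contain midpoints. Midpoints preserve the bound \<omega> on the gradients and, by convexity of the
  power, the L^p bound that defines \<open>Cn\<close>.\<close>

lemma countable_dense_sobolev:
  obtains S where "countable S" "\<And>z. z \<in> S \<Longrightarrow> sobolev_pair p z"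
    "\<And>u g e. sobolev_pair p (u, g) \<Longrightarrow> 0 < e \<Longrightarrow>
      \<exists>z\<in>S. (\<integral>\<^sup>+x. ennreal (\<bar>fst z x - u x\<bar> powr p) \<partial>M) < ennreal e \<and> energy p (\<lambda>x. fst z x - u x)
          < ennreal e"
proof -
  obtain D where D: "countable D" "\<And>z. z \<in> D \<Longrightarrow> sobolev_pair p z"
    and Dd: "\<And>u g e. sobolev_pair p (u, g) \<Longrightarrow> 0 < e \<Longrightarrow> \<exists>(s, h)\<in>D. (\<integral>\<^sup>+x. ennreal (\<bar>s x - u x\<bar> powr p) \<partial>M)
        < ennreal e \<and>
       (\<integral>\<^sup>+x. ennreal_rpow (h x - g x) p \<partial>M) < ennreal e"
    by (rule sobolev_pairs_separable[OF p_ge_1]) blast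
  obtain S where S: "countable S" "D \<subseteq> S" "\<And>z. z \<in> S \<Longrightarrow> sobolev_pair p z"
    "\<And>z w. z \<in> S \<Longrightarrow> w \<in> S \<Longrightarrow> pair_mid z w \<in> S"
    using midpoint_closure[OF D] by blast
  show thesis
  proof (rule that[OF S(1) S(3)])
    fix u g and e :: real
    assume ug: "sobolev_pair p (u, g)" and e: "0 < e"
    note [measurable] = sobolev_pairD(1,3)[OF ug]
    have uL: "ball_integrable u" by (rule ball_integrable_of_Lp[OF p_ge_1 sobolev_pairD(1,4)[OF ug]])
    define q where "q = (2::real) powr p"
    have q: "0 < q" by (simp add: q_def)
    \<comment> \<open>The first bound puts the j-th difference into \<open>Cn j\<close>; the second
      beats the weights of \<open>rpow_suminf_le\<close> and makes \<omega> an L^p function.\<close>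
    define \<epsilon> where "\<epsilon> j = min (1 / real (Suc j)) ((1/2) ^ Suc j / q ^ Suc j)" for j
    have \<epsilon>: "0 < \<epsilon> j" for j using q by (simp add: \<epsilon>_def)
    have "\<exists>zz. \<forall>j. zz j \<in> D \<and> (\<integral>\<^sup>+x. ennreal (\<bar>fst (zz j) x - u x\<bar> powr p) \<partial>M) < ennreal (\<epsilon> j) \<and>
       (\<integral>\<^sup>+x. ennreal_rpow (snd (zz j) x - g x) p \<partial>M) < ennreal (\<epsilon> j)"
    proof (intro choice allI)
      fix j
      obtain s h where "(s, h) \<in> D" "(\<integral>\<^sup>+x. ennreal (\<bar>s x - u x\<bar> powr p) \<partial>M) < ennreal (\<epsilon> j)"
        "(\<integral>\<^sup>+x. ennreal_rpow (h x - g x) p \<partial>M) < ennreal (\<epsilon> j)"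
        using Dd[OF ug \<epsilon>[of j]] by blast
      then show "\<exists>z. z \<in> D \<and> (\<integral>\<^sup>+x. ennreal (\<bar>fst z x - u x\<bar> powr p) \<partial>M) < ennreal (\<epsilon> j) \<and>
       (\<integral>\<^sup>+x. ennreal_rpow (snd z x - g x) p \<partial>M) < ennreal (\<epsilon> j)"
        by (intro exI[of _ "(s, h)"]) simp
    qed
    then obtain zz where zz: "\<And>j. zz j \<in> D" "\<And>j. (\<integral>\<^sup>+x. ennreal (\<bar>fst (zz j) x - u x\<bar> powr p) \<partial>M)
        < ennreal (\<epsilon> j)"
      "\<And>j. (\<integral>\<^sup>+x. ennreal_rpow (snd (zz j) x - g x) p \<partial>M) < ennreal (\<epsilon> j)" by blast
    have zm [measurable]: "snd (zz j) \<in> borel_measurable borel" for j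
      using sobolev_pairD(3)[of p "fst (zz j)" "snd (zz j)"] D(2)[OF zz(1)[of j]] by simp
    \<comment> \<open>Truncated differences give a majorant of g and of all the chosen gradients at
      once.\<close>
    define \<omega> where "\<omega> x = g x + (\<Sum>j. snd (zz j) x - g x)" for x
    have [measurable]: "\<omega> \<in> borel_measurable borel" unfolding \<omega>_def by measurable
    have g\<omega>: "g x \<le> \<omega> x" for x unfolding \<omega>_def by simp
    have z\<omega>: "snd (zz j) x \<le> \<omega> x" for j x
    proof -
      have "snd (zz j) x \<le> g x + (snd (zz j) x - g x)"
        by (metis add.commute diff_add_self_ennreal linorder_linear order_refl)
      also have "\<dots> \<le> \<omega> x"
        unfolding \<omega>_def using sum_le_suminf[of "\<lambda>j. snd (zz j) x - g x" "{j}"] by (intro add_left_mono) auto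
      finally show ?thesis .
    qed
    have \<omega>fin: "(\<integral>\<^sup>+x. ennreal_rpow (\<omega> x) p \<partial>M) < \<infinity>"
    proof -
      have "(\<integral>\<^sup>+x. ennreal_rpow (\<Sum>j. snd (zz j) x - g x) p \<partial>M) \<le> (\<integral>\<^sup>+x. (\<Sum>j. ennreal (q ^ Suc j)
          * ennreal_rpow (snd (zz j) x - g x) p) \<partial>M)"
        unfolding q_def using p_ge_1 by (intro nn_integral_mono rpow_suminf_le) auto
      also have "\<dots> = (\<Sum>j. ennreal (q ^ Suc j) * (\<integral>\<^sup>+x. ennreal_rpow (snd (zz j) x - g x) p \<partial>M))"
        by (subst nn_integral_suminf, measurable) (simp add: nn_integral_cmult)
      also have "\<dots> \<le> (\<Sum>j. ennreal ((1/2) ^ Suc j))"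
      proof (intro suminf_le)
        fix j
        have "ennreal (q ^ Suc j) * (\<integral>\<^sup>+x. ennreal_rpow (snd (zz j) x - g x) p \<partial>M) \<le> ennreal (q ^ Suc j)
            * ennreal (\<epsilon> j)"
          by (rule mult_left_mono[OF less_imp_le[OF zz(3)]]) simp
        also have "\<dots> = ennreal (q ^ Suc j * \<epsilon> j)" using q \<epsilon>[of j] by (intro ennreal_mult[symmetric]) auto
        also have "\<dots> \<le> ennreal (q ^ Suc j * ((1/2) ^ Suc j / q ^ Suc j))"
          using q by (intro ennreal_leI mult_left_mono) (auto simp: \<epsilon>_def)
        also have "q ^ Suc j * ((1/2) ^ Suc j / q ^ Suc j) = (1/2) ^ Suc j" using q by (simp del: power_Suc)
        finally show "ennreal (q ^ Suc j) * (\<integral>\<^sup>+x. ennreal_rpow (snd (zz j) x - g x) p \<partial>M)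
            \<le> ennreal ((1/2) ^ Suc j)" .
      qed auto
      also have "\<dots> = ennreal 1" by (rule suminf_ennreal_eq[OF _ power_half_series]) simp
      finally have "(\<integral>\<^sup>+x. ennreal_rpow (\<Sum>j. snd (zz j) x - g x) p \<partial>M) < \<infinity>" by (rule le_less_trans) simp
      from rpow_integral_finite[OF _ _ _ sobolev_pairD(5)[OF ug] this, of 1 1]
      show ?thesis using p_ge_1 unfolding \<omega>_def by simp
    qed
    obtain \<theta> where [measurable]: "\<theta> \<in> borel_measurable borel" and \<theta>: "\<And>x. 0 < \<theta> x" "(\<integral>\<^sup>+x. \<theta> x \<partial>M) < \<infinity>"
      using positive_integrable_function by blast
    \<comment> \<open>The difference of an element of S and u has an upper gradient below \<omega> +
      \<omega>, one \<omega> from each function; \<theta> keeps \<rho>, and with it \<Omega>,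
      positive.\<close>
    define \<rho> where "\<rho> x = ennreal_rpow (\<omega> x + \<omega> x) p + \<theta> x" for x
    have \<rho>m [measurable]: "\<rho> \<in> borel_measurable borel" unfolding \<rho>_def by measurable
    have \<rho>pos: "0 < \<rho> x" for x using \<theta>(1)[of x] by (simp add: \<rho>_def add_nonneg_pos)
    have \<rho>fin: "(\<integral>\<^sup>+x. \<rho> x \<partial>M) < \<infinity>"
      using rpow_integral_finite[OF _ _ _ \<omega>fin \<omega>fin, of 1 1] p_ge_1 \<theta>(2)
          by (simp add: \<rho>_def nn_integral_add)
    define Cn where "Cn n = {v. \<exists>z\<in>S. v = (\<lambda>x. fst z x - u x) \<and> (\<forall>x. snd z x \<le> \<omega> x) \<and>
        (\<integral>\<^sup>+x. ennreal (\<bar>v x\<bar> powr p) \<partial>M) \<le> ennreal (1 / real (Suc n))}" for n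
    have Cn_pair: "\<exists>h. sobolev_pair p (v, h) \<and> (\<forall>x. h x \<le> \<omega> x + \<omega> x)" if v: "v \<in> Cn n" for v n
    proof -
      obtain z where z: "z \<in> S" "v = (\<lambda>x. fst z x - u x)" "\<And>x. snd z x \<le> \<omega> x" using v by (auto simp: Cn_def)
      have "sobolev_pair p (\<lambda>x. 1 * fst z x + (-1) * u x, \<lambda>x. ennreal \<bar>1\<bar> * snd z x + ennreal \<bar>-1\<bar> * g x)"
        by (rule sobolev_pair_combine[OF _ ug]) (use S(3)[OF z(1)] in simp)
      then have "sobolev_pair p (v, \<lambda>x. snd z x + g x)" by (simp add: z(2))
      moreover have "snd z x + g x \<le> \<omega> x + \<omega> x" for x using z(3) g\<omega> by (rule add_mono)
      ultimately show ?thesis by blast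
    qed
    define K where "K = enn2real (ennreal (real (packing 4) * quotient_const powr (2 * p))
        * (of_nat (packing (5 * l)) * (\<integral>\<^sup>+x. \<rho> x \<partial>M)))"
    have se: "scale_energy \<rho> k v \<le> ennreal K" if vh: "sobolev_pair p (v, h)" "\<And>x. h x \<le> \<omega> x + \<omega> x" for v h k
    proof -
      have "scale_energy \<rho> k v \<le> ennreal (real (packing 4) * quotient_const powr (2 * p))
          * (of_nat (packing (5 * l)) * (\<integral>\<^sup>+x. \<rho> x \<partial>M))"
      proof (rule scale_energy_le[OF _ sobolev_pairD(2)[OF vh(1)] _ \<rho>m])
        show "ball_integrable v" by (rule ball_integrable_of_Lp[OF p_ge_1 sobolev_pairD(1,4)[OF vh(1)]])
        fix x
        have "ennreal_rpow (h x) p \<le> ennreal_rpow (\<omega> x + \<omega> x) p" using p_ge_1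
            by (intro rpow_mono vh(2)) auto
        also have "\<dots> \<le> \<rho> x" by (simp add: \<rho>_def)
        finally show "ennreal_rpow (h x) p \<le> \<rho> x" .
      qed
      also have "\<dots> = ennreal K" unfolding K_def using \<rho>fin
          by (simp add: ennreal_mult_less_top of_nat_less_top)
      finally show ?thesis .
    qed
    obtain v where v: "\<And>n. v n \<in> Cn n"
      and vC: "\<And>e. 0 < e \<Longrightarrow>
          \<exists>N. \<forall>n\<ge>N. \<forall>m\<ge>N. enn2real (liminf (\<lambda>k. scale_energy \<rho> k (\<lambda>x. (v n x - v m x) / 2))) < e"
    \<comment> \<open>The minimized quantity is the upper limit of the scale energies, so the defect
      supplied by \<open>limsup_liminf_parallelogram\<close> is the lower limit for the half
      difference.\<close>
    proof (rule midpoint_minimizing_sequence[of Cn "\<lambda>v w x. (v x + w x) / 2"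
        "\<lambda>v. enn2real (limsup (\<lambda>k. scale_energy \<rho> k v))" K
          "\<lambda>v w. enn2real (liminf (\<lambda>k. scale_energy \<rho> k (\<lambda>x. (v x - w x) / 2)))"])
      fix n
      have "(\<lambda>x. fst (zz n) x - u x) \<in> Cn n"
      proof -
        have "(\<integral>\<^sup>+x. ennreal (\<bar>fst (zz n) x - u x\<bar> powr p) \<partial>M) \<le> ennreal (1 / real (Suc n))"
          using zz(2)[of n] by (rule order_trans[OF less_imp_le]) (auto simp: \<epsilon>_def intro!: ennreal_leI)
        then show ?thesis unfolding Cn_def using zz(1)[of n] S(2) z\<omega> by blast
      qed
      then show "Cn n \<noteq> {}" by blast
    next
      fix m n :: nat assume mn: "m \<le> n"
      have "ennreal (1 / real (Suc n)) \<le> ennreal (1 / real (Suc m))"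
        using mn by (intro ennreal_leI divide_left_mono) auto
      then show "Cn n \<subseteq> Cn m" unfolding Cn_def by (blast intro: order_trans)
    next
      fix n v w assume vw: "v \<in> Cn n" "w \<in> Cn n"
      obtain z where z: "z \<in> S" "v = (\<lambda>x. fst z x - u x)" "\<And>x. snd z x \<le> \<omega> x" using vw
          by (auto simp: Cn_def)
      obtain y where y: "y \<in> S" "w = (\<lambda>x. fst y x - u x)" "\<And>x. snd y x \<le> \<omega> x" using vw
          by (auto simp: Cn_def)
      have [measurable]: "v \<in> borel_measurable borel" "w \<in> borel_measurable borel"
        using Cn_pair[OF vw(1)] Cn_pair[OF vw(2)] by (auto dest: sobolev_pairD)
      have "(\<lambda>x. (v x + w x) / 2) = (\<lambda>x. fst (pair_mid z y) x - u x)"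
        by (simp add: pair_mid_def z y fun_eq_iff field_simps)
      moreover have "snd (pair_mid z y) x \<le> \<omega> x" for x
      proof -
        have "snd (pair_mid z y) x = ennreal (1 / 2) * (snd z x + snd y x)"
            by (simp add: pair_mid_def distrib_left)
        also have "\<dots> \<le> ennreal (1 / 2) * (\<omega> x + \<omega> x)" by (intro mult_left_mono add_mono z y) simp
        finally show ?thesis by (simp only: ennreal_half_add)
      qed
      moreover have "(\<integral>\<^sup>+x. ennreal (\<bar>(v x + w x) / 2\<bar> powr p) \<partial>M) \<le> ennreal (1 / real (Suc n))"
      proof -
        have "(\<integral>\<^sup>+x. ennreal (\<bar>(v x + w x) / 2\<bar> powr p) \<partial>M) \<le> (\<integral>\<^sup>+x. ennreal (1 / 2)
            * (ennreal (\<bar>v x\<bar> powr p) + ennreal (\<bar>w x\<bar> powr p)) \<partial>M)"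
        proof (rule nn_integral_mono)
          fix x
          have "\<bar>(v x + w x) / 2\<bar> powr p \<le> (1/2 * \<bar>v x\<bar> + 1/2 * \<bar>w x\<bar>) powr p"
            using p_ge_1 by (intro powr_mono2) auto
          also have "\<dots> \<le> 1/2 * \<bar>v x\<bar> powr p + 1/2 * \<bar>w x\<bar> powr p"
            by (rule powr_convex_ge0[OF p_ge_1]) auto
          also have "\<dots> = 1/2 * (\<bar>v x\<bar> powr p + \<bar>w x\<bar> powr p)" by (simp add: distrib_left)
          finally have "ennreal (\<bar>(v x + w x) / 2\<bar> powr p) \<le> ennreal (1/2 * (\<bar>v x\<bar> powr p
              + \<bar>w x\<bar> powr p))" by (rule ennreal_leI)
          also have "\<dots> = ennreal (1 / 2) * (ennreal (\<bar>v x\<bar> powr p) + ennreal (\<bar>w x\<bar> powr p))"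
            by (subst ennreal_mult) (auto simp: ennreal_plus)
          finally show "ennreal (\<bar>(v x + w x) / 2\<bar> powr p) \<le> ennreal (1 / 2) * (ennreal (\<bar>v x\<bar> powr p)
              + ennreal (\<bar>w x\<bar> powr p))" .
        qed
        also have "\<dots> = ennreal (1 / 2) * ((\<integral>\<^sup>+x. ennreal (\<bar>v x\<bar> powr p) \<partial>M)
            + (\<integral>\<^sup>+x. ennreal (\<bar>w x\<bar> powr p) \<partial>M))"
          by (subst nn_integral_cmult, measurable) (subst nn_integral_add, measurable)
        also have "\<dots> \<le> ennreal (1 / 2) * (ennreal (1 / real (Suc n)) + ennreal (1 / real (Suc n)))"
          using vw by (intro mult_left_mono add_mono) (auto simp: Cn_def)
        finally show ?thesis by (simp only: ennreal_half_add)
      qed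
      ultimately show "(\<lambda>x. (v x + w x) / 2) \<in> Cn n"
        unfolding Cn_def using S(4)[OF z(1) y(1)] by blast
    next
      fix v assume v: "v \<in> Cn 0"
      show "0 \<le> enn2real (limsup (\<lambda>k. scale_energy \<rho> k v))" by simp
      have "limsup (\<lambda>k. scale_energy \<rho> k v) \<le> ennreal K"
        using Cn_pair[OF v] se by (intro Limsup_bounded) auto
      then show "enn2real (limsup (\<lambda>k. scale_energy \<rho> k v)) \<le> K"
        by (intro enn2real_leI) (auto simp: K_def)
    next
      fix v w assume vw: "v \<in> Cn 0" "w \<in> Cn 0"
      obtain h where h: "sobolev_pair p (v, h)" "\<And>x. h x \<le> \<omega> x + \<omega> x" using Cn_pair[OF vw(1)] by blast
      obtain k where k: "sobolev_pair p (w, k)" "\<And>x. k x \<le> \<omega> x + \<omega> x" using Cn_pair[OF vw(2)] by blast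
      have L: "ball_integrable v" "ball_integrable w"
        by (rule ball_integrable_of_Lp[OF p_ge_1 sobolev_pairD(1,4)[OF h(1)]], rule
            ball_integrable_of_Lp[OF p_ge_1 sobolev_pairD(1,4)[OF k(1)]])
      show "enn2real (limsup (\<lambda>k. scale_energy \<rho> k (\<lambda>x. (v x + w x) / 2)))
          + enn2real (liminf (\<lambda>k. scale_energy \<rho> k (\<lambda>x. (v x - w x) / 2)))
        \<le> (enn2real (limsup (\<lambda>k. scale_energy \<rho> k v)) + enn2real (limsup (\<lambda>k. scale_energy \<rho> k w))) / 2"
        by (rule limsup_liminf_parallelogram[where K = K])
           (use scale_energy_clarkson[OF L] se[OF h] se[OF k] in auto)
    qed blast
    have vpair: "\<exists>h. sobolev_pair p (v n, h) \<and> (\<forall>x. h x \<le> \<omega> x + \<omega> x)" for n by (rule Cn_pair[OF v])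
    then obtain h where h: "\<And>n. sobolev_pair p (v n, h n)" "\<And>n x. h n x \<le> \<omega> x + \<omega> x" by metis
    have vm [measurable]: "v n \<in> borel_measurable borel" for n by (rule sobolev_pairD(1)[OF h(1)])
    have vsmall: "(\<integral>\<^sup>+x. ennreal (\<bar>v n x\<bar> powr p) \<partial>M) \<le> ennreal (1 / real (Suc n))" for n
      using v[of n] by (auto simp: Cn_def)
    have lim: "\<exists>N. \<forall>n\<ge>N. (\<integral>\<^sup>+x. ennreal (\<bar>v n x\<bar> powr p) \<partial>M) < ennreal e" if e: "0 < e" for e
    proof -
      obtain N where N: "1 / real (Suc N) < e" using nat_approx_posE[OF e] by blast
      have "(\<integral>\<^sup>+x. ennreal (\<bar>v n x\<bar> powr p) \<partial>M) < ennreal e" if "n \<ge> N" for n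
      proof -
        have "1 / real (Suc n) \<le> 1 / real (Suc N)" using that by (intro divide_left_mono) auto
        then have "1 / real (Suc n) < e" using N by linarith
        then have "ennreal (1 / real (Suc n)) < ennreal e" by (rule ennreal_lessI[OF e])
        then show ?thesis using vsmall[of n] by (rule le_less_trans[rotated])
      qed
      then show ?thesis by blast
    qed
    have cauchy: "\<exists>N. \<forall>n\<ge>N. \<forall>m\<ge>N. energy p (\<lambda>x. v n x - v m x) < ennreal e" if e: "0 < e" for e
    proof -
      \<comment> \<open>Doubling the half difference multiplies the energy by q = 2^p; the spare
        factor 4 leaves room for the strict inequality that \<open>energy_cmult\<close> asks
        for.\<close>
      have e': "0 < e / (4 * q)" using e q by simp
      obtain \<delta> where \<delta>: "0 < (\<delta>::real)"
        "\<And>v g. sobolev_pair p (v, g) \<Longrightarrow> (\<exists>\<^sub>F k in sequentially. scale_energy \<rho> k v < ennreal \<delta>) \<Longrightarrow>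
            energy p v \<le> ennreal (e / (4 * q))"
        using energy_small[OF \<rho>m \<rho>fin \<rho>pos e'] by blast
      obtain N where N: "\<And>n m. n \<ge> N \<Longrightarrow> m \<ge> N \<Longrightarrow>
          enn2real (liminf (\<lambda>k. scale_energy \<rho> k (\<lambda>x. (v n x - v m x) / 2))) < \<delta>"
        using vC[OF \<delta>(1)] by blast
      have "energy p (\<lambda>x. v n x - v m x) < ennreal e" if nm: "n \<ge> N" "m \<ge> N" for n m
      proof -
        let ?d = "\<lambda>x. (v n x - v m x) / 2"
        have eq: "?d = (\<lambda>x. 1/2 * v n x + (-1/2) * v m x)" by (auto simp: field_simps)
        have dp: "sobolev_pair p (?d, \<lambda>x. ennreal \<bar>1/2\<bar> * h n x + ennreal \<bar>-1/2\<bar> * h m x)"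
          unfolding eq by (rule sobolev_pair_combine[OF h(1) h(1)])
        have "ennreal \<bar>1/2\<bar> * h n x + ennreal \<bar>-1/2\<bar> * h m x \<le> \<omega> x + \<omega> x" for x
        proof -
          have "ennreal \<bar>1/2\<bar> * h n x + ennreal \<bar>-1/2\<bar> * h m x = ennreal (1/2) * (h n x + h m x)"
              by (simp add: distrib_left)
          also have "\<dots> \<le> ennreal (1/2) * ((\<omega> x + \<omega> x) + (\<omega> x + \<omega> x))"
              by (intro mult_left_mono add_mono h) simp
          finally show ?thesis by (simp only: ennreal_half_add)
        qed
        from se[OF dp this] have bd: "scale_energy \<rho> k ?d \<le> ennreal K" for k .
        have "liminf (\<lambda>k. scale_energy \<rho> k ?d) \<le> ennreal K"
          using Liminf_le_Limsup[of sequentially "\<lambda>k. scale_energy \<rho> k ?d"] Limsup_bounded[of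
              "\<lambda>k. scale_energy \<rho> k ?d" "ennreal K" sequentially] bd
          by (auto intro: order_trans)
        then have "liminf (\<lambda>k. scale_energy \<rho> k ?d) < top" by (rule le_less_trans) simp
        then have "liminf (\<lambda>k. scale_energy \<rho> k ?d)
            = ennreal (enn2real (liminf (\<lambda>k. scale_energy \<rho> k ?d)))" by simp
        also have "\<dots> < ennreal \<delta>" by (rule ennreal_lessI[OF \<delta>(1) N[OF nm]])
        finally have lt: "liminf (\<lambda>k. scale_energy \<rho> k ?d) < ennreal \<delta>" .
        have "\<exists>\<^sub>F k in sequentially. scale_energy \<rho> k ?d < ennreal \<delta>"
        proof (rule ccontr)
          assume "\<not> ?thesis"
          then have "eventually (\<lambda>k. ennreal \<delta> \<le> scale_energy \<rho> k ?d) sequentially"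
              by (simp add: not_frequently not_less)
          then have "ennreal \<delta> \<le> liminf (\<lambda>k. scale_energy \<rho> k ?d)" by (rule Liminf_bounded)
          then show False using lt by simp
        qed
        from \<delta>(2)[OF dp this] have "energy p ?d \<le> ennreal (e / (4 * q))" .
        also have "\<dots> < ennreal (e / (2 * q))" using e q by (intro ennreal_lessI) (auto simp: field_simps)
        finally have "energy p (\<lambda>x. 2 * ?d x) \<le> ennreal (\<bar>2\<bar> powr p) * ennreal (e / (2 * q))"
          by (intro energy_cmult) auto
        also have "\<dots> = ennreal (e / 2)" using e q by (simp add: q_def flip: ennreal_mult)
        also have "\<dots> < ennreal e" using e by (intro ennreal_lessI) auto
        also have "(\<lambda>x. 2 * ?d x) = (\<lambda>x. v n x - v m x)" by auto
        finally show ?thesis .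
      qed
      then show ?thesis by blast
    qed
    have "\<exists>N. \<forall>n\<ge>N. energy p (v n) \<le> ennreal (e / 2)"
      using e by (intro energy_tendsto_0[OF p_ge_1 vm sobolev_pairD(2)[OF h(1)] sobolev_pairD(5)[OF h(1)]
          lim cauchy]) auto
    then obtain N1 where N1: "\<And>n. n \<ge> N1 \<Longrightarrow> energy p (v n) \<le> ennreal (e / 2)" by blast
    obtain N2 where N2: "\<And>n. n \<ge> N2 \<Longrightarrow> (\<integral>\<^sup>+x. ennreal (\<bar>v n x\<bar> powr p) \<partial>M) < ennreal e" using lim[OF e]
        by blast
    let ?n = "max N1 N2"
    have "energy p (v ?n) < ennreal e"
      using N1[of ?n] e by (intro le_less_trans[OF _ ennreal_lessI[of e "e / 2"]]) auto
    moreover have "(\<integral>\<^sup>+x. ennreal (\<bar>v ?n x\<bar> powr p) \<partial>M) < ennreal e" by (rule N2) simp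
    moreover obtain z where "z \<in> S" "v ?n = (\<lambda>x. fst z x - u x)" using v[of ?n] by (auto simp: Cn_def)
    ultimately show "\<exists>z\<in>S. (\<integral>\<^sup>+x. ennreal (\<bar>fst z x - u x\<bar> powr p) \<partial>M) < ennreal e \<and> energy p (\<lambda>x. fst z x
        - u x) < ennreal e"
      by (intro bexI[of _ z]) auto
  qed
qed

end

section \<open>The Newtonian norm\<close>

lemma newtonian_norm_eq:
  assumes "0 < p"
  shows "newtonian_norm M p f = ennreal_rpow ((\<integral>\<^sup>+x. ennreal_rpow (e2ennreal \<bar>f x\<bar>) p \<partial>M) +
    (INF g\<in>{g. upper_gradient g f}. \<integral>\<^sup>+x. ennreal_rpow (g x) p \<partial>M)) (1 / p)"
  using assms by (simp add: newtonian_norm_def Lp_norm_def)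

lemma newtonian_norm_diff_commute:
  "newtonian_norm M p (\<lambda>x. u x - v x) = newtonian_norm M p (\<lambda>x. v x - u x)"
proof -
  have abs: "\<bar>u x - v x\<bar> = \<bar>v x - u x\<bar>" for x by (cases "u x"; cases "v x") auto
  have "\<bar>(u x - v x) - (u y - v y)\<bar> = \<bar>(v x - u x) - (v y - u y)\<bar>" for x y
    by (cases "u x"; cases "v x"; cases "u y"; cases "v y") auto
  then have "upper_gradient g (\<lambda>x. u x - v x) \<longleftrightarrow> upper_gradient g (\<lambda>x. v x - u x)" for g
    by (simp add: upper_gradient_def)
  then show ?thesis by (simp add: newtonian_norm_def abs)
qed

text \<open>An infinite value at one end makes the difference infinite by convention, which a finite
  integral excludes.\<close>

lemma upper_gradient_infinite:
  assumes g: "upper_gradient g u" and \<gamma>: "nonconst_rectifiable_curve \<gamma> a b" and fin: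
      "curve_integral \<gamma> a b g \<noteq> top"
  shows "\<bar>u (\<gamma> a)\<bar> \<noteq> \<infinity>" "\<bar>u (\<gamma> b)\<bar> \<noteq> \<infinity>"
proof -
  have "e2ennreal \<bar>u (\<gamma> a) - u (\<gamma> b)\<bar> \<noteq> top"
    using g \<gamma> fin by (metis upper_gradient_def top_unique)
  then have "\<bar>u (\<gamma> a) - u (\<gamma> b)\<bar> \<noteq> \<infinity>" by (metis e2ennreal_infty infinity_ennreal_def)
  then show "\<bar>u (\<gamma> a)\<bar> \<noteq> \<infinity>" "\<bar>u (\<gamma> b)\<bar> \<noteq> \<infinity>"
    using ereal_abs_diff_convention[of "u (\<gamma> a)" "u (\<gamma> b)"] by auto
qed

lemma curve_integral_add:
  assumes "nonconst_rectifiable_curve \<gamma> a b" "g \<in> borel_measurable borel" "h \<in> borel_measurable borel"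
  shows "curve_integral \<gamma> a b (\<lambda>x. g x + h x) = curve_integral \<gamma> a b g + curve_integral \<gamma> a b h"
  unfolding curve_integral_eq_line_integral by (rule line_integral_add) (use assms in auto)

lemma curve_integral_cmult:
  assumes "nonconst_rectifiable_curve \<gamma> a b" "g \<in> borel_measurable borel"
  shows "curve_integral \<gamma> a b (\<lambda>x. c * g x) = c * curve_integral \<gamma> a b g"
  unfolding curve_integral_eq_line_integral by (rule line_integral_cmult) (use assms in auto)

lemma e2ennreal_abs_ereal [simp]: "e2ennreal \<bar>ereal x\<bar> = ennreal \<bar>x\<bar>"
  by simp

context borel_measure
begin

text \<open>The l^p combination of two L^p norms; the Newtonian norm is its infimum over upper
  gradients in the second slot.\<close>

definition pair_norm :: "real \<Rightarrow> ('a \<Rightarrow> ennreal) \<Rightarrow> ('a \<Rightarrow> ennreal) \<Rightarrow> ennreal" where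
  "pair_norm p f g = ennreal_rpow ((\<integral>\<^sup>+x. ennreal_rpow (f x) p \<partial>M) + (\<integral>\<^sup>+x. ennreal_rpow (g x) p \<partial>M))
      (1 / p)"

text \<open>Minkowski's inequality for both slots together: the weights of
  \<open>rpow_add_le_weighted\<close> depend only on the total norms, so the same weights serve both
  integrals.\<close>

lemma pair_norm_triangle:
  assumes p: "1 \<le> p" and m [measurable]: "f \<in> borel_measurable borel" "g \<in> borel_measurable borel"
    "f' \<in> borel_measurable borel" "g' \<in> borel_measurable borel"
  shows "pair_norm p (\<lambda>x. f x + f' x) (\<lambda>x. g x + g' x) \<le> pair_norm p f g + pair_norm p f' g'"
proof (cases "pair_norm p f g = top \<or> pair_norm p f' g' = top")
  case True
  then show ?thesis by auto
next
  case False
  define N where "N f g = (\<integral>\<^sup>+x. ennreal_rpow (f x) p \<partial>M) + (\<integral>\<^sup>+x. ennreal_rpow (g x) p \<partial>M)" for f g ::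
      "'a \<Rightarrow> ennreal"
  obtain A where A: "0 \<le> A" "pair_norm p f g = ennreal A" using False by (cases "pair_norm p f g") auto
  obtain B where B: "0 \<le> B" "pair_norm p f' g' = ennreal B" using False by (cases "pair_norm p f' g'") auto
  have NA: "N f g = ennreal (A powr p)"
  proof -
    have "N f g = ennreal_rpow (pair_norm p f g) p" using p by (simp add: pair_norm_def N_def)
    then show ?thesis using A by simp
  qed
  have NB: "N f' g' = ennreal (B powr p)"
  proof -
    have "N f' g' = ennreal_rpow (pair_norm p f' g') p" using p by (simp add: pair_norm_def N_def)
    then show ?thesis using B by simp
  qed
  have le_e: "pair_norm p (\<lambda>x. f x + f' x) (\<lambda>x. g x + g' x) \<le> ennreal (A + B) + ennreal e" if e: "0 < e"
      for e
  proof -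
    \<comment> \<open>The weights must be positive although the norms may vanish, hence the added e
      / 2.\<close>
    define \<alpha> where "\<alpha> = A + e / 2"
    define \<beta> where "\<beta> = B + e / 2"
    have pos: "0 < \<alpha>" "0 < \<beta>" "A \<le> \<alpha>" "B \<le> \<beta>" using A B e by (auto simp: \<alpha>_def \<beta>_def)
    define c1 where "c1 = (\<alpha> + \<beta>) powr (p - 1) * \<alpha> powr (1 - p)"
    define c2 where "c2 = (\<alpha> + \<beta>) powr (p - 1) * \<beta> powr (1 - p)"
    have c: "0 \<le> c1" "0 \<le> c2" by (auto simp: c1_def c2_def)
    have one: "(\<integral>\<^sup>+x. ennreal_rpow (h x + h' x) p \<partial>M) \<le> ennreal c1 * (\<integral>\<^sup>+x. ennreal_rpow (h x) p \<partial>M)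
        + ennreal c2 * (\<integral>\<^sup>+x. ennreal_rpow (h' x) p \<partial>M)"
      if [measurable]: "h \<in> borel_measurable borel" "h' \<in> borel_measurable borel" for h h'
    proof -
      have "(\<integral>\<^sup>+x. ennreal_rpow (h x + h' x) p \<partial>M) \<le> (\<integral>\<^sup>+x. ennreal c1 * ennreal_rpow (h x) p + ennreal c2
          * ennreal_rpow (h' x) p \<partial>M)"
        unfolding c1_def c2_def by (intro nn_integral_mono rpow_add_le_weighted p pos)
      also have "\<dots> = ennreal c1 * (\<integral>\<^sup>+x. ennreal_rpow (h x) p \<partial>M) + ennreal c2
          * (\<integral>\<^sup>+x. ennreal_rpow (h' x) p \<partial>M)"
        by (simp add: nn_integral_add nn_integral_cmult)
      finally show ?thesis .
    qed
    have "N (\<lambda>x. f x + f' x) (\<lambda>x. g x + g' x)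
       \<le> (ennreal c1 * (\<integral>\<^sup>+x. ennreal_rpow (f x) p \<partial>M) + ennreal c2 * (\<integral>\<^sup>+x. ennreal_rpow (f' x) p \<partial>M))
        + (ennreal c1 * (\<integral>\<^sup>+x. ennreal_rpow (g x) p \<partial>M) + ennreal c2 * (\<integral>\<^sup>+x. ennreal_rpow (g' x) p \<partial>M))"
      unfolding N_def by (intro add_mono one m)
    also have "\<dots> = ennreal c1 * N f g + ennreal c2 * N f' g'"
      by (simp add: N_def distrib_left add_ac)
    also have "\<dots> = ennreal (c1 * A powr p) + ennreal (c2 * B powr p)"
      unfolding NA NB using c by (simp add: ennreal_mult)
    also have "\<dots> = ennreal (c1 * A powr p + c2 * B powr p)"
      using c by (intro ennreal_plus[symmetric]) auto
    also have "\<dots> \<le> ennreal (c1 * \<alpha> powr p + c2 * \<beta> powr p)"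
      using c pos A B p by (intro ennreal_leI add_mono mult_left_mono powr_mono2) auto
    also have "c1 * \<alpha> powr p + c2 * \<beta> powr p = (\<alpha> + \<beta>) powr (p - 1) * (\<alpha> + \<beta>)"
    proof -
      have "\<alpha> powr (1 - p) * \<alpha> powr p = \<alpha>" "\<beta> powr (1 - p) * \<beta> powr p = \<beta>"
        using pos by (simp_all add: powr_add[symmetric])
      then show ?thesis unfolding c1_def c2_def by (simp add: mult.assoc distrib_left)
    qed
    also have "\<dots> = (\<alpha> + \<beta>) powr p" using pos powr_mult_base[of "\<alpha> + \<beta>" "p - 1"] by (simp add: mult.commute)
    also have "ennreal ((\<alpha> + \<beta>) powr p) = ennreal_rpow (ennreal (\<alpha> + \<beta>)) p"
      by (rule rpow_ennreal[symmetric]) (use pos in simp)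
    finally have "N (\<lambda>x. f x + f' x) (\<lambda>x. g x + g' x) \<le> ennreal_rpow (ennreal (\<alpha> + \<beta>)) p" .
    then have "pair_norm p (\<lambda>x. f x + f' x) (\<lambda>x. g x + g' x)
        \<le> ennreal_rpow (ennreal_rpow (ennreal (\<alpha> + \<beta>)) p) (1 / p)"
      unfolding pair_norm_def N_def using p by (intro rpow_mono) auto
    also have "\<dots> = ennreal (\<alpha> + \<beta>)" by (rule rpow_inverse(2)) (use p in simp)
    also have "\<dots> = ennreal (A + B + e)" by (simp add: \<alpha>_def \<beta>_def add_ac)
    also have "\<dots> = ennreal (A + B) + ennreal e" using A B e by (intro ennreal_plus) auto
    finally show ?thesis .
  qed
  have "pair_norm p (\<lambda>x. f x + f' x) (\<lambda>x. g x + g' x) \<le> ennreal (A + B)"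
    by (rule ennreal_le_epsilon, rule le_e)
  then show ?thesis using A B by (simp add: ennreal_plus)
qed

lemma newtonian_norm_le_pair_norm:
  assumes p: "1 \<le> p" and g: "upper_gradient g f"
  shows "newtonian_norm M p f \<le> pair_norm p (\<lambda>x. e2ennreal \<bar>f x\<bar>) g"
proof -
  have "(INF g\<in>{g. upper_gradient g f}. \<integral>\<^sup>+x. ennreal_rpow (g x) p \<partial>M) \<le> (\<integral>\<^sup>+x. ennreal_rpow (g x) p \<partial>M)"
    by (rule INF_lower) (use g in simp)
  then show ?thesis
    using p by (simp add: newtonian_norm_eq pair_norm_def rpow_mono add_left_mono)
qed

text \<open>The infimum sits inside a sum and a power; inverting the power and subtracting the first
  integral, if finite, brings it outside.\<close>

lemma newtonian_norm_greatest:
  assumes p: "1 \<le> p" and le: "\<And>g. upper_gradient g f \<Longrightarrow> X \<le> pair_norm p (\<lambda>x. e2ennreal \<bar>f x\<bar>) g"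
  shows "X \<le> newtonian_norm M p f"
proof -
  let ?a = "\<integral>\<^sup>+x. ennreal_rpow (e2ennreal \<bar>f x\<bar>) p \<partial>M"
  have p0: "0 < p" using p by simp
  have "ennreal_rpow X p \<le> ?a + (INF g\<in>{g. upper_gradient g f}. \<integral>\<^sup>+x. ennreal_rpow (g x) p \<partial>M)"
  proof (cases "?a = top")
    case False
    have "ennreal_rpow X p - ?a \<le> (INF g\<in>{g. upper_gradient g f}. \<integral>\<^sup>+x. ennreal_rpow (g x) p \<partial>M)"
    proof (rule INF_greatest)
      fix g assume "g \<in> {g. upper_gradient g f}"
      then have "X \<le> pair_norm p (\<lambda>x. e2ennreal \<bar>f x\<bar>) g" using le by simp
      then have "ennreal_rpow X p \<le> ?a + (\<integral>\<^sup>+x. ennreal_rpow (g x) p \<partial>M)"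
        unfolding rpow_le_iff[OF p0] pair_norm_def .
      then show "ennreal_rpow X p - ?a \<le> (\<integral>\<^sup>+x. ennreal_rpow (g x) p \<partial>M)"
        using False by (simp add: ennreal_minus_le_iff)
    qed
    then show ?thesis using False by (simp add: ennreal_minus_le_iff)
  qed simp
  then show ?thesis unfolding rpow_le_iff[OF p0] newtonian_norm_eq[OF p0] .
qed

lemma newtonian_norm_finiteD:
  assumes p: "1 \<le> p" and fin: "newtonian_norm M p f < \<infinity>"
  obtains g where "upper_gradient g f" "(\<integral>\<^sup>+x. ennreal_rpow (g x) p \<partial>M) < \<infinity>"
      "(\<integral>\<^sup>+x. ennreal_rpow (e2ennreal \<bar>f x\<bar>) p \<partial>M) < \<infinity>"
proof -
  have *: "(\<integral>\<^sup>+x. ennreal_rpow (e2ennreal \<bar>f x\<bar>) p \<partial>M) + (INF g\<in>{g. upper_gradient g f}. \<integral>\<^sup>+x.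
      ennreal_rpow (g x) p \<partial>M) < \<infinity>"
    using p fin by (simp add: newtonian_norm_eq)
  then have "(INF g\<in>{g. upper_gradient g f}. \<integral>\<^sup>+x. ennreal_rpow (g x) p \<partial>M) < \<infinity>" by (auto simp: less_top)
  then obtain g where "upper_gradient g f" "(\<integral>\<^sup>+x. ennreal_rpow (g x) p \<partial>M) < \<infinity>"
      by (auto simp: INF_less_iff)
  then show thesis using * by (intro that) auto
qed

text \<open>Adding \<epsilon> * \<open>g0\<close> to an upper gradient of f makes it one of f',
  because a curve with an end where the functions differ has infinite integral of \<open>g0\<close>.
  The cost is \<epsilon> times the norm of \<open>g0\<close>, with \<epsilon> arbitrary.\<close>

lemma newtonian_norm_change_le:
  assumes p: "1 \<le> p" and [measurable]: "f \<in> borel_measurable borel" "f' \<in> borel_measurable borel"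
    and g0 [measurable]: "g0 \<in> borel_measurable borel" and fin: "(\<integral>\<^sup>+x. ennreal_rpow (g0 x) p \<partial>M) < \<infinity>"
    and AE: "AE x in M. f x = f' x"
    and eq: "\<And>\<gamma> a b. nonconst_rectifiable_curve \<gamma> a b \<Longrightarrow> curve_integral \<gamma> a b g0 \<noteq> top \<Longrightarrow>
        f (\<gamma> a) = f' (\<gamma> a) \<and> f (\<gamma> b) = f' (\<gamma> b)"
  shows "newtonian_norm M p f' \<le> newtonian_norm M p f"
proof (rule newtonian_norm_greatest[OF p])
  fix g assume g: "upper_gradient g f"
  then have [measurable]: "g \<in> borel_measurable borel" by (simp add: upper_gradient_def)
  obtain K where K: "0 \<le> K" "pair_norm p (\<lambda>x. 0) g0 = ennreal K"
    using fin by (cases "pair_norm p (\<lambda>x. 0) g0") (auto simp: pair_norm_def)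
  have le_e: "newtonian_norm M p f' \<le> pair_norm p (\<lambda>x. e2ennreal \<bar>f x\<bar>) g + ennreal e" if e: "0 < e" for e
  proof -
    define \<epsilon> where "\<epsilon> = e / (K + 1)"
    have \<epsilon>: "0 < \<epsilon>" "\<epsilon> * K \<le> e" using e K by (auto simp: \<epsilon>_def field_simps)
    have "upper_gradient (\<lambda>x. g x + ennreal \<epsilon> * g0 x) f'"
      unfolding upper_gradient_def
    proof (intro conjI allI impI)
      fix \<gamma> :: "real \<Rightarrow> 'a" and a b assume \<gamma>: "nonconst_rectifiable_curve \<gamma> a b"
      have ci: "curve_integral \<gamma> a b (\<lambda>x. g x + ennreal \<epsilon> * g0 x) = curve_integral \<gamma> a b g + ennreal \<epsilon>
          * curve_integral \<gamma> a b g0"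
        by (simp add: curve_integral_add[OF \<gamma>] curve_integral_cmult[OF \<gamma>])
      show "e2ennreal \<bar>f' (\<gamma> a) - f' (\<gamma> b)\<bar> \<le> curve_integral \<gamma> a b (\<lambda>x. g x + ennreal \<epsilon> * g0 x)"
      proof (cases "curve_integral \<gamma> a b g0 = top")
        case True
        then show ?thesis using \<epsilon> by (simp add: ci ennreal_mult_top)
      next
        case False
        have "e2ennreal \<bar>f (\<gamma> a) - f (\<gamma> b)\<bar> \<le> curve_integral \<gamma> a b g"
          using g \<gamma> by (metis upper_gradient_def)
        then have "e2ennreal \<bar>f' (\<gamma> a) - f' (\<gamma> b)\<bar> \<le> curve_integral \<gamma> a b g"
          using eq[OF \<gamma> False] by simp
        also have "\<dots> \<le> curve_integral \<gamma> a b g + ennreal \<epsilon> * curve_integral \<gamma> a b g0" by simp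
        finally show ?thesis unfolding ci .
      qed
    qed measurable
    then have "newtonian_norm M p f' \<le> pair_norm p (\<lambda>x. e2ennreal \<bar>f' x\<bar>) (\<lambda>x. g x + ennreal \<epsilon> * g0 x)"
      by (rule newtonian_norm_le_pair_norm[OF p])
    also have "pair_norm p (\<lambda>x. e2ennreal \<bar>f' x\<bar>) (\<lambda>x. g x + ennreal \<epsilon> * g0 x)
        = pair_norm p (\<lambda>x. e2ennreal \<bar>f x\<bar> + 0) (\<lambda>x. g x + ennreal \<epsilon> * g0 x)"
      unfolding pair_norm_def
      by (intro arg_cong2[where f = ennreal_rpow] arg_cong2[where f = "(+)"] nn_integral_cong_AE refl)
         (use AE in eventually_elim, simp)
    also have "\<dots> \<le> pair_norm p (\<lambda>x. e2ennreal \<bar>f x\<bar>) g + pair_norm p (\<lambda>x. 0) (\<lambda>x. ennreal \<epsilon> * g0 x)"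
      by (rule pair_norm_triangle[OF p]) measurable
    also have "pair_norm p (\<lambda>x. 0) (\<lambda>x. ennreal \<epsilon> * g0 x) = ennreal \<epsilon> * pair_norm p (\<lambda>x. 0) g0"
      using p \<epsilon> by (simp add: pair_norm_def rpow_mult nn_integral_cmult powr_powr)
    also have "\<dots> \<le> ennreal e" using K \<epsilon> by (simp add: ennreal_leI flip: ennreal_mult)
    finally show ?thesis by (simp add: add_left_mono)
  qed
  show "newtonian_norm M p f' \<le> pair_norm p (\<lambda>x. e2ennreal \<bar>f x\<bar>) g"
    by (rule ennreal_le_epsilon, rule le_e)
qed

definition real_norm :: "real \<Rightarrow> ('a \<Rightarrow> real) \<Rightarrow> ennreal" where
  "real_norm p f = newtonian_norm M p (\<lambda>x. ereal (f x))"

lemma real_norm_triangle: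
  assumes p: "1 \<le> p" and [measurable]: "f \<in> borel_measurable borel" "h \<in> borel_measurable borel"
  shows "real_norm p (\<lambda>x. f x + h x) \<le> real_norm p f + real_norm p h"
proof -
  have key: "real_norm p (\<lambda>x. f x + h x) \<le> pair_norm p (\<lambda>x. ennreal \<bar>f x\<bar>) g1 + pair_norm p (\<lambda>x.
      ennreal \<bar>h x\<bar>) g2"
    if g: "real_upper_gradient g1 f" "real_upper_gradient g2 h" for g1 g2
  proof -
    note [measurable] = real_upper_gradientD(1)[OF g(1)] real_upper_gradientD(1)[OF g(2)]
    have "upper_gradient (\<lambda>x. g1 x + g2 x) (\<lambda>x. ereal (f x + h x))"
      using real_upper_gradient_add[OF g] unfolding real_upper_gradient_iff .
    then have "real_norm p (\<lambda>x. f x + h x) \<le> pair_norm p (\<lambda>x. e2ennreal \<bar>ereal (f x + h x)\<bar>) (\<lambda>x. g1 x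
        + g2 x)"
      unfolding real_norm_def by (rule newtonian_norm_le_pair_norm[OF p])
    also have "\<dots> \<le> pair_norm p (\<lambda>x. ennreal \<bar>f x\<bar> + ennreal \<bar>h x\<bar>) (\<lambda>x. g1 x + g2 x)"
      unfolding pair_norm_def
    proof (intro rpow_mono add_right_mono nn_integral_mono)
      fix x
      show "e2ennreal \<bar>ereal (f x + h x)\<bar> \<le> ennreal \<bar>f x\<bar> + ennreal \<bar>h x\<bar>"
        unfolding e2ennreal_abs_ereal using ennreal_leI[OF abs_triangle_ineq[of "f x" "h x"]]
        by (subst ennreal_plus[symmetric]) (simp_all del: ennreal_plus)
    qed (use p in auto)
    also have "\<dots> \<le> pair_norm p (\<lambda>x. ennreal \<bar>f x\<bar>) g1 + pair_norm p (\<lambda>x. ennreal \<bar>h x\<bar>) g2"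
      by (rule pair_norm_triangle[OF p]) measurable
    finally show ?thesis .
  qed
  show ?thesis
  proof (cases "real_norm p f = top")
    case True
    then show ?thesis by simp
  next
    case False
    \<comment> \<open>The two infima are removed one at a time, each after subtracting the other,
      finite, term.\<close>
    have "real_norm p (\<lambda>x. f x + h x) - real_norm p f \<le> real_norm p h"
      unfolding real_norm_def[of p h]
    proof (rule newtonian_norm_greatest[OF p])
      fix g2 assume g2: "upper_gradient g2 (\<lambda>x. ereal (h x))"
      let ?B = "pair_norm p (\<lambda>x. ennreal \<bar>h x\<bar>) g2"
      show "real_norm p (\<lambda>x. f x + h x) - real_norm p f \<le> pair_norm p (\<lambda>x. e2ennreal \<bar>ereal (h x)\<bar>) g2"
      proof (cases "?B = top")
        case B: False
        have "real_norm p (\<lambda>x. f x + h x) - ?B \<le> real_norm p f"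
          unfolding real_norm_def[of p f]
        proof (rule newtonian_norm_greatest[OF p])
          fix g1 assume g1: "upper_gradient g1 (\<lambda>x. ereal (f x))"
          show "real_norm p (\<lambda>x. f x + h x) - ?B \<le> pair_norm p (\<lambda>x. e2ennreal \<bar>ereal (f x)\<bar>) g1"
            using key[of g1 g2] g1 g2 B
                by (simp add: real_upper_gradient_iff ennreal_minus_le_iff add.commute)
        qed
        then show ?thesis using False B by (simp add: ennreal_minus_le_iff add.commute)
      qed simp
    qed
    then show ?thesis using False by (simp add: ennreal_minus_le_iff)
  qed
qed

lemma real_norm_zero: "1 \<le> p \<Longrightarrow> real_norm p (\<lambda>x. 0) = 0"
proof -
  assume p: "1 \<le> p"
  have "upper_gradient (\<lambda>x. 0) (\<lambda>x::'a. ereal 0)" unfolding real_upper_gradient_iff[symmetric]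
      by (simp add: real_upper_gradient_def)
  from newtonian_norm_le_pair_norm[OF p this] show ?thesis
    by (simp add: real_norm_def pair_norm_def)
qed

lemma finite_points:
  assumes p: "1 \<le> p" and u: "u \<in> borel_measurable borel" "newtonian_norm M p u < \<infinity>"
  obtains g where "upper_gradient g u" "g \<in> borel_measurable borel" "(\<integral>\<^sup>+x. ennreal_rpow (g x) p \<partial>M) < \<infinity>"
      "AE x in M. \<bar>u x\<bar> \<noteq> \<infinity>"
    "(\<integral>\<^sup>+x. ennreal (\<bar>real_of_ereal (u x)\<bar> powr p) \<partial>M) < \<infinity>"
proof -
  note [measurable] = u(1)
  obtain g where g: "upper_gradient g u" "(\<integral>\<^sup>+x. ennreal_rpow (g x) p \<partial>M) < \<infinity>"
      "(\<integral>\<^sup>+x. ennreal_rpow (e2ennreal \<bar>u x\<bar>) p \<partial>M) < \<infinity>"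
    by (rule newtonian_norm_finiteD[OF p u(2)])
  have "AE x in M. ennreal_rpow (e2ennreal \<bar>u x\<bar>) p \<noteq> \<infinity>"
    using g(3) by (intro nn_integral_PInf_AE) auto
  then have AE: "AE x in M. \<bar>u x\<bar> \<noteq> \<infinity>" by eventually_elim auto
  have "(\<integral>\<^sup>+x. ennreal (\<bar>real_of_ereal (u x)\<bar> powr p) \<partial>M) = (\<integral>\<^sup>+x. ennreal_rpow (e2ennreal \<bar>u x\<bar>) p \<partial>M)"
  proof (rule nn_integral_cong_AE)
    show "AE x in M. ennreal (\<bar>real_of_ereal (u x)\<bar> powr p) = ennreal_rpow (e2ennreal \<bar>u x\<bar>) p"
      using AE
    proof eventually_elim
      case (elim x)
      then obtain r where "u x = ereal r" by (cases "u x") auto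
      then show ?case by simp
    qed
  qed
  then show thesis using g AE by (intro that[of g]) (auto simp: upper_gradient_def)
qed

text \<open>Both readings of the difference agree where u and v are finite. That is the case almost
  everywhere, and at the ends of each curve along which g + h has a finite integral.\<close>

lemma newtonian_norm_diff_eq:
  assumes p: "1 \<le> p" and u: "u \<in> borel_measurable borel" "newtonian_norm M p u < \<infinity>"
    and v: "v \<in> borel_measurable borel" "newtonian_norm M p v < \<infinity>"
  shows "newtonian_norm M p (\<lambda>x. u x - v x) = real_norm p (\<lambda>x. real_of_ereal (u x) - real_of_ereal (v x))"
proof -
  note [measurable] = u(1) v(1)
  obtain g where g: "upper_gradient g u" and gm [measurable]: "g \<in> borel_measurable borel" and gf:
      "(\<integral>\<^sup>+x. ennreal_rpow (g x) p \<partial>M) < \<infinity>" "AE x in M. \<bar>u x\<bar> \<noteq> \<infinity>"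
    by (rule finite_points[OF p u])
  obtain h where h: "upper_gradient h v" and hm [measurable]: "h \<in> borel_measurable borel" and hf:
      "(\<integral>\<^sup>+x. ennreal_rpow (h x) p \<partial>M) < \<infinity>" "AE x in M. \<bar>v x\<bar> \<noteq> \<infinity>"
    by (rule finite_points[OF p v])
  let ?f = "\<lambda>x. u x - v x" and ?f' = "\<lambda>x. ereal (real_of_ereal (u x) - real_of_ereal (v x))" and ?g =
      "\<lambda>x. g x + h x"
  have fin: "(\<integral>\<^sup>+x. ennreal_rpow (?g x) p \<partial>M) < \<infinity>"
    using rpow_integral_finite[OF _ gm hm gf(1) hf(1), of 1 1] p by simp
  have pt: "?f x = ?f' x" if "\<bar>u x\<bar> \<noteq> \<infinity>" "\<bar>v x\<bar> \<noteq> \<infinity>" for x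
    using that by (cases "u x"; cases "v x") auto
  have AE: "AE x in M. ?f x = ?f' x" using gf(2) hf(2) by eventually_elim (rule pt)
  have eq: "?f (\<gamma> a) = ?f' (\<gamma> a) \<and> ?f (\<gamma> b) = ?f' (\<gamma> b)"
    if \<gamma>: "nonconst_rectifiable_curve \<gamma> a b" and "curve_integral \<gamma> a b ?g \<noteq> top" for \<gamma> a b
  proof -
    have "curve_integral \<gamma> a b g \<noteq> top" "curve_integral \<gamma> a b h \<noteq> top"
      using that(2) by (auto simp: curve_integral_add[OF \<gamma> gm hm])
    then show ?thesis
      using upper_gradient_infinite[OF g \<gamma>] upper_gradient_infinite[OF h \<gamma>] by (intro conjI pt) auto
  qed
  have m: "?f \<in> borel_measurable borel" "?f' \<in> borel_measurable borel" "?g \<in> borel_measurable borel"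
      by measurable
  show ?thesis
    unfolding real_norm_def
  proof (rule antisym)
    show "newtonian_norm M p ?f \<le> newtonian_norm M p ?f'"
      by (rule newtonian_norm_change_le[OF p m(2,1,3) fin]) (use AE eq in \<open>auto simp: eq_commute\<close>)
    show "newtonian_norm M p ?f' \<le> newtonian_norm M p ?f"
      by (rule newtonian_norm_change_le[OF p m(1,2,3) fin AE eq])
  qed
qed

end

section \<open>Separability\<close>

text \<open>By the triangle inequality \<delta> is unchanged when its arguments move within their
  classes, so chosen representatives compute a metric on the quotient, and the classes of D are
  dense because D is.\<close>

lemma separable_pseudometric_quotient:
  fixes \<delta> :: "'f \<Rightarrow> 'f \<Rightarrow> ennreal" and F :: "'f set"
  defines "rel \<equiv> {(u, v). u \<in> F \<and> v \<in> F \<and> \<delta> u v = 0}"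
  defines "d \<equiv> \<lambda>U V. enn2real (\<delta> (SOME u. u \<in> U) (SOME v. v \<in> V))"
  assumes sym: "\<And>u v. \<delta> u v = \<delta> v u"
    and refl: "\<And>u. u \<in> F \<Longrightarrow> \<delta> u u = 0"
    and fin: "\<And>u v. u \<in> F \<Longrightarrow> v \<in> F \<Longrightarrow> \<delta> u v < \<infinity>"
    and tri: "\<And>u v w. u \<in> F \<Longrightarrow> v \<in> F \<Longrightarrow> w \<in> F \<Longrightarrow> \<delta> u w \<le> \<delta> u v + \<delta> v w"
    and D: "countable D" "D \<subseteq> F" "\<And>u r. u \<in> F \<Longrightarrow> 0 < r \<Longrightarrow> \<exists>z\<in>D. \<delta> u z < ennreal r"
  shows "separable_space (Metric_space.mtopology (F // rel) d)"
proof -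
  have eqv: "equiv F rel"
  proof (rule equivI)
    show "rel \<subseteq> F \<times> F" by (auto simp: rel_def)
    show "refl_on F rel" by (auto simp: refl_on_def rel_def refl)
    show "sym rel" by (auto simp: sym_def rel_def sym)
    show "trans rel"
    proof (rule transI)
      fix u v w assume "(u, v) \<in> rel" "(v, w) \<in> rel"
      then show "(u, w) \<in> rel" using tri[of u v w] by (auto simp: rel_def)
    qed
  qed
  have rep: "(SOME u. u \<in> U) \<in> F \<and> U = rel `` {SOME u. u \<in> U}" if U: "U \<in> F // rel" for U
  proof -
    obtain u where u: "u \<in> F" "U = rel `` {u}" using U by (auto simp: quotient_def)
    then have "u \<in> U" using equiv_class_self[OF eqv] by auto
    then have s: "(SOME u. u \<in> U) \<in> U" by (rule someI)
    then have w: "(u, SOME u. u \<in> U) \<in> rel" using u by auto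
    then have "(SOME u. u \<in> U) \<in> F" unfolding rel_def by blast
    moreover have "U = rel `` {SOME u. u \<in> U}" using equiv_class_eq[OF eqv w] u(2) by (rule trans[rotated])
    ultimately show ?thesis ..
  qed
  have cong: "\<delta> u v = \<delta> u' v'" if "(u, u') \<in> rel" "(v, v') \<in> rel" for u v u' v'
  proof (rule antisym)
    have F: "u \<in> F" "u' \<in> F" "v \<in> F" "v' \<in> F" and z: "\<delta> u u' = 0" "\<delta> v v' = 0" using that
        by (auto simp: rel_def)
    have "\<delta> u v \<le> \<delta> u u' + (\<delta> u' v' + \<delta> v' v)"
      using tri[OF F(1,2,3)] tri[OF F(2,4,3)] by (meson add_left_mono order_trans)
    then show "\<delta> u v \<le> \<delta> u' v'" using z sym[of v' v] by simp
    have "\<delta> u' v' \<le> \<delta> u' u + (\<delta> u v + \<delta> v v')"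
      using tri[OF F(2,1,4)] tri[OF F(1,3,4)] by (meson add_left_mono order_trans)
    then show "\<delta> u' v' \<le> \<delta> u v" using z sym[of u' u] by simp
  qed
  interpret Metric_space "F // rel" d
  proof
    show "0 \<le> d U V" for U V by (simp add: d_def)
    show "d U V = d V U" for U V unfolding d_def by (subst sym) simp
  next
    fix U V assume UV: "U \<in> F // rel" "V \<in> F // rel"
    let ?u = "SOME u. u \<in> U" and ?v = "SOME v. v \<in> V"
    have "d U V = 0 \<longleftrightarrow> \<delta> ?u ?v = 0"
      unfolding d_def using fin[of ?u ?v] rep[OF UV(1)] rep[OF UV(2)] by (auto simp: enn2real_eq_0_iff)
    also have "\<dots> \<longleftrightarrow> (?u, ?v) \<in> rel" using rep[OF UV(1)] rep[OF UV(2)] by (simp add: rel_def)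
    also have "\<dots> \<longleftrightarrow> rel `` {?u} = rel `` {?v}"
      using rep[OF UV(1)] rep[OF UV(2)] eq_equiv_class_iff[OF eqv, of ?u ?v] by auto
    also have "\<dots> \<longleftrightarrow> U = V" using rep[OF UV(1)] rep[OF UV(2)] by metis
    finally show "d U V = 0 \<longleftrightarrow> U = V" .
  next
    fix U V W assume UVW: "U \<in> F // rel" "V \<in> F // rel" "W \<in> F // rel"
    let ?u = "SOME u. u \<in> U" and ?v = "SOME v. v \<in> V" and ?w = "SOME w. w \<in> W"
    have F: "?u \<in> F" "?v \<in> F" "?w \<in> F" using rep UVW by blast+
    have "enn2real (\<delta> ?u ?w) \<le> enn2real (\<delta> ?u ?v + \<delta> ?v ?w)"
      using fin[OF F(1,2)] fin[OF F(2,3)] by (intro enn2real_mono tri F) auto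
    also have "\<dots> = enn2real (\<delta> ?u ?v) + enn2real (\<delta> ?v ?w)"
      using fin[OF F(1,2)] fin[OF F(2,3)] by (intro enn2real_plus) auto
    finally show "d U W \<le> d U V + d V W" by (simp add: d_def)
  qed
  define C where "C = (\<lambda>z. rel `` {z}) ` D"
  have CF: "C \<subseteq> F // rel" using D(2) by (auto simp: C_def intro: quotientI)
  show ?thesis
    unfolding separable_space_def
  proof (intro exI[of _ C] conjI)
    show "countable C" unfolding C_def using D(1) by (rule countable_image)
    show "C \<subseteq> topspace mtopology" using CF by simp
    show "mtopology closure_of C = topspace mtopology"
    proof (intro antisym closure_of_subset_topspace subsetI)
      fix U assume "U \<in> topspace mtopology"
      then have U: "U \<in> F // rel" by simp
      let ?u = "SOME u. u \<in> U"
      show "U \<in> mtopology closure_of C"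
        unfolding in_closure_of
      proof (intro conjI allI impI)
        show "U \<in> topspace mtopology" using U by simp
        fix T assume "U \<in> T \<and> openin mtopology T"
        then obtain r where r: "0 < r" "mball U r \<subseteq> T" by (auto simp: openin_mtopology)
        obtain z where z: "z \<in> D" "\<delta> ?u z < ennreal r" using D(3)[of ?u r] rep[OF U] r by blast
        let ?Z = "rel `` {z}"
        have Z: "?Z \<in> F // rel" using z CF by (auto simp: C_def)
        have zF: "z \<in> F" using z(1) D(2) by blast
        have "(z, SOME v. v \<in> ?Z) \<in> rel"
          using eq_equiv_class_iff[OF eqv zF conjunct1[OF rep[OF Z]]] conjunct2[OF rep[OF Z]]
              by (rule iffD1)
        moreover have "(?u, ?u) \<in> rel" using rep[OF U] refl by (auto simp: rel_def)
        ultimately have "\<delta> ?u z = \<delta> ?u (SOME v. v \<in> ?Z)" by (intro cong)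
        then have lt: "\<delta> ?u (SOME v. v \<in> ?Z) < ennreal r" using z(2) by simp
        have "d U ?Z < r"
        proof -
          have "ennreal (enn2real (\<delta> ?u (SOME v. v \<in> ?Z))) < ennreal r"
            using lt by (subst ennreal_enn2real) (auto intro: less_trans)
          then show ?thesis unfolding d_def by (subst (asm) ennreal_less_iff) simp_all
        qed
        then have "?Z \<in> mball U r" using U Z by simp
        then show "\<exists>y. y \<in> C \<and> y \<in> T" using r z by (auto simp: C_def)
      qed
    qed
  qed
qed

text \<open>\<open>distr M borel (\<lambda>x. x)\<close> is the restriction of M to the Borel sets.
  The function and all its upper gradients are Borel, so each integral in the norm is the same for
  both measures.\<close>

lemma newtonian_norm_borel_restriction:
  fixes M :: "'a::metric_space measure"
  assumes M: "sets borel \<subseteq> sets M" and f [measurable]: "f \<in> borel_measurable borel" and p: "0 < p"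
  shows "newtonian_norm (distr M borel (\<lambda>x. x)) p f = newtonian_norm M p f"
proof -
  have "UNIV \<in> sets M" using M by (rule subsetD) simp
  from sets.sets_into_space[OF this] have sp: "space M = UNIV" by auto
  then have id: "(\<lambda>x. x) \<in> measurable M borel"
    using M by (intro measurableI) (auto simp: sp)
  show ?thesis
    unfolding newtonian_norm_eq[OF p]
  proof (intro arg_cong2[where f = ennreal_rpow] arg_cong2[where f = "(+)"] INF_cong refl)
    show "(\<integral>\<^sup>+x. ennreal_rpow (e2ennreal \<bar>f x\<bar>) p \<partial>distr M borel (\<lambda>x. x))
        = (\<integral>\<^sup>+x. ennreal_rpow (e2ennreal \<bar>f x\<bar>) p \<partial>M)"
      by (rule nn_integral_distr[OF id]) measurable
    fix g assume "g \<in> {g. upper_gradient g f}"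
    then have [measurable]: "g \<in> borel_measurable borel" by (simp add: upper_gradient_def)
    show "(\<integral>\<^sup>+x. ennreal_rpow (g x) p \<partial>distr M borel (\<lambda>x. x)) = (\<integral>\<^sup>+x. ennreal_rpow (g x) p \<partial>M)"
      by (rule nn_integral_distr[OF id]) measurable
  qed
qed

text \<open>The constant c is doubled because the diameter of a ball is at most twice its radius;
  everything else involves Borel functions and balls only, so it carries over to the restricted
  measure.\<close>

lemma poincare_space_borel_restriction:
  fixes M :: "'a::metric_space measure"
  assumes mms: "metric_measure_space M" and db: "doubling_measure M" and p: "1 \<le> p" and PI:
      "supports_Poincare M p"
  obtains C c l where "poincare_space (distr M borel (\<lambda>x. x)) C p c l"
proof -
  let ?\<mu> = "distr M borel (\<lambda>x. x)"
  have M: "sets borel \<subseteq> sets M" using mms by (simp add: metric_measure_space_def)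
  have sp: "space M = UNIV"
  proof -
    have "UNIV \<in> sets M" using M by (rule subsetD) simp
    from sets.sets_into_space[OF this] show ?thesis by auto
  qed
  have id: "(\<lambda>x. x) \<in> measurable M borel"
    using M by (intro measurableI) (auto simp: sp)
  have em: "emeasure ?\<mu> A = emeasure M A" if "A \<in> sets borel" for A
    using that by (simp add: emeasure_distr[OF id] sp)
  have nn: "(\<integral>\<^sup>+x. f x \<partial>?\<mu>) = (\<integral>\<^sup>+x. f x \<partial>M)" if "f \<in> borel_measurable borel" for f :: "'a \<Rightarrow> ennreal"
    using that by (intro nn_integral_distr[OF id]) simp
  have bor: "f \<in> borel_measurable M" if "f \<in> borel_measurable borel" for f :: "'a \<Rightarrow> ereal"
    using measurable_compose[OF id that] .
  obtain C where C: "1 \<le> C" "\<And>x r. 0 < r \<Longrightarrow> emeasure M (ball x (2 * r)) \<le> ennreal C * emeasure M (ball x r)"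
    using db unfolding doubling_measure_def by blast
  obtain c l where cl: "0 < c" "1 \<le> l" and P: "\<And>x r u g. 0 < r \<Longrightarrow> u \<in> borel_measurable borel \<Longrightarrow>
      locally_integrable M u \<Longrightarrow> upper_gradient g u \<Longrightarrow>
     (\<integral>\<^sup>+y\<in>ball x r. e2ennreal \<bar>u y - ereal (mean_value M (ball x r) u)\<bar> \<partial>M) / emeasure M (ball x r)
       \<le> ennreal (c * diameter (ball x r)) * ennreal_rpow ((\<integral>\<^sup>+y\<in>ball x (l * r).
           ennreal_rpow (g y) p \<partial>M) / emeasure M (ball x (l * r))) (1 / p)"
    using PI unfolding supports_Poincare_def by blast
  interpret \<mu>: doubling_space ?\<mu> C
  proof
    show "sets ?\<mu> = sets borel" by simp
    show "0 < r \<Longrightarrow> 0 < emeasure ?\<mu> (ball x r)" for x r using mms by (simp add: em metric_measure_space_def)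
    show "emeasure ?\<mu> (ball x r) < \<infinity>" for x r
      using mms by (cases "0 < r") (auto simp: em metric_measure_space_def ball_empty)
    show "1 \<le> C" by (rule C)
    show "0 < r \<Longrightarrow> emeasure ?\<mu> (ball x (2 * r)) \<le> ennreal C * emeasure ?\<mu> (ball x r)" for x r
      using C(2) by (simp add: em)
  qed
  have "poincare_space ?\<mu> C p (2 * c) l"
  proof
    show "1 \<le> p" "0 < 2 * c" "1 \<le> l" using p cl by auto
    fix r :: real and u :: "'a \<Rightarrow> real" and g and x :: 'a
    assume r: "0 < r" and u: "\<mu>.ball_integrable u" and g: "real_upper_gradient g u"
    note [measurable] = \<mu>.ball_integrable_measurable[OF u] real_upper_gradientD(1)[OF g]
    let ?u = "\<lambda>x. ereal (u x)" and ?B = "ball x r" and ?lB = "ball x (l * r)"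
    have um: "?u \<in> borel_measurable borel" by measurable
    have loc: "locally_integrable M ?u"
      unfolding locally_integrable_def
    proof (intro conjI allI impI bor um)
      fix x r
      have "(\<integral>\<^sup>+y\<in>ball x r. e2ennreal \<bar>?u y\<bar> \<partial>M) = (\<integral>\<^sup>+y\<in>ball x r. ennreal \<bar>u y\<bar> \<partial>?\<mu>)"
        unfolding e2ennreal_abs_ereal by (rule nn[symmetric]) measurable
      then show "(\<integral>\<^sup>+y\<in>ball x r. e2ennreal \<bar>?u y\<bar> \<partial>M) < \<infinity>" using u by (simp add: \<mu>.ball_integrable_def)
    qed
    have mean: "mean_value M ?B ?u = \<mu>.ball_mean u x r"
    proof -
      have "(LINT y:?B|M. u y) = (LINT y:?B|?\<mu>. u y)"
        unfolding set_lebesgue_integral_def by (rule integral_distr[OF id, symmetric]) measurable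
      moreover have "measure M ?B = measure ?\<mu> ?B" by (simp add: measure_def em)
      ultimately show ?thesis by (simp add: mean_value_def \<mu>.ball_mean_def)
    qed
    let ?A = "ennreal_rpow ((\<integral>\<^sup>+y\<in>?lB. ennreal_rpow (g y) p \<partial>?\<mu>) / emeasure ?\<mu> ?lB) (1 / p)"
    have A: "ennreal_rpow ((\<integral>\<^sup>+y\<in>?lB. ennreal_rpow (g y) p \<partial>M) / emeasure M ?lB) (1 / p) = ?A"
    proof -
      have "(\<integral>\<^sup>+y\<in>?lB. ennreal_rpow (g y) p \<partial>?\<mu>) = (\<integral>\<^sup>+y\<in>?lB. ennreal_rpow (g y) p \<partial>M)"
          by (rule nn) measurable
      then show ?thesis by (simp add: em)
    qed
    have I: "(\<integral>\<^sup>+y\<in>?B. e2ennreal \<bar>?u y - ereal (mean_value M ?B ?u)\<bar> \<partial>M) = (\<integral>\<^sup>+y\<in>?B. ennreal \<bar>u y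
        - \<mu>.ball_mean u x r\<bar> \<partial>?\<mu>)"
    proof -
      have "(\<integral>\<^sup>+y\<in>?B. e2ennreal \<bar>?u y - ereal (mean_value M ?B ?u)\<bar> \<partial>M) = (\<integral>\<^sup>+y\<in>?B. ennreal \<bar>u y
          - \<mu>.ball_mean u x r\<bar> \<partial>M)"
        by (simp add: mean)
      also have "\<dots> = (\<integral>\<^sup>+y\<in>?B. ennreal \<bar>u y - \<mu>.ball_mean u x r\<bar> \<partial>?\<mu>)" by (rule nn[symmetric]) measurable
      finally show ?thesis .
    qed
    have diam: "diameter ?B \<le> 2 * r"
    proof -
      have ne: "?B \<noteq> {}" using r by simp
      have "dist y z \<le> 2 * r" if "y \<in> ?B" "z \<in> ?B" for y z
        using that dist_triangle[of y z x] by (simp add: dist_commute)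
      then have "(SUP (y, z)\<in>?B \<times> ?B. dist y z) \<le> 2 * r"
        using ne by (intro cSUP_least) auto
      then show ?thesis using ne by (simp add: diameter_def)
    qed
    have emB: "emeasure M ?B = emeasure ?\<mu> ?B" by (simp add: em)
    have B: "emeasure ?\<mu> ?B \<noteq> 0" "emeasure ?\<mu> ?B \<noteq> top"
      using \<mu>.ball_pos[OF r, of x] \<mu>.ball_finite[of x r] by auto
    have "(\<integral>\<^sup>+y\<in>?B. ennreal \<bar>u y - \<mu>.ball_mean u x r\<bar> \<partial>?\<mu>) / emeasure ?\<mu> ?B \<le> ennreal (c * diameter ?B)
        * ?A"
      using P[OF r um loc g[unfolded real_upper_gradient_iff], of x] unfolding I A emB .
    also have "\<dots> \<le> ennreal (2 * c * r) * ?A"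
      using diam cl by (intro mult_right_mono ennreal_leI) (auto simp: mult.left_commute)
    finally have "(\<integral>\<^sup>+y\<in>?B. ennreal \<bar>u y - \<mu>.ball_mean u x r\<bar> \<partial>?\<mu>) / emeasure ?\<mu> ?B * emeasure ?\<mu> ?B
        \<le> ennreal (2 * c * r) * ?A * emeasure ?\<mu> ?B"
      by (rule mult_right_mono) simp
    then show "(\<integral>\<^sup>+y\<in>?B. ennreal \<bar>u y - \<mu>.ball_mean u x r\<bar> \<partial>?\<mu>) \<le> ennreal (2 * c * r) * ?A * emeasure ?\<mu> ?B"
      by (simp only: ennreal_divide_mult_cancel[OF B])
  qed
  then show thesis by (rule that)
qed

theorem theorem1p2:
  fixes M :: "'a::metric_space measure" and p :: real
  assumes "metric_measure_space M"
    and "borel_regular M"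
    and "doubling_measure M"
    and "1 \<le> p"
    and "supports_Poincare M p"
  shows "separable_space (newtonian_topology M p)"
proof -
  let ?\<mu> = "distr M borel (\<lambda>x. x)"
  have M: "sets borel \<subseteq> sets M" using assms(1) by (simp add: metric_measure_space_def)
  have p: "1 \<le> p" "0 < p" using assms(4) by auto
  obtain C c l where "poincare_space ?\<mu> C p c l"
    by (rule poincare_space_borel_restriction[OF assms(1,3,4,5)])
  then interpret poincare_space ?\<mu> C p c l .
  let ?F = "newtonian_functions M p"
  let ?r = "\<lambda>u x. real_of_ereal (u x)"
  \<comment> \<open>Formed with M, to match the quotient in the statement; on functions of finite
    norm it equals the norm of the difference of their finite parts, where the triangle inequality
    is available.\<close>
  define \<delta> where "\<delta> u v = newtonian_norm M p (\<lambda>x. u x - v x)" for u v :: "'a \<Rightarrow> ereal"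
  have F: "u \<in> ?F \<longleftrightarrow> u \<in> borel_measurable borel \<and> newtonian_norm ?\<mu> p u < \<infinity>" for u
    by (auto simp: newtonian_functions_def newtonian_norm_borel_restriction[OF M _ p(2)])
  have \<delta>: "\<delta> u v = real_norm p (\<lambda>x. ?r u x - ?r v x)" if "u \<in> ?F" "v \<in> ?F" for u v
  proof -
    have [measurable]: "u \<in> borel_measurable borel" "v \<in> borel_measurable borel" using that
        by (auto simp: F)
    have "\<delta> u v = newtonian_norm ?\<mu> p (\<lambda>x. u x - v x)"
      unfolding \<delta>_def by (rule newtonian_norm_borel_restriction[OF M _ p(2), symmetric]) measurable
    also have "\<dots> = real_norm p (\<lambda>x. ?r u x - ?r v x)"
      using that by (intro newtonian_norm_diff_eq p) (auto simp: F)
    finally show ?thesis .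
  qed
  have tri: "\<delta> u w \<le> \<delta> u v + \<delta> v w" if "u \<in> ?F" "v \<in> ?F" "w \<in> ?F" for u v w
  proof -
    have [measurable]: "u \<in> borel_measurable borel" "v \<in> borel_measurable borel"
        "w \<in> borel_measurable borel" using that by (auto simp: F)
    have "real_norm p (\<lambda>x. (?r u x - ?r v x) + (?r v x - ?r w x)) \<le> real_norm p (\<lambda>x. ?r u x - ?r v x)
        + real_norm p (\<lambda>x. ?r v x - ?r w x)"
      by (rule real_norm_triangle[OF p(1)]) measurable
    then show ?thesis using that by (simp add: \<delta>)
  qed
  have zero: "(\<lambda>x. 0) \<in> ?F"
    using real_norm_zero[OF p(1)] by (simp add: F real_norm_def zero_ereal_def)
  have fin0: "\<delta> u (\<lambda>x. 0) < \<infinity>" if "u \<in> ?F" for u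
    using that by (simp add: \<delta>_def newtonian_functions_def)
  have sym: "\<delta> u v = \<delta> v u" for u v unfolding \<delta>_def by (rule newtonian_norm_diff_commute)
  have fin: "\<delta> u v < \<infinity>" if "u \<in> ?F" "v \<in> ?F" for u v
    using tri[OF that(1) zero that(2)] fin0[OF that(1)] fin0[OF that(2)] sym[of "\<lambda>x. 0" v]
    by (auto simp: less_top[symmetric] top_unique)
  have refl: "\<delta> u u = 0" if "u \<in> ?F" for u
    using that real_norm_zero[OF p(1)] by (simp add: \<delta>)
  obtain S where S: "countable S" "\<And>z. z \<in> S \<Longrightarrow> sobolev_pair p z"
    "\<And>u g e. sobolev_pair p (u, g) \<Longrightarrow> 0 < e \<Longrightarrow>
      \<exists>z\<in>S. (\<integral>\<^sup>+x. ennreal (\<bar>fst z x - u x\<bar> powr p) \<partial>?\<mu>) < ennreal e \<and> energy p (\<lambda>x. fst z x - u x)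
          < ennreal e"
    using countable_dense_sobolev by blast
  define D where "D = (\<lambda>z x. ereal (fst z x)) ` S"
  have DF: "D \<subseteq> ?F"
  proof
    fix u assume "u \<in> D"
    then obtain s g where sg: "sobolev_pair p (s, g)" "u = (\<lambda>x. ereal (s x))" using S(2)
        by (force simp: D_def)
    note [measurable] = sobolev_pairD(1)[OF sg(1)]
    have "newtonian_norm ?\<mu> p u \<le> pair_norm p (\<lambda>x. e2ennreal \<bar>u x\<bar>) g"
      using sobolev_pairD(2)[OF sg(1)] sg(2)
          by (intro newtonian_norm_le_pair_norm p) (simp add: real_upper_gradient_iff)
    also have "\<dots> < \<infinity>" using sobolev_pairD(4,5)[OF sg(1)] by (simp add: pair_norm_def sg(2))
    finally show "u \<in> ?F" by (simp add: F sg(2))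
  qed
  have dense: "\<exists>z\<in>D. \<delta> u z < ennreal r" if u: "u \<in> ?F" and r: "0 < r" for u r
  proof -
    have uF: "u \<in> borel_measurable borel" "newtonian_norm ?\<mu> p u < \<infinity>" using u by (auto simp: F)
    note [measurable] = uF(1)
    obtain g where g: "upper_gradient g u" "g \<in> borel_measurable borel" "(\<integral>\<^sup>+x. ennreal_rpow (g x) p \<partial>?\<mu>)
        < \<infinity>"
      "(\<integral>\<^sup>+x. ennreal (\<bar>?r u x\<bar> powr p) \<partial>?\<mu>) < \<infinity>"
      by (rule finite_points[OF p(1) uF])
    \<comment> \<open>Along curves with a finite integral of g both end values of u are finite, so
      setting the infinite values to 0 does no harm.\<close>
    have "real_upper_gradient g (?r u)"
      unfolding real_upper_gradient_iff upper_gradient_def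
    proof (intro conjI allI impI g(2))
      fix \<gamma> :: "real \<Rightarrow> 'a" and a b assume \<gamma>: "nonconst_rectifiable_curve \<gamma> a b"
      show "e2ennreal \<bar>ereal (?r u (\<gamma> a)) - ereal (?r u (\<gamma> b))\<bar> \<le> curve_integral \<gamma> a b g"
      proof (cases "curve_integral \<gamma> a b g = top")
        case False
        have "ereal (?r u (\<gamma> a)) = u (\<gamma> a)" "ereal (?r u (\<gamma> b)) = u (\<gamma> b)"
          using upper_gradient_infinite[OF g(1) \<gamma> False] by (auto intro: ereal_real')
        then show ?thesis using g(1) \<gamma> by (metis upper_gradient_def)
      qed simp
    qed
    then have ug: "sobolev_pair p (?r u, g)" using g by (simp add: sobolev_pair_def)
    \<comment> \<open>Both integrals come out below r^p / 4, so the norm is at most r divided by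
      2^(1/p), strictly less than r.\<close>
    have e: "0 < r powr p / 4" using r by simp
    obtain z where z: "z \<in> S" "(\<integral>\<^sup>+x. ennreal (\<bar>fst z x - ?r u x\<bar> powr p) \<partial>?\<mu>) < ennreal (r powr p / 4)"
      "energy p (\<lambda>x. fst z x - ?r u x) < ennreal (r powr p / 4)"
      using S(3)[OF ug e] by blast
    obtain h where h: "real_upper_gradient h (\<lambda>x. fst z x - ?r u x)" "(\<integral>\<^sup>+x. ennreal_rpow (h x) p \<partial>?\<mu>)
        < ennreal (r powr p / 4)"
      using z(3) by (rule energy_lessD)
    let ?z = "\<lambda>x. ereal (fst z x)"
    have zD: "?z \<in> D" using z(1) by (auto simp: D_def)
    have "\<delta> u ?z = \<delta> ?z u" by (rule sym)
    also have "\<dots> = real_norm p (\<lambda>x. fst z x - ?r u x)"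
      using DF zD u by (subst \<delta>) auto
    also have "\<dots> \<le> pair_norm p (\<lambda>x. ennreal \<bar>fst z x - ?r u x\<bar>) h"
      using newtonian_norm_le_pair_norm[OF p(1) h(1)[unfolded real_upper_gradient_iff]]
      unfolding real_norm_def e2ennreal_abs_ereal .
    also have "\<dots> \<le> ennreal_rpow (ennreal (r powr p / 4) + ennreal (r powr p / 4)) (1 / p)"
      unfolding pair_norm_def using z(2) h(2) p by (intro rpow_mono add_mono) auto
    also have "ennreal (r powr p / 4) + ennreal (r powr p / 4) = ennreal (r powr p / 2)"
      by (subst ennreal_plus[symmetric]) auto
    also have "ennreal_rpow (ennreal (r powr p / 2)) (1 / p) = ennreal ((r powr p / 2) powr (1 / p))"
      by simp
    also have "\<dots> < ennreal r"
    proof (rule ennreal_lessI[OF r])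
      have "(r powr p / 2) powr (1 / p) < (r powr p) powr (1 / p)"
        using r p by (intro powr_less_mono2) auto
      also have "\<dots> = r" using r p by (simp add: powr_powr)
      finally show "(r powr p / 2) powr (1 / p) < r" .
    qed
    finally show ?thesis using zD by blast
  qed
  have "separable_space (Metric_space.mtopology (?F // {(u, v). u \<in> ?F \<and> v \<in> ?F \<and> \<delta> u v = 0})
      (\<lambda>U V. enn2real (\<delta> (SOME u. u \<in> U) (SOME v. v \<in> V))))"
  proof (rule separable_pseudometric_quotient[where D = D])
    show "countable D" unfolding D_def using S(1) by (rule countable_image)
  qed (use sym refl fin tri DF dense in auto)
  moreover have "newtonian_space M p = ?F // {(u, v). u \<in> ?F \<and> v \<in> ?F \<and> \<delta> u v = 0}"
    by (simp add: newtonian_space_def newtonian_rel_def \<delta>_def)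
  moreover have "newtonian_dist M p = (\<lambda>U V. enn2real (\<delta> (SOME u. u \<in> U) (SOME v. v \<in> V)))"
    by (simp add: newtonian_dist_def \<delta>_def fun_eq_iff)
  ultimately show ?thesis by (simp add: newtonian_topology_def)
qed

end
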